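(* Let $1<p_i<2$ for all $i=1,\dots,N$ and let $u$ be a non-negative local weak solution in $\Omega_T$ to $\partial_t u-\operatorname{div}A(x,t,u,Du)=B(x,t,u,Du)$ under the structure conditions with constants $C_o,C_1>0$, $C\ge 0$. There exists a positive constant $\gamma$ depending only on the data $\{N,p_i,C_o,C_1\}$ such that the following holds. Let $t,\rho>0$ be such that $\mathbb K_{2\rho}\times[0,t]\subset\Omega_T$, and set $\nu_\Sigma=\sum_{k=1}^N\left(\frac{t}{\rho^p}\right)^{\frac1{2-p_k}}$ and $\lambda_i=N(p_i-2)+p$. Then either there exists an index $i\in\{1,\dots,N\}$ for which $$C^{p_i}\rho^p>\min\{1,\nu_\Sigma^{p_i}\},$$ or $$\sup_{0\le\tau\le t}\int_{\mathbb K_\rho}u(x,\tau)\,dx\le\gamma\inf_{0\le\tau\le t}\int_{\mathbb K_{2\rho}}u(x,\tau)\,dx+\gamma\sum_{i=1}^N\left(\frac{t}{\rho^{\lambda_i}}\right)^{\frac1{2-p_i}}.$$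
   Context: Setting. $\Omega\subset\mathbb R^N$ is open and bounded, $T>0$, $\Omega_T=\Omega\times[0,T]$. Exponents $1<p_1\le\dots\le p_N<2$; $p=N/\big(\sum_{i=1}^N 1/p_i\big)$ is their harmonic mean, with $p<N$. Equation. $\partial_t u-\operatorname{div}A(x,t,u,Du)=B(x,t,u,Du)$ in $\Omega_T$, where $A=(A_1,\dots,A_N):\Omega_T\times\mathbb R^{N+1}\to\mathbb R^N$ and $B:\Omega_T\times\mathbb R^{N+1}\to\mathbb R$ are Carathéodory functions satisfying, for a.e. $(x,t)\in\Omega_T$, all $(s,\xi)\in\mathbb R\times\mathbb R^N$ and all $i$, the structure conditions $A_i(x,t,s,\xi)\xi_i\ge C_o|\xi_i|^{p_i}-C^{p_i}$, $|A_i(x,t,s,\xi)|\le C_1|\xi_i|^{p_i-1}+C^{p_i-1}$, $|B(x,t,s,\xi)|\le\sum_{i=1}^N C(|\xi_i|^{p_i-1}+C^{p_i-1})$, with constants $C_o,C_1>0$, $C\ge0$. Function spaces. $W^{1,\mathbf p}_{o}(\Omega)=\{u\in W^{1,1}_o(\Omega):\partial_iu\in L^{p_i}_{loc}(\Omega)\}$ and $W^{1,\mathbf p}_{loc}(\Omega)=\{u\in W^{1,1}_{loc}(\Omega):\partial_iu\in L^{p_i}_{loc}(\Omega)\}$; $L^{\mathbf p}_{loc}(0,T;W^{1,\mathbf p}_{loc}(\Omega))$ (resp. with $W^{1,\mathbf p}_o$) is the set of $u\in L^1_{loc}(0,T;W^{1,1}_{loc}(\Omega))$ (resp. $W^{1,1}_o$)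 with $\partial_iu\in L^{p_i}_{loc}(0,T;L^{p_i}_{loc}(\Omega))$ for all $i$. Weak solutions. A local weak sub(super)-solution is $u\in C(0,T;L^2_{loc}(\Omega))\cap L^{\mathbf p}_{loc}(0,T;W^{1,\mathbf p}_{loc}(\Omega))$ (continuity understood as a map $[0,T]\to L^2_{loc}(\Omega)$) such that for all $0\le t_1\le t_2\le T$ and all compact $K\subset\subset\Omega$, $$\int_K u\varphi\,dx\Big|_{t_1}^{t_2}+\int_{t_1}^{t_2}\!\!\int_K\Big\{-u\,\partial_\tau\varphi+\sum_iA_i(x,\tau,u,Du)\,\partial_i\varphi\Big\}dx\,d\tau\le(\ge)\int_{t_1}^{t_2}\!\!\int_KB(x,\tau,u,Du)\varphi\,dx\,d\tau$$ for all non-negative $\varphi\in W^{1,2}_{loc}(0,T;L^2_{loc}(K))\cap L^{\mathbf p}_{loc}(0,T;W^{1,\mathbf p}_o(K))$. A local weak solution is both a sub- and a super-solution. Standard anisotropic cubes. For $a,\rho>0$, $\mathbb K_{a\rho}=\prod_{i=1}^N\big\{|x_i|<(a\rho)^{\frac p{p_i}}\big\}$. *)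

theory Defs
  imports "HOL-Analysis.Analysis"
begin

text \<open>
  Conventions. Space-time functions are curried, \<open>u x t\<close>. Lebesgue classes are handled through
  representatives: measurability, integrability and a.e. statements refer to the completed
  Lebesgue measure, and only the values on \<open>\<Omega> \<times> [0,T]\<close> matter. Elements of Bochner spaces such as
  \<open>L\<^sup>q(a,b; L\<^sup>q(K))\<close> are represented by jointly measurable functions on \<open>K \<times> [a,b]\<close>. A weak
  gradient or weak time derivative is carried along as a separate function.

  As in \<open>L\<^sup>q\<^sub>l\<^sub>o\<^sub>c(0,T; \<dots>)\<close>, local in time refers to compact subintervals of the open interval
  \<open>(0,T)\<close>. Local in space refers to compact subsets of the set at hand, so that for a compact
  set \<open>K\<close> the space \<open>L\<^sup>q\<^sub>l\<^sub>o\<^sub>c(K)\<close> is \<open>L\<^sup>q(K)\<close>.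
\<close>

section \<open>Test functions and Sobolev spaces in the space variable\<close>

primrec C_k :: "nat \<Rightarrow> ('a::euclidean_space \<Rightarrow> real) \<Rightarrow> bool" where
  "C_k 0 f \<longleftrightarrow> continuous_on UNIV f"
| "C_k (Suc k) f \<longleftrightarrow> (\<forall>x. f differentiable (at x)) \<and>
     (\<forall>b\<in>Basis. C_k k (\<lambda>x. frechet_derivative f (at x) b))"

definition test_functions :: "'a::euclidean_space set \<Rightarrow> ('a \<Rightarrow> real) set" where
  "test_functions U = {\<psi>. (\<forall>k. C_k k \<psi>) \<and>
     compact (closure {x. \<psi> x \<noteq> 0}) \<and> closure {x. \<psi> x \<noteq> 0} \<subseteq> U}"

definition partial :: "'n \<Rightarrow> (real^'n::finite \<Rightarrow> real) \<Rightarrow> real^'n \<Rightarrow> real" where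
  "partial i \<psi> x = frechet_derivative \<psi> (at x) (axis i 1)"

text \<open>\<open>f \<in> W\<^sup>1\<^sup>,\<^sup>1\<^sub>l\<^sub>o\<^sub>c(U)\<close> with weak gradient \<open>g\<close>, for open \<open>U\<close>.\<close>

definition W11_loc ::
    "(real^'n::finite) set \<Rightarrow> (real^'n \<Rightarrow> real) \<Rightarrow> (real^'n \<Rightarrow> real^'n) \<Rightarrow> bool" where
  "W11_loc U f g \<longleftrightarrow>
     (\<forall>K. compact K \<and> K \<subseteq> U \<longrightarrow> f absolutely_integrable_on K \<and> g absolutely_integrable_on K) \<and>
     (\<forall>\<psi>\<in>test_functions U. \<forall>i.
        (LINT x:U|lebesgue. f x * partial i \<psi> x) = - (LINT x:U|lebesgue. g x $ i * \<psi> x))"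

text \<open>
  \<open>f \<in> W\<^sup>1\<^sup>,\<^sup>1\<^sub>o(S)\<close> with weak gradient \<open>g\<close>: the \<open>W\<^sup>1\<^sup>,\<^sup>1\<close>-closure of the smooth functions compactly
  supported in the interior of \<open>S\<close>. It is used for compact \<open>S\<close>; since the norms are taken over
  \<open>S\<close>, both \<open>f\<close> and \<open>g\<close> vanish a.e. on the frontier of \<open>S\<close>.
\<close>

definition W11_o ::
    "(real^'n::finite) set \<Rightarrow> (real^'n \<Rightarrow> real) \<Rightarrow> (real^'n \<Rightarrow> real^'n) \<Rightarrow> bool" where
  "W11_o S f g \<longleftrightarrow> f absolutely_integrable_on S \<and> g absolutely_integrable_on S \<and>
     (\<exists>\<psi>. (\<forall>n::nat. \<psi> n \<in> test_functions (interior S)) \<and>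
        (\<lambda>n. LINT x:S|lebesgue. \<bar>f x - \<psi> n x\<bar>) \<longlonglongrightarrow> 0 \<and>
        (\<forall>i. (\<lambda>n. LINT x:S|lebesgue. \<bar>g x $ i - partial i (\<psi> n) x\<bar>) \<longlonglongrightarrow> 0))"

section \<open>Spaces of time-dependent functions\<close>

text \<open>\<open>f \<in> L\<^sup>q\<^sub>l\<^sub>o\<^sub>c(0,T; L\<^sup>q\<^sub>l\<^sub>o\<^sub>c(S))\<close>\<close>

definition Lq_loc ::
    "real \<Rightarrow> 'a::euclidean_space set \<Rightarrow> real \<Rightarrow> ('a \<Rightarrow> real \<Rightarrow> real) \<Rightarrow> bool" where
  "Lq_loc T S q f \<longleftrightarrow>
     (\<lambda>(x, t). f x t) \<in> borel_measurable (lebesgue_on (S \<times> {0<..<T})) \<and>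
     (\<forall>K a b. compact K \<and> K \<subseteq> S \<and> 0 < a \<and> b < T \<longrightarrow>
        set_integrable lebesgue (K \<times> {a..b}) (\<lambda>(x, t). \<bar>f x t\<bar> powr q))"

text \<open>\<open>f \<in> C(I; L\<^sup>2\<^sub>l\<^sub>o\<^sub>c(S))\<close>\<close>

definition C_L2_loc ::
    "real set \<Rightarrow> 'a::euclidean_space set \<Rightarrow> ('a \<Rightarrow> real \<Rightarrow> real) \<Rightarrow> bool" where
  "C_L2_loc I S f \<longleftrightarrow>
     (\<forall>t\<in>I. (\<lambda>x. f x t) \<in> borel_measurable (lebesgue_on S)) \<and>
     (\<forall>K. compact K \<and> K \<subseteq> S \<longrightarrow>
        (\<forall>t\<in>I. set_integrable lebesgue K (\<lambda>x. (f x t)\<^sup>2)) \<and>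
        (\<forall>s\<in>I. ((\<lambda>t. LINT x:K|lebesgue. (f x t - f x s)\<^sup>2) \<longlongrightarrow> 0) (at s within I)))"

text \<open>\<open>f \<in> L\<^sup>\<^bold>p\<^sub>l\<^sub>o\<^sub>c(0,T; W\<^sup>1\<^sup>,\<^sup>\<^bold>p\<^sub>l\<^sub>o\<^sub>c(U))\<close> with spatial weak gradient \<open>g\<close>\<close>

definition Lp_W1p_loc :: "real \<Rightarrow> (real^'n::finite) set \<Rightarrow> ('n \<Rightarrow> real) \<Rightarrow>
    (real^'n \<Rightarrow> real \<Rightarrow> real) \<Rightarrow> (real^'n \<Rightarrow> real \<Rightarrow> real^'n) \<Rightarrow> bool" where
  "Lp_W1p_loc T U p f g \<longleftrightarrow>
     Lq_loc T U 1 f \<and> (\<forall>i. Lq_loc T U 1 (\<lambda>x t. g x t $ i)) \<and>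
     (AE t in lebesgue_on {0<..<T}. W11_loc U (\<lambda>x. f x t) (\<lambda>x. g x t)) \<and>
     (\<forall>i. Lq_loc T U (p i) (\<lambda>x t. g x t $ i))"

text \<open>\<open>f \<in> L\<^sup>\<^bold>p\<^sub>l\<^sub>o\<^sub>c(0,T; W\<^sup>1\<^sup>,\<^sup>\<^bold>p\<^sub>o(K))\<close> with spatial weak gradient \<open>g\<close>, for compact \<open>K\<close>\<close>

definition Lp_W1p_o :: "real \<Rightarrow> (real^'n::finite) set \<Rightarrow> ('n \<Rightarrow> real) \<Rightarrow>
    (real^'n \<Rightarrow> real \<Rightarrow> real) \<Rightarrow> (real^'n \<Rightarrow> real \<Rightarrow> real^'n) \<Rightarrow> bool" where
  "Lp_W1p_o T K p f g \<longleftrightarrow>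
     Lq_loc T K 1 f \<and> (\<forall>i. Lq_loc T K 1 (\<lambda>x t. g x t $ i)) \<and>
     (AE t in lebesgue_on {0<..<T}. W11_o K (\<lambda>x. f x t) (\<lambda>x. g x t)) \<and>
     (\<forall>i. Lq_loc T K (p i) (\<lambda>x t. g x t $ i))"

text \<open>
  \<open>f \<in> W\<^sup>1\<^sup>,\<^sup>2\<^sub>l\<^sub>o\<^sub>c(0,T; L\<^sup>2\<^sub>l\<^sub>o\<^sub>c(S))\<close> with weak time derivative \<open>h\<close>. The defining identity
  \<open>\<integral> f \<eta>' dt = - \<integral> h \<eta> dt\<close> is one between elements of \<open>L\<^sup>2\<^sub>l\<^sub>o\<^sub>c(S)\<close>.
\<close>

definition W12_loc_L2_loc :: "real \<Rightarrow> 'a::euclidean_space set \<Rightarrow>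
    ('a \<Rightarrow> real \<Rightarrow> real) \<Rightarrow> ('a \<Rightarrow> real \<Rightarrow> real) \<Rightarrow> bool" where
  "W12_loc_L2_loc T S f h \<longleftrightarrow> Lq_loc T S 2 f \<and> Lq_loc T S 2 h \<and>
     (\<forall>\<eta>\<in>test_functions {0<..<T}. AE x in lebesgue_on S.
        (LINT t:{0<..<T}|lebesgue. f x t * deriv \<eta> t) =
        - (LINT t:{0<..<T}|lebesgue. h x t * \<eta> t))"

section \<open>The equation\<close>

definition hmean :: "('n::finite \<Rightarrow> real) \<Rightarrow> real" where
  "hmean p = real CARD('n) / (\<Sum>i\<in>UNIV. 1 / p i)"

definition caratheodory :: "(real^'n::finite) set \<Rightarrow> real \<Rightarrow>
    (real^'n \<Rightarrow> real \<Rightarrow> real \<Rightarrow> real^'n \<Rightarrow> 'b::euclidean_space) \<Rightarrow> bool" where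
  "caratheodory \<Omega> T F \<longleftrightarrow>
     (\<forall>s \<xi>. (\<lambda>(x, t). F x t s \<xi>) \<in> borel_measurable (lebesgue_on (\<Omega> \<times> {0..T}))) \<and>
     (AE (x, t) in lebesgue_on (\<Omega> \<times> {0..T}). continuous_on UNIV (\<lambda>(s, \<xi>). F x t s \<xi>))"

definition structure_conditions :: "(real^'n::finite) set \<Rightarrow> real \<Rightarrow> ('n \<Rightarrow> real) \<Rightarrow>
    real \<Rightarrow> real \<Rightarrow> real \<Rightarrow>
    (real^'n \<Rightarrow> real \<Rightarrow> real \<Rightarrow> real^'n \<Rightarrow> real^'n) \<Rightarrow>
    (real^'n \<Rightarrow> real \<Rightarrow> real \<Rightarrow> real^'n \<Rightarrow> real) \<Rightarrow> bool" where
  "structure_conditions \<Omega> T p Co C1 C A B \<longleftrightarrow>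
     (AE (x, t) in lebesgue_on (\<Omega> \<times> {0..T}). \<forall>s \<xi>.
        (\<forall>i. A x t s \<xi> $ i * \<xi> $ i \<ge> Co * \<bar>\<xi> $ i\<bar> powr p i - C powr p i) \<and>
        (\<forall>i. \<bar>A x t s \<xi> $ i\<bar> \<le> C1 * \<bar>\<xi> $ i\<bar> powr (p i - 1) + C powr (p i - 1)) \<and>
        \<bar>B x t s \<xi>\<bar> \<le> (\<Sum>i\<in>UNIV. C * (\<bar>\<xi> $ i\<bar> powr (p i - 1) + C powr (p i - 1))))"

text \<open>
  The weak inequality \<open>R (lhs) (rhs)\<close> with \<open>R\<close> one of \<open>\<le>\<close>, \<open>\<ge>\<close>, for all \<open>0 \<le> t1 \<le> t2 \<le> T\<close>, all
  compact \<open>K \<subseteq> \<Omega>\<close> and all admissible non-negative \<open>\<phi>\<close>, whenever its terms are defined: \<open>\<phi>\<close> is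
  the representative that is continuous as a map \<open>[t1,t2] \<rightarrow> L\<^sup>2(K)\<close>, so that it has values at
  \<open>t1\<close> and \<open>t2\<close>, and the two space-time integrals exist. For \<open>0 < t1\<close> and \<open>t2 < T\<close> such a
  representative of \<open>\<phi>\<close> always exists and, under the structure conditions, so do the integrals;
  only for \<open>t1 = 0\<close> or \<open>t2 = T\<close> is there a restriction on \<open>\<phi>\<close>, because all spaces are local in
  \<open>(0,T)\<close>. Without this proviso the totalised Lebesgue integral would assign the value 0
  to divergent integrals.
\<close>

definition weak_ineq :: "(real \<Rightarrow> real \<Rightarrow> bool) \<Rightarrow>
    (real^'n::finite) set \<Rightarrow> real \<Rightarrow> ('n \<Rightarrow> real) \<Rightarrow>
    (real^'n \<Rightarrow> real \<Rightarrow> real \<Rightarrow> real^'n \<Rightarrow> real^'n) \<Rightarrow>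
    (real^'n \<Rightarrow> real \<Rightarrow> real \<Rightarrow> real^'n \<Rightarrow> real) \<Rightarrow>
    (real^'n \<Rightarrow> real \<Rightarrow> real) \<Rightarrow> (real^'n \<Rightarrow> real \<Rightarrow> real^'n) \<Rightarrow> bool" where
  "weak_ineq R \<Omega> T p A B u Du \<longleftrightarrow>
     (\<forall>t1 t2 K \<phi> D\<phi> \<phi>t.
        let lhs = (\<lambda>(x, \<tau>). - u x \<tau> * \<phi>t x \<tau>
                     + (\<Sum>i\<in>UNIV. A x \<tau> (u x \<tau>) (Du x \<tau>) $ i * D\<phi> x \<tau> $ i));
            rhs = (\<lambda>(x, \<tau>). B x \<tau> (u x \<tau>) (Du x \<tau>) * \<phi> x \<tau>)
        in
        0 \<le> t1 \<and> t1 \<le> t2 \<and> t2 \<le> T \<and> compact K \<and> K \<subseteq> \<Omega> \<and>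
        W12_loc_L2_loc T K \<phi> \<phi>t \<and> Lp_W1p_o T K p \<phi> D\<phi> \<and>
        (AE (x, \<tau>) in lebesgue_on (K \<times> {0<..<T}). 0 \<le> \<phi> x \<tau>) \<and>
        C_L2_loc {t1..t2} K \<phi> \<and>
        set_integrable lebesgue (K \<times> {t1..t2}) lhs \<and>
        set_integrable lebesgue (K \<times> {t1..t2}) rhs \<longrightarrow>
        R ((LINT x:K|lebesgue. u x t2 * \<phi> x t2) - (LINT x:K|lebesgue. u x t1 * \<phi> x t1)
             + (LINT z:K \<times> {t1..t2}|lebesgue. lhs z))
          (LINT z:K \<times> {t1..t2}|lebesgue. rhs z))"

definition local_weak_subsolution where
  "local_weak_subsolution \<Omega> T p A B u \<longleftrightarrow> C_L2_loc {0..T} \<Omega> u \<and>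
     (\<exists>Du. Lp_W1p_loc T \<Omega> p u Du \<and> weak_ineq (\<le>) \<Omega> T p A B u Du)"

definition local_weak_supersolution where
  "local_weak_supersolution \<Omega> T p A B u \<longleftrightarrow> C_L2_loc {0..T} \<Omega> u \<and>
     (\<exists>Du. Lp_W1p_loc T \<Omega> p u Du \<and> weak_ineq (\<ge>) \<Omega> T p A B u Du)"

definition local_weak_solution where
  "local_weak_solution \<Omega> T p A B u \<longleftrightarrow>
     local_weak_subsolution \<Omega> T p A B u \<and> local_weak_supersolution \<Omega> T p A B u"

section \<open>Geometry and parameters of the estimate\<close>

definition aniso_cube :: "('n::finite \<Rightarrow> real) \<Rightarrow> real \<Rightarrow> (real^'n) set" where
  "aniso_cube p r = {x. \<forall>i. \<bar>x $ i\<bar> < r powr (hmean p / p i)}"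

definition nu_Sigma :: "('n::finite \<Rightarrow> real) \<Rightarrow> real \<Rightarrow> real \<Rightarrow> real" where
  "nu_Sigma p t \<rho> = (\<Sum>k\<in>UNIV. (t / \<rho> powr hmean p) powr (1 / (2 - p k)))"

definition lambda_exp :: "('n::finite \<Rightarrow> real) \<Rightarrow> 'n \<Rightarrow> real" where
  "lambda_exp p i = real CARD('n) * (p i - 2) + hmean p"

end

theory Submission
  imports Defs
begin

text \<open>
  Put \<open>v = u + \<nu>\<close> with \<open>\<nu> = \<nu>\<^sub>\<Sigma>\<close>, and let \<open>\<zeta> = \<xi>\<^sup>m\<close> be a high power of a smooth cutoff function between
  the cubes of size \<open>\<rho>\<close> and \<open>2\<rho>\<close>. Testing the supersolution property with \<open>v\<^sup>-\<^sup>a \<zeta>\<close> for a small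
  \<open>a > 0\<close> bounds the energy \<open>\<integral>\<integral> \<Sum>\<^sub>i v\<^sup>-\<^sup>a\<^sup>-\<^sup>1 \<bar>\<partial>\<^sub>i u\<bar> powr p\<^sub>i \<zeta>\<close> by a multiple of
  \<open>S = sup\<^sub>t \<integral> v\<^sup>1\<^sup>-\<^sup>a \<xi>\<^sup>m\<^sup>-\<^sup>2\<close>: the choice of \<open>\<nu>\<close> gives \<open>t \<nu> powr (p\<^sub>i - 2) \<le> \<rho> powr p\<close>, which takes care of the
  derivatives of \<open>\<zeta>\<close>, and if the first alternative fails, then the lower order terms are of the same
  size. Testing with \<open>\<zeta>\<close> alone and estimating the flux by the energy shows that the masses
  \<open>\<integral> u \<zeta>\<close> at two times differ by at most a multiple of \<open>\<nu>\<^sup>a S\<close>. Since \<open>1 - a < 1\<close>, this is at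
  most half of the largest mass plus a multiple of \<open>\<nu> \<rho>\<^sup>N\<close>, and \<open>\<nu> \<rho>\<^sup>N\<close> is the sum in the
  statement.

  The function \<open>v\<^sup>-\<^sup>a \<zeta>\<close> is not regular enough in time to be a test function. Therefore its value
  at a time \<open>\<sigma>\<close> is used as a time-independent test function on \<open>[\<sigma> - h, \<sigma>]\<close>. Concavity of
  \<open>s\<^sup>1\<^sup>-\<^sup>a\<close> controls the time difference; integrating over \<open>\<sigma>\<close> makes it telescope, and \<open>h\<close> tends to
  \<open>0\<close> by continuity of translations in \<open>L\<^sup>p\<close>.
\<close>

section \<open>Smooth functions\<close>

text \<open>The singular range closes the argument. The flux is bounded by
  \<open>\<nu> powr a\<close> times the energy density plus a multiple of
  \<open>\<nu> powr a * v powr (1 - a)\<close>, and the second term has this form as soon as a p_i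
  \<le> 2 - p_i; this fixes a. Young's inequality costs two powers of \<xi>; they are recovered when
  \<open>v powr (1 - a) * \<xi> ^ (m - 2)\<close> is compared with the power 1 - a of
  \<open>v * \<xi> ^ m\<close>, for which m a \<ge> 2 suffices; this fixes m. So all constants come
  from the data, before a solution is given.

  The energy uses the supersolution inequality alone, the mass estimate uses both inequalities.
  These come with possibly different weak gradients, hence uniqueness of weak gradients is proved
  first. The spaces are local in the open interval (0,T), so all integral estimates live on compact
  subintervals, and the times 0 and t are reached by continuity into L^2.

  The cube of size 2\<rho> has half-edges enlarged by the factors 2^(p/p_i) with p/p_i > 1/2, so
  uniformly in the data only a factor sqrt 2 is available for the cutoff.\<close>

lemma C_k_SucI:
  assumes "\<And>x. (f has_derivative f' x) (at x)" "\<And>b. b \<in> Basis \<Longrightarrow> C_k k (\<lambda>x. f' x b)"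
  shows "C_k (Suc k) f"
proof -
  have "frechet_derivative f (at x) = f' x" for x
    using assms(1) frechet_derivative_at by metis
  then show ?thesis using assms by (auto simp: differentiable_def)
qed

lemma C_k_has_derivative:
  "C_k (Suc k) f \<Longrightarrow> (f has_derivative frechet_derivative f (at x)) (at x)"
  by (simp add: frechet_derivative_works)

lemma C_k_continuous: "C_k k f \<Longrightarrow> continuous_on UNIV f"
  by (cases k) (auto intro!: continuous_at_imp_continuous_on differentiable_imp_continuous_within)

lemma C_k_mono: "C_k (Suc k) f \<Longrightarrow> C_k k f"
proof (induction k arbitrary: f)
  case 0
  then show ?case using C_k_continuous[of "Suc 0" f] by simp
next
  case (Suc k)
  then show ?case unfolding C_k.simps(2)[of "Suc k"] C_k.simps(2)[of k f] by blast
qed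

lemma C_k_const: "C_k k (\<lambda>x. c)"
proof (induction k arbitrary: c)
  case (Suc k)
  then show ?case by (intro C_k_SucI[where f' = "\<lambda>_ _. 0"]) auto
qed simp

lemma C_k_add:
  "C_k k f \<Longrightarrow> C_k k g \<Longrightarrow> C_k k (\<lambda>x. f x + g x)"
proof (induction k arbitrary: f g)
  case (Suc k)
  show ?case
    by (rule C_k_SucI[OF has_derivative_add[OF C_k_has_derivative[OF Suc.prems(1)]
          C_k_has_derivative[OF Suc.prems(2)]]])
      (use Suc in auto)
qed (auto intro: continuous_intros)

lemma C_k_mult:
  "C_k k f \<Longrightarrow> C_k k g \<Longrightarrow> C_k k (\<lambda>x. f x * g x)"
proof (induction k arbitrary: f g)
  case (Suc k)
  show ?case
    by (rule C_k_SucI[OF has_derivative_mult[OF C_k_has_derivative[OF Suc.prems(1)]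
          C_k_has_derivative[OF Suc.prems(2)]]])
      (use Suc C_k_mono[OF Suc.prems(1)] C_k_mono[OF Suc.prems(2)] in \<open>auto intro!: C_k_add\<close>)
qed (auto intro: continuous_intros)

lemma C_k_prod:
  "(\<And>i. i \<in> I \<Longrightarrow> C_k k (f i)) \<Longrightarrow> C_k k (\<lambda>x. \<Prod>i\<in>I. f i x)"
  by (induction I rule: infinite_finite_induct) (auto intro: C_k_mult C_k_const)

lemma C_k_power: "C_k k f \<Longrightarrow> C_k k (\<lambda>x. f x ^ n)"
  by (induction n) (auto intro: C_k_mult C_k_const)

lemma C_k_powr:
  assumes "C_k k f" "\<And>x. 0 < f x"
  shows "C_k k (\<lambda>x. f x powr c)"
  using assms(1)
proof (induction k arbitrary: c)
  case 0
  then show ?case using assms(2) by (auto intro!: continuous_intros simp: less_imp_neq[symmetric])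
next
  case (Suc k)
  have "((\<lambda>x. f x powr c) has_derivative
    (\<lambda>h. c * f x powr (c - 1) * frechet_derivative f (at x) h)) (at x)" for x
    using has_derivative_powr[OF C_k_has_derivative[OF Suc.prems, of x] has_derivative_const[of c] assms(2)] assms(2)[of x]
    by (simp add: powr_diff mult_ac)
  moreover have "C_k k (\<lambda>x. c * f x powr (c - 1) * frechet_derivative f (at x) b)" if "b \<in> Basis" for b
    using Suc that C_k_mono[OF Suc.prems] by (intro C_k_mult C_k_const) auto
  ultimately show ?case by (intro C_k_SucI)
qed

text \<open>Powers of \<open>1 / t\<close> are included so that the family is closed under differentiation.\<close>

definition flat :: "nat \<Rightarrow> real \<Rightarrow> real" where
  "flat n t = (if 0 < t then exp (- 1 / t) / t ^ n else 0)"

text \<open>A single term of the exponential series, of order n + 2, beats the pole of order n and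
  leaves a factor \<open>t ^ 2\<close>. That factor makes the difference quotient of
  \<open>flat n\<close> at 0 tend to 0.\<close>

lemma flat_bound:
  assumes "0 < t" shows "flat n t \<le> fact (n + 2) * t ^ 2"
proof -
  have "(1 / t) ^ (n + 2) / fact (n + 2) \<le> exp (1 / t)"
  proof -
    have "(\<Sum>i\<in>{n+2}. inverse (fact i) * (1 / t) ^ i) \<le> (\<Sum>i. inverse (fact i) * (1 / t) ^ i)"
      using assms by (intro sum_le_suminf summable_exp) auto
    then show ?thesis by (simp add: exp_def divide_inverse mult_ac)
  qed
  then have "exp (- 1 / t) / t ^ n \<le> fact (n + 2) * t ^ 2"
    using assms by (simp add: exp_minus divide_simps mult_ac del: fact_Suc power_Suc) (simp add: power_add power2_eq_square mult_ac del: fact_Suc)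
  then show ?thesis using assms by (simp add: flat_def)
qed

lemma flat_deriv: "(flat n has_real_derivative (flat (n + 2) t - real n * flat (n + 1) t)) (at t)"
proof -
  consider "t < 0" | "t = 0" | "0 < t" by linarith
  then show ?thesis
  proof cases
    case 1
    have "((\<lambda>_. 0) has_real_derivative 0) (at t)" by simp
    then have "(flat n has_real_derivative 0) (at t)"
      by (rule has_field_derivative_transform_within_open[where S = "{..<0}"])
        (use 1 in \<open>auto simp: flat_def\<close>)
    then show ?thesis using 1 by (simp add: flat_def)
  next
    \<comment> \<open>This is the only point where the two formulas meet. Since
      \<open>flat n 0 = 0\<close>, it is enough that \<open>flat n h / h\<close> tends to 0 as h
      tends to 0 from either side.\<close>
    case 2
    have *: "norm (flat n h / h) \<le> fact (n + 2) * \<bar>h\<bar>" if "h \<noteq> 0" for h :: real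
    proof (cases "0 < h")
      case True
      then show ?thesis using flat_bound[of h n]
        by (simp add: flat_def power2_eq_square field_simps)
    qed (simp add: flat_def mult_nonneg_nonpos del: fact_Suc)
    have "((\<lambda>h. flat n h / h) \<longlongrightarrow> 0) (at 0)"
    proof (rule Lim_null_comparison)
      show "\<forall>\<^sub>F h in at 0. norm (flat n h / h) \<le> fact (n + 2) * \<bar>h\<bar>"
        using * by (auto simp: eventually_at_filter)
      show "((\<lambda>h::real. fact (n + 2) * \<bar>h\<bar>) \<longlongrightarrow> 0) (at 0)"
        by (auto intro!: tendsto_eq_intros)
    qed
    then show ?thesis using 2 by (simp add: DERIV_def flat_def)
  next
    case 3
    have p: "((\<lambda>t. t ^ n) has_real_derivative real n * t ^ n / t) (at t)"
      using DERIV_pow[of n t] 3 by (cases n) auto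
    have e: "((\<lambda>t. exp (- 1 / t)) has_real_derivative exp (- 1 / t) * (1 / t ^ 2)) (at t)"
      using 3 by (auto intro!: derivative_eq_intros simp: power2_eq_square)
    have "((\<lambda>t. exp (- 1 / t) / t ^ n) has_real_derivative
        (exp (- 1 / t) / t ^ (n + 2) - real n * (exp (- 1 / t) / t ^ (n + 1)))) (at t)"
      by (rule DERIV_cong[OF DERIV_divide[OF e p]]) (use 3 in \<open>auto simp: field_simps power2_eq_square\<close>)
    then have "(flat n has_real_derivative
        (exp (- 1 / t) / t ^ (n + 2) - real n * (exp (- 1 / t) / t ^ (n + 1)))) (at t)"
      by (rule has_field_derivative_transform_within_open[where S = "{0<..}"])
        (use 3 in \<open>auto simp: flat_def\<close>)
    then show ?thesis using 3 by (simp add: flat_def)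
  qed
qed

lemma C_k_real_SucI:
  assumes "\<And>t. (f has_real_derivative f' t) (at t)" "C_k k f'"
  shows "C_k (Suc k) f"
  using assms by (intro C_k_SucI[of f "\<lambda>t h. f' t * h"]) (auto simp: has_field_derivative_def)

lemma C_k_flat: "C_k k (flat n)"
proof (induction k arbitrary: n)
  case 0
  then show ?case using flat_deriv DERIV_isCont continuous_at_imp_continuous_on by (metis C_k.simps(1))
next
  case (Suc k)
  have "C_k k (\<lambda>t. flat (n + 2) t + (- real n) * flat (n + 1) t)"
    by (intro C_k_add C_k_mult C_k_const Suc)
  then show ?case using flat_deriv[of n] by (intro C_k_real_SucI[of "flat n"]) auto
qed

lemma C_k_affine_comp:
  fixes g :: "real \<Rightarrow> real" and l :: "'a::euclidean_space \<Rightarrow> real"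
  assumes "C_k k g" "linear l"
  shows "C_k k (\<lambda>x. g (c + l x))"
  using assms(1)
proof (induction k arbitrary: g)
  case 0
  have "continuous_on UNIV l" using assms(2) by (rule linear_continuous_on[OF linear_conv_bounded_linear[THEN iffD1]])
  then show ?case using 0 by (auto intro!: continuous_on_compose2[of UNIV g] continuous_intros)
next
  case (Suc k)
  have l: "(l has_derivative l) (at x)" for x
    using assms(2) by (simp add: bounded_linear_imp_has_derivative linear_conv_bounded_linear)
  have gd: "frechet_derivative g (at y) h = h * frechet_derivative g (at y) 1" for y h
    using linear_cmul[OF has_derivative_linear[OF C_k_has_derivative[OF Suc.prems]], of y h 1] by simp
  have "((\<lambda>x. g (c + l x)) has_derivative (\<lambda>h. frechet_derivative g (at (c + l x)) (l h))) (at x)" for x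
    by (rule has_derivative_compose[OF _ C_k_has_derivative[OF Suc.prems]])
      (auto intro!: derivative_eq_intros l)
  then have "((\<lambda>x. g (c + l x)) has_derivative (\<lambda>h. l h * frechet_derivative g (at (c + l x)) 1)) (at x)" for x
    using gd by (metis (no_types, lifting) ext)
  moreover have "C_k k (\<lambda>y. frechet_derivative g (at y) 1)" using Suc.prems by simp
  then have "C_k k (\<lambda>x. l b * frechet_derivative g (at (c + l x)) 1)" for b
    by (intro C_k_mult C_k_const Suc.IH)
  ultimately show ?case by (intro C_k_SucI)
qed

text \<open>The usual exponential bump supported in [-1,1], left without normalisation: the cutoff
  only needs an explicit positive lower bound away from the endpoints.\<close>

definition bump :: "real \<Rightarrow> real" where
  "bump s = flat 0 (1 + s) * flat 0 (1 - s)"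

lemma C_k_bump: "C_k k bump"
proof -
  have "C_k k (\<lambda>x. flat 0 (1 + x) * flat 0 (1 + (- x)))"
    by (intro C_k_mult C_k_affine_comp C_k_flat) (auto simp: linear_id[unfolded id_def] module_hom_uminus)
  then show ?thesis by (simp add: bump_def[abs_def])
qed

lemma flat0_bounds: "0 \<le> flat 0 t" "flat 0 t \<le> 1"
  by (auto simp: flat_def)

lemma bump_bounds: "0 \<le> bump s" "bump s \<le> 1"
  using flat0_bounds by (auto simp: bump_def intro!: mult_le_one mult_nonneg_nonneg)

lemma bump_pos_iff: "bump s > 0 \<longleftrightarrow> \<bar>s\<bar> < 1"
  by (auto simp: bump_def flat_def zero_less_mult_iff)

lemma bump_eq_0: "1 \<le> \<bar>s\<bar> \<Longrightarrow> bump s = 0"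
  by (auto simp: bump_def flat_def)

text \<open>The bound B is an absolute number. It enters the constant in front of the derivative of
  the cutoff and hence must not depend on the size of the cube.\<close>

lemma bump_deriv:
  obtains b' B where "\<And>s. (bump has_real_derivative b' s) (at s)" "\<And>s. \<bar>b' s\<bar> \<le> B" "B > 0"
proof -
  define b' where "b' s = flat 2 (1 + s) * flat 0 (1 - s) - flat 0 (1 + s) * flat 2 (1 - s)" for s :: real
  have [derivative_intros]: "((\<lambda>x. flat 0 (f x)) has_real_derivative flat 2 (f x) * D) (at x)"
    if "(f has_real_derivative D) (at x)" for f x D
    using DERIV_chain2[OF flat_deriv[of 0] that] by (simp add: numeral_2_eq_2)
  have "(bump has_real_derivative b' s) (at s)" for s
    unfolding bump_def[abs_def] b'_def by (auto intro!: derivative_eq_intros)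
  \<comment> \<open>For arguments up to 2 the bound on \<open>flat 2\<close> is 24 * 4 = 96, and the
    factors \<open>flat 0\<close> are at most 1, so 200 is generous.\<close>
  moreover have "\<bar>b' s\<bar> \<le> 200" for s
  proof -
    have *: "0 \<le> flat 2 x \<and> flat 2 x \<le> fact 4 * 2 ^ 2" if "x \<le> 2" for x
    proof (cases "0 < x")
      case True
      then have "x ^ 2 \<le> 2 ^ 2" using that by (intro power_mono) auto
      then show ?thesis using flat_bound[OF True, of 2] True by (auto simp: flat_def fact_numeral)
    qed (simp add: flat_def)
    show ?thesis
    proof (cases "\<bar>s\<bar> < 1")
      case True
      have "flat 2 (1 + s) * flat 0 (1 - s) \<le> (fact 4 * 2 ^ 2) * 1" "flat 0 (1 + s) * flat 2 (1 - s) \<le> 1 * (fact 4 * 2 ^ 2)"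
        by (intro mult_mono; use *[of "1 + s"] *[of "1 - s"] flat0_bounds True in auto)+
      moreover have "0 \<le> flat 2 (1 + s) * flat 0 (1 - s)" "0 \<le> flat 0 (1 + s) * flat 2 (1 - s)"
        by (intro mult_nonneg_nonneg; use *[of "1 + s"] *[of "1 - s"] flat0_bounds True in auto)+
      ultimately show ?thesis unfolding b'_def abs_le_iff by (simp add: fact_numeral)
    next
      case False
      then show ?thesis by (auto simp: b'_def flat_def)
    qed
  qed
  ultimately show ?thesis using that[of b' 200] by auto
qed

section \<open>Translations and mollification\<close>

definition compactly_supported :: "('a::euclidean_space \<Rightarrow> real) \<Rightarrow> bool" where
  "compactly_supported f \<longleftrightarrow> continuous_on UNIV f \<and> compact (closure {x. f x \<noteq> 0})"

lemma compactly_supported_continuous: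
  "compactly_supported f \<Longrightarrow> continuous_on A f"
  unfolding compactly_supported_def using continuous_on_subset by blast

lemma compactly_supported_borel:
  "compactly_supported f \<Longrightarrow> f \<in> borel_measurable borel"
  unfolding compactly_supported_def by (intro borel_measurable_continuous_onI) simp

lemma compactly_supported_bounded:
  assumes "compactly_supported f"
  obtains B where "0 < B" "\<And>x. \<bar>f x\<bar> \<le> B"
proof -
  let ?S = "closure {x. f x \<noteq> 0}"
  have "compact (f ` ?S)"
    by (rule compact_continuous_image[OF compactly_supported_continuous[OF assms]])
      (use assms in \<open>auto simp: compactly_supported_def\<close>)
  then obtain B where B: "\<And>x. x \<in> ?S \<Longrightarrow> \<bar>f x\<bar> \<le> B"
    using compact_imp_bounded bounded_iff by (metis imageI real_norm_def)
  have "\<bar>f x\<bar> \<le> max B 1" for x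
    using B[of x] closure_subset[of "{x. f x \<noteq> 0}"] by (cases "f x = 0") auto
  then show ?thesis using that[of "max B 1"] by auto
qed

lemma compactly_supported_uniform:
  assumes "compactly_supported f" "0 < e"
  obtains d where "0 < d" "\<And>x y. norm (x - y) < d \<Longrightarrow> \<bar>f x - f y\<bar> < e"
proof -
  let ?S = "closure {x. f x \<noteq> 0}"
  \<comment> \<open>Of two close points only one may lie in the support. The closed unit
    neighbourhood of the support is compact and contains the other one too, once distances are kept
    below 1.\<close>
  define K where "K = {x + y |x y. x \<in> ?S \<and> y \<in> cball 0 1}"
  have "compact K" unfolding K_def using assms by (intro compact_sums) (auto simp: compactly_supported_def)
  then have "uniformly_continuous_on K f"
    by (rule compact_uniformly_continuous[OF compactly_supported_continuous[OF assms(1)]])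
  from uniformly_continuous_onE[OF this assms(2)]
  obtain d where d: "0 < d" "\<And>x y. x \<in> K \<Longrightarrow> y \<in> K \<Longrightarrow> dist y x < d \<Longrightarrow> dist (f y) (f x) < e"
    by metis
  have *: "\<bar>f x - f y\<bar> < e" if "x \<in> ?S" "norm (x - y) < min d 1" for x y
  proof -
    have "x \<in> K" unfolding K_def using that(1) by (intro CollectI exI[of _ x] exI[of _ 0]) auto
    moreover have "y \<in> K" unfolding K_def using that by (intro CollectI exI[of _ x] exI[of _ "y - x"]) (auto simp: norm_minus_commute)
    ultimately show ?thesis using d(2)[of y x] that by (auto simp: dist_norm)
  qed
  have "\<bar>f x - f y\<bar> < e" if "norm (x - y) < min d 1" for x y
  proof (cases "x \<in> ?S \<or> y \<in> ?S")
    case True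
    then show ?thesis using *[of x y] *[of y x] that by (auto simp: abs_minus_commute norm_minus_commute)
  next
    case False
    then have "f x = 0" "f y = 0" using closure_subset[of "{x. f x \<noteq> 0}"] by auto
    then show ?thesis using assms by simp
  qed
  then show ?thesis using that[of "min d 1"] d(1) by simp
qed

lemma compactly_supported_integrable:
  assumes "compactly_supported f"
  shows "integrable lborel f"
proof -
  let ?S = "closure {x. f x \<noteq> 0}"
  have "set_integrable lborel ?S f"
    unfolding set_integrable_def
    by (rule borel_integrable_compact[OF _ compactly_supported_continuous[OF assms]])
      (use assms in \<open>auto simp: compactly_supported_def\<close>)
  moreover have "indicat_real ?S x *\<^sub>R f x = f x" for x
    using closure_subset[of "{x. f x \<noteq> 0}"] by (auto simp: indicator_def)
  then have "(\<lambda>x. indicat_real ?S x *\<^sub>R f x) = f" by blast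
  ultimately show ?thesis by (simp only: set_integrable_def)
qed

lemma test_functions_mono: "U \<subseteq> V \<Longrightarrow> test_functions U \<subseteq> test_functions V"
  by (auto simp: test_functions_def)

lemma test_functions_compactly_supported:
  "f \<in> test_functions U \<Longrightarrow> compactly_supported f"
  by (auto simp: test_functions_def compactly_supported_def intro: C_k_continuous)

lemma test_functions_has_derivative:
  "f \<in> test_functions U \<Longrightarrow> (f has_derivative frechet_derivative f (at x)) (at x)"
  by (rule C_k_has_derivative[of 0]) (auto simp: test_functions_def simp del: C_k.simps)

lemma test_functions_directional:
  assumes "f \<in> test_functions U" "b \<in> Basis"
  shows "(\<lambda>x. frechet_derivative f (at x) b) \<in> test_functions U"
proof -
  let ?S = "closure {x. f x \<noteq> 0}"
  let ?g = "\<lambda>x. frechet_derivative f (at x) b"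
  have "C_k k ?g" for k
    using assms unfolding test_functions_def by (auto dest!: spec[of _ "Suc k"])
  moreover have "?g x = 0" if "x \<notin> ?S" for x
  proof -
    have "(f has_derivative (\<lambda>_. 0)) (at x)"
      by (rule has_derivative_transform_within_open[of "\<lambda>_. 0" _ _ _ "- ?S"])
        (use that closure_subset[of "{x. f x \<noteq> 0}"] in auto)
    then show ?thesis using frechet_derivative_at by (metis)
  qed
  then have "{x. ?g x \<noteq> 0} \<subseteq> ?S" by auto
  then have "closure {x. ?g x \<noteq> 0} \<subseteq> ?S" by (rule closure_minimal) simp
  moreover from this have "compact (closure {x. ?g x \<noteq> 0})"
    using assms(1) compact_Int_closed[of ?S "closure {x. ?g x \<noteq> 0}"] by (auto simp: test_functions_def Int_absorb1)
  ultimately show ?thesis using assms(1) by (auto simp: test_functions_def)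
qed

section \<open>Translations and reflections in Lebesgue integrals\<close>

lemma lborel_affine_sign:
  fixes t :: "'a::euclidean_space"
  assumes "\<bar>c\<bar> = 1"
  shows "distr lborel borel (\<lambda>x. t + c *\<^sub>R x) = lborel"
  using lborel_affine[of c t] assms by (auto simp: density_1)

lemma nn_integral_lborel_affine_sign:
  fixes t :: "'a::euclidean_space"
  assumes "\<bar>c\<bar> = 1" "f \<in> borel_measurable borel"
  shows "(\<integral>\<^sup>+x. f (t + c *\<^sub>R x) \<partial>lborel) = (\<integral>\<^sup>+x. f x \<partial>lborel)"
proof -
  have "(\<integral>\<^sup>+x. f x \<partial>lborel) = (\<integral>\<^sup>+x. f x \<partial>distr lborel borel (\<lambda>x. t + c *\<^sub>R x))"
    by (simp only: lborel_affine_sign[OF assms(1)])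
  also have "\<dots> = (\<integral>\<^sup>+x. f (t + c *\<^sub>R x) \<partial>lborel)"
    using assms(2) by (intro nn_integral_distr) auto
  finally show ?thesis by simp
qed

lemma integral_lborel_affine_sign:
  fixes t :: "'a::euclidean_space" and f :: "'a \<Rightarrow> real"
  assumes "\<bar>c\<bar> = 1" "f \<in> borel_measurable borel"
  shows "(LINT x|lborel. f (t + c *\<^sub>R x)) = (LINT x|lborel. f x)"
proof -
  have "(LINT x|lborel. f x) = (LINT x|distr lborel borel (\<lambda>x. t + c *\<^sub>R x). f x)"
    by (simp only: lborel_affine_sign[OF assms(1)])
  also have "\<dots> = (LINT x|lborel. f (t + c *\<^sub>R x))"
    using assms(2) by (intro integral_distr) auto
  finally show ?thesis by simp
qed

lemma integrable_lborel_affine_sign: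
  fixes t :: "'a::euclidean_space" and f :: "'a \<Rightarrow> real"
  assumes "\<bar>c\<bar> = 1" "integrable lborel f"
  shows "integrable lborel (\<lambda>x. f (t + c *\<^sub>R x))"
proof (rule integrableI_bounded)
  have f: "f \<in> borel_measurable borel" using assms(2) by auto
  then show "(\<lambda>x. f (t + c *\<^sub>R x)) \<in> borel_measurable lborel" by measurable
  have "(\<integral>\<^sup>+x. ennreal (norm (f (t + c *\<^sub>R x))) \<partial>lborel) = (\<integral>\<^sup>+x. ennreal (norm (f x)) \<partial>lborel)"
    using assms(1) f by (intro nn_integral_lborel_affine_sign) auto
  then show "(\<integral>\<^sup>+x. ennreal (norm (f (t + c *\<^sub>R x))) \<partial>lborel) < \<infinity>"
    using assms(2) by (simp add: integrable_iff_bounded)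
qed

lemma nn_integral_lborel_shift:
  fixes y :: "'a::euclidean_space"
  shows "f \<in> borel_measurable borel \<Longrightarrow> (\<integral>\<^sup>+x. f (x - y) \<partial>lborel) = (\<integral>\<^sup>+x. f x \<partial>lborel)"
  using nn_integral_lborel_affine_sign[of 1 f "- y"] by simp

lemma integrable_lborel_shift:
  fixes y :: "'a::euclidean_space" and f :: "'a \<Rightarrow> real"
  shows "integrable lborel f \<Longrightarrow> integrable lborel (\<lambda>x. f (x - y))"
  using integrable_lborel_affine_sign[of 1 f "- y"] by simp

lemma integral_lborel_shift:
  fixes y :: "'a::euclidean_space" and f :: "'a \<Rightarrow> real"
  shows "f \<in> borel_measurable borel \<Longrightarrow> (LINT x|lborel. f (x - y)) = (LINT x|lborel. f x)"
  using integral_lborel_affine_sign[of 1 f "- y"] by simp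

lemma nn_integral_lborel_reflect:
  fixes y :: "'a::euclidean_space"
  shows "f \<in> borel_measurable borel \<Longrightarrow> (\<integral>\<^sup>+x. f (y - x) \<partial>lborel) = (\<integral>\<^sup>+x. f x \<partial>lborel)"
  using nn_integral_lborel_affine_sign[of "-1" f y] by simp

lemma integral_lborel_reflect:
  fixes y :: "'a::euclidean_space" and f :: "'a \<Rightarrow> real"
  shows "f \<in> borel_measurable borel \<Longrightarrow> (LINT x|lborel. f (y - x)) = (LINT x|lborel. f x)"
  using integral_lborel_affine_sign[of "-1" f y] by simp

lemma integrable_lborel_reflect:
  fixes y :: "'a::euclidean_space" and f :: "'a \<Rightarrow> real"
  shows "integrable lborel f \<Longrightarrow> integrable lborel (\<lambda>x. f (y - x))"
  using integrable_lborel_affine_sign[of "-1" f y] by simp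

text \<open>Induction over the construction of integrable functions. An indicator is squeezed
  between a compact set C and an open set U; a translation shorter than the distance of C from the
  complement of U changes the indicator only on U - C and on the translate of U - C. Sums are
  immediate, and limits follow from dominated convergence and translation invariance.\<close>

proposition L1_translation_continuous:
  fixes f :: "'a::euclidean_space \<Rightarrow> real"
  assumes "integrable lborel f" "0 < e"
  shows "\<exists>d>0. \<forall>y. norm y < d \<longrightarrow> (\<integral>\<^sup>+x. ennreal \<bar>f (x - y) - f x\<bar> \<partial>lborel) \<le> ennreal e"
  using assms
proof (induction arbitrary: e rule: integrable_induct)
  case (base A c)
  \<comment> \<open>The set U - C will have measure at most 2\<epsilon> and is counted twice, once
    translated; this explains the 4. Adding 1 to \<open>\<bar>c\<bar>\<close> covers c = 0.\<close>
  define \<epsilon> where "\<epsilon> = e / 4 / (\<bar>c\<bar> + 1)"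
  have \<epsilon>: "0 < \<epsilon>" using base by (simp add: \<epsilon>_def add_pos_nonneg)
  have A: "A \<in> sets lebesgue" using base by simp
  obtain U where U: "open U" "A \<subseteq> U" "emeasure lebesgue (U - A) < ennreal \<epsilon>"
    using sets_lebesgue_outer_open[OF A \<epsilon>] by metis
  obtain C0 where C0: "closed C0" "C0 \<subseteq> A" "emeasure lebesgue (A - C0) < ennreal (\<epsilon>/2)"
    using sets_lebesgue_inner_closed[OF A, of "\<epsilon>/2"] \<epsilon> by (metis half_gt_zero)
  \<comment> \<open>Inner regularity provides only a closed set. Cutting with a large ball makes it
    compact, which is what gives a positive distance to the complement of U.\<close>
  have "\<exists>n::nat. emeasure lborel (A - cball 0 (real n)) < ennreal (\<epsilon>/2)"
  proof -
    have "(\<lambda>n. emeasure lborel (A - cball 0 (real n))) \<longlonglongrightarrow> emeasure lborel (\<Inter>n. A - cball 0 (real n))"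
    proof (rule Lim_emeasure_decseq)
      show "decseq (\<lambda>n. A - cball 0 (real n))" by (auto simp: decseq_def)
      show "emeasure lborel (A - cball 0 (real i)) \<noteq> \<infinity>" for i
      proof -
        have "emeasure lborel (A - cball 0 (real i)) \<le> emeasure lborel A"
          using base by (intro emeasure_mono) auto
        then show ?thesis using base(2) by (auto simp: top_unique)
      qed
    qed (use base in auto)
    moreover have "(\<Inter>n. A - cball 0 (real n)) = {}"
    proof -
      have "\<exists>n. x \<in> cball 0 (real n)" for x :: 'a using real_arch_simple[of "norm x"] by auto
      then show ?thesis by blast
    qed
    ultimately have "(\<lambda>n. emeasure lborel (A - cball 0 (real n))) \<longlonglongrightarrow> 0"
      by (simp only: emeasure_empty)
    then have "\<forall>\<^sub>F n in sequentially. emeasure lborel (A - cball 0 (real n)) < ennreal (\<epsilon>/2)"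
      using \<epsilon> by (intro order_tendstoD(2)) auto
    then show ?thesis using eventually_happens'[OF sequentially_bot] by blast
  qed
  then obtain n :: nat where n: "emeasure lborel (A - cball 0 (real n)) < ennreal (\<epsilon>/2)" by blast
  define C where "C = C0 \<inter> cball 0 (real n)"
  have C: "compact C" "C \<subseteq> A" using C0 by (auto simp: C_def closed_Int_compact)
  have AC: "emeasure lborel (A - C) \<le> ennreal \<epsilon>"
  proof -
    have "emeasure lborel (A - C) \<le> emeasure lborel ((A - C0) \<union> (A - cball 0 (real n)))"
      using base C0 by (intro emeasure_mono) (auto simp: C_def)
    also have "\<dots> \<le> emeasure lborel (A - C0) + emeasure lborel (A - cball 0 (real n))"
      using base C0 by (intro emeasure_subadditive) auto
    also have "emeasure lborel (A - C0) = emeasure lebesgue (A - C0)"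
      using base C0 by simp
    also have "emeasure lebesgue (A - C0) + emeasure lborel (A - cball 0 (real n)) \<le> ennreal (\<epsilon>/2) + ennreal (\<epsilon>/2)"
      using C0 n by (intro add_mono) auto
    also have "\<dots> = ennreal \<epsilon>" using \<epsilon> by (simp flip: ennreal_plus)
    finally show ?thesis .
  qed
  have UC_borel: "U \<in> sets borel" "C \<in> sets borel" "A \<in> sets borel"
    using C U base by (auto simp: borel_open borel_compact)
  have UC: "emeasure lborel (U - C) \<le> ennreal (2 * \<epsilon>)"
  proof -
    have "emeasure lborel (U - C) \<le> emeasure lborel ((U - A) \<union> (A - C))"
      using UC_borel by (intro emeasure_mono) (auto intro!: sets.Un sets.Diff)
    also have "\<dots> \<le> emeasure lborel (U - A) + emeasure lborel (A - C)"
      using UC_borel by (intro emeasure_subadditive) (auto intro!: sets.Un sets.Diff)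
    also have "emeasure lborel (U - A) = emeasure lebesgue (U - A)"
      using UC_borel by (auto intro!: sets.Diff)
    also have "emeasure lebesgue (U - A) + emeasure lborel (A - C) \<le> ennreal \<epsilon> + ennreal \<epsilon>"
      using U AC by (intro add_mono) auto
    also have "\<dots> = ennreal (2 * \<epsilon>)" using \<epsilon> by (simp flip: ennreal_plus)
    finally show ?thesis .
  qed
  obtain d where d: "0 < d" "\<And>x. x \<in> C \<Longrightarrow> ball x d \<subseteq> U"
  proof -
    have "C \<subseteq> U" using C U by auto
    then obtain d where "0 < d" "(\<Union>x\<in>C. ball x d) \<subseteq> U"
      using compact_subset_open_imp_ball_epsilon_subset[OF C(1) U(1)] by blast
    then show ?thesis using that[of d] by blast
  qed
  have [measurable]: "U - C \<in> sets borel" using UC_borel by (intro sets.Diff)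
  show ?case
  proof (intro exI[of _ d] conjI allI impI d)
    fix y :: 'a assume y: "norm y < d"
    have pt: "ennreal \<bar>indicat_real A (x - y) *\<^sub>R c - indicat_real A x *\<^sub>R c\<bar>
       \<le> ennreal \<bar>c\<bar> * (indicator (U - C) (x - y) + indicator (U - C) x)" for x
    proof -
      have "x - y \<in> U" if "x \<in> C" using d(2)[OF that] y by (auto simp: dist_norm subset_iff)
      moreover have "x \<in> U" if "x - y \<in> C" using d(2)[OF that] y by (auto simp: dist_norm norm_minus_commute subset_iff)
      ultimately have "x \<in> U - C \<or> x - y \<in> U - C" if "(x - y \<in> A) \<noteq> (x \<in> A)"
        using C(2) U(2) that by blast
      moreover have "ennreal \<bar>c\<bar> * 1 \<le> ennreal \<bar>c\<bar> * (indicator (U - C) (x - y) + indicator (U - C) x)"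
        if "x \<in> U - C \<or> x - y \<in> U - C"
        using that by (intro mult_left_mono) (auto simp: indicator_def)
      ultimately show ?thesis by (cases "x - y \<in> A"; cases "x \<in> A") auto
    qed
    have "(\<integral>\<^sup>+x. ennreal \<bar>indicat_real A (x - y) *\<^sub>R c - indicat_real A x *\<^sub>R c\<bar> \<partial>lborel)
      \<le> (\<integral>\<^sup>+x. ennreal \<bar>c\<bar> * (indicator (U - C) (x - y) + indicator (U - C) x) \<partial>lborel)"
      by (intro nn_integral_mono pt)
    also have "\<dots> = ennreal \<bar>c\<bar> * ((\<integral>\<^sup>+x. indicator (U - C) (x - y) \<partial>lborel) + (\<integral>\<^sup>+x. indicator (U - C) x \<partial>lborel))"
      by (simp add: nn_integral_cmult nn_integral_add del: nn_integral_indicator)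
    also have "(\<integral>\<^sup>+x. indicator (U - C) (x - y) \<partial>lborel) = (\<integral>\<^sup>+x. indicator (U - C) x \<partial>lborel)"
      by (rule nn_integral_lborel_shift) auto
    also have "(\<integral>\<^sup>+x. indicator (U - C) x \<partial>lborel) = emeasure lborel (U - C)" by simp
    also have "ennreal \<bar>c\<bar> * (emeasure lborel (U - C) + emeasure lborel (U - C))
       \<le> ennreal \<bar>c\<bar> * (ennreal (2 * \<epsilon>) + ennreal (2 * \<epsilon>))"
      using UC by (intro mult_left_mono add_mono) auto
    also have "\<dots> = ennreal (\<bar>c\<bar> * (4 * \<epsilon>))"
      using \<epsilon> by (simp flip: ennreal_plus ennreal_mult)
    also have "\<dots> \<le> ennreal e"
    proof (rule ennreal_leI)
      have "\<bar>c\<bar> * (4 * \<epsilon>) \<le> (\<bar>c\<bar> + 1) * (4 * \<epsilon>)"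
        using \<epsilon> by (intro mult_right_mono) auto
      also have "\<dots> = e" unfolding \<epsilon>_def by (simp add: field_simps add_pos_nonneg)
      finally show "\<bar>c\<bar> * (4 * \<epsilon>) \<le> e" .
    qed
    finally show "(\<integral>\<^sup>+x. ennreal \<bar>indicat_real A (x - y) *\<^sub>R c - indicat_real A x *\<^sub>R c\<bar> \<partial>lborel) \<le> ennreal e" .
  qed
next
  case (add f g)
  have e2: "0 < e / 2" using add.prems by simp
  obtain d1 where d1: "0 < d1" "\<And>y. norm y < d1 \<Longrightarrow> (\<integral>\<^sup>+x. ennreal \<bar>f (x - y) - f x\<bar> \<partial>lborel) \<le> ennreal (e/2)"
    using add.IH(1)[OF e2] by blast
  obtain d2 where d2: "0 < d2" "\<And>y. norm y < d2 \<Longrightarrow> (\<integral>\<^sup>+x. ennreal \<bar>g (x - y) - g x\<bar> \<partial>lborel) \<le> ennreal (e/2)"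
    using add.IH(2)[OF e2] by blast
  have [measurable]: "f \<in> borel_measurable borel" "g \<in> borel_measurable borel" using add.hyps by auto
  show ?case
  proof (intro exI[of _ "min d1 d2"] conjI allI impI)
    fix y :: 'a assume y: "norm y < min d1 d2"
    have "(\<integral>\<^sup>+x. ennreal \<bar>f (x - y) + g (x - y) - (f x + g x)\<bar> \<partial>lborel)
      \<le> (\<integral>\<^sup>+x. ennreal \<bar>f (x - y) - f x\<bar> + ennreal \<bar>g (x - y) - g x\<bar> \<partial>lborel)"
      by (intro nn_integral_mono) (simp flip: ennreal_plus)
    also have "\<dots> = (\<integral>\<^sup>+x. ennreal \<bar>f (x - y) - f x\<bar> \<partial>lborel) + (\<integral>\<^sup>+x. ennreal \<bar>g (x - y) - g x\<bar> \<partial>lborel)"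
      by (intro nn_integral_add) auto
    also have "\<dots> \<le> ennreal (e/2) + ennreal (e/2)"
      using d1 d2 y by (intro add_mono) auto
    also have "\<dots> = ennreal e" using add.prems by (simp flip: ennreal_plus)
    finally show "(\<integral>\<^sup>+x. ennreal \<bar>f (x - y) + g (x - y) - (f x + g x)\<bar> \<partial>lborel) \<le> ennreal e" .
  qed (use d1 d2 in auto)
next
  case (lim f s)
  have [measurable]: "f \<in> borel_measurable borel" "s i \<in> borel_measurable borel" for i using lim.hyps by auto
  have "(\<lambda>i. \<integral>\<^sup>+x. ennreal \<bar>s i x - f x\<bar> \<partial>lborel) \<longlonglongrightarrow> (\<integral>\<^sup>+x. 0 \<partial>(lborel::'a measure))"
  proof (rule nn_integral_dominated_convergence[where w = "\<lambda>x. ennreal (3 * \<bar>f x\<bar>)"])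
    show "(\<integral>\<^sup>+x. ennreal (3 * \<bar>f x\<bar>) \<partial>lborel) < \<infinity>"
      using lim.hyps(4) by (simp add: integrable_iff_bounded ennreal_mult nn_integral_cmult ennreal_mult_less_top)
    show "AE x in lborel. (\<lambda>i. ennreal \<bar>s i x - f x\<bar>) \<longlonglongrightarrow> 0"
    proof (rule AE_I2)
      fix x
      have "(\<lambda>i. \<bar>s i x - f x\<bar>) \<longlonglongrightarrow> \<bar>f x - f x\<bar>" using lim.hyps(2)[of x] by (intro tendsto_intros) auto
      then show "(\<lambda>i. ennreal \<bar>s i x - f x\<bar>) \<longlonglongrightarrow> 0"
        by (auto intro: tendsto_ennrealI[where x = 0, simplified])
    qed
    show "AE x in lborel. ennreal \<bar>s i x - f x\<bar> \<le> ennreal (3 * \<bar>f x\<bar>)" for i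
    proof (rule AE_I2)
      fix x
      show "ennreal \<bar>s i x - f x\<bar> \<le> ennreal (3 * \<bar>f x\<bar>)"
        using lim.hyps(3)[of x i] by (intro ennreal_leI) auto
    qed
  qed auto
  then have "\<forall>\<^sub>F i in sequentially. (\<integral>\<^sup>+x. ennreal \<bar>s i x - f x\<bar> \<partial>lborel) < ennreal (e/3)"
    using lim.prems by (intro order_tendstoD(2)) auto
  then obtain i where i: "(\<integral>\<^sup>+x. ennreal \<bar>s i x - f x\<bar> \<partial>lborel) < ennreal (e/3)"
    using eventually_happens'[OF sequentially_bot] by blast
  obtain d where d: "0 < d" "\<And>y. norm y < d \<Longrightarrow> (\<integral>\<^sup>+x. ennreal \<bar>s i (x - y) - s i x\<bar> \<partial>lborel) \<le> ennreal (e/3)"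
    using lim.IH[of "e/3" i] lim.prems by auto
  show ?case
  proof (intro exI[of _ d] conjI allI impI d)
    fix y :: 'a assume y: "norm y < d"
    have "(\<integral>\<^sup>+x. ennreal \<bar>f (x - y) - f x\<bar> \<partial>lborel)
      \<le> (\<integral>\<^sup>+x. (ennreal \<bar>s i (x - y) - f (x - y)\<bar> + ennreal \<bar>s i (x - y) - s i x\<bar>) + ennreal \<bar>s i x - f x\<bar> \<partial>lborel)"
      by (intro nn_integral_mono) (simp flip: ennreal_plus)
    also have "\<dots> = ((\<integral>\<^sup>+x. ennreal \<bar>s i (x - y) - f (x - y)\<bar> \<partial>lborel) + (\<integral>\<^sup>+x. ennreal \<bar>s i (x - y) - s i x\<bar> \<partial>lborel))
        + (\<integral>\<^sup>+x. ennreal \<bar>s i x - f x\<bar> \<partial>lborel)"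
      by (simp add: nn_integral_add)
    also have "(\<integral>\<^sup>+x. ennreal \<bar>s i (x - y) - f (x - y)\<bar> \<partial>lborel) = (\<integral>\<^sup>+x. ennreal \<bar>s i x - f x\<bar> \<partial>lborel)"
      by (rule nn_integral_lborel_shift[of "\<lambda>x. ennreal \<bar>s i x - f x\<bar>"]) auto
    also have "((\<integral>\<^sup>+x. ennreal \<bar>s i x - f x\<bar> \<partial>lborel) + (\<integral>\<^sup>+x. ennreal \<bar>s i (x - y) - s i x\<bar> \<partial>lborel))
        + (\<integral>\<^sup>+x. ennreal \<bar>s i x - f x\<bar> \<partial>lborel) \<le> (ennreal (e/3) + ennreal (e/3)) + ennreal (e/3)"
      using i d y by (intro add_mono) auto
    also have "\<dots> = ennreal e" using lim.prems by (simp flip: ennreal_plus)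
    finally show "(\<integral>\<^sup>+x. ennreal \<bar>f (x - y) - f x\<bar> \<partial>lborel) \<le> ennreal e" .
  qed
qed

lemma integrable_mult_bounded:
  fixes f g :: "'a \<Rightarrow> real"
  assumes "integrable M f" "g \<in> borel_measurable M" "\<And>x. \<bar>g x\<bar> \<le> B"
  shows "integrable M (\<lambda>x. f x * g x)"
proof (rule Bochner_Integration.integrable_bound)
  show "integrable M (\<lambda>x. B * f x)" using assms(1) by simp
  show "(\<lambda>x. f x * g x) \<in> borel_measurable M" using assms by auto
  have "\<bar>f x\<bar> * \<bar>g x\<bar> \<le> \<bar>f x\<bar> * \<bar>B\<bar>" for x
    using assms(3)[of x] by (intro mult_left_mono) auto
  then show "AE x in M. norm (f x * g x) \<le> norm (B * f x)"
    by (intro AE_I2) (simp add: abs_mult mult.commute)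
qed

lemma abs_integral_le:
  fixes f g :: "'a \<Rightarrow> real"
  assumes "integrable M f" "integrable M g" "\<And>x. \<bar>f x\<bar> \<le> g x"
  shows "\<bar>integral\<^sup>L M f\<bar> \<le> integral\<^sup>L M g"
  using assms by (intro order_trans[OF integral_abs_bound] integral_mono) auto

section \<open>Convolution with smooth kernels\<close>

definition mollify :: "('a::euclidean_space \<Rightarrow> real) \<Rightarrow> ('a \<Rightarrow> real) \<Rightarrow> 'a \<Rightarrow> real" where
  "mollify f \<eta> x = (LINT y|lborel. f y * \<eta> (x - y))"

lemma mollify_integrand:
  assumes "integrable lborel f" "compactly_supported \<eta>"
  shows "integrable lborel (\<lambda>y. f y * \<eta> (x - y))"
proof -
  obtain B where "\<And>x. \<bar>\<eta> x\<bar> \<le> B" using compactly_supported_bounded[OF assms(2)] by blast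
  moreover have [measurable]: "\<eta> \<in> borel_measurable borel" using assms(2) by (rule compactly_supported_borel)
  have "(\<lambda>y. \<eta> (x - y)) \<in> borel_measurable lborel" by measurable
  ultimately show ?thesis using integrable_mult_bounded[OF assms(1)] by blast
qed

lemma directional_representation:
  assumes "linear f'"
  shows "f' h = (\<Sum>b\<in>Basis. (h \<bullet> b) * (f' b :: real))"
proof -
  have "f' h = f' (\<Sum>b\<in>Basis. (h \<bullet> b) *\<^sub>R b)" by (simp only: euclidean_representation)
  then show ?thesis by (simp add: linear_sum[OF assms] linear_cmul[OF assms])
qed

text \<open>The remainder of the first order expansion is small uniformly in the base point z,
  because the directional derivatives are uniformly continuous. The uniformity allows integration of
  the expansion against a function that is merely integrable.\<close>

lemma test_functions_linearization:
  fixes \<eta> :: "'a::euclidean_space \<Rightarrow> real"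
  assumes \<eta>: "\<eta> \<in> test_functions V" and "0 < e"
  obtains d where "0 < d"
    "\<And>z h. norm h < d \<Longrightarrow> \<bar>\<eta> (z + h) - \<eta> z - frechet_derivative \<eta> (at z) h\<bar> \<le> e * norm h"
proof -
  define D where "D = (\<lambda>z. frechet_derivative \<eta> (at z))"
  define e' where "e' = e / real DIM('a)"
  have e': "0 < e'" using assms(2) by (simp add: e'_def)
  have D: "(\<eta> has_derivative D z) (at z)" for z
    unfolding D_def by (rule test_functions_has_derivative[OF \<eta>])
  have "\<forall>b\<in>Basis. \<exists>d>0. \<forall>z z'. norm (z - z') < d \<longrightarrow> \<bar>D z b - D z' b\<bar> < e'"
  proof
    fix b :: 'a assume "b \<in> Basis"
    then have "compactly_supported (\<lambda>z. D z b)"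
      unfolding D_def by (rule test_functions_compactly_supported[OF test_functions_directional[OF \<eta>]])
    from compactly_supported_uniform[OF this e'] show "\<exists>d>0. \<forall>z z'. norm (z - z') < d \<longrightarrow> \<bar>D z b - D z' b\<bar> < e'"
      by metis
  qed
  then obtain d where d: "\<forall>b\<in>Basis. 0 < d b \<and> (\<forall>z z'. norm (z - z') < d b \<longrightarrow> \<bar>D z b - D z' b\<bar> < e')"
    by (auto dest!: bchoice)
  define \<delta> where "\<delta> = Min (d ` Basis)"
  have \<delta>: "0 < \<delta>" "\<And>b. b \<in> Basis \<Longrightarrow> \<delta> \<le> d b"
    using d by (auto simp: \<delta>_def)
  have on: "onorm (D z - D z') \<le> e" if "norm (z - z') < \<delta>" for z z'
  proof (rule onorm_le)
    fix h
    have "(D z - D z') h = (\<Sum>b\<in>Basis. (h \<bullet> b) * (D z b - D z' b))"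
      using directional_representation[OF has_derivative_linear[OF D[of z]], of h]
        directional_representation[OF has_derivative_linear[OF D[of z']], of h]
      by (simp add: sum_subtractf algebra_simps)
    also have "norm \<dots> \<le> (\<Sum>b\<in>(Basis::'a set). norm h * e')"
    proof (rule sum_norm_le)
      fix b :: 'a assume b: "b \<in> Basis"
      have "\<bar>D z b - D z' b\<bar> \<le> e'" using d \<delta>(2)[OF b] that b by (meson less_imp_le less_le_trans)
      then show "norm ((h \<bullet> b) * (D z b - D z' b)) \<le> norm h * e'"
        unfolding real_norm_def abs_mult using Basis_le_norm[OF b] by (intro mult_mono) auto
    qed
    also have "\<dots> = e * norm h" by (simp add: e'_def)
    finally show "norm ((D z - D z') h) \<le> e * norm h" .
  qed
  show thesis
  proof (rule that[OF \<delta>(1)])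
    fix z h :: 'a assume h: "norm h < \<delta>"
    have "norm (\<eta> (z + h) - \<eta> z - D z (z + h - z)) \<le> norm (z + h - z) * e"
    proof (rule differentiable_bound_linearization[where S = "ball z \<delta>"])
      show "z + t *\<^sub>R (z + h - z) \<in> ball z \<delta>" if "t \<in> {0..1}" for t
      proof -
        have "\<bar>t\<bar> * norm h \<le> 1 * norm h" using that by (intro mult_right_mono) auto
        then show ?thesis using h by (simp add: dist_norm)
      qed
      show "(\<eta> has_derivative D x) (at x within ball z \<delta>)" for x
        using D has_derivative_at_withinI by blast
      show "onorm (D x - D z) \<le> e" if "x \<in> ball z \<delta>" for x
        using that by (intro on) (simp add: dist_norm norm_minus_commute)
      show "z \<in> ball z \<delta>" using \<delta> by simp
    qed
    then show "\<bar>\<eta> (z + h) - \<eta> z - frechet_derivative \<eta> (at z) h\<bar> \<le> e * norm h"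
      by (simp add: D_def mult.commute)
  qed
qed

text \<open>The derivative falls on the kernel: the uniform expansion of \<eta> is multiplied by f
  and integrated, so no regularity of f is involved.\<close>

lemma mollify_has_derivative:
  fixes f \<eta> :: "'a::euclidean_space \<Rightarrow> real"
  assumes f: "integrable lborel f" and \<eta>: "\<eta> \<in> test_functions V"
  shows "(mollify f \<eta> has_derivative
     (\<lambda>h. \<Sum>b\<in>Basis. (h \<bullet> b) * mollify f (\<lambda>z. frechet_derivative \<eta> (at z) b) x)) (at x)"
proof -
  define D where "D = (\<lambda>z. frechet_derivative \<eta> (at z))"
  have Dcs: "compactly_supported (\<lambda>z. D z b)" if "b \<in> Basis" for b
    unfolding D_def by (rule test_functions_compactly_supported[OF test_functions_directional[OF \<eta> that]])
  have Dint: "integrable lborel (\<lambda>y. f y * D (x - y) b)" if "b \<in> Basis" for b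
    using mollify_integrand[OF f Dcs[OF that]] .
  have Drep: "D z h = (\<Sum>b\<in>Basis. (h \<bullet> b) * D z b)" for z h
    unfolding D_def using test_functions_has_derivative[OF \<eta>]
    by (intro directional_representation has_derivative_linear)
  have int: "integrable lborel (\<lambda>y. f y * \<eta> (x - y))" for x
    using mollify_integrand[OF f test_functions_compactly_supported[OF \<eta>]] .
  have fD: "(\<lambda>y. f y * D (x - y) h) = (\<lambda>y. \<Sum>b\<in>Basis. (h \<bullet> b) * (f y * D (x - y) b))" for h
    by (subst Drep) (simp add: sum_distrib_left mult_ac)
  have eq: "(\<Sum>b\<in>Basis. (h \<bullet> b) * mollify f (\<lambda>z. D z b) x) = (LINT y|lborel. f y * D (x - y) h)" for h
    unfolding fD[of h] mollify_def using Dint by (simp add: Bochner_Integration.integral_sum)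
  have intD: "integrable lborel (\<lambda>y. f y * D (x - y) h)" for h
    unfolding fD[of h] using Dint by (intro Bochner_Integration.integrable_sum integrable_mult_right) auto
  define F where "F = (LINT y|lborel. \<bar>f y\<bar>)"
  have F: "0 \<le> F" unfolding F_def by simp
  have Dz: "frechet_derivative \<eta> (at z) = D z" for z by (simp add: D_def)
  show ?thesis unfolding has_derivative_at_alt Dz
  proof (intro conjI allI impI)
    have "linear (\<lambda>h. \<Sum>b\<in>Basis. (h \<bullet> b) * mollify f (\<lambda>z. D z b) x)"
      by (intro linearI) (auto simp: inner_add_left algebra_simps sum.distrib sum_distrib_left)
    then show "bounded_linear (\<lambda>h. \<Sum>b\<in>Basis. (h \<bullet> b) * mollify f (\<lambda>z. D z b) x)"
      by (simp add: linear_conv_bounded_linear)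
    fix e :: real assume e: "0 < e"
    \<comment> \<open>F is the L1 norm of f; dividing by F + 1 leaves a remainder below e also when
      F = 0.\<close>
    then have e1: "0 < e / (F + 1)" using F by simp
    obtain d where d: "0 < d"
      "\<And>z h. norm h < d \<Longrightarrow> \<bar>\<eta> (z + h) - \<eta> z - frechet_derivative \<eta> (at z) h\<bar> \<le> e / (F + 1) * norm h"
      using test_functions_linearization[OF \<eta> e1] by blast
    show "\<exists>d>0. \<forall>y. norm (y - x) < d \<longrightarrow> norm (mollify f \<eta> y - mollify f \<eta> x
         - (\<Sum>b\<in>Basis. ((y - x) \<bullet> b) * mollify f (\<lambda>z. D z b) x)) \<le> e * norm (y - x)"
    proof (intro exI[of _ d] conjI allI impI d(1))
      fix y assume y: "norm (y - x) < d"
      define h where "h = y - x"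
      have yx: "y = x + h" by (simp add: h_def)
      have "mollify f \<eta> y - mollify f \<eta> x - (\<Sum>b\<in>Basis. ((y - x) \<bullet> b) * mollify f (\<lambda>z. D z b) x)
        = (LINT z|lborel. f z * \<eta> (y - z)) - (LINT z|lborel. f z * \<eta> (x - z)) - (LINT z|lborel. f z * D (x - z) h)"
        unfolding eq h_def by (simp add: mollify_def)
      also have "\<dots> = (LINT z|lborel. f z * \<eta> (y - z) - f z * \<eta> (x - z) - f z * D (x - z) h)"
        using int intD by simp
      also have "norm \<dots> \<le> (LINT z|lborel. \<bar>f z\<bar> * (e / (F + 1) * norm h))"
        unfolding real_norm_def
      proof (rule abs_integral_le)
        show "integrable lborel (\<lambda>z. f z * \<eta> (y - z) - f z * \<eta> (x - z) - f z * D (x - z) h)"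
          using int intD by simp
        show "integrable lborel (\<lambda>z. \<bar>f z\<bar> * (e / (F + 1) * norm h))"
          using f by (intro integrable_mult_left) auto
        fix z
        have "f z * \<eta> (y - z) - f z * \<eta> (x - z) - f z * D (x - z) h
          = f z * (\<eta> ((x - z) + h) - \<eta> (x - z) - D (x - z) h)"
          by (simp add: yx algebra_simps)
        moreover have "\<bar>\<eta> ((x - z) + h) - \<eta> (x - z) - D (x - z) h\<bar> \<le> e / (F + 1) * norm h"
          unfolding D_def using y by (intro d(2)) (simp add: h_def)
        ultimately show "\<bar>f z * \<eta> (y - z) - f z * \<eta> (x - z) - f z * D (x - z) h\<bar>
            \<le> \<bar>f z\<bar> * (e / (F + 1) * norm h)"
          by (simp only: abs_mult) (intro mult_left_mono, auto)
      qed
      also have "\<dots> = F * (e / (F + 1) * norm h)"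
        unfolding F_def by (rule integral_mult_left_zero)
      also have "\<dots> = (F / (F + 1)) * (e * norm h)" by simp
      also have "\<dots> \<le> 1 * (e * norm h)"
        using F e by (intro mult_right_mono) auto
      finally show "norm (mollify f \<eta> y - mollify f \<eta> x
         - (\<Sum>b\<in>Basis. ((y - x) \<bullet> b) * mollify f (\<lambda>z. D z b) x)) \<le> e * norm (y - x)"
        by (simp add: h_def)
    qed
  qed
qed

lemma mollify_directional:
  fixes f \<eta> :: "'a::euclidean_space \<Rightarrow> real"
  assumes "integrable lborel f" "\<eta> \<in> test_functions V" "b \<in> Basis"
  shows "frechet_derivative (mollify f \<eta>) (at x) b = mollify f (\<lambda>z. frechet_derivative \<eta> (at z) b) x"
proof -
  have "frechet_derivative (mollify f \<eta>) (at x) b =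
     (\<Sum>b'\<in>Basis. (b \<bullet> b') * mollify f (\<lambda>z. frechet_derivative \<eta> (at z) b') x)"
    using fun_cong[OF frechet_derivative_at[OF mollify_has_derivative[OF assms(1,2)]], of b] by simp
  also have "\<dots> = (\<Sum>b'\<in>Basis. if b' = b then mollify f (\<lambda>z. frechet_derivative \<eta> (at z) b') x else 0)"
    using assms(3) by (intro sum.cong) (auto simp: inner_Basis)
  finally show ?thesis using assms(3) by simp
qed

text \<open>A directional derivative of a mollification is the mollification with the differentiated
  kernel, which is again a test function; hence the induction runs over all kernels
  simultaneously.\<close>

lemma C_k_mollify:
  assumes "integrable lborel f" "\<eta> \<in> test_functions V"
  shows "C_k k (mollify f \<eta>)"
  using assms(2)
proof (induction k arbitrary: \<eta>)
  case 0
  have "mollify f \<eta> differentiable (at x)" for x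
    using mollify_has_derivative[OF assms(1) 0] unfolding differentiable_def by blast
  then show ?case by (auto intro!: continuous_at_imp_continuous_on differentiable_imp_continuous_within)
next
  case (Suc k)
  have "mollify f \<eta> differentiable (at x)" for x
    using mollify_has_derivative[OF assms(1) Suc.prems] unfolding differentiable_def by blast
  moreover have "C_k k (mollify f (\<lambda>z. frechet_derivative \<eta> (at z) b))" if "b \<in> Basis" for b
    by (rule Suc.IH[OF test_functions_directional[OF Suc.prems that]])
  ultimately show ?case using mollify_directional[OF assms(1) Suc.prems] by simp
qed

lemma mollifier_exists:
  assumes "0 < d"
  shows "\<exists>\<eta>\<in>test_functions (ball (0::'a::euclidean_space) d). (\<forall>x. 0 \<le> \<eta> x) \<and> (LINT x|lborel. \<eta> x) = 1"
proof -
  \<comment> \<open>With this scale the support lies where every coordinate is at most d / (2 DIM),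
    so the norm is at most d / 2 by comparison with the sum of the coordinates.\<close>
  define s where "s = 2 * real DIM('a) / d"
  have s: "0 < s" using assms by (simp add: s_def)
  define \<eta>0 :: "'a \<Rightarrow> real" where "\<eta>0 x = (\<Prod>b\<in>Basis. bump (0 + s * (x \<bullet> b)))" for x
  have C: "C_k k \<eta>0" for k
    unfolding \<eta>0_def by (intro C_k_prod C_k_affine_comp C_k_bump)
      (auto intro!: linearI simp: algebra_simps inner_add_left)
  have nonneg: "0 \<le> \<eta>0 x" for x unfolding \<eta>0_def by (intro prod_nonneg) (simp add: bump_bounds)
  have "norm x \<le> d / 2" if "\<eta>0 x \<noteq> 0" for x
  proof -
    have "\<bar>x \<bullet> b\<bar> \<le> 1 / s" if "b \<in> Basis" for b
    proof -
      have "bump (0 + s * (x \<bullet> b)) \<noteq> 0" using \<open>\<eta>0 x \<noteq> 0\<close> that unfolding \<eta>0_def by (metis finite_Basis prod_zero_iff)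
      then have "\<bar>s * (x \<bullet> b)\<bar> < 1" using bump_eq_0[of "0 + s * (x \<bullet> b)"] by fastforce
      then show ?thesis using s by (simp add: abs_mult field_simps)
    qed
    then have "norm x \<le> (\<Sum>b\<in>(Basis::'a set). 1 / s)"
      by (intro order_trans[OF norm_le_l1] sum_mono)
    also have "\<dots> = d / 2" using assms by (simp add: s_def)
    finally show ?thesis .
  qed
  then have sub: "closure {x. \<eta>0 x \<noteq> 0} \<subseteq> cball 0 (d / 2)"
    by (intro closure_minimal) auto
  moreover have "cball 0 (d / 2) \<subseteq> ball (0::'a) d" using assms by auto
  moreover have "compact (closure {x. \<eta>0 x \<noteq> 0})"
    using sub bounded_subset[OF bounded_cball] by (auto simp: compact_eq_bounded_closed)
  ultimately have T: "\<eta>0 \<in> test_functions (ball 0 d)"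
    using C unfolding test_functions_def by auto
  note cs = test_functions_compactly_supported[OF T]
  define c where "c = (LINT x|lborel. \<eta>0 x)"
  \<comment> \<open>If the integral vanished, the set where \<eta>0 is nonzero would be negligible;
    but it is open and contains the origin.\<close>
  have "c \<noteq> 0"
  proof
    assume "c = 0"
    then have "AE x in lborel. \<eta>0 x = 0"
      unfolding c_def using integral_nonneg_eq_0_iff_AE[OF compactly_supported_integrable[OF cs]] nonneg by simp
    then have "AE x in lebesgue. \<eta>0 x = 0" by (rule AE_completion)
    then have "negligible {x. \<eta>0 x \<noteq> 0}"
      using AE_iff_null_sets[of "{x. \<eta>0 x \<noteq> 0}" lebesgue]
      unfolding negligible_iff_null_sets eventually_ae_filter
      by (auto intro: completion.complete2 null_sets_completion_subset)
    moreover have "open {x. \<eta>0 x \<noteq> 0}"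
      using cs by (intro open_Collect_neq) (auto simp: compactly_supported_def)
    moreover have "0 \<in> {x. \<eta>0 x \<noteq> 0}"
      using bump_pos_iff[of 0] by (simp add: \<eta>0_def)
    ultimately show False using open_not_negligible by blast
  qed
  moreover have "0 \<le> c" unfolding c_def using nonneg by (intro Bochner_Integration.integral_nonneg)
  ultimately have c: "0 < c" by simp
  define \<eta> where "\<eta> = (\<lambda>x. (1 / c) * \<eta>0 x)"
  have "{x. \<eta> x \<noteq> 0} = {x. \<eta>0 x \<noteq> 0}" using c by (auto simp: \<eta>_def)
  moreover have "C_k k \<eta>" for k unfolding \<eta>_def by (intro C_k_mult C_k_const C)
  ultimately have "\<eta> \<in> test_functions (ball 0 d)" using T by (simp add: test_functions_def)
  moreover have "(LINT x|lborel. \<eta> x) = 1" using c by (simp add: \<eta>_def c_def)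
  moreover have "0 \<le> \<eta> x" for x using c nonneg by (simp add: \<eta>_def)
  ultimately show ?thesis by blast
qed

lemma test_functions_support: "\<eta> \<in> test_functions U \<Longrightarrow> x \<notin> U \<Longrightarrow> \<eta> x = 0"
  using closure_subset[of "{x. \<eta> x \<noteq> 0}"] by (auto simp: test_functions_def)

lemma mollify_measurable:
  assumes "integrable lborel f" "\<eta> \<in> test_functions U"
  shows "mollify f \<eta> \<in> borel_measurable borel"
  using C_k_continuous[OF C_k_mollify[OF assms, of 0]] by (intro borel_measurable_continuous_onI)

text \<open>As the kernel has mass 1, the error is an average of f(x - y) - f(x) over y. Tonelli's
  theorem moves the L1 norm inside the average.\<close>

lemma mollify_L1_bound:
  fixes f :: "'a::euclidean_space \<Rightarrow> real"
  assumes f: "integrable lborel f" and \<eta>: "\<eta> \<in> test_functions (ball 0 d)" "\<And>x. 0 \<le> \<eta> x" "(LINT x|lborel. \<eta> x) = 1"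
    and tr: "\<And>y. norm y < d \<Longrightarrow> (\<integral>\<^sup>+x. ennreal \<bar>f (x - y) - f x\<bar> \<partial>lborel) \<le> e"
  shows "(\<integral>\<^sup>+x. ennreal \<bar>mollify f \<eta> x - f x\<bar> \<partial>lborel) \<le> e"
proof -
  have [measurable]: "f \<in> borel_measurable borel" "\<eta> \<in> borel_measurable borel"
    using f compactly_supported_borel[OF test_functions_compactly_supported[OF \<eta>(1)]] by auto
  note cs = test_functions_compactly_supported[OF \<eta>(1)]
  note \<eta>i = compactly_supported_integrable[OF cs]
  have "ennreal \<bar>mollify f \<eta> x - f x\<bar> \<le> (\<integral>\<^sup>+y. ennreal \<bar>f (x - y) - f x\<bar> * ennreal (\<eta> y) \<partial>lborel)" for x
  proof -
    have i1: "integrable lborel (\<lambda>y. f (x - y) * \<eta> y)"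
      using integrable_lborel_reflect[OF mollify_integrand[OF f cs, of x], of x] by simp
    have "mollify f \<eta> x = (LINT y|lborel. f (x - y) * \<eta> y)"
      unfolding mollify_def using integral_lborel_reflect[of "\<lambda>y. f y * \<eta> (x - y)" x] by simp
    moreover have "f x = (LINT y|lborel. f x * \<eta> y)" using \<eta>(3) by simp
    ultimately have "mollify f \<eta> x - f x = (LINT y|lborel. f (x - y) * \<eta> y - f x * \<eta> y)"
      using i1 \<eta>i by simp
    also have "ennreal \<bar>\<dots>\<bar> \<le> (\<integral>\<^sup>+y. ennreal (norm (f (x - y) * \<eta> y - f x * \<eta> y)) \<partial>lborel)"
      using i1 \<eta>i integral_norm_bound_ennreal[of lborel "\<lambda>y. f (x - y) * \<eta> y - f x * \<eta> y"] by simp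
    also have "\<dots> = (\<integral>\<^sup>+y. ennreal \<bar>f (x - y) - f x\<bar> * ennreal (\<eta> y) \<partial>lborel)"
    proof (intro nn_integral_cong)
      fix y
      have "norm (f (x - y) * \<eta> y - f x * \<eta> y) = \<bar>f (x - y) - f x\<bar> * \<eta> y"
        using \<eta>(2)[of y] by (simp add: left_diff_distrib[symmetric] abs_mult)
      then show "ennreal (norm (f (x - y) * \<eta> y - f x * \<eta> y)) = ennreal \<bar>f (x - y) - f x\<bar> * ennreal (\<eta> y)"
        using \<eta>(2)[of y] by (simp add: ennreal_mult)
    qed
    finally show ?thesis .
  qed
  then have "(\<integral>\<^sup>+x. ennreal \<bar>mollify f \<eta> x - f x\<bar> \<partial>lborel)
    \<le> (\<integral>\<^sup>+x. (\<integral>\<^sup>+y. ennreal \<bar>f (x - y) - f x\<bar> * ennreal (\<eta> y) \<partial>lborel) \<partial>lborel)"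
    by (intro nn_integral_mono)
  also have "\<dots> = (\<integral>\<^sup>+y. (\<integral>\<^sup>+x. ennreal \<bar>f (x - y) - f x\<bar> * ennreal (\<eta> y) \<partial>lborel) \<partial>lborel)"
    by (rule lborel_pair.Fubini'[symmetric]) measurable
  also have "\<dots> = (\<integral>\<^sup>+y. (\<integral>\<^sup>+x. ennreal \<bar>f (x - y) - f x\<bar> \<partial>lborel) * ennreal (\<eta> y) \<partial>lborel)"
    by (intro nn_integral_cong nn_integral_multc) measurable
  also have "\<dots> \<le> (\<integral>\<^sup>+y. e * ennreal (\<eta> y) \<partial>lborel)"
  proof (intro nn_integral_mono)
    fix y
    show "(\<integral>\<^sup>+x. ennreal \<bar>f (x - y) - f x\<bar> \<partial>lborel) * ennreal (\<eta> y) \<le> e * ennreal (\<eta> y)"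
    proof (cases "norm y < d")
      case True
      then show ?thesis using tr by (intro mult_right_mono) auto
    next
      case False
      then show ?thesis using test_functions_support[OF \<eta>(1)] by simp
    qed
  qed
  also have "\<dots> = e * ennreal (LINT y|lborel. \<eta> y)"
    using \<eta>i \<eta>(2) by (simp add: nn_integral_cmult nn_integral_eq_integral)
  finally show ?thesis using \<eta>(3) by simp
qed

text \<open>One sequence of kernels serves every integrable f, so that a function and all components
  of its weak gradient can be mollified together.\<close>

lemma mollifier_sequence:
  assumes "0 < \<delta>"
  obtains \<eta> :: "nat \<Rightarrow> 'a::euclidean_space \<Rightarrow> real" where
    "\<And>n. \<eta> n \<in> test_functions (ball 0 \<delta>)" "\<And>n x. 0 \<le> \<eta> n x"
    "\<And>f n. integrable lborel f \<Longrightarrow> integrable lborel (\<lambda>x. mollify f (\<eta> n) x - f x)"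
    "\<And>f. integrable lborel f \<Longrightarrow> (\<lambda>n. LINT x|lborel. \<bar>mollify f (\<eta> n) x - f x\<bar>) \<longlonglongrightarrow> 0"
proof -
  define d where "d n = \<delta> / real (Suc n)" for n
  have d: "0 < d n" "d n \<le> \<delta>" for n using assms by (auto simp: d_def divide_le_eq)
  have d0: "d \<longlonglongrightarrow> 0"
    unfolding d_def using LIMSEQ_Suc[OF lim_const_over_n[of \<delta>]] by simp
  have "\<forall>n. \<exists>\<eta>. \<eta> \<in> test_functions (ball (0::'a) (d n)) \<and> (\<forall>x. 0 \<le> \<eta> x) \<and> (LINT x|lborel. \<eta> x) = 1"
    using mollifier_exists[OF d(1)] by blast
  then obtain \<eta> :: "nat \<Rightarrow> 'a \<Rightarrow> real" where \<eta>: "\<And>n. \<eta> n \<in> test_functions (ball 0 (d n))"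
    "\<And>n x. 0 \<le> \<eta> n x" "\<And>n. (LINT x|lborel. \<eta> n x) = 1"
    by (auto dest!: choice)
  have T: "\<eta> n \<in> test_functions (ball 0 \<delta>)" for n
    using \<eta>(1)[of n] test_functions_mono[of "ball 0 (d n)" "ball 0 \<delta>"] subset_ball[OF d(2)] by blast
  have lim: "\<exists>d>0. \<forall>n. d' n < d \<longrightarrow> (\<integral>\<^sup>+x. ennreal \<bar>mollify f (\<eta> n) x - f x\<bar> \<partial>lborel) \<le> ennreal e"
    if deq: "d' = d" and f: "integrable lborel f" and e: "0 < e" for f e d'
  proof -
    obtain r where r: "0 < r" "\<forall>y. norm y < r \<longrightarrow> (\<integral>\<^sup>+x. ennreal \<bar>f (x - y) - f x\<bar> \<partial>lborel) \<le> ennreal e"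
      using L1_translation_continuous[OF f e] by blast
    show ?thesis
    proof (intro exI[of _ r] conjI allI impI r(1))
      fix n assume "d' n < r"
      then show "(\<integral>\<^sup>+x. ennreal \<bar>mollify f (\<eta> n) x - f x\<bar> \<partial>lborel) \<le> ennreal e"
        using r(2) deq by (intro mollify_L1_bound[OF f \<eta>(1,2,3)]) auto
    qed
  qed
  have int: "integrable lborel (\<lambda>x. mollify f (\<eta> n) x - f x)" if f: "integrable lborel f" for f n
  proof (rule integrableI_bounded)
    show "(\<lambda>x. mollify f (\<eta> n) x - f x) \<in> borel_measurable lborel"
      using mollify_measurable[OF f T] f by auto
    have [measurable]: "f \<in> borel_measurable borel" using f by auto
    define I where "I = (\<integral>\<^sup>+x. ennreal \<bar>f x\<bar> \<partial>lborel)"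
    have I: "I < top" using f by (simp add: I_def integrable_iff_bounded)
    have "(\<integral>\<^sup>+x. ennreal \<bar>f (x - y) - f x\<bar> \<partial>lborel) \<le> I + I" for y
    proof -
      have "(\<integral>\<^sup>+x. ennreal \<bar>f (x - y) - f x\<bar> \<partial>lborel) \<le> (\<integral>\<^sup>+x. ennreal \<bar>f (x - y)\<bar> + ennreal \<bar>f x\<bar> \<partial>lborel)"
        by (intro nn_integral_mono) (simp flip: ennreal_plus)
      also have "\<dots> = (\<integral>\<^sup>+x. ennreal \<bar>f (x - y)\<bar> \<partial>lborel) + (\<integral>\<^sup>+x. ennreal \<bar>f x\<bar> \<partial>lborel)"
        by (intro nn_integral_add) auto
      also have "(\<integral>\<^sup>+x. ennreal \<bar>f (x - y)\<bar> \<partial>lborel) = I"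
        unfolding I_def by (rule nn_integral_lborel_shift[of "\<lambda>x. ennreal \<bar>f x\<bar>"]) auto
      finally show ?thesis by (simp add: I_def)
    qed
    then have "(\<integral>\<^sup>+x. ennreal \<bar>mollify f (\<eta> n) x - f x\<bar> \<partial>lborel) \<le> I + I"
      by (intro mollify_L1_bound[OF f \<eta>(1,2,3)])
    also have "\<dots> < top" using I by simp
    finally show "(\<integral>\<^sup>+x. ennreal (norm (mollify f (\<eta> n) x - f x)) \<partial>lborel) < \<infinity>" by simp
  qed
  show thesis
  proof (rule that[OF T \<eta>(2) int])
    fix f :: "'a \<Rightarrow> real" assume f: "integrable lborel f"
    show "(\<lambda>n. LINT x|lborel. \<bar>mollify f (\<eta> n) x - f x\<bar>) \<longlonglongrightarrow> 0"
    proof (rule LIMSEQ_I)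
      fix e :: real assume e: "0 < e"
      obtain r where r: "0 < r" "\<forall>n. d n < r \<longrightarrow> (\<integral>\<^sup>+x. ennreal \<bar>mollify f (\<eta> n) x - f x\<bar> \<partial>lborel) \<le> ennreal (e/2)"
        using lim[OF refl f, of "e/2"] e by auto
      obtain N where N: "\<And>n. N \<le> n \<Longrightarrow> d n < r"
        using order_tendstoD(2)[OF d0 r(1)] unfolding eventually_sequentially by blast
      have "norm ((LINT x|lborel. \<bar>mollify f (\<eta> n) x - f x\<bar>) - 0) < e" if "N \<le> n" for n
      proof -
        have "ennreal (LINT x|lborel. \<bar>mollify f (\<eta> n) x - f x\<bar>) = (\<integral>\<^sup>+x. ennreal \<bar>mollify f (\<eta> n) x - f x\<bar> \<partial>lborel)"
          using int[OF f, of n] by (intro nn_integral_eq_integral[symmetric]) auto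
        also have "\<dots> \<le> ennreal (e/2)" using r(2) N[OF that] by blast
        finally have "(LINT x|lborel. \<bar>mollify f (\<eta> n) x - f x\<bar>) \<le> e/2" using e by simp
        moreover have "0 \<le> (LINT x|lborel. \<bar>mollify f (\<eta> n) x - f x\<bar>)" by simp
        ultimately show ?thesis using e by simp
      qed
      then show "\<exists>no. \<forall>n\<ge>no. norm ((LINT x|lborel. \<bar>mollify f (\<eta> n) x - f x\<bar>) - 0) < e" by blast
    qed
  qed
qed

section \<open>Weak gradients and a chain rule\<close>

lemma set_integral_lebesgue_eq:
  fixes f :: "'a::euclidean_space \<Rightarrow> real"
  assumes "A \<in> sets borel" "f \<in> borel_measurable borel"
  shows "(LINT x:A|lebesgue. f x) = (LINT x|lborel. indicator A x * f x)"
proof -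
  have "(\<lambda>x. indicator A x *\<^sub>R f x) \<in> borel_measurable lborel" using assms by auto
  from integral_completion[OF this] show ?thesis by (simp add: set_lebesgue_integral_def)
qed

lemma set_integrable_lebesgue_iff:
  fixes f :: "'a::euclidean_space \<Rightarrow> real"
  assumes "A \<in> sets borel" "f \<in> borel_measurable borel"
  shows "set_integrable lebesgue A f \<longleftrightarrow> integrable lborel (\<lambda>x. indicator A x * f x)"
proof -
  have "(\<lambda>x. indicator A x *\<^sub>R f x) \<in> borel_measurable lborel" using assms by auto
  from integrable_completion[OF this] show ?thesis by (simp add: set_integrable_def)
qed

lemma absolutely_integrable_vec_nth:
  fixes g :: "'a::euclidean_space \<Rightarrow> real^'n::finite"
  assumes "g absolutely_integrable_on K"
  shows "(\<lambda>x. g x $ i) absolutely_integrable_on K"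
  using absolutely_integrable_component[OF assms, of "axis i 1"] by (simp add: inner_axis)

lemma absolutely_integrable_vec_lambda:
  fixes h :: "'n::finite \<Rightarrow> 'a::euclidean_space \<Rightarrow> real"
  assumes "\<And>i. (\<lambda>x. h i x) absolutely_integrable_on K"
  shows "(\<lambda>x. \<chi> i. h i x) absolutely_integrable_on K"
proof (rule absolutely_integrable_componentwise)
  fix b :: "real^'n" assume "b \<in> Basis"
  then obtain i where "b = axis i 1" by (auto simp: Basis_vec_def)
  then show "(\<lambda>x. (\<chi> i. h i x) \<bullet> b) absolutely_integrable_on K"
    using assms[of i] by (simp add: inner_axis)
qed

lemma axis_one_Basis: "axis i (1::real) \<in> Basis"
  by simp

lemma partial_eqI: "(f has_derivative f') (at x) \<Longrightarrow> partial i f x = f' (axis i 1)"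
  unfolding partial_def using frechet_derivative_at by metis

lemma test_functions_partial:
  "\<psi> \<in> test_functions U \<Longrightarrow> partial i \<psi> \<in> test_functions U"
  unfolding partial_def[abs_def] by (rule test_functions_directional[OF _ axis_one_Basis])

section \<open>Mollification of weakly differentiable functions\<close>

lemma C_k_reflect:
  fixes f :: "'a::euclidean_space \<Rightarrow> real"
  shows "C_k k f \<Longrightarrow> C_k k (\<lambda>y. f (x - y))"
proof (induction k arbitrary: f)
  case 0
  then show ?case by (auto intro!: continuous_on_compose2[of UNIV f] continuous_intros)
next
  case (Suc k)
  have "((\<lambda>y. x - y) has_derivative (\<lambda>h. - h)) (at y)" for y
    by (auto intro!: derivative_eq_intros)
  then have "((\<lambda>y. f (x - y)) has_derivative (\<lambda>h. frechet_derivative f (at (x - y)) (- h))) (at y)" for y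
    by (rule has_derivative_compose) (rule C_k_has_derivative[OF Suc.prems])
  moreover have "frechet_derivative f (at z) (- h) = (- 1) * frechet_derivative f (at z) h" for z h
    using linear_neg[OF has_derivative_linear[OF C_k_has_derivative[OF Suc.prems]]] by simp
  ultimately have "((\<lambda>y. f (x - y)) has_derivative (\<lambda>h. (- 1) * frechet_derivative f (at (x - y)) h)) (at y)" for y
    by (simp only:)
  moreover have "C_k k (\<lambda>y. (- 1) * frechet_derivative f (at (x - y)) b)" if "b \<in> Basis" for b
  proof -
    have "C_k k (\<lambda>y. frechet_derivative f (at y) b)" using Suc.prems that by simp
    then show ?thesis by (intro C_k_mult C_k_const Suc.IH)
  qed
  ultimately show ?case by (rule C_k_SucI)
qed

lemma test_functions_reflect:
  assumes "\<eta> \<in> test_functions (ball 0 \<delta>)" "ball x \<delta> \<subseteq> U"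
  shows "(\<lambda>y. \<eta> (x - y)) \<in> test_functions U"
proof -
  let ?S = "closure {z. \<eta> z \<noteq> 0}"
  have S: "compact ?S" "?S \<subseteq> ball 0 \<delta>" using assms(1) by (auto simp: test_functions_def)
  have comp: "compact ((\<lambda>z. x - z) ` ?S)"
    by (intro compact_continuous_image S continuous_intros)
  have "{y. \<eta> (x - y) \<noteq> 0} \<subseteq> (\<lambda>z. x - z) ` ?S"
  proof
    fix y assume "y \<in> {y. \<eta> (x - y) \<noteq> 0}"
    then have "x - y \<in> ?S" using closure_subset[of "{z. \<eta> z \<noteq> 0}"] by auto
    then show "y \<in> (\<lambda>z. x - z) ` ?S" by (intro image_eqI[of _ _ "x - y"]) auto
  qed
  then have sub: "closure {y. \<eta> (x - y) \<noteq> 0} \<subseteq> (\<lambda>z. x - z) ` ?S"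
    using compact_imp_closed[OF comp] by (rule closure_minimal)
  moreover have "(\<lambda>z. x - z) ` ?S \<subseteq> U"
  proof
    fix y assume "y \<in> (\<lambda>z. x - z) ` ?S"
    then have "x - y \<in> ball 0 \<delta>" using S(2) by auto
    then have "y \<in> ball x \<delta>" by (simp add: dist_norm norm_minus_commute)
    then show "y \<in> U" using assms(2) by blast
  qed
  moreover have "compact (closure {y. \<eta> (x - y) \<noteq> 0})"
    using bounded_subset[OF compact_imp_bounded[OF comp] sub] by (simp add: compact_eq_bounded_closed)
  ultimately show ?thesis using assms(1) unfolding test_functions_def by (auto intro: C_k_reflect)
qed

lemma partial_reflect:
  assumes "\<eta> \<in> test_functions V"
  shows "partial i (\<lambda>y. \<eta> (x - y)) y = - partial i \<eta> (x - y)"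
proof -
  have "((\<lambda>y. x - y) has_derivative (\<lambda>h. - h)) (at y)"
    by (auto intro!: derivative_eq_intros)
  then have "((\<lambda>y. \<eta> (x - y)) has_derivative (\<lambda>h. frechet_derivative \<eta> (at (x - y)) (- h))) (at y)"
    by (rule has_derivative_compose) (rule test_functions_has_derivative[OF assms])
  from partial_eqI[OF this] show ?thesis
    using linear_neg[OF has_derivative_linear[OF test_functions_has_derivative[OF assms]]]
    by (simp add: partial_def[of i \<eta>])
qed

lemma W11_loc_integrable:
  assumes "W11_loc U f g" "compact K" "K \<subseteq> U"
  shows "f \<in> borel_measurable borel \<Longrightarrow> integrable lborel (\<lambda>x. indicator K x * f x)"
    and "(\<lambda>x. g x $ i) \<in> borel_measurable borel \<Longrightarrow> integrable lborel (\<lambda>x. indicator K x * g x $ i)"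
proof -
  have *: "f absolutely_integrable_on K" "g absolutely_integrable_on K"
    using assms unfolding W11_loc_def by blast+
  then show "f \<in> borel_measurable borel \<Longrightarrow> integrable lborel (\<lambda>x. indicator K x * f x)"
    using set_integrable_lebesgue_iff[of K f] assms(2) by (simp add: borel_compact)
  show "(\<lambda>x. g x $ i) \<in> borel_measurable borel \<Longrightarrow> integrable lborel (\<lambda>x. indicator K x * g x $ i)"
    using set_integrable_lebesgue_iff[of K "\<lambda>x. g x $ i"] assms(2) absolutely_integrable_vec_nth[OF *(2)]
    by (simp add: borel_compact)
qed

text \<open>The reflected kernel \<open>\<lambda>y. \<eta> (x - y)\<close> is a test function in the
  definition of the weak gradient, and its derivatives are minus those of \<eta>. Multiplying f and
  g by the indicator of K makes them integrable on the whole space; at x nothing changes because the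
  kernel lives in \<open>ball x \<delta>\<close>, a subset of K.\<close>

lemma W11_loc_mollify:
  assumes W: "W11_loc U f g" and U: "open U" and K: "compact K" "K \<subseteq> U" "ball x \<delta> \<subseteq> K"
    and f[measurable]: "f \<in> borel_measurable borel" and g[measurable]: "(\<lambda>x. g x $ i) \<in> borel_measurable borel"
    and \<eta>: "\<eta> \<in> test_functions (ball 0 \<delta>)"
  shows "partial i (mollify (\<lambda>y. indicator K y * f y) \<eta>) x = mollify (\<lambda>y. indicator K y * g y $ i) \<eta> x"
proof -
  let ?\<psi> = "\<lambda>y. \<eta> (x - y)"
  have \<psi>: "?\<psi> \<in> test_functions U" "?\<psi> \<in> test_functions (ball x \<delta>)"
    using \<eta> K by (auto intro!: test_functions_reflect)
  have out: "?\<psi> y = 0" "partial i ?\<psi> y = 0" if "y \<notin> K" for y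
  proof -
    have y: "y \<notin> ball x \<delta>" using that K(3) by blast
    show "?\<psi> y = 0" "partial i ?\<psi> y = 0"
      by (rule test_functions_support[OF \<psi>(2) y] test_functions_support[OF test_functions_partial[OF \<psi>(2)] y])+
  qed
  have KU: "indicator U y * (h * (c::real)) = indicator K y * h * c" if "y \<notin> K \<Longrightarrow> c = 0" for y h c
    using that K(2) by (auto simp: indicator_def)
  have [measurable]: "?\<psi> \<in> borel_measurable borel" "partial i ?\<psi> \<in> borel_measurable borel"
    by (intro compactly_supported_borel[OF test_functions_compactly_supported[OF \<psi>(1)]]
        compactly_supported_borel[OF test_functions_compactly_supported[OF test_functions_partial[OF \<psi>(1)]]])+
  have Ub: "U \<in> sets borel" using U by simp
  have "partial i (mollify (\<lambda>y. indicator K y * f y) \<eta>) x = mollify (\<lambda>y. indicator K y * f y) (partial i \<eta>) x"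
    unfolding partial_def[abs_def]
    by (rule mollify_directional[OF W11_loc_integrable(1)[OF W K(1,2) f] \<eta> axis_one_Basis])
  also have "\<dots> = - (LINT y|lborel. indicator K y * f y * partial i ?\<psi> y)"
    unfolding mollify_def partial_reflect[OF \<eta>] by simp
  also have "(LINT y|lborel. indicator K y * f y * partial i ?\<psi> y) = (LINT y|lborel. indicator U y * (f y * partial i ?\<psi> y))"
    by (intro Bochner_Integration.integral_cong refl KU[symmetric] out(2))
  also have "\<dots> = (LINT y:U|lebesgue. f y * partial i ?\<psi> y)"
    by (rule set_integral_lebesgue_eq[symmetric, OF Ub]) measurable
  also have "\<dots> = - (LINT y:U|lebesgue. g y $ i * ?\<psi> y)"
    using conjunct2[OF W[unfolded W11_loc_def], rule_format, OF \<psi>(1), of i] .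
  also have "(LINT y:U|lebesgue. g y $ i * ?\<psi> y) = (LINT y|lborel. indicator U y * (g y $ i * ?\<psi> y))"
    by (rule set_integral_lebesgue_eq[OF Ub]) measurable
  also have "\<dots> = (LINT y|lborel. indicator K y * g y $ i * ?\<psi> y)"
    by (intro Bochner_Integration.integral_cong refl KU out(1))
  finally show ?thesis unfolding mollify_def by simp
qed

lemma compact_neighbourhood:
  fixes K :: "'a::euclidean_space set"
  assumes "compact K" "open U" "K \<subseteq> U"
  obtains \<delta> K' where "0 < \<delta>" "compact K'" "K' \<subseteq> U" "\<And>x. x \<in> K \<Longrightarrow> ball x \<delta> \<subseteq> K'" "K \<subseteq> K'"
proof -
  obtain \<delta> where \<delta>: "0 < \<delta>" "(\<Union>x\<in>K. cball x \<delta>) \<subseteq> U"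
    by (rule compact_subset_open_imp_cball_epsilon_subset[OF assms])
  define K' where "K' = {x + y |x y. x \<in> K \<and> y \<in> cball 0 \<delta>}"
  have eq: "K' = (\<Union>x\<in>K. cball x \<delta>)"
  proof (intro set_eqI iffI)
    fix z assume "z \<in> K'"
    then obtain x y where z: "z = x + y" "x \<in> K" "norm y \<le> \<delta>" by (auto simp: K'_def)
    then have "z \<in> cball x \<delta>" by (simp add: dist_norm)
    then show "z \<in> (\<Union>x\<in>K. cball x \<delta>)" using z(2) by (rule UN_I[rotated])
  next
    fix z assume "z \<in> (\<Union>x\<in>K. cball x \<delta>)"
    then obtain x where "x \<in> K" "dist x z \<le> \<delta>" by auto
    then show "z \<in> K'" unfolding K'_def
      by (intro CollectI exI[of _ x] exI[of _ "z - x"]) (auto simp: dist_norm norm_minus_commute)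
  qed
  show thesis
  proof (rule that[OF \<delta>(1)])
    show "compact K'" unfolding K'_def using assms(1) compact_cball by (rule compact_sums)
    show "K' \<subseteq> U" using \<delta>(2) eq by simp
    show "ball x \<delta> \<subseteq> K'" if "x \<in> K" for x
    proof -
      have "cball x \<delta> \<subseteq> K'" unfolding eq using that by (rule UN_upper)
      then show ?thesis using ball_subset_cball by blast
    qed
    show "K \<subseteq> K'"
    proof
      fix x assume "x \<in> K"
      moreover have "x \<in> cball x \<delta>" using \<delta>(1) by simp
      ultimately show "x \<in> K'" unfolding eq by (rule UN_I)
    qed
  qed
qed

text \<open>On K the mollifications of both gradients are derivatives of one and the same mollified
  function, hence equal; their L1 limits agree. This is used to identify the gradient of the
  subsolution property with that of the supersolution property.\<close>

lemma W11_loc_unique: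
  assumes W: "W11_loc U f g1" "W11_loc U f g2" and U: "open U" and K: "compact K" "K \<subseteq> U"
    and [measurable]: "f \<in> borel_measurable borel" "(\<lambda>x. g1 x $ i) \<in> borel_measurable borel"
      "(\<lambda>x. g2 x $ i) \<in> borel_measurable borel"
  shows "AE x in lborel. x \<in> K \<longrightarrow> g1 x $ i = g2 x $ i"
proof -
  obtain \<delta> K' where K': "0 < \<delta>" "compact K'" "K' \<subseteq> U" "\<And>x. x \<in> K \<Longrightarrow> ball x \<delta> \<subseteq> K'" "K \<subseteq> K'"
    using compact_neighbourhood[OF K(1) U K(2)] by blast
  have [measurable]: "K \<in> sets borel" using K by (simp add: borel_compact)
  obtain \<eta> :: "nat \<Rightarrow> real^'a \<Rightarrow> real" where \<eta>: "\<And>n. \<eta> n \<in> test_functions (ball 0 \<delta>)" "\<And>n x. 0 \<le> \<eta> n x"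
    "\<And>f n. integrable lborel f \<Longrightarrow> integrable lborel (\<lambda>x. mollify f (\<eta> n) x - f x)"
    "\<And>f. integrable lborel f \<Longrightarrow> (\<lambda>n. LINT x|lborel. \<bar>mollify f (\<eta> n) x - f x\<bar>) \<longlonglongrightarrow> 0"
    by (rule mollifier_sequence[OF K'(1)]) (rule that)
  define h1 h2 where "h1 x = indicator K' x * g1 x $ i" and "h2 x = indicator K' x * g2 x $ i" for x
  have h: "integrable lborel h1" "integrable lborel h2"
    unfolding h1_def[abs_def] h2_def[abs_def]
    by (rule W11_loc_integrable(2)[OF W(1) K'(2,3)] W11_loc_integrable(2)[OF W(2) K'(2,3)]; measurable)+
  have eq: "mollify h1 (\<eta> n) x = mollify h2 (\<eta> n) x" if "x \<in> K" for x n
    using W11_loc_mollify[OF W(1) U K'(2,3) K'(4)[OF that] _ _ \<eta>(1)[of n], of i]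
      W11_loc_mollify[OF W(2) U K'(2,3) K'(4)[OF that] _ _ \<eta>(1)[of n], of i]
    by (simp add: h1_def[abs_def] h2_def[abs_def])
  have hK: "integrable lborel (\<lambda>x. indicator K x * \<bar>h1 x - h2 x\<bar>)"
    using integrable_mult_bounded[of lborel "\<lambda>x. \<bar>h1 x - h2 x\<bar>" "indicator K" 1] h
    by (simp add: mult.commute)
  have le: "(LINT x|lborel. indicator K x * \<bar>h1 x - h2 x\<bar>)
    \<le> (LINT x|lborel. \<bar>mollify h1 (\<eta> n) x - h1 x\<bar>) + (LINT x|lborel. \<bar>mollify h2 (\<eta> n) x - h2 x\<bar>)" for n
  proof -
    have "(LINT x|lborel. indicator K x * \<bar>h1 x - h2 x\<bar>)
      \<le> (LINT x|lborel. \<bar>mollify h1 (\<eta> n) x - h1 x\<bar> + \<bar>mollify h2 (\<eta> n) x - h2 x\<bar>)"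
    proof (intro integral_mono hK Bochner_Integration.integrable_add integrable_abs \<eta>(3) h)
      fix x
      show "indicator K x * \<bar>h1 x - h2 x\<bar> \<le> \<bar>mollify h1 (\<eta> n) x - h1 x\<bar> + \<bar>mollify h2 (\<eta> n) x - h2 x\<bar>"
        using eq[of x n] by (cases "x \<in> K") auto
    qed
    also have "\<dots> = (LINT x|lborel. \<bar>mollify h1 (\<eta> n) x - h1 x\<bar>) + (LINT x|lborel. \<bar>mollify h2 (\<eta> n) x - h2 x\<bar>)"
      by (intro Bochner_Integration.integral_add integrable_abs \<eta>(3) h)
    finally show ?thesis .
  qed
  have "(\<lambda>n. (LINT x|lborel. \<bar>mollify h1 (\<eta> n) x - h1 x\<bar>) + (LINT x|lborel. \<bar>mollify h2 (\<eta> n) x - h2 x\<bar>)) \<longlonglongrightarrow> 0 + 0"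
    by (intro tendsto_add \<eta>(4) h)
  then have "(LINT x|lborel. indicator K x * \<bar>h1 x - h2 x\<bar>) \<le> 0"
    using le by (intro LIMSEQ_le_const[of _ 0]) auto
  moreover have nn: "0 \<le> indicator K x * \<bar>h1 x - h2 x\<bar>" for x by simp
  then have "0 \<le> (LINT x|lborel. indicator K x * \<bar>h1 x - h2 x\<bar>)"
    by (rule Bochner_Integration.integral_nonneg)
  ultimately have "(LINT x|lborel. indicator K x * \<bar>h1 x - h2 x\<bar>) = 0" by simp
  then have "AE x in lborel. indicator K x * \<bar>h1 x - h2 x\<bar> = 0"
    using integral_nonneg_eq_0_iff_AE[OF hK] nn by simp
  then show ?thesis
  proof eventually_elim
    case (elim x)
    then show ?case using K'(5) by (auto simp: h1_def h2_def indicator_def)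
  qed
qed

section \<open>Chain rule for negative powers\<close>

lemma powr_neg_lipschitz:
  fixes \<nu> c s s' :: real
  assumes "0 < \<nu>" "0 \<le> c" "0 \<le> s" "0 \<le> s'"
  shows "\<bar>(s + \<nu>) powr (- c) - (s' + \<nu>) powr (- c)\<bar> \<le> c * \<nu> powr (- c - 1) * \<bar>s - s'\<bar>"
proof -
  have "norm ((s + \<nu>) powr (- c) - (s' + \<nu>) powr (- c)) \<le> c * \<nu> powr (- c - 1) * norm (s - s')"
  proof (rule field_differentiable_bound[of "{0..}" _ "\<lambda>z. (- c) * (z + \<nu>) powr (- c - 1)"])
    fix z :: real assume z: "z \<in> {0..}"
    show "((\<lambda>z. (z + \<nu>) powr - c) has_field_derivative - c * (z + \<nu>) powr (- c - 1)) (at z within {0..})"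
      by (rule has_field_derivative_at_within, rule derivative_eq_intros refl | use z assms in simp)+
    have "(z + \<nu>) powr (- c - 1) \<le> \<nu> powr (- c - 1)"
      using z assms by (intro powr_mono2') auto
    then show "norm (- c * (z + \<nu>) powr (- c - 1)) \<le> c * \<nu> powr (- c - 1)"
      using assms by (simp add: abs_mult mult_left_mono)
  qed (use assms in auto)
  then show ?thesis by simp
qed

lemma set_integral_bound_tendsto_0:
  fixes h :: "nat \<Rightarrow> 'a \<Rightarrow> real"
  assumes "\<And>n. integrable M (B n)" "\<And>n x. \<bar>h n x\<bar> \<le> B n x" "\<And>n. h n \<in> borel_measurable M"
    "(\<lambda>n. LINT x|M. B n x) \<longlonglongrightarrow> 0"
  shows "(\<lambda>n. LINT x|M. h n x) \<longlonglongrightarrow> 0"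
proof (rule Lim_null_comparison[OF _ assms(4)])
  have "\<bar>LINT x|M. h n x\<bar> \<le> (LINT x|M. B n x)" for n
  proof (rule abs_integral_le[OF _ assms(1,2)])
    show "integrable M (h n)"
      by (rule Bochner_Integration.integrable_bound[OF assms(1) assms(3)])
        (use assms(2) in \<open>auto intro!: AE_I2 intro: order_trans[OF _ abs_ge_self]\<close>)
  qed
  then show "\<forall>\<^sub>F n in sequentially. norm (LINT x|M. h n x) \<le> (LINT x|M. B n x)" by simp
qed

lemma integrable_indicator_compact:
  "compact K \<Longrightarrow> integrable lborel (indicat_real K)"
  using borel_integrable_compact[of K "\<lambda>_. 1::real"] by simp

lemma mollify_nonneg:
  assumes "\<And>y. 0 \<le> f y" "\<And>y. 0 \<le> \<eta> y"
  shows "0 \<le> mollify f \<eta> x"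
  unfolding mollify_def using assms by (intro Bochner_Integration.integral_nonneg) simp

text \<open>The difference is arranged so that \<open>Fa - Fb\<close> multiplies the limit gradient
  \<open>ga\<close>. That product is only treated by dominated convergence, whereas the two other
  terms are small by L1 convergence.\<close>

lemma abs_product_rule_diff_le:
  fixes Fa :: real
  assumes "\<bar>Fb\<bar> \<le> L" "\<bar>z\<bar> \<le> Z" "\<bar>dz\<bar> \<le> Z'" "\<bar>Ga - Gb\<bar> \<le> d"
  shows "\<bar>Fa * ga * z + Ga * dz - (Fb * gb * z + Gb * dz)\<bar>
     \<le> L * \<bar>gb - ga\<bar> * Z + \<bar>ga\<bar> * \<bar>Fa - Fb\<bar> * Z + d * Z'"
proof -
  have "Fa * ga * z + Ga * dz - (Fb * gb * z + Gb * dz)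
    = - (Fb * (gb - ga) * z) + (ga * (Fa - Fb)) * z + (Ga - Gb) * dz"
    by (simp add: algebra_simps)
  also have "\<bar>\<dots>\<bar> \<le> \<bar>Fb\<bar> * \<bar>gb - ga\<bar> * \<bar>z\<bar> + \<bar>ga\<bar> * \<bar>Fa - Fb\<bar> * \<bar>z\<bar> + \<bar>Ga - Gb\<bar> * \<bar>dz\<bar>"
    by (simp only: abs_mult[symmetric])
  also have "\<dots> \<le> L * \<bar>gb - ga\<bar> * Z + \<bar>ga\<bar> * \<bar>Fa - Fb\<bar> * Z + d * Z'"
    using assms by (intro add_mono mult_mono mult_nonneg_nonneg) auto
  finally show ?thesis .
qed

text \<open>The approximating test functions are the same expression with f replaced by its
  mollification v n. They are smooth because v n is nonnegative, so \<open>v n + \<nu>\<close> stays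
  away from the singularity of the power, and \<zeta> confines the support to the interior of
  K.\<close>

lemma W11_o_powr:
  fixes f :: "real^'n::finite \<Rightarrow> real"
  assumes U: "open U" and K: "compact K" "K \<subseteq> U" and W: "W11_loc U f g"
    and f[measurable]: "f \<in> borel_measurable borel" and f0: "\<And>x. 0 \<le> f x"
    and g[measurable]: "\<And>i. (\<lambda>x. g x $ i) \<in> borel_measurable borel"
    and \<zeta>: "\<zeta> \<in> test_functions (interior K)" and \<nu>: "0 < \<nu>" and a: "0 < a"
  shows "W11_o K (\<lambda>x. (f x + \<nu>) powr (- a) * \<zeta> x)
    (\<lambda>x. \<chi> i. - a * (f x + \<nu>) powr (- a - 1) * g x $ i * \<zeta> x + (f x + \<nu>) powr (- a) * partial i \<zeta> x)"
proof -
  obtain \<delta> K' where K': "0 < \<delta>" "compact K'" "K' \<subseteq> U" "\<And>x. x \<in> K \<Longrightarrow> ball x \<delta> \<subseteq> K'" "K \<subseteq> K'"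
    using compact_neighbourhood[OF K(1) U K(2)] by blast
  have [measurable]: "K \<in> sets borel" "K' \<in> sets borel" using K K' by (auto simp: borel_compact)
  obtain \<eta> :: "nat \<Rightarrow> real^'n \<Rightarrow> real" where \<eta>: "\<And>n. \<eta> n \<in> test_functions (ball 0 \<delta>)" "\<And>n x. 0 \<le> \<eta> n x"
    "\<And>f n. integrable lborel f \<Longrightarrow> integrable lborel (\<lambda>x. mollify f (\<eta> n) x - f x)"
    "\<And>f. integrable lborel f \<Longrightarrow> (\<lambda>n. LINT x|lborel. \<bar>mollify f (\<eta> n) x - f x\<bar>) \<longlonglongrightarrow> 0"
    by (rule mollifier_sequence[OF K'(1)]) (rule that)
  define f' where "f' x = indicator K' x * f x" for x
  define g' where "g' i x = indicator K' x * g x $ i" for i x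
  have f'0: "0 \<le> f' x" for x using f0 by (simp add: f'_def)
  have f'K: "f' x = f x" "g' i x = g x $ i" if "x \<in> K" for i x using that K'(5) by (auto simp: f'_def g'_def)
  have f'i: "integrable lborel f'" unfolding f'_def[abs_def] by (rule W11_loc_integrable(1)[OF W K'(2,3)]) measurable
  have g'i: "integrable lborel (g' i)" for i unfolding g'_def[abs_def] by (rule W11_loc_integrable(2)[OF W K'(2,3)]) measurable
  have [measurable]: "f' \<in> borel_measurable borel" "g' i \<in> borel_measurable borel" for i
    using f'i g'i[of i] by auto
  \<comment> \<open>Convergence almost everywhere is needed in addition to L1 convergence: in the
    gradient the factor \<open>(v n + \<nu>) powr (- a - 1)\<close> multiplies g, which is
    unbounded, and so dominated convergence is applied there.\<close>
  obtain r :: "nat \<Rightarrow> nat" where r: "strict_mono r"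
    "AE x in lborel. (\<lambda>n. mollify f' (\<eta> (r n)) x - f' x) \<longlonglongrightarrow> 0"
    using tendsto_L1_AE_subseq[of lborel "\<lambda>n x. mollify f' (\<eta> n) x - f' x"] \<eta>(3,4)[OF f'i] by auto
  define v where "v n = mollify f' (\<eta> (r n))" for n
  define w where "w i n = mollify (g' i) (\<eta> (r n))" for i n
  define \<psi> where "\<psi> n x = (v n x + \<nu>) powr (- a) * \<zeta> x" for n x
  have vi: "integrable lborel (\<lambda>x. v n x - f' x)" for n unfolding v_def by (rule \<eta>(3)[OF f'i])
  have wi: "integrable lborel (\<lambda>x. w i n x - g' i x)" for i n unfolding w_def by (rule \<eta>(3)[OF g'i])
  have vlim: "(\<lambda>n. LINT x|lborel. \<bar>v n x - f' x\<bar>) \<longlonglongrightarrow> 0"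
    using LIMSEQ_subseq_LIMSEQ[OF \<eta>(4)[OF f'i] r(1)] by (simp add: v_def comp_def)
  have wlim: "(\<lambda>n. LINT x|lborel. \<bar>w i n x - g' i x\<bar>) \<longlonglongrightarrow> 0" for i
    using LIMSEQ_subseq_LIMSEQ[OF \<eta>(4)[OF g'i] r(1)] by (simp add: w_def comp_def)
  have vAE: "AE x in lborel. (\<lambda>n. v n x) \<longlonglongrightarrow> f' x"
    using r(2) by (simp add: v_def LIM_zero_iff)
  have v0: "0 \<le> v n x" for n x unfolding v_def using f'0 \<eta>(2) by (rule mollify_nonneg)
  have [measurable]: "v n \<in> borel_measurable borel" "w i n \<in> borel_measurable borel" for i n
    unfolding v_def w_def by (rule mollify_measurable[OF f'i \<eta>(1)] mollify_measurable[OF g'i \<eta>(1)])+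
  have w: "partial i (v n) x = w i n x" if "x \<in> K" for i n x
    using W11_loc_mollify[OF W U K'(2,3) K'(4)[OF that] _ _ \<eta>(1)[of "r n"], of i] f g
    unfolding v_def w_def f'_def[abs_def] g'_def[abs_def] by simp
  note \<zeta>cs = test_functions_compactly_supported[OF \<zeta>]
  note d\<zeta>cs = test_functions_compactly_supported[OF test_functions_partial[OF \<zeta>]]
  have [measurable]: "\<zeta> \<in> borel_measurable borel" "partial i \<zeta> \<in> borel_measurable borel" for i
    by (rule compactly_supported_borel[OF \<zeta>cs] compactly_supported_borel[OF d\<zeta>cs])+
  obtain Z where Z: "0 < Z" "\<And>x. \<bar>\<zeta> x\<bar> \<le> Z" using compactly_supported_bounded[OF \<zeta>cs] by blast
  have "\<forall>i. \<exists>Z. 0 < Z \<and> (\<forall>x. \<bar>partial i \<zeta> x\<bar> \<le> Z)"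
  proof
    fix i
    show "\<exists>Z. 0 < Z \<and> (\<forall>x. \<bar>partial i \<zeta> x\<bar> \<le> Z)"
      by (rule compactly_supported_bounded[OF d\<zeta>cs[of i]]) blast
  qed
  then obtain Z' where Z': "\<And>i. 0 < Z' i" "\<And>i x. \<bar>partial i \<zeta> x\<bar> \<le> Z' i"
    by (auto dest!: choice)
  \<comment> \<open>L0 bounds the power itself; L1 bounds its derivative and is thereby also its
    Lipschitz constant on the half line.\<close>
  define L0 L1 where "L0 = \<nu> powr (- a)" and "L1 = a * \<nu> powr (- a - 1)"
  have L: "0 < L0" "0 < L1" using \<nu> a by (auto simp: L0_def L1_def)
  have F0: "\<bar>(s + \<nu>) powr (- a)\<bar> \<le> L0" if "0 \<le> s" for s
    unfolding L0_def using that \<nu> a by (simp add: powr_mono2')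
  have F1: "\<bar>- a * (s + \<nu>) powr (- a - 1)\<bar> \<le> L1" if "0 \<le> s" for s
    unfolding L1_def using that \<nu> a by (simp add: abs_mult powr_mono2')
  have FL: "\<bar>(s + \<nu>) powr (- a) - (s' + \<nu>) powr (- a)\<bar> \<le> L1 * \<bar>s - s'\<bar>" if "0 \<le> s" "0 \<le> s'" for s s'
    unfolding L1_def using powr_neg_lipschitz[OF \<nu> _ that, of a] a by simp
  have smooth: "\<And>k. C_k k (v n)" "v n \<in> borel_measurable borel" for n
    unfolding v_def using C_k_mollify[OF f'i \<eta>(1)] mollify_measurable[OF f'i \<eta>(1)] by auto
  have \<psi>C: "C_k k (\<psi> n)" for k n
    unfolding \<psi>_def using \<zeta> v0 \<nu>
    by (intro C_k_mult C_k_powr C_k_add smooth C_k_const) (auto simp: test_functions_def intro: add_nonneg_pos)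
  have sub: "{x. \<psi> n x \<noteq> 0} \<subseteq> {x. \<zeta> x \<noteq> 0}" for n by (auto simp: \<psi>_def)
  have \<psi>T: "\<psi> n \<in> test_functions (interior K)" for n
  proof -
    have cl: "closure {x. \<psi> n x \<noteq> 0} \<subseteq> closure {x. \<zeta> x \<noteq> 0}" using sub by (rule closure_mono)
    moreover have "compact (closure {x. \<psi> n x \<noteq> 0})"
      using \<zeta> bounded_subset[OF compact_imp_bounded cl] by (simp add: test_functions_def compact_eq_bounded_closed)
    ultimately show ?thesis using \<psi>C \<zeta> unfolding test_functions_def by blast
  qed
  have d\<psi>: "partial i (\<psi> n) x = - a * (v n x + \<nu>) powr (- a - 1) * partial i (v n) x * \<zeta> x
      + (v n x + \<nu>) powr (- a) * partial i \<zeta> x" for i n x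
  proof -
    have pos: "0 < v n x + \<nu>" using v0[of n x] \<nu> by simp
    have dv: "(v n has_derivative frechet_derivative (v n) (at x)) (at x)"
      by (rule C_k_has_derivative[of 0]) (rule smooth(1))
    have "((\<lambda>x. v n x + \<nu>) has_derivative frechet_derivative (v n) (at x)) (at x)"
      using has_derivative_add[OF dv has_derivative_const[of \<nu>]] by simp
    from has_derivative_powr[OF this has_derivative_const[of "- a"] pos]
    have "((\<lambda>x. (v n x + \<nu>) powr (- a)) has_derivative
      (\<lambda>h. - a * (v n x + \<nu>) powr (- a - 1) * frechet_derivative (v n) (at x) h)) (at x)"
      using pos by (simp add: powr_diff mult_ac)
    from has_derivative_mult[OF this test_functions_has_derivative[OF \<zeta>]]
    have "(\<psi> n has_derivative (\<lambda>h. (v n x + \<nu>) powr (- a) * frechet_derivative \<zeta> (at x) h +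
        - a * (v n x + \<nu>) powr (- a - 1) * frechet_derivative (v n) (at x) h * \<zeta> x)) (at x)"
      unfolding \<psi>_def[abs_def] .
    from partial_eqI[OF this, of i] show ?thesis by (simp add: partial_def[of i \<zeta>] partial_def[of i "v n"])
  qed
  have [measurable]: "\<psi> n \<in> borel_measurable borel" "partial i (\<psi> n) \<in> borel_measurable borel" for i n
    by (rule compactly_supported_borel[OF test_functions_compactly_supported[OF \<psi>T]]
        compactly_supported_borel[OF test_functions_compactly_supported[OF test_functions_partial[OF \<psi>T]]])+
  define D where "D i x = - a * (f x + \<nu>) powr (- a - 1) * g x $ i * \<zeta> x + (f x + \<nu>) powr (- a) * partial i \<zeta> x" for i x
  have [measurable]: "D i \<in> borel_measurable borel" for i unfolding D_def by measurable
  have Kint: "integrable lborel (indicat_real K)"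
    using K(1) by (rule integrable_indicator_compact)
  have int0: "set_integrable lebesgue K (\<lambda>x. (f x + \<nu>) powr (- a) * \<zeta> x)"
  proof (subst set_integrable_lebesgue_iff)
    have "\<bar>(f x + \<nu>) powr (- a) * \<zeta> x\<bar> \<le> L0 * Z" for x
      unfolding abs_mult using F0[OF f0[of x]] Z L by (intro mult_mono) auto
    then show "integrable lborel (\<lambda>x. indicat_real K x * ((f x + \<nu>) powr (- a) * \<zeta> x))"
      by (intro integrable_mult_bounded[OF Kint]) measurable
  qed measurable
  have intD: "set_integrable lebesgue K (D i)" for i
  proof (subst set_integrable_lebesgue_iff)
    have "\<bar>- a * (f x + \<nu>) powr (- a - 1) * \<zeta> x\<bar> \<le> L1 * Z" for x
      using F1[OF f0[of x]] Z L unfolding abs_mult[of _ "\<zeta> x"] by (intro mult_mono) auto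
    then have 1: "integrable lborel (\<lambda>x. (indicat_real K x * g x $ i) * (- a * (f x + \<nu>) powr (- a - 1) * \<zeta> x))"
      by (intro integrable_mult_bounded[OF W11_loc_integrable(2)[OF W K g]]) measurable
    have "\<bar>(f x + \<nu>) powr (- a) * partial i \<zeta> x\<bar> \<le> L0 * Z' i" for x
      unfolding abs_mult using F0[OF f0[of x]] Z' L by (intro mult_mono) auto
    then have 2: "integrable lborel (\<lambda>x. indicat_real K x * ((f x + \<nu>) powr (- a) * partial i \<zeta> x))"
      by (intro integrable_mult_bounded[OF Kint]) measurable
    have "(\<lambda>x. indicat_real K x * D i x) = (\<lambda>x. (indicat_real K x * g x $ i) * (- a * (f x + \<nu>) powr (- a - 1) * \<zeta> x)
       + indicat_real K x * ((f x + \<nu>) powr (- a) * partial i \<zeta> x))"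
      by (simp add: D_def fun_eq_iff algebra_simps)
    then show "integrable lborel (\<lambda>x. indicat_real K x * D i x)" using 1 2 by simp
  qed measurable
  have lim0: "(\<lambda>n. LINT x:K|lebesgue. \<bar>(f x + \<nu>) powr (- a) * \<zeta> x - \<psi> n x\<bar>) \<longlonglongrightarrow> 0"
  proof -
    have "(\<lambda>n. LINT x|lborel. indicator K x * \<bar>(f x + \<nu>) powr (- a) * \<zeta> x - \<psi> n x\<bar>) \<longlonglongrightarrow> 0"
    proof (rule set_integral_bound_tendsto_0[where B = "\<lambda>n x. (L1 * Z) * \<bar>v n x - f' x\<bar>"])
      fix n x
      show "integrable lborel (\<lambda>x. (L1 * Z) * \<bar>v n x - f' x\<bar>)" using vi[of n] by simp
      show "\<bar>indicat_real K x * \<bar>(f x + \<nu>) powr (- a) * \<zeta> x - \<psi> n x\<bar>\<bar> \<le> L1 * Z * \<bar>v n x - f' x\<bar>"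
      proof (cases "x \<in> K")
        case True
        have "\<bar>(f x + \<nu>) powr (- a) * \<zeta> x - \<psi> n x\<bar> = \<bar>(f' x + \<nu>) powr (- a) - (v n x + \<nu>) powr (- a)\<bar> * \<bar>\<zeta> x\<bar>"
          using f'K(1)[OF True] by (simp add: \<psi>_def abs_mult[symmetric] left_diff_distrib)
        also have "\<dots> \<le> (L1 * \<bar>f' x - v n x\<bar>) * Z"
          using FL[OF f'0 v0] Z L by (intro mult_mono) auto
        finally show ?thesis using True by (simp add: abs_minus_commute mult_ac)
      qed (use L Z in simp)
      show "(\<lambda>x. indicat_real K x * \<bar>(f x + \<nu>) powr (- a) * \<zeta> x - \<psi> n x\<bar>) \<in> borel_measurable lborel" by measurable
      show "(\<lambda>n. LINT x|lborel. L1 * Z * \<bar>v n x - f' x\<bar>) \<longlonglongrightarrow> 0"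
        using tendsto_mult_right_zero[OF vlim, of "L1 * Z"] by simp
    qed
    then show ?thesis by (subst set_integral_lebesgue_eq) measurable
  qed
  have lim1: "(\<lambda>n. LINT x:K|lebesgue. \<bar>D i x - partial i (\<psi> n) x\<bar>) \<longlonglongrightarrow> 0" for i
  proof -
    define E where "E n x = \<bar>g' i x\<bar> * \<bar>(- a * (f' x + \<nu>) powr (- a - 1)) - (- a * (v n x + \<nu>) powr (- a - 1))\<bar>" for n x
    have [measurable]: "E n \<in> borel_measurable borel" for n unfolding E_def by measurable
    have Eb: "\<bar>E n x\<bar> \<le> (2 * L1) * \<bar>g' i x\<bar>" for n x
    proof -
      have "\<bar>(- a * (f' x + \<nu>) powr (- a - 1)) - (- a * (v n x + \<nu>) powr (- a - 1))\<bar> \<le> 2 * L1"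
        using F1[OF f'0[of x]] F1[OF v0[of n x]] by linarith
      then have "\<bar>g' i x\<bar> * \<bar>(- a * (f' x + \<nu>) powr (- a - 1)) - (- a * (v n x + \<nu>) powr (- a - 1))\<bar> \<le> \<bar>g' i x\<bar> * (2 * L1)"
        by (intro mult_left_mono) auto
      then show ?thesis by (simp add: E_def abs_mult mult.commute)
    qed
    have Ei: "integrable lborel (E n)" for n
      by (rule Bochner_Integration.integrable_bound[of _ "\<lambda>x. (2 * L1) * \<bar>g' i x\<bar>"])
        (use g'i[of i] Eb L in \<open>auto simp: abs_mult\<close>)
    have Elim: "(\<lambda>n. LINT x|lborel. E n x) \<longlonglongrightarrow> (LINT x|(lborel :: (real^'n) measure). 0)"
    proof (rule integral_dominated_convergence[of "\<lambda>_. 0" lborel E "\<lambda>x. (2 * L1) * \<bar>g' i x\<bar>"])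
      show "AE x in lborel. (\<lambda>n. E n x) \<longlonglongrightarrow> 0"
        using vAE
      proof eventually_elim
        case (elim x)
        have nz: "f' x + \<nu> \<noteq> 0" using f'0[of x] \<nu> by simp
        then have "(\<lambda>n. E n x) \<longlonglongrightarrow> \<bar>g' i x\<bar> * \<bar>(- a * (f' x + \<nu>) powr (- a - 1)) - (- a * (f' x + \<nu>) powr (- a - 1))\<bar>"
          unfolding E_def by (intro tendsto_intros elim disjI1 nz)
        then show ?case by simp
      qed
      show "AE x in lborel. norm (E n x) \<le> 2 * L1 * \<bar>g' i x\<bar>" for n using Eb by simp
    qed (use g'i[of i] in auto)
    have "(\<lambda>n. LINT x|lborel. indicator K x * \<bar>D i x - partial i (\<psi> n) x\<bar>) \<longlonglongrightarrow> 0"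
    proof (rule set_integral_bound_tendsto_0[where B = "\<lambda>n x. (L1 * Z) * \<bar>w i n x - g' i x\<bar> + Z * E n x + (L1 * Z' i) * \<bar>v n x - f' x\<bar>"])
      fix n x
      show "integrable lborel (\<lambda>x. (L1 * Z) * \<bar>w i n x - g' i x\<bar> + Z * E n x + (L1 * Z' i) * \<bar>v n x - f' x\<bar>)"
        using vi[of n] wi[of i n] Ei[of n] by simp
      show "\<bar>indicat_real K x * \<bar>D i x - partial i (\<psi> n) x\<bar>\<bar>
         \<le> (L1 * Z) * \<bar>w i n x - g' i x\<bar> + Z * E n x + (L1 * Z' i) * \<bar>v n x - f' x\<bar>"
      proof (cases "x \<in> K")
        case True
        have "\<bar>D i x - partial i (\<psi> n) x\<bar> \<le> L1 * \<bar>w i n x - g' i x\<bar> * Z + E n x * Z + (L1 * \<bar>f' x - v n x\<bar>) * Z' i"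
          unfolding D_def d\<psi> w[OF True] f'K[OF True, symmetric] E_def
          by (rule abs_product_rule_diff_le[OF F1[OF v0] Z(2) Z'(2) FL[OF f'0 v0]])
        also have "\<dots> = (L1 * Z) * \<bar>w i n x - g' i x\<bar> + Z * E n x + (L1 * Z' i) * \<bar>v n x - f' x\<bar>"
          unfolding abs_minus_commute[of "f' x"] by (simp add: mult_ac)
        finally show ?thesis using True by simp
      next
        case False
        then show ?thesis using L Z(1) Z'(1)[of i] by (simp add: E_def)
      qed
      show "(\<lambda>x. indicat_real K x * \<bar>D i x - partial i (\<psi> n) x\<bar>) \<in> borel_measurable lborel" by measurable
      have "(\<lambda>n. (L1 * Z) * (LINT x|lborel. \<bar>w i n x - g' i x\<bar>) + Z * (LINT x|lborel. E n x)
          + (L1 * Z' i) * (LINT x|lborel. \<bar>v n x - f' x\<bar>)) \<longlonglongrightarrow> (L1 * Z) * 0 + Z * 0 + (L1 * Z' i) * 0"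
        using Elim by (intro tendsto_intros vlim wlim) simp
      then show "(\<lambda>n. LINT x|lborel. (L1 * Z) * \<bar>w i n x - g' i x\<bar> + Z * E n x + (L1 * Z' i) * \<bar>v n x - f' x\<bar>) \<longlonglongrightarrow> 0"
        using vi wi[of i] Ei by simp
    qed
    then show ?thesis by (subst set_integral_lebesgue_eq) measurable
  qed
  have "(\<lambda>x. \<chi> i. D i x) absolutely_integrable_on K"
    by (rule absolutely_integrable_vec_lambda) (rule intD)
  then have "W11_o K (\<lambda>x. (f x + \<nu>) powr (- a) * \<zeta> x) (\<lambda>x. \<chi> i. D i x)"
    unfolding W11_o_def using int0 \<psi>T lim0 lim1 by auto
  then show ?thesis by (simp add: D_def)
qed

section \<open>Borel representatives\<close>

lemma AE_lebesgue_on_iff: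
  "S \<in> sets borel \<Longrightarrow> (AE z in lebesgue_on S. P z) \<longleftrightarrow> (AE z in lborel. z \<in> S \<longrightarrow> P z)"
  by (subst AE_restrict_space_iff) (auto simp: AE_completion_iff)

lemma borel_representative:
  fixes f :: "'a::euclidean_space \<Rightarrow> real"
  assumes "f \<in> borel_measurable (lebesgue_on S)" "S \<in> sets borel"
  obtains g where "g \<in> borel_measurable borel" "AE z in lborel. z \<in> S \<longrightarrow> f z = g z"
proof -
  have "(\<lambda>z. indicator S z *\<^sub>R f z) \<in> borel_measurable lebesgue"
    using assms by (subst borel_measurable_restrict_space_iff[symmetric]) auto
  from completion_ex_borel_measurable_real[OF this]
  obtain g where g: "g \<in> borel_measurable lborel" "AE z in lborel. indicator S z *\<^sub>R f z = g z" by blast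
  show thesis
  proof (rule that)
    show "g \<in> borel_measurable borel" using g(1) by simp
    show "AE z in lborel. z \<in> S \<longrightarrow> f z = g z"
      using g(2) by eventually_elim (auto simp: indicator_def)
  qed
qed

text \<open>P need not define a measurable set, so its failure set is first enclosed in a Borel null
  set. The converse direction below asks for measurability.\<close>

lemma AE_lborel_sections:
  fixes P :: "'a::euclidean_space \<times> 'b::euclidean_space \<Rightarrow> bool"
  assumes "AE z in lborel. P z"
  shows "AE t in lborel. AE x in lborel. P (x, t)"
proof -
  obtain N where N: "N \<in> null_sets lborel" "{z. \<not> P z} \<subseteq> N"
    using assms unfolding eventually_ae_filter by auto
  then have N': "N \<in> sets (lborel \<Otimes>\<^sub>M lborel)" unfolding lborel_prod by auto
  have "AE z in lborel \<Otimes>\<^sub>M lborel. z \<notin> N"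
    unfolding lborel_prod by (rule AE_not_in[OF N(1)])
  then have "AE x in lborel. AE t in lborel. (x, t) \<notin> N" by (rule lborel_pair.AE_pair)
  then have "AE t in lborel. AE x in lborel. (x, t) \<notin> N"
  proof (rule lborel_pair.AE_commute[THEN iffD1, rotated])
    have "{z \<in> space (lborel \<Otimes>\<^sub>M lborel). (fst z, snd z) \<notin> N} = space (lborel \<Otimes>\<^sub>M lborel) - N" by auto
    then show "{z \<in> space (lborel \<Otimes>\<^sub>M lborel). (fst z, snd z) \<notin> N} \<in> sets (lborel \<Otimes>\<^sub>M lborel)"
      using sets.compl_sets[OF N'] by (simp only:)
  qed
  then show ?thesis
  proof (rule AE_mp)
    show "AE t in lborel. (AE x in lborel. (x, t) \<notin> N) \<longrightarrow> (AE x in lborel. P (x, t))"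
    proof (rule AE_I2, rule impI)
      fix t :: 'b assume "AE x in lborel. (x, t) \<notin> N"
      then show "AE x in lborel. P (x, t)" by eventually_elim (use N(2) in auto)
    qed
  qed
qed

lemma AE_lborel_from_sections:
  fixes P :: "'a::euclidean_space \<times> 'b::euclidean_space \<Rightarrow> bool"
  assumes "AE t in lborel. AE x in lborel. P (x, t)" "{z. P z} \<in> sets borel"
  shows "AE z in lborel. P z"
proof -
  have m: "{z \<in> space (lborel \<Otimes>\<^sub>M lborel). P (fst z, snd z)} \<in> sets (lborel \<Otimes>\<^sub>M lborel)"
    unfolding lborel_prod using assms(2) by simp
  have "AE x in lborel. AE t in lborel. P (x, t)"
    using assms(1) lborel_pair.AE_commute[of "\<lambda>x t. P (x, t)", OF m] by simp
  then have "AE z in lborel \<Otimes>\<^sub>M lborel. P (fst z, snd z)"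
    using lborel_pair.AE_pair_iff[of "\<lambda>x t. P (x, t)", OF m] by simp
  then show ?thesis unfolding lborel_prod by simp
qed

text \<open>This passes from integrals over the completed measure, in which the notions are stated,
  to Borel integrands, for which Fubini's theorem is available. Measurability of f is not assumed:
  completeness transfers it from g.\<close>

lemma set_integral_lebesgue_AE:
  fixes f g :: "'a::euclidean_space \<Rightarrow> real"
  assumes A: "A \<in> sets borel" and g[measurable]: "g \<in> borel_measurable borel"
    and ae: "AE z in lborel. z \<in> A \<longrightarrow> f z = g z"
  shows "set_integrable lebesgue A f \<longleftrightarrow> integrable lborel (\<lambda>z. indicator A z * g z)"
    and "(LINT z:A|lebesgue. f z) = (LINT z|lborel. indicator A z * g z)"
proof -
  have ae': "AE z in lebesgue. indicator A z *\<^sub>R g z = indicator A z *\<^sub>R f z"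
    unfolding AE_completion_iff using ae by eventually_elim (auto simp: indicator_def)
  have gm: "(\<lambda>z. indicator A z *\<^sub>R g z) \<in> borel_measurable lborel" using A by auto
  then have gm': "(\<lambda>z. indicator A z *\<^sub>R g z) \<in> borel_measurable lebesgue" by (rule measurable_completion)
  have fm: "(\<lambda>z. indicator A z *\<^sub>R f z) \<in> borel_measurable lebesgue"
    by (rule borel_measurable_AE[OF gm' ae'])
  show "set_integrable lebesgue A f \<longleftrightarrow> integrable lborel (\<lambda>z. indicator A z * g z)"
    unfolding set_integrable_def using integrable_cong_AE[OF gm' fm ae'] integrable_completion[OF gm] by simp
  show "(LINT z:A|lebesgue. f z) = (LINT z|lborel. indicator A z * g z)"
    unfolding set_lebesgue_integral_def using integral_cong_AE[OF gm' fm ae'] integral_completion[OF gm] by simp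
qed

text \<open>g is a pointwise limit of simple functions. For a simple function the composition splits
  into finitely many measurable pieces, and continuity of F in its last two arguments carries
  measurability to the limit, outside the null set E on which continuity fails. The result is
  Lebesgue measurable only, as F is.\<close>

lemma caratheodory_measurable:
  fixes F :: "real^'n::finite \<Rightarrow> real \<Rightarrow> real \<Rightarrow> real^'n \<Rightarrow> 'b::euclidean_space"
    and g :: "(real^'n) \<times> real \<Rightarrow> real \<times> (real^'n)"
  assumes F: "caratheodory \<Omega> T F" and \<Omega>: "\<Omega> \<in> sets borel" and g: "g \<in> borel_measurable borel"
  shows "(\<lambda>z. indicator (\<Omega> \<times> {0..T}) z *\<^sub>R F (fst z) (snd z) (fst (g z)) (snd (g z))) \<in> borel_measurable lebesgue"
proof -
  define S where "S = \<Omega> \<times> {0..T}"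
  have S: "S \<in> sets borel" unfolding S_def using \<Omega> by (simp add: borel_Times)
  have "g \<in> borel_measurable lborel" using g by simp
  from borel_measurable_implies_sequence_metric[OF this, of undefined]
  obtain s where s: "\<And>n. simple_function lborel (s n)" "\<And>z. (\<lambda>n. s n z) \<longlonglongrightarrow> g z" by auto
  define G where "G c z = indicator S z *\<^sub>R F (fst z) (snd z) (fst c) (snd c)" for c z
  have Gm: "G c \<in> borel_measurable lebesgue" for c
  proof -
    have "(\<lambda>(x, t). F x t (fst c) (snd c)) \<in> borel_measurable (lebesgue_on S)"
      using F unfolding caratheodory_def S_def by blast
    then have "(\<lambda>z. F (fst z) (snd z) (fst c) (snd c)) \<in> borel_measurable (lebesgue_on S)"
      by (simp add: case_prod_beta')
    then show ?thesis unfolding G_def using S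
      by (subst borel_measurable_restrict_space_iff[symmetric]) auto
  qed
  have Gs: "(\<lambda>z. G (s n z) z) \<in> borel_measurable lebesgue" for n
  proof (rule measurable_compose_countable'[where I = "range (s n)"])
    show "G c \<in> borel_measurable lebesgue" for c by (rule Gm)
    have fin: "finite (range (s n))" using s(1)[of n] by (simp add: simple_function_def)
    then show "countable (range (s n))" by (rule countable_finite)
    have "s n -` A \<in> sets lborel" if "A \<subseteq> range (s n)" for A
    proof -
      have "s n -` A = (\<Union>c\<in>A. s n -` {c})" by auto
      moreover have sv: "s n -` {c} \<in> sets lborel" if "c \<in> range (s n)" for c
        using s(1)[of n] that by (auto simp: simple_function_def)
      have "(\<Union>c\<in>A. s n -` {c}) \<in> sets lborel"
        by (intro sets.finite_UN finite_subset[OF that fin] sv) (use that in blast)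
      ultimately show ?thesis by simp
    qed
    then show "s n \<in> lebesgue \<rightarrow>\<^sub>M count_space (range (s n))"
      by (auto simp: measurable_def)
  qed
  define E where "E = {z \<in> S. \<not> continuous_on UNIV (\<lambda>c. F (fst z) (snd z) (fst c) (snd c))}"
  have "AE (x, t) in lebesgue_on S. continuous_on UNIV (\<lambda>(s, \<xi>). F x t s \<xi>)"
    using F unfolding caratheodory_def S_def by blast
  then have "AE z in lebesgue_on S. continuous_on UNIV (\<lambda>c. F (fst z) (snd z) (fst c) (snd c))"
    by (simp add: case_prod_beta')
  then have aeC: "AE z in lebesgue. z \<in> S \<longrightarrow> continuous_on UNIV (\<lambda>c. F (fst z) (snd z) (fst c) (snd c))"
    using AE_lebesgue_on_iff[OF S] by (simp add: AE_completion_iff)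
  have E: "AE z in lebesgue. z \<notin> E" using aeC by eventually_elim (auto simp: E_def)
  then have "E \<in> null_sets lebesgue"
    using completion.AE_iff_null_sets[of "\<lambda>z. z \<notin> E" lborel] by simp
  then have Em: "E \<in> sets lebesgue" by (rule null_setsD2)
  have "(\<lambda>z. indicator (- E) z *\<^sub>R G (g z) z) \<in> borel_measurable lebesgue"
  proof (rule borel_measurable_LIMSEQ_metric)
    show "(\<lambda>z. indicator (- E) z *\<^sub>R G (s n z) z) \<in> borel_measurable lebesgue" for n
      using Gs[of n] Em by (intro borel_measurable_scaleR borel_measurable_indicator) (auto intro: Compl_in_sets_lebesgue[THEN iffD2])
    fix z
    show "(\<lambda>n. indicator (- E) z *\<^sub>R G (s n z) z) \<longlonglongrightarrow> indicator (- E) z *\<^sub>R G (g z) z"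
    proof (cases "z \<in> S \<and> z \<notin> E")
      case True
      then have c: "continuous_on UNIV (\<lambda>c. F (fst z) (snd z) (fst c) (snd c))" by (auto simp: E_def)
      have "(\<lambda>n. F (fst z) (snd z) (fst (s n z)) (snd (s n z))) \<longlonglongrightarrow> F (fst z) (snd z) (fst (g z)) (snd (g z))"
        by (rule continuous_on_tendsto_compose[OF c s(2)]) auto
      then show ?thesis using True by (simp add: G_def)
    next
      case False
      then have "indicator (- E) z *\<^sub>R G c z = 0" for c by (auto simp: G_def indicator_def)
      then show ?thesis by (simp only: tendsto_const)
    qed
  qed
  then have "(\<lambda>z. G (g z) z) \<in> borel_measurable lebesgue"
    by (rule borel_measurable_AE) (use E in eventually_elim, simp)
  then show ?thesis by (simp add: G_def S_def)
qed

lemma caratheodory_representative: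
  fixes F :: "real^'n::finite \<Rightarrow> real \<Rightarrow> real \<Rightarrow> real^'n \<Rightarrow> real"
    and g :: "(real^'n) \<times> real \<Rightarrow> real \<times> (real^'n)"
  assumes F: "(\<lambda>z. indicator (\<Omega> \<times> {0..T}) z *\<^sub>R F (fst z) (snd z) (fst (g z)) (snd (g z))) \<in> borel_measurable lebesgue"
  obtains \<alpha> where "\<alpha> \<in> borel_measurable borel"
    "AE z in lborel. z \<in> \<Omega> \<times> {0..T} \<longrightarrow> F (fst z) (snd z) (fst (g z)) (snd (g z)) = \<alpha> z"
proof -
  from completion_ex_borel_measurable_real[OF F]
  obtain \<alpha> where \<alpha>: "\<alpha> \<in> borel_measurable lborel"
    "AE z in lborel. indicator (\<Omega> \<times> {0..T}) z *\<^sub>R F (fst z) (snd z) (fst (g z)) (snd (g z)) = \<alpha> z" by blast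
  show thesis
  proof (rule that)
    show "\<alpha> \<in> borel_measurable borel" using \<alpha>(1) by simp
    show "AE z in lborel. z \<in> \<Omega> \<times> {0..T} \<longrightarrow> F (fst z) (snd z) (fst (g z)) (snd (g z)) = \<alpha> z"
      using \<alpha>(2) by eventually_elim (auto simp: indicator_def)
  qed
qed

section \<open>Time-independent functions in the space-time function spaces\<close>

lemma integrable_product_lborel:
  fixes f :: "'a::euclidean_space \<Rightarrow> real" and g :: "'b::euclidean_space \<Rightarrow> real"
  assumes "integrable lborel f" "integrable lborel g"
  shows "integrable lborel (\<lambda>z. f (fst z) * g (snd z))"
proof -
  have [measurable]: "f \<in> borel_measurable borel" "g \<in> borel_measurable borel" using assms by auto
  have "integrable (lborel \<Otimes>\<^sub>M lborel) (\<lambda>z. f (fst z) * g (snd z))"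
  proof (rule lborel_pair.Fubini_integrable)
    have "(\<lambda>z. f (fst z) * g (snd z)) \<in> borel_measurable (borel \<Otimes>\<^sub>M borel)" by measurable
    then show "(\<lambda>z. f (fst z) * g (snd z)) \<in> borel_measurable (lborel \<Otimes>\<^sub>M lborel)" by simp
    show "integrable lborel (\<lambda>x. LINT y|lborel. norm (f (fst (x, y)) * g (snd (x, y))))"
      using assms by (simp add: abs_mult)
  qed (use assms in simp)
  then show ?thesis by (simp add: lborel_prod)
qed

lemma Lq_loc_time_independent:
  fixes f :: "'a::euclidean_space \<Rightarrow> real"
  assumes f[measurable]: "f \<in> borel_measurable borel" and K: "compact K" and q: "0 \<le> q"
    and int: "integrable lborel (\<lambda>x. indicator K x * \<bar>f x\<bar> powr q)"
  shows "Lq_loc T K q (\<lambda>x t. f x)"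
  unfolding Lq_loc_def
proof (intro conjI allI impI)
  have "(\<lambda>z. f (fst z)) \<in> borel_measurable (borel :: ('a \<times> real) measure)"
    by (rule measurable_compose[OF _ f]) (simp add: borel_measurable_continuous_onI continuous_on_fst)
  then have "(\<lambda>(x, t::real). f x) \<in> borel_measurable lborel" by (simp add: case_prod_beta')
  then show "(\<lambda>(x, t). f x) \<in> borel_measurable (lebesgue_on (K \<times> {0<..<T}))"
    by (intro measurable_restrict_space1 measurable_completion)
  fix K' :: "'a set" and a b :: real
  assume "compact K' \<and> K' \<subseteq> K \<and> 0 < a \<and> b < T"
  then have K': "compact K'" "K' \<subseteq> K" by auto
  have [measurable]: "K \<in> sets borel" "K' \<in> sets borel" using K K' by (auto simp: borel_compact)
  have 1: "integrable lborel (\<lambda>x. indicator K' x * \<bar>f x\<bar> powr q)"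
    by (rule Bochner_Integration.integrable_bound[OF int])
      (measurable, use K'(2) in \<open>auto simp: indicator_def\<close>)
  have 2: "integrable lborel (indicat_real {a..b})" by (rule integrable_indicator_compact) simp
  have eq: "indicator (K' \<times> {a..b}) z * \<bar>f (fst z)\<bar> powr q = (indicator K' (fst z) * \<bar>f (fst z)\<bar> powr q) * indicat_real {a..b} (snd z)" for z
  proof -
    have "indicat_real (K' \<times> {a..b}) z = indicator K' (fst z) * indicator {a..b} (snd z)"
      using indicator_times[of K' "{a..b}" z] by simp
    then show ?thesis by simp
  qed
  have m: "(\<lambda>z. \<bar>f (fst z)\<bar> powr q) \<in> borel_measurable (borel :: ('a \<times> real) measure)"
    using \<open>(\<lambda>z. f (fst z)) \<in> borel_measurable (borel :: ('a \<times> real) measure)\<close> by measurable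
  have "set_integrable lebesgue (K' \<times> {a..b}) (\<lambda>z. \<bar>f (fst z)\<bar> powr q)"
    unfolding set_integrable_lebesgue_iff[OF borel_Times[OF \<open>K' \<in> sets borel\<close> atLeastAtMost_borel] m] eq
    by (rule integrable_product_lborel[OF 1 2])
  then show "set_integrable lebesgue (K' \<times> {a..b}) (\<lambda>(x, t). \<bar>f x\<bar> powr q)"
    by (simp add: case_prod_beta')
qed

text \<open>This is the assertion that a function constant in time has weak time derivative
  0.\<close>

lemma integral_deriv_test_function_eq_0:
  fixes \<eta> :: "real \<Rightarrow> real"
  assumes "\<eta> \<in> test_functions {0<..<T}"
  shows "(LINT t:{0<..<T}|lebesgue. c * deriv \<eta> t) = 0"
proof -
  have der: "(\<eta> has_real_derivative frechet_derivative \<eta> (at t) 1) (at t)" for t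
    using test_functions_has_derivative[OF assms, of t]
    by (metis has_real_derivative has_field_derivative_def mult.commute mult_cancel_right2 mult_1 frechet_derivative_at)
  have d: "deriv \<eta> t = frechet_derivative \<eta> (at t) 1" for t
    using DERIV_imp_deriv[OF der] .
  have T1: "(\<lambda>t. frechet_derivative \<eta> (at t) 1) \<in> test_functions {0<..<T}"
    by (rule test_functions_directional[OF assms]) simp
  note cs = test_functions_compactly_supported[OF T1]
  have cont: "continuous_on {0..T} (\<lambda>t. frechet_derivative \<eta> (at t) 1)"
    by (rule compactly_supported_continuous[OF cs])
  show ?thesis
  proof (cases "0 \<le> T")
    case True
    have "(LINT t:{0<..<T}|lebesgue. c * deriv \<eta> t) = (LINT t|lborel. indicator {0<..<T} t * (c * frechet_derivative \<eta> (at t) 1))"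
      unfolding d using compactly_supported_borel[OF cs] by (intro set_integral_lebesgue_eq) auto
    \<comment> \<open>The open interval may be replaced by the closed one since the derivative of
      \<eta> vanishes at both ends; the fundamental theorem then applies on a compact
      interval.\<close>
    also have "\<dots> = (LINT t|lborel. c * (indicator {0..T} t *\<^sub>R frechet_derivative \<eta> (at t) 1))"
      using test_functions_support[OF T1] by (intro Bochner_Integration.integral_cong) (auto simp: indicator_def)
    also have "\<dots> = c * (LINT t|lborel. indicator {0..T} t *\<^sub>R frechet_derivative \<eta> (at t) 1)" by simp
    also have "(LINT t|lborel. indicator {0..T} t *\<^sub>R frechet_derivative \<eta> (at t) 1) = \<eta> T - \<eta> 0"
      by (rule integral_FTC_atLeastAtMost[OF True _ cont])
        (use der in \<open>auto simp: has_real_derivative_iff_has_vector_derivative[symmetric] intro: has_field_derivative_at_within\<close>)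
    also have "\<dots> = 0" using test_functions_support[OF assms] by simp
    finally show ?thesis by simp
  qed (simp add: set_lebesgue_integral_def)
qed

text \<open>All test functions of the proof are of this kind. Their weak time derivative is 0, so
  the term with u and the time derivative of the test function disappears from the weak
  formulation.\<close>

lemma time_independent_admissible:
  fixes \<phi> :: "real^'n::finite \<Rightarrow> real" and D\<phi> :: "real^'n \<Rightarrow> real^'n"
  assumes \<phi>[measurable]: "\<phi> \<in> borel_measurable borel" and D[measurable]: "\<And>i. (\<lambda>x. D\<phi> x $ i) \<in> borel_measurable borel"
    and K: "compact K" and W: "W11_o K \<phi> D\<phi>" and b: "\<And>x. \<bar>\<phi> x\<bar> \<le> M"
    and Dp: "\<And>i. integrable lborel (\<lambda>x. indicator K x * \<bar>D\<phi> x $ i\<bar> powr p i)" and p: "\<And>i. 0 < p i"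
  shows "W12_loc_L2_loc T K (\<lambda>x t. \<phi> x) (\<lambda>x t. 0)" "Lp_W1p_o T K p (\<lambda>x t. \<phi> x) (\<lambda>x t. D\<phi> x)"
    "C_L2_loc I K (\<lambda>x t. \<phi> x)"
proof -
  have [measurable]: "K \<in> sets borel" using K by (simp add: borel_compact)
  note Ki = integrable_indicator_compact[OF K]
  have M: "0 \<le> M" using b[of undefined] by linarith
  have pw: "integrable lborel (\<lambda>x. indicator K x * \<bar>\<phi> x\<bar> powr q)" if "0 \<le> q" for q
    by (rule integrable_mult_bounded[OF Ki, where B = "M powr q"])
      (measurable, use b that M in \<open>auto intro: powr_mono2\<close>)
  have sq: "\<bar>\<phi> x\<bar> powr 2 = (\<phi> x)\<^sup>2" for x by (simp add: powr_numeral)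
  show "W12_loc_L2_loc T K (\<lambda>x t. \<phi> x) (\<lambda>x t. 0)"
    unfolding W12_loc_L2_loc_def
  proof (intro conjI ballI)
    show "Lq_loc T K 2 (\<lambda>x t. \<phi> x)" by (rule Lq_loc_time_independent[OF \<phi> K _ pw]) auto
    show "Lq_loc T K 2 (\<lambda>x t. 0)" by (rule Lq_loc_time_independent[OF _ K]) auto
    fix \<eta> :: "real \<Rightarrow> real" assume "\<eta> \<in> test_functions {0<..<T}"
    then show "AE x in lebesgue_on K. (LINT t:{0<..<T}|lebesgue. \<phi> x * deriv \<eta> t) = - (LINT t:{0<..<T}|lebesgue. 0 * \<eta> t)"
      using integral_deriv_test_function_eq_0 by simp
  qed
  show "Lp_W1p_o T K p (\<lambda>x t. \<phi> x) (\<lambda>x t. D\<phi> x)"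
    unfolding Lp_W1p_o_def
  proof (intro conjI allI)
    show "Lq_loc T K 1 (\<lambda>x t. \<phi> x)" by (rule Lq_loc_time_independent[OF \<phi> K _ pw]) auto
    fix i
    have Da: "D\<phi> absolutely_integrable_on K" using W unfolding W11_o_def by blast
    then have "integrable lborel (\<lambda>x. indicator K x * D\<phi> x $ i)"
      using set_integrable_lebesgue_iff[of K "\<lambda>x. D\<phi> x $ i"] absolutely_integrable_vec_nth[OF Da, of i] by simp
    from integrable_abs[OF this] have "integrable lborel (\<lambda>x. indicator K x * \<bar>D\<phi> x $ i\<bar> powr 1)"
      by (simp add: abs_mult)
    then show "Lq_loc T K 1 (\<lambda>x t. D\<phi> x $ i)" by (intro Lq_loc_time_independent[OF D K]) auto
    show "Lq_loc T K (p i) (\<lambda>x t. D\<phi> x $ i)"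
      using p[of i] by (intro Lq_loc_time_independent[OF D K _ Dp]) auto
  qed (use W in simp)
  show "C_L2_loc I K (\<lambda>x t. \<phi> x)"
    unfolding C_L2_loc_def
  proof (intro conjI ballI allI impI)
    have "\<phi> \<in> borel_measurable lborel" by simp
    then show "\<phi> \<in> borel_measurable (lebesgue_on K)" by (intro measurable_restrict_space1 measurable_completion)
    fix K' :: "(real^'n) set" assume K': "compact K' \<and> K' \<subseteq> K"
    then have [measurable]: "K' \<in> sets borel" by (auto simp: borel_compact)
    have "integrable lborel (\<lambda>x. indicator K' x * (\<phi> x)\<^sup>2)"
      by (rule Bochner_Integration.integrable_bound[OF pw[of 2]])
        (use K' in \<open>auto simp: indicator_def sq\<close>)
    then show "set_integrable lebesgue K' (\<lambda>x. (\<phi> x)\<^sup>2)" by (subst set_integrable_lebesgue_iff) auto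
  qed simp
qed

section \<open>Time-independent test functions\<close>

text \<open>Distinguishing whether y is below or above \<epsilon> w gives Young's inequality with an
  explicit constant and without conjugate exponents.\<close>

lemma young_powr:
  fixes w y \<epsilon> q :: real
  assumes "0 \<le> w" "0 \<le> y" "0 < \<epsilon>" "1 < q"
  shows "w powr (q - 1) * y \<le> \<epsilon> * w powr q + \<epsilon> powr (1 - q) * y powr q"
proof (cases "y \<le> \<epsilon> * w")
  case True
  have "w powr (q - 1) * y \<le> w powr (q - 1) * (\<epsilon> * w)" using True by (intro mult_left_mono) auto
  also have "\<dots> = \<epsilon> * w powr q"
    using assms by (cases "w = 0") (auto simp: powr_diff)
  finally show ?thesis by (simp add: add_increasing2)
next
  case False
  then have "0 \<le> \<epsilon> * w" "\<epsilon> * w < y" using assms by auto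
  then have y: "0 < y" "w \<le> y / \<epsilon>" using assms by (linarith, simp add: pos_le_divide_eq mult.commute)
  have "w powr (q - 1) * y \<le> (y / \<epsilon>) powr (q - 1) * y"
    using assms y by (intro mult_right_mono powr_mono2) auto
  also have "\<dots> = \<epsilon> powr (1 - q) * y powr q"
    using assms y by (simp add: powr_divide powr_diff field_simps)
  finally show ?thesis using assms by (simp add: add_increasing)
qed

lemma integrable_dominated:
  fixes f g :: "'a \<Rightarrow> real"
  assumes "integrable M (\<lambda>z. indicator S z * g z)" "f \<in> borel_measurable M" "S \<in> sets M"
    "AE z in M. z \<in> S \<longrightarrow> \<bar>f z\<bar> \<le> g z"
  shows "integrable M (\<lambda>z. indicator S z * f z)"
proof (rule Bochner_Integration.integrable_bound[OF assms(1)])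
  show "(\<lambda>z. indicator S z * f z) \<in> borel_measurable M" using assms by simp
  show "AE z in M. norm (indicator S z * f z) \<le> norm (indicator S z * g z)"
    using assms(4) by eventually_elim (auto simp: indicator_def)
qed

text \<open>Growth of order q - 1 in W places \<alpha> in the dual space of L^q on sets of finite
  measure; the pointwise Young inequality takes the role of Hoelder's.\<close>

lemma integrable_growth_pairing:
  fixes q c1 c :: real
  assumes q: "1 < q" and c: "0 \<le> c1" "0 \<le> c" and [measurable]: "\<alpha> \<in> borel_measurable M" "D \<in> borel_measurable M" and S: "S \<in> sets M"
    and I: "integrable M (indicat_real S)" and W: "integrable M (\<lambda>z. indicator S z * \<bar>W z\<bar> powr q)"
    and D: "integrable M (\<lambda>z. indicator S z * \<bar>D z\<bar> powr q)"
    and ae: "AE z in M. z \<in> S \<longrightarrow> \<bar>\<alpha> z\<bar> \<le> c1 * \<bar>W z\<bar> powr (q - 1) + c"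
  shows "integrable M (\<lambda>z. indicator S z * (\<alpha> z * D z))"
proof (rule integrable_dominated[OF _ _ S])
  show "integrable M (\<lambda>z. indicator S z * (c1 * \<bar>W z\<bar> powr q + (c1 + c) * \<bar>D z\<bar> powr q + c))"
    using integrable_mult_right[OF W, of c1] integrable_mult_right[OF D, of "c1 + c"] integrable_mult_right[OF I, of c]
    by (simp add: distrib_left mult_ac)
  show "(\<lambda>z. \<alpha> z * D z) \<in> borel_measurable M" by measurable
  show "AE z in M. z \<in> S \<longrightarrow> \<bar>\<alpha> z * D z\<bar> \<le> c1 * \<bar>W z\<bar> powr q + (c1 + c) * \<bar>D z\<bar> powr q + c"
    using ae
  proof (eventually_elim, intro impI)
    fix z assume elim: "z \<in> S \<longrightarrow> \<bar>\<alpha> z\<bar> \<le> c1 * \<bar>W z\<bar> powr (q - 1) + c" "z \<in> S"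
    have 1: "\<bar>W z\<bar> powr (q - 1) * \<bar>D z\<bar> \<le> \<bar>W z\<bar> powr q + \<bar>D z\<bar> powr q"
      using young_powr[of "\<bar>W z\<bar>" "\<bar>D z\<bar>" 1 q] q by simp
    have 2: "\<bar>D z\<bar> \<le> 1 + \<bar>D z\<bar> powr q"
      using young_powr[of 1 "\<bar>D z\<bar>" 1 q] q by simp
    have "\<bar>\<alpha> z * D z\<bar> \<le> (c1 * \<bar>W z\<bar> powr (q - 1) + c) * \<bar>D z\<bar>"
      unfolding abs_mult using elim by (intro mult_right_mono) auto
    also have "\<dots> = c1 * (\<bar>W z\<bar> powr (q - 1) * \<bar>D z\<bar>) + c * \<bar>D z\<bar>" by (simp add: algebra_simps)
    also have "\<dots> \<le> c1 * (\<bar>W z\<bar> powr q + \<bar>D z\<bar> powr q) + c * (1 + \<bar>D z\<bar> powr q)"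
      using 1 2 c by (intro add_mono mult_left_mono) auto
    finally show "\<bar>\<alpha> z * D z\<bar> \<le> c1 * \<bar>W z\<bar> powr q + (c1 + c) * \<bar>D z\<bar> powr q + c"
      by (simp add: algebra_simps)
  qed
qed

lemma powr_minus_one_le: "0 \<le> w \<Longrightarrow> 1 < q \<Longrightarrow> w powr (q - 1) \<le> 1 + w powr (q::real)"
  using young_powr[of w 1 1 q] by simp

text \<open>
  \<open>U\<close>, \<open>W i\<close>, \<open>\<alpha> i\<close> and \<open>\<beta>\<close> are Borel representatives of \<open>u\<close>, \<open>\<partial>\<^sub>i u\<close>, \<open>A\<^sub>i(x,t,u,Du)\<close> and
  \<open>B(x,t,u,Du)\<close>. The function \<open>u\<close> is kept along with \<open>U\<close> because the weak formulation evaluates it at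
  all times, whereas \<open>U\<close> agrees with it at almost all times only.
\<close>

locale borel_weak_solution =
  fixes K :: "(real^'n::finite) set" and T :: real and p :: "'n \<Rightarrow> real" and Co C1 C :: real
    and u :: "real^'n \<Rightarrow> real \<Rightarrow> real" and U :: "(real^'n) \<times> real \<Rightarrow> real"
    and W \<alpha> :: "'n \<Rightarrow> (real^'n) \<times> real \<Rightarrow> real" and \<beta> :: "(real^'n) \<times> real \<Rightarrow> real"
  assumes K: "compact K" and p: "\<And>i. 1 < p i" "\<And>i. p i < 2"
    and C: "0 < Co" "0 < C1" "0 \<le> C"
    and borel[measurable]: "U \<in> borel_measurable borel" "\<And>i. W i \<in> borel_measurable borel"
      "\<And>i. \<alpha> i \<in> borel_measurable borel" "\<beta> \<in> borel_measurable borel"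
    and U_nonneg: "\<And>z. 0 \<le> U z"
    and cont: "C_L2_loc {0..T} K u"
    and u_U: "AE t in lborel. t \<in> {0<..<T} \<longrightarrow> (AE x in lborel. x \<in> K \<longrightarrow> u x t = U (x, t))"
    and struct: "AE z in lborel. z \<in> K \<times> {0<..<T} \<longrightarrow>
      (\<forall>i. Co * \<bar>W i z\<bar> powr p i - C powr p i \<le> \<alpha> i z * W i z \<and>
        \<bar>\<alpha> i z\<bar> \<le> C1 * \<bar>W i z\<bar> powr (p i - 1) + C powr (p i - 1)) \<and>
      \<bar>\<beta> z\<bar> \<le> (\<Sum>i\<in>UNIV. C * (\<bar>W i z\<bar> powr (p i - 1) + C powr (p i - 1)))"
    and W_int: "\<And>i a b. 0 < a \<Longrightarrow> b < T \<Longrightarrow> integrable lborel (\<lambda>z. indicator (K \<times> {a..b}) z * \<bar>W i z\<bar> powr p i)"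
    and powr_test: "AE t in lborel. t \<in> {0<..<T} \<longrightarrow>
      (\<forall>\<zeta> \<nu> a. \<zeta> \<in> test_functions (interior K) \<longrightarrow> 0 < \<nu> \<longrightarrow> 0 < a \<longrightarrow>
        W11_o K (\<lambda>x. (U (x, t) + \<nu>) powr (- a) * \<zeta> x)
          (\<lambda>x. \<chi> i. - a * (U (x, t) + \<nu>) powr (- a - 1) * W i (x, t) * \<zeta> x + (U (x, t) + \<nu>) powr (- a) * partial i \<zeta> x))"
    and super: "\<And>t1 t2 \<phi> D\<phi> M. 0 < t1 \<Longrightarrow> t1 \<le> t2 \<Longrightarrow> t2 < T \<Longrightarrow> \<phi> \<in> borel_measurable borel \<Longrightarrow>
      (\<And>i. (\<lambda>x. D\<phi> x $ i) \<in> borel_measurable borel) \<Longrightarrow> W11_o K \<phi> D\<phi> \<Longrightarrow> (\<And>x. 0 \<le> \<phi> x) \<Longrightarrow> (\<And>x. \<phi> x \<le> M) \<Longrightarrow>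
      (\<And>i. integrable lborel (\<lambda>x. indicator K x * \<bar>D\<phi> x $ i\<bar> powr p i)) \<Longrightarrow>
      (LINT x:K|lebesgue. u x t2 * \<phi> x) - (LINT x:K|lebesgue. u x t1 * \<phi> x)
        + (LINT z|lborel. indicator (K \<times> {t1..t2}) z * (\<Sum>i\<in>UNIV. \<alpha> i z * D\<phi> (fst z) $ i))
      \<ge> (LINT z|lborel. indicator (K \<times> {t1..t2}) z * (\<beta> z * \<phi> (fst z)))"
    and sub: "\<And>t1 t2 \<phi> D\<phi> M. 0 < t1 \<Longrightarrow> t1 \<le> t2 \<Longrightarrow> t2 < T \<Longrightarrow> \<phi> \<in> borel_measurable borel \<Longrightarrow>
      (\<And>i. (\<lambda>x. D\<phi> x $ i) \<in> borel_measurable borel) \<Longrightarrow> W11_o K \<phi> D\<phi> \<Longrightarrow> (\<And>x. 0 \<le> \<phi> x) \<Longrightarrow> (\<And>x. \<phi> x \<le> M) \<Longrightarrow>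
      (\<And>i. integrable lborel (\<lambda>x. indicator K x * \<bar>D\<phi> x $ i\<bar> powr p i)) \<Longrightarrow>
      (LINT x:K|lebesgue. u x t2 * \<phi> x) - (LINT x:K|lebesgue. u x t1 * \<phi> x)
        + (LINT z|lborel. indicator (K \<times> {t1..t2}) z * (\<Sum>i\<in>UNIV. \<alpha> i z * D\<phi> (fst z) $ i))
      \<le> (LINT z|lborel. indicator (K \<times> {t1..t2}) z * (\<beta> z * \<phi> (fst z)))"

section \<open>Transfer of the weak formulation to Borel representatives\<close>

lemma W11_loc_cong_AE:
  assumes W: "W11_loc \<Omega> f g" and \<Omega>: "open \<Omega>"
    and f'[measurable]: "f' \<in> borel_measurable borel" and g'[measurable]: "\<And>i. g' i \<in> borel_measurable borel"
    and f: "AE x in lborel. x \<in> \<Omega> \<longrightarrow> f x = f' x"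
    and g: "\<And>i. AE x in lborel. x \<in> \<Omega> \<longrightarrow> g x $ i = g' i x"
  shows "W11_loc \<Omega> f' (\<lambda>x. \<chi> i. g' i x)"
proof -
  have on: "AE x in lborel. x \<in> K \<longrightarrow> f x = f' x" "AE x in lborel. x \<in> K \<longrightarrow> g x $ i = g' i x" if "K \<subseteq> \<Omega>" for K i
    using f g[of i] that by (eventually_elim, blast)+
  show ?thesis unfolding W11_loc_def
  proof (intro conjI allI impI ballI)
    fix K assume K: "compact K \<and> K \<subseteq> \<Omega>"
    then have Kb: "K \<in> sets borel" and KO: "K \<subseteq> \<Omega>" by (auto simp: borel_compact)
    have WK: "f absolutely_integrable_on K" "g absolutely_integrable_on K"
      using W K unfolding W11_loc_def by blast+
    show "f' absolutely_integrable_on K"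
      using WK(1) set_integral_lebesgue_AE(1)[OF Kb f' on(1)[OF KO]] set_integrable_lebesgue_iff[OF Kb f'] by simp
    have "g' i absolutely_integrable_on K" for i
      using absolutely_integrable_vec_nth[OF WK(2), of i] set_integral_lebesgue_AE(1)[OF Kb g' on(2)[OF KO]]
        set_integrable_lebesgue_iff[OF Kb g'] by simp
    then show "(\<lambda>x. \<chi> i. g' i x) absolutely_integrable_on K" by (intro absolutely_integrable_vec_lambda)
  next
    fix \<psi> i assume \<psi>: "\<psi> \<in> test_functions \<Omega>"
    have Ob: "\<Omega> \<in> sets borel" using \<Omega> by simp
    have [measurable]: "\<psi> \<in> borel_measurable borel" "partial i \<psi> \<in> borel_measurable borel"
      by (rule compactly_supported_borel[OF test_functions_compactly_supported[OF \<psi>]]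
          compactly_supported_borel[OF test_functions_compactly_supported[OF test_functions_partial[OF \<psi>]]])+
    have m1: "(\<lambda>x. f' x * partial i \<psi> x) \<in> borel_measurable borel" by measurable
    have m2: "(\<lambda>x. g' i x * \<psi> x) \<in> borel_measurable borel" by measurable
    have e1: "(LINT x:\<Omega>|lebesgue. f x * partial i \<psi> x) = (LINT x|lborel. indicator \<Omega> x * (f' x * partial i \<psi> x))"
      by (rule set_integral_lebesgue_AE(2)[OF Ob m1]) (use f in \<open>eventually_elim, simp\<close>)
    have e2: "(LINT x:\<Omega>|lebesgue. g x $ i * \<psi> x) = (LINT x|lborel. indicator \<Omega> x * (g' i x * \<psi> x))"
      by (rule set_integral_lebesgue_AE(2)[OF Ob m2]) (use g[of i] in \<open>eventually_elim, simp\<close>)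
    have "(LINT x:\<Omega>|lebesgue. f x * partial i \<psi> x) = - (LINT x:\<Omega>|lebesgue. g x $ i * \<psi> x)"
      using W \<psi> unfolding W11_loc_def by blast
    then show "(LINT x:\<Omega>|lebesgue. f' x * partial i \<psi> x) = - (LINT x:\<Omega>|lebesgue. (\<chi> i. g' i x) $ i * \<psi> x)"
      using e1 e2 set_integral_lebesgue_eq[OF Ob m1] set_integral_lebesgue_eq[OF Ob m2] by simp
  qed
qed

text \<open>R is kept arbitrary so that the sub- and the supersolution inequality are obtained at
  once. The work lies in the provisos of \<open>weak_ineq\<close>: both space-time integrals exist,
  which holds for 0 < t1 and t2 < T because the gradient is integrable to the powers p_i on compact
  subintervals of (0,T).\<close>

lemma weak_ineq_time_independent:
  fixes \<Omega> :: "(real^'n::finite) set" and W \<alpha> :: "'n \<Rightarrow> (real^'n) \<times> real \<Rightarrow> real"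
  assumes w: "weak_ineq R \<Omega> T p A B u Du" and K: "compact K" "K \<subseteq> \<Omega>" and p: "\<And>i. 1 < p i" and C: "0 \<le> C1" "0 \<le> C"
    and [measurable]: "\<And>i. \<alpha> i \<in> borel_measurable borel" "\<beta> \<in> borel_measurable borel"
    and W_int: "\<And>i. integrable lborel (\<lambda>z. indicator (K \<times> {t1..t2}) z * \<bar>W i z\<bar> powr p i)"
    and \<alpha>: "AE z in lborel. z \<in> K \<times> {0<..<T} \<longrightarrow> (\<forall>i. A (fst z) (snd z) (u (fst z) (snd z)) (Du (fst z) (snd z)) $ i = \<alpha> i z)"
    and \<beta>: "AE z in lborel. z \<in> K \<times> {0<..<T} \<longrightarrow> B (fst z) (snd z) (u (fst z) (snd z)) (Du (fst z) (snd z)) = \<beta> z"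
    and growth: "AE z in lborel. z \<in> K \<times> {0<..<T} \<longrightarrow>
      (\<forall>i. \<bar>\<alpha> i z\<bar> \<le> C1 * \<bar>W i z\<bar> powr (p i - 1) + C powr (p i - 1)) \<and>
      \<bar>\<beta> z\<bar> \<le> (\<Sum>i\<in>UNIV. C * (\<bar>W i z\<bar> powr (p i - 1) + C powr (p i - 1)))"
    and t: "0 < t1" "t1 \<le> t2" "t2 < T"
    and \<phi>[measurable]: "\<phi> \<in> borel_measurable borel" and D\<phi>[measurable]: "\<And>i. (\<lambda>x. D\<phi> x $ i) \<in> borel_measurable borel"
    and W11: "W11_o K \<phi> D\<phi>" and b: "\<And>x. 0 \<le> \<phi> x" "\<And>x. \<phi> x \<le> M"
    and Di: "\<And>i. integrable lborel (\<lambda>x. indicator K x * \<bar>D\<phi> x $ i\<bar> powr p i)"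
  shows "R ((LINT x:K|lebesgue. u x t2 * \<phi> x) - (LINT x:K|lebesgue. u x t1 * \<phi> x)
        + (LINT z|lborel. indicator (K \<times> {t1..t2}) z * (\<Sum>i\<in>UNIV. \<alpha> i z * D\<phi> (fst z) $ i)))
      (LINT z|lborel. indicator (K \<times> {t1..t2}) z * (\<beta> z * \<phi> (fst z)))"
proof -
  let ?S = "K \<times> {t1..t2}"
  have Kb[measurable]: "K \<in> sets borel" using K by (simp add: borel_compact)
  have S: "?S \<in> sets borel" by (rule borel_Times[OF Kb atLeastAtMost_borel])
  have SI: "integrable lborel (indicat_real ?S)"
    using K(1) by (intro integrable_indicator_compact compact_Times) auto
  have sub: "?S \<subseteq> K \<times> {0<..<T}" using t by auto
  have fstm: "fst \<in> borel_measurable (borel :: ((real^'n) \<times> real) measure)"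
    by (intro borel_measurable_continuous_onI continuous_on_fst continuous_on_id)
  have pi: "integrable lborel (\<lambda>z. indicator ?S z * \<bar>D\<phi> (fst z) $ i\<bar> powr p i)" for i
  proof -
    have "integrable lborel (\<lambda>z. (indicator K (fst z) * \<bar>D\<phi> (fst z) $ i\<bar> powr p i) * indicat_real {t1..t2} (snd z))"
      by (rule integrable_product_lborel[OF Di integrable_indicator_compact]) simp
    then show ?thesis by (simp add: indicator_times mult_ac)
  qed
  have Dm[measurable]: "(\<lambda>z. D\<phi> (fst z) $ i) \<in> borel_measurable (borel :: ((real^'n) \<times> real) measure)" for i
    by (rule measurable_compose[OF fstm D\<phi>])
  have \<phi>m[measurable]: "(\<lambda>z. \<phi> (fst z)) \<in> borel_measurable (borel :: ((real^'n) \<times> real) measure)"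
    by (rule measurable_compose[OF fstm \<phi>])
  have ai: "integrable lborel (\<lambda>z. indicator ?S z * (\<alpha> i z * D\<phi> (fst z) $ i))" for i
  proof (rule integrable_growth_pairing[OF p[of i] C(1) _ _ _ _ SI W_int pi])
    show "0 \<le> C powr (p i - 1)" by simp
    show "\<alpha> i \<in> borel_measurable lborel" "(\<lambda>z. D\<phi> (fst z) $ i) \<in> borel_measurable (lborel :: ((real^'n) \<times> real) measure)"
      "?S \<in> sets lborel" using S Dm by simp_all
    show "AE z in lborel. z \<in> ?S \<longrightarrow> \<bar>\<alpha> i z\<bar> \<le> C1 * \<bar>W i z\<bar> powr (p i - 1) + C powr (p i - 1)"
      using growth by eventually_elim (use sub in blast)
  qed
  define L where "L z = (\<Sum>i\<in>UNIV. \<alpha> i z * D\<phi> (fst z) $ i)" for z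
  have Lm: "L \<in> borel_measurable borel" unfolding L_def by measurable
  have Rm: "(\<lambda>z. \<beta> z * \<phi> (fst z)) \<in> borel_measurable borel" by measurable
  have Li: "integrable lborel (\<lambda>z. indicator ?S z * L z)"
    unfolding L_def sum_distrib_left by (intro Bochner_Integration.integrable_sum ai)
  have bi: "integrable lborel (\<lambda>z. indicator ?S z * \<beta> z)"
  proof (rule integrable_dominated[where g = "\<lambda>z. \<Sum>i\<in>UNIV. C * ((1 + \<bar>W i z\<bar> powr p i) + C powr (p i - 1))"])
    have "integrable lborel (\<lambda>z. \<Sum>i\<in>UNIV. (C * (1 + C powr (p i - 1))) * indicator ?S z + C * (indicator ?S z * \<bar>W i z\<bar> powr p i))"
      by (intro Bochner_Integration.integrable_sum Bochner_Integration.integrable_add integrable_mult_right SI W_int)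
    then show "integrable lborel (\<lambda>z. indicator ?S z * (\<Sum>i\<in>UNIV. C * ((1 + \<bar>W i z\<bar> powr p i) + C powr (p i - 1))))"
      by (simp add: sum_distrib_left algebra_simps)
    show "AE z in lborel. z \<in> ?S \<longrightarrow> \<bar>\<beta> z\<bar> \<le> (\<Sum>i\<in>UNIV. C * ((1 + \<bar>W i z\<bar> powr p i) + C powr (p i - 1)))"
      using growth
    proof (eventually_elim, intro impI)
      fix z assume "z \<in> K \<times> {0<..<T} \<longrightarrow> (\<forall>i. \<bar>\<alpha> i z\<bar> \<le> C1 * \<bar>W i z\<bar> powr (p i - 1) + C powr (p i - 1)) \<and>
          \<bar>\<beta> z\<bar> \<le> (\<Sum>i\<in>UNIV. C * (\<bar>W i z\<bar> powr (p i - 1) + C powr (p i - 1)))" "z \<in> ?S"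
      then have "\<bar>\<beta> z\<bar> \<le> (\<Sum>i\<in>UNIV. C * (\<bar>W i z\<bar> powr (p i - 1) + C powr (p i - 1)))" using sub by blast
      also have "\<dots> \<le> (\<Sum>i\<in>UNIV. C * ((1 + \<bar>W i z\<bar> powr p i) + C powr (p i - 1)))"
        using C powr_minus_one_le[OF _ p] by (intro sum_mono mult_left_mono add_mono) auto
      finally show "\<bar>\<beta> z\<bar> \<le> (\<Sum>i\<in>UNIV. C * ((1 + \<bar>W i z\<bar> powr p i) + C powr (p i - 1)))" .
    qed
  qed (use S in simp_all)
  have Ri: "integrable lborel (\<lambda>z. indicator ?S z * (\<beta> z * \<phi> (fst z)))"
  proof -
    have "\<bar>\<phi> x\<bar> \<le> M" for x using b by simp
    then have "integrable lborel (\<lambda>z. (indicator ?S z * \<beta> z) * \<phi> (fst z))"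
      by (intro integrable_mult_bounded[OF bi]) simp_all
    then show ?thesis by (simp add: mult_ac)
  qed
  define lhs rhs where "lhs = (\<lambda>(x, \<tau>). - u x \<tau> * 0 + (\<Sum>i\<in>UNIV. A x \<tau> (u x \<tau>) (Du x \<tau>) $ i * D\<phi> x $ i))"
    and "rhs = (\<lambda>(x, \<tau>). B x \<tau> (u x \<tau>) (Du x \<tau>) * \<phi> x)"
  have L: "AE z in lborel. z \<in> ?S \<longrightarrow> lhs z = L z"
    using \<alpha> by eventually_elim (use sub in \<open>auto simp: lhs_def L_def\<close>)
  have R: "AE z in lborel. z \<in> ?S \<longrightarrow> rhs z = \<beta> z * \<phi> (fst z)"
    using \<beta> by eventually_elim (use sub in \<open>auto simp: rhs_def\<close>)
  note Leq = set_integral_lebesgue_AE[OF S Lm L] and Req = set_integral_lebesgue_AE[OF S Rm R]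
  have b': "\<bar>\<phi> x\<bar> \<le> M" for x using b by simp
  have p0: "0 < p i" for i using p[of i] by simp
  note adm = time_independent_admissible[OF \<phi> D\<phi> K(1) W11 b' Di p0]
  have "AE z in lebesgue_on (K \<times> {0<..<T}). 0 \<le> \<phi> (fst z)" using b by simp
  then have nn: "AE (x, \<tau>) in lebesgue_on (K \<times> {0<..<T}). 0 \<le> \<phi> x" by (simp add: case_prod_beta')
  have "R ((LINT x:K|lebesgue. u x t2 * \<phi> x) - (LINT x:K|lebesgue. u x t1 * \<phi> x) + (LINT z:?S|lebesgue. lhs z))
      (LINT z:?S|lebesgue. rhs z)"
    using w[unfolded weak_ineq_def Let_def, rule_format, of t1 t2 K "\<lambda>x t. \<phi> x" "\<lambda>x t. 0" "\<lambda>x t. D\<phi> x"]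
      t K adm nn Leq(1) Req(1) Li Ri unfolding lhs_def rhs_def by auto
  then show ?thesis unfolding Leq(2) Req(2) by (simp only: L_def)
qed

lemma borel_measurable_vec_lambda:
  fixes g :: "'n::finite \<Rightarrow> 'a \<Rightarrow> real"
  assumes "\<And>i. g i \<in> borel_measurable M"
  shows "(\<lambda>z. \<chi> i. g i z) \<in> borel_measurable M"
proof (subst borel_measurable_euclidean_space, rule ballI)
  fix b :: "real^'n" assume "b \<in> Basis"
  then obtain i where "b = axis i 1" by (auto simp: Basis_vec_def)
  then show "(\<lambda>z. (\<chi> i. g i z) \<bullet> b) \<in> borel_measurable M" using assms[of i] by (simp add: inner_axis)
qed

lemma measurable_section:
  fixes f :: "'a::euclidean_space \<times> real \<Rightarrow> real"
  assumes "f \<in> borel_measurable borel"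
  shows "(\<lambda>x. f (x, t)) \<in> borel_measurable borel"
  by (rule measurable_compose[OF _ assms]) (intro borel_measurable_continuous_onI continuous_intros)

text \<open>The last property is quantified over U because two different gradients will be attached
  to one common representative of u.\<close>

lemma gradient_representative:
  fixes \<Omega> :: "(real^'n::finite) set"
  assumes "Lp_W1p_loc T \<Omega> p u Du" and \<Omega>: "open \<Omega>"
  obtains W where "\<And>i. W i \<in> borel_measurable borel"
    "AE z in lborel. z \<in> \<Omega> \<times> {0<..<T} \<longrightarrow> Du (fst z) (snd z) = (\<chi> i. W i z)"
    "\<And>K a b i. compact K \<Longrightarrow> K \<subseteq> \<Omega> \<Longrightarrow> 0 < a \<Longrightarrow> b < T \<Longrightarrow>
       integrable lborel (\<lambda>z. indicator (K \<times> {a..b}) z * \<bar>W i z\<bar> powr p i)"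
    "\<And>U. U \<in> borel_measurable borel \<Longrightarrow> AE z in lborel. z \<in> \<Omega> \<times> {0<..<T} \<longrightarrow> u (fst z) (snd z) = U z \<Longrightarrow>
       AE t in lborel. t \<in> {0<..<T} \<longrightarrow> W11_loc \<Omega> (\<lambda>x. U (x, t)) (\<lambda>x. \<chi> i. W i (x, t))"
proof -
  let ?S = "\<Omega> \<times> {0<..<T}"
  have S: "?S \<in> sets borel" using \<Omega> by (intro borel_open open_Times) auto
  have L: "Lq_loc T \<Omega> (p i) (\<lambda>x t. Du x t $ i)" for i using assms(1) unfolding Lp_W1p_loc_def by blast
  have "(\<lambda>(x, t). Du x t $ i) \<in> borel_measurable (lebesgue_on ?S)" for i
    using L[of i] unfolding Lq_loc_def by blast
  then have "\<exists>g. g \<in> borel_measurable borel \<and> (AE z in lborel. z \<in> ?S \<longrightarrow> (\<lambda>(x, t). Du x t $ i) z = g z)" for i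
    by (rule borel_representative[OF _ S]) blast
  then have "\<forall>i. \<exists>g. g \<in> borel_measurable borel \<and> (AE z in lborel. z \<in> ?S \<longrightarrow> (\<lambda>(x, t). Du x t $ i) z = g z)" ..
  from choice[OF this] obtain W where W': "\<forall>i. W i \<in> borel_measurable borel \<and>
    (AE z in lborel. z \<in> ?S \<longrightarrow> (\<lambda>(x, t). Du x t $ i) z = W i z)" ..
  have W: "W i \<in> borel_measurable borel"
    "AE z in lborel. z \<in> ?S \<longrightarrow> (\<lambda>(x, t). Du x t $ i) z = W i z" for i
    using spec[OF W', of i] by blast+
  have W2: "AE z in lborel. z \<in> ?S \<longrightarrow> Du (fst z) (snd z) $ i = W i z" for i
    using W(2)[of i] by (simp add: case_prod_beta')
  have "AE z in lborel. \<forall>i\<in>UNIV. z \<in> ?S \<longrightarrow> Du (fst z) (snd z) $ i = W i z"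
    using W2 by (subst AE_finite_all) auto
  then have eq: "AE z in lborel. z \<in> ?S \<longrightarrow> Du (fst z) (snd z) = (\<chi> i. W i z)"
    by eventually_elim (simp add: vec_eq_iff)
  show thesis
  proof (rule that[OF W(1) eq])
    fix K :: "(real^'n) set" and a b :: real and i
    assume K: "compact K" "K \<subseteq> \<Omega>" and ab: "0 < a" "b < T"
    have KS: "K \<times> {a..b} \<in> sets borel" using K by (intro borel_Times) (auto simp: borel_compact)
    have sub: "K \<times> {a..b} \<subseteq> ?S" using K ab by auto
    have "set_integrable lebesgue (K \<times> {a..b}) (\<lambda>(x, t). \<bar>Du x t $ i\<bar> powr p i)"
      using L[of i] K ab unfolding Lq_loc_def by blast
    moreover have "AE z in lborel. z \<in> K \<times> {a..b} \<longrightarrow> (\<lambda>(x, t). \<bar>Du x t $ i\<bar> powr p i) z = \<bar>W i z\<bar> powr p i"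
      using W2[of i] by eventually_elim (use sub in \<open>auto simp: case_prod_beta'\<close>)
    moreover have "(\<lambda>z. \<bar>W i z\<bar> powr p i) \<in> borel_measurable borel" using W(1)[of i] by measurable
    ultimately show "integrable lborel (\<lambda>z. indicator (K \<times> {a..b}) z * \<bar>W i z\<bar> powr p i)"
      using set_integral_lebesgue_AE(1)[OF KS] by blast
  next
    fix U assume U: "U \<in> borel_measurable borel" "AE z in lborel. z \<in> ?S \<longrightarrow> u (fst z) (snd z) = U z"
    have "AE t in lebesgue_on {0<..<T}. W11_loc \<Omega> (\<lambda>x. u x t) (\<lambda>x. Du x t)"
      using assms(1) unfolding Lp_W1p_loc_def by blast
    then have 1: "AE t in lborel. t \<in> {0<..<T} \<longrightarrow> W11_loc \<Omega> (\<lambda>x. u x t) (\<lambda>x. Du x t)"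
      by (subst (asm) AE_lebesgue_on_iff) auto
    have 2: "AE t in lborel. AE x in lborel. (x, t) \<in> ?S \<longrightarrow> u x t = U (x, t)"
      using AE_lborel_sections[OF U(2)] by simp
    have 3: "AE t in lborel. AE x in lborel. (x, t) \<in> ?S \<longrightarrow> Du x t = (\<chi> i. W i (x, t))"
      using AE_lborel_sections[OF eq] by simp
    show "AE t in lborel. t \<in> {0<..<T} \<longrightarrow> W11_loc \<Omega> (\<lambda>x. U (x, t)) (\<lambda>x. \<chi> i. W i (x, t))"
      using 1 2 3
    proof (eventually_elim, intro impI)
      fix t assume t: "t \<in> {0<..<T} \<longrightarrow> W11_loc \<Omega> (\<lambda>x. u x t) (\<lambda>x. Du x t)"
        "AE x in lborel. (x, t) \<in> ?S \<longrightarrow> u x t = U (x, t)"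
        "AE x in lborel. (x, t) \<in> ?S \<longrightarrow> Du x t = (\<chi> i. W i (x, t))" "t \<in> {0<..<T}"
      show "W11_loc \<Omega> (\<lambda>x. U (x, t)) (\<lambda>x. \<chi> i. W i (x, t))"
      proof (rule W11_loc_cong_AE[OF _ \<Omega> measurable_section[OF U(1)] measurable_section[OF W(1)]])
        show "W11_loc \<Omega> (\<lambda>x. u x t) (\<lambda>x. Du x t)" using t by blast
        show "AE x in lborel. x \<in> \<Omega> \<longrightarrow> u x t = U (x, t)" using t(2) by eventually_elim (use t(4) in auto)
        show "AE x in lborel. x \<in> \<Omega> \<longrightarrow> Du x t $ i = W i (x, t)" for i
          using t(3) by eventually_elim (use t(4) in auto)
      qed
    qed
  qed
qed

text \<open>The two halves of the solution property each bring a weak gradient of their own. Once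
  these are known to agree almost everywhere on K \<times> (0,T), a single choice of W, \<alpha> and
  \<beta> represents the coefficients in both inequalities.\<close>

lemma borel_weak_solution_exists:
  fixes \<Omega> K :: "(real^'n::finite) set"
  assumes \<Omega>: "open \<Omega>" and K: "compact K" "K \<subseteq> \<Omega>" and p: "\<And>i. 1 < p i" "\<And>i. p i < 2"
    and C: "0 < Co" "0 < C1" "0 \<le> C"
    and car: "caratheodory \<Omega> T A" "caratheodory \<Omega> T B" and st: "structure_conditions \<Omega> T p Co C1 C A B"
    and sol: "local_weak_solution \<Omega> T p A B u"
    and nonneg: "AE (x, \<tau>) in lebesgue_on (\<Omega> \<times> {0..T}). 0 \<le> u x \<tau>"
  obtains U W \<alpha> \<beta> where "borel_weak_solution K T p Co C1 C u U W \<alpha> \<beta>"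
proof -
  let ?S = "\<Omega> \<times> {0<..<T}" and ?S' = "\<Omega> \<times> {0..T}"
  have Ob: "\<Omega> \<in> sets borel" using \<Omega> by simp
  have S: "?S \<in> sets borel" using \<Omega> by (intro borel_open open_Times) auto
  have S': "?S' \<in> sets borel" using Ob by (intro borel_Times) auto
  have KS: "K \<times> {0<..<T} \<subseteq> ?S" "?S \<subseteq> ?S'" using K by auto
  obtain Du1 where Du1: "Lp_W1p_loc T \<Omega> p u Du1" "weak_ineq (\<le>) \<Omega> T p A B u Du1"
    using sol unfolding local_weak_solution_def local_weak_subsolution_def by blast
  obtain Du2 where Du2: "Lp_W1p_loc T \<Omega> p u Du2" "weak_ineq (\<ge>) \<Omega> T p A B u Du2"
    using sol unfolding local_weak_solution_def local_weak_supersolution_def by blast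
  have "(\<lambda>(x, t). u x t) \<in> borel_measurable (lebesgue_on ?S)"
    using Du1(1) unfolding Lp_W1p_loc_def Lq_loc_def by blast
  then obtain U0 where U0: "U0 \<in> borel_measurable borel" "AE z in lborel. z \<in> ?S \<longrightarrow> (\<lambda>(x, t). u x t) z = U0 z"
    by (rule borel_representative[OF _ S])
  \<comment> \<open>The truncation makes U nonnegative at every point, so that powers of
    \<open>U + \<nu>\<close> can be handled without exceptional sets; by the sign of u it changes U0
    on a null set of the cylinder only.\<close>
  define U where "U z = max 0 (U0 z)" for z
  have U[measurable]: "U \<in> borel_measurable borel" unfolding U_def using U0(1) by measurable
  have "AE z in lebesgue_on ?S'. 0 \<le> u (fst z) (snd z)" using nonneg by (simp add: case_prod_beta')
  then have "AE z in lborel. z \<in> ?S' \<longrightarrow> 0 \<le> u (fst z) (snd z)" by (simp add: AE_lebesgue_on_iff[OF S'])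
  then have uU: "AE z in lborel. z \<in> ?S \<longrightarrow> u (fst z) (snd z) = U z"
    using U0(2) by eventually_elim (use KS in \<open>auto simp: U_def case_prod_beta'\<close>)
  obtain W where W: "\<And>i. W i \<in> borel_measurable borel"
    "AE z in lborel. z \<in> ?S \<longrightarrow> Du2 (fst z) (snd z) = (\<chi> i. W i z)"
    "\<And>K a b i. compact K \<Longrightarrow> K \<subseteq> \<Omega> \<Longrightarrow> 0 < a \<Longrightarrow> b < T \<Longrightarrow>
       integrable lborel (\<lambda>z. indicator (K \<times> {a..b}) z * \<bar>W i z\<bar> powr p i)"
    "\<And>U. U \<in> borel_measurable borel \<Longrightarrow> AE z in lborel. z \<in> ?S \<longrightarrow> u (fst z) (snd z) = U z \<Longrightarrow>
       AE t in lborel. t \<in> {0<..<T} \<longrightarrow> W11_loc \<Omega> (\<lambda>x. U (x, t)) (\<lambda>x. \<chi> i. W i (x, t))"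
    by (rule gradient_representative[OF Du2(1) \<Omega>]) (rule that)
  obtain V where V: "\<And>i. V i \<in> borel_measurable borel"
    "AE z in lborel. z \<in> ?S \<longrightarrow> Du1 (fst z) (snd z) = (\<chi> i. V i z)"
    "\<And>K a b i. compact K \<Longrightarrow> K \<subseteq> \<Omega> \<Longrightarrow> 0 < a \<Longrightarrow> b < T \<Longrightarrow>
       integrable lborel (\<lambda>z. indicator (K \<times> {a..b}) z * \<bar>V i z\<bar> powr p i)"
    "\<And>U. U \<in> borel_measurable borel \<Longrightarrow> AE z in lborel. z \<in> ?S \<longrightarrow> u (fst z) (snd z) = U z \<Longrightarrow>
       AE t in lborel. t \<in> {0<..<T} \<longrightarrow> W11_loc \<Omega> (\<lambda>x. U (x, t)) (\<lambda>x. \<chi> i. V i (x, t))"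
    by (rule gradient_representative[OF Du1(1) \<Omega>]) (rule that)
  note [measurable] = W(1) V(1)
  \<comment> \<open>Uniqueness of weak gradients is applied on almost every time slice. Borel
    measurability of \<open>V i\<close> and \<open>W i\<close> is what allows the return from slices
    to space-time.\<close>
  have VW: "AE z in lborel. z \<in> K \<times> {0<..<T} \<longrightarrow> V i z = W i z" for i
  proof (rule AE_lborel_from_sections)
    have "K \<times> {0<..<T} \<in> sets borel" using K by (intro borel_Times) (auto simp: borel_compact)
    then show "{z. z \<in> K \<times> {0<..<T} \<longrightarrow> V i z = W i z} \<in> sets borel" by measurable
    show "AE t in lborel. AE x in lborel. (x, t) \<in> K \<times> {0<..<T} \<longrightarrow> V i (x, t) = W i (x, t)"
      using V(4)[OF U uU] W(4)[OF U uU]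
    proof eventually_elim
      case (elim t)
      show ?case
      proof (cases "t \<in> {0<..<T}")
        case True
        have "AE x in lborel. x \<in> K \<longrightarrow> (\<chi> i. V i (x, t)) $ i = (\<chi> i. W i (x, t)) $ i"
          using elim True
          by (intro W11_loc_unique[OF _ _ \<Omega> K]) (auto intro: measurable_section U V(1) W(1))
        then show ?thesis by eventually_elim auto
      qed auto
    qed
  qed
  have "AE z in lborel. \<forall>i\<in>UNIV. z \<in> K \<times> {0<..<T} \<longrightarrow> V i z = W i z"
    using VW by (subst AE_finite_all) auto
  then have Du1W: "AE z in lborel. z \<in> K \<times> {0<..<T} \<longrightarrow> Du1 (fst z) (snd z) = (\<chi> i. W i z)"
    using V(2) by eventually_elim (use KS in auto)
  have Du2W: "AE z in lborel. z \<in> K \<times> {0<..<T} \<longrightarrow> Du2 (fst z) (snd z) = (\<chi> i. W i z)"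
    using W(2) by eventually_elim (use KS in auto)
  have uUK: "AE z in lborel. z \<in> K \<times> {0<..<T} \<longrightarrow> u (fst z) (snd z) = U z"
    using uU by eventually_elim (use KS in auto)
  define g where "g z = (U z, \<chi> i. W i z)" for z
  have g: "g \<in> borel_measurable borel"
    unfolding g_def by (intro borel_measurable_Pair U borel_measurable_vec_lambda W(1))
  have "\<exists>\<alpha>. \<alpha> \<in> borel_measurable borel \<and> (AE z in lborel. z \<in> ?S' \<longrightarrow> A (fst z) (snd z) (fst (g z)) (snd (g z)) $ i = \<alpha> z)" for i
  proof -
    have "(\<lambda>z. (indicator ?S' z *\<^sub>R A (fst z) (snd z) (fst (g z)) (snd (g z))) \<bullet> axis i 1) \<in> borel_measurable lebesgue"
      by (intro borel_measurable_inner caratheodory_measurable[OF car(1) Ob g]) simp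
    then have "(\<lambda>z. indicator ?S' z *\<^sub>R (A (fst z) (snd z) (fst (g z)) (snd (g z)) $ i)) \<in> borel_measurable lebesgue"
      by (simp add: inner_axis)
    from caratheodory_representative[where F = "\<lambda>x t s \<xi>. A x t s \<xi> $ i", OF this]
    obtain \<alpha> where "\<alpha> \<in> borel_measurable borel" "AE z in lborel. z \<in> ?S' \<longrightarrow> A (fst z) (snd z) (fst (g z)) (snd (g z)) $ i = \<alpha> z" .
    then show ?thesis by (intro exI[of _ \<alpha>] conjI)
  qed
  then have "\<forall>i. \<exists>\<alpha>. \<alpha> \<in> borel_measurable borel \<and> (AE z in lborel. z \<in> ?S' \<longrightarrow> A (fst z) (snd z) (fst (g z)) (snd (g z)) $ i = \<alpha> z)" ..
  from choice[OF this] obtain \<alpha> where \<alpha>': "\<forall>i. \<alpha> i \<in> borel_measurable borel \<and>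
    (AE z in lborel. z \<in> ?S' \<longrightarrow> A (fst z) (snd z) (fst (g z)) (snd (g z)) $ i = \<alpha> i z)" ..
  have \<alpha>: "\<alpha> i \<in> borel_measurable borel"
    "AE z in lborel. z \<in> ?S' \<longrightarrow> A (fst z) (snd z) (fst (g z)) (snd (g z)) $ i = \<alpha> i z" for i
    using spec[OF \<alpha>', of i] by simp_all
  have \<alpha>2: "AE z in lborel. \<forall>i\<in>UNIV. z \<in> ?S' \<longrightarrow> A (fst z) (snd z) (fst (g z)) (snd (g z)) $ i = \<alpha> i z"
    using \<alpha>(2) by (subst AE_finite_all) auto
  obtain \<beta> where \<beta>: "\<beta> \<in> borel_measurable borel"
    "AE z in lborel. z \<in> ?S' \<longrightarrow> B (fst z) (snd z) (fst (g z)) (snd (g z)) = \<beta> z"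
    by (rule caratheodory_representative[where F = B, OF caratheodory_measurable[OF car(2) Ob g]])
  have "AE z in lebesgue_on ?S'. \<forall>s \<xi>.
        (\<forall>i. A (fst z) (snd z) s \<xi> $ i * \<xi> $ i \<ge> Co * \<bar>\<xi> $ i\<bar> powr p i - C powr p i) \<and>
        (\<forall>i. \<bar>A (fst z) (snd z) s \<xi> $ i\<bar> \<le> C1 * \<bar>\<xi> $ i\<bar> powr (p i - 1) + C powr (p i - 1)) \<and>
        \<bar>B (fst z) (snd z) s \<xi>\<bar> \<le> (\<Sum>i\<in>UNIV. C * (\<bar>\<xi> $ i\<bar> powr (p i - 1) + C powr (p i - 1)))"
    using st unfolding structure_conditions_def by (simp only: case_prod_beta')
  then have st': "AE z in lborel. z \<in> ?S' \<longrightarrow> (\<forall>s \<xi>.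
        (\<forall>i. A (fst z) (snd z) s \<xi> $ i * \<xi> $ i \<ge> Co * \<bar>\<xi> $ i\<bar> powr p i - C powr p i) \<and>
        (\<forall>i. \<bar>A (fst z) (snd z) s \<xi> $ i\<bar> \<le> C1 * \<bar>\<xi> $ i\<bar> powr (p i - 1) + C powr (p i - 1)) \<and>
        \<bar>B (fst z) (snd z) s \<xi>\<bar> \<le> (\<Sum>i\<in>UNIV. C * (\<bar>\<xi> $ i\<bar> powr (p i - 1) + C powr (p i - 1))))"
    by (simp only: AE_lebesgue_on_iff[OF S'])
  have struct: "AE z in lborel. z \<in> K \<times> {0<..<T} \<longrightarrow>
      (\<forall>i. Co * \<bar>W i z\<bar> powr p i - C powr p i \<le> \<alpha> i z * W i z \<and>
        \<bar>\<alpha> i z\<bar> \<le> C1 * \<bar>W i z\<bar> powr (p i - 1) + C powr (p i - 1)) \<and>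
      \<bar>\<beta> z\<bar> \<le> (\<Sum>i\<in>UNIV. C * (\<bar>W i z\<bar> powr (p i - 1) + C powr (p i - 1)))"
    using st' \<alpha>2 \<beta>(2)
  proof (eventually_elim, intro impI)
    fix z
    assume a: "z \<in> ?S' \<longrightarrow> (\<forall>s \<xi>.
        (\<forall>i. A (fst z) (snd z) s \<xi> $ i * \<xi> $ i \<ge> Co * \<bar>\<xi> $ i\<bar> powr p i - C powr p i) \<and>
        (\<forall>i. \<bar>A (fst z) (snd z) s \<xi> $ i\<bar> \<le> C1 * \<bar>\<xi> $ i\<bar> powr (p i - 1) + C powr (p i - 1)) \<and>
        \<bar>B (fst z) (snd z) s \<xi>\<bar> \<le> (\<Sum>i\<in>UNIV. C * (\<bar>\<xi> $ i\<bar> powr (p i - 1) + C powr (p i - 1))))"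
      "\<forall>i\<in>UNIV. z \<in> ?S' \<longrightarrow> A (fst z) (snd z) (fst (g z)) (snd (g z)) $ i = \<alpha> i z"
      "z \<in> ?S' \<longrightarrow> B (fst z) (snd z) (fst (g z)) (snd (g z)) = \<beta> z" "z \<in> K \<times> {0<..<T}"
    then have z: "z \<in> ?S'" using KS by blast
    show "(\<forall>i. Co * \<bar>W i z\<bar> powr p i - C powr p i \<le> \<alpha> i z * W i z \<and>
        \<bar>\<alpha> i z\<bar> \<le> C1 * \<bar>W i z\<bar> powr (p i - 1) + C powr (p i - 1)) \<and>
      \<bar>\<beta> z\<bar> \<le> (\<Sum>i\<in>UNIV. C * (\<bar>W i z\<bar> powr (p i - 1) + C powr (p i - 1)))"
      using spec[OF spec[OF mp[OF a(1) z], of "fst (g z)"], of "snd (g z)"] a(2,3) z by (auto simp: g_def)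
  qed
  have growth: "AE z in lborel. z \<in> K \<times> {0<..<T} \<longrightarrow>
      (\<forall>i. \<bar>\<alpha> i z\<bar> \<le> C1 * \<bar>W i z\<bar> powr (p i - 1) + C powr (p i - 1)) \<and>
      \<bar>\<beta> z\<bar> \<le> (\<Sum>i\<in>UNIV. C * (\<bar>W i z\<bar> powr (p i - 1) + C powr (p i - 1)))"
    using struct by eventually_elim blast
  have C': "0 \<le> C1" "0 \<le> C" using C by auto
  have AB: "AE z in lborel. z \<in> K \<times> {0<..<T} \<longrightarrow> (\<forall>i. A (fst z) (snd z) (u (fst z) (snd z)) (Du (fst z) (snd z)) $ i = \<alpha> i z)"
     "AE z in lborel. z \<in> K \<times> {0<..<T} \<longrightarrow> B (fst z) (snd z) (u (fst z) (snd z)) (Du (fst z) (snd z)) = \<beta> z"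
    if "AE z in lborel. z \<in> K \<times> {0<..<T} \<longrightarrow> Du (fst z) (snd z) = (\<chi> i. W i z)" for Du
  proof -
    show "AE z in lborel. z \<in> K \<times> {0<..<T} \<longrightarrow> (\<forall>i. A (fst z) (snd z) (u (fst z) (snd z)) (Du (fst z) (snd z)) $ i = \<alpha> i z)"
      using that uUK \<alpha>2
    proof (eventually_elim, intro impI allI)
      fix z i
      assume a: "z \<in> K \<times> {0<..<T} \<longrightarrow> Du (fst z) (snd z) = (\<chi> i. W i z)"
        "z \<in> K \<times> {0<..<T} \<longrightarrow> u (fst z) (snd z) = U z"
        "\<forall>i\<in>UNIV. z \<in> ?S' \<longrightarrow> A (fst z) (snd z) (fst (g z)) (snd (g z)) $ i = \<alpha> i z" "z \<in> K \<times> {0<..<T}"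
      have "z \<in> ?S'" using a(4) KS by blast
      then show "A (fst z) (snd z) (u (fst z) (snd z)) (Du (fst z) (snd z)) $ i = \<alpha> i z"
        using a(3) mp[OF a(1,4)] mp[OF a(2,4)] by (simp add: g_def)
    qed
    show "AE z in lborel. z \<in> K \<times> {0<..<T} \<longrightarrow> B (fst z) (snd z) (u (fst z) (snd z)) (Du (fst z) (snd z)) = \<beta> z"
      using that uUK \<beta>(2)
    proof (eventually_elim, intro impI)
      fix z
      assume a: "z \<in> K \<times> {0<..<T} \<longrightarrow> Du (fst z) (snd z) = (\<chi> i. W i z)"
        "z \<in> K \<times> {0<..<T} \<longrightarrow> u (fst z) (snd z) = U z"
        "z \<in> ?S' \<longrightarrow> B (fst z) (snd z) (fst (g z)) (snd (g z)) = \<beta> z" "z \<in> K \<times> {0<..<T}"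
      have "z \<in> ?S'" using a(4) KS by blast
      then show "B (fst z) (snd z) (u (fst z) (snd z)) (Du (fst z) (snd z)) = \<beta> z"
        using a(3) mp[OF a(1,4)] mp[OF a(2,4)] by (simp add: g_def)
    qed
  qed
  have "borel_weak_solution K T p Co C1 C u U W \<alpha> \<beta>"
  proof
    have c\<Omega>: "C_L2_loc {0..T} \<Omega> u"
      using sol unfolding local_weak_solution_def local_weak_subsolution_def by blast
    show "C_L2_loc {0..T} K u"
      unfolding C_L2_loc_def
    proof (intro conjI ballI allI impI)
      fix t assume "t \<in> {0..T}"
      then have "(\<lambda>x. u x t) \<in> borel_measurable (lebesgue_on \<Omega>)" using c\<Omega> unfolding C_L2_loc_def by blast
      then show "(\<lambda>x. u x t) \<in> borel_measurable (lebesgue_on K)"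
        by (rule measurable_restrict_mono) (rule K(2))
    next
      fix K' t assume "compact K' \<and> K' \<subseteq> K" "t \<in> {0..T}"
      then show "set_integrable lebesgue K' (\<lambda>x. (u x t)\<^sup>2)"
        using c\<Omega> K(2) unfolding C_L2_loc_def by blast
    next
      fix K' s assume "compact K' \<and> K' \<subseteq> K" "s \<in> {0..T}"
      then show "((\<lambda>t. LINT x:K'|lebesgue. (u x t - u x s)\<^sup>2) \<longlongrightarrow> 0) (at s within {0..T})"
        using c\<Omega> K(2) unfolding C_L2_loc_def by blast
    qed
    show "AE t in lborel. t \<in> {0<..<T} \<longrightarrow> (AE x in lborel. x \<in> K \<longrightarrow> u x t = U (x, t))"
      using AE_lborel_sections[OF uUK] by eventually_elim auto
    show "AE t in lborel. t \<in> {0<..<T} \<longrightarrow>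
      (\<forall>\<zeta> \<nu> a. \<zeta> \<in> test_functions (interior K) \<longrightarrow> 0 < \<nu> \<longrightarrow> 0 < a \<longrightarrow>
        W11_o K (\<lambda>x. (U (x, t) + \<nu>) powr (- a) * \<zeta> x)
          (\<lambda>x. \<chi> i. - a * (U (x, t) + \<nu>) powr (- a - 1) * W i (x, t) * \<zeta> x + (U (x, t) + \<nu>) powr (- a) * partial i \<zeta> x))"
      using W(4)[OF U uU]
    proof (eventually_elim, intro impI allI)
      fix t \<zeta> and \<nu> a :: real
      assume t: "t \<in> {0<..<T} \<longrightarrow> W11_loc \<Omega> (\<lambda>x. U (x, t)) (\<lambda>x. \<chi> i. W i (x, t))" "t \<in> {0<..<T}"
        and \<zeta>: "\<zeta> \<in> test_functions (interior K)" and \<nu>: "0 < \<nu>" "0 < a"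
      have "W11_o K (\<lambda>x. (U (x, t) + \<nu>) powr (- a) * \<zeta> x)
        (\<lambda>x. \<chi> i. - a * (U (x, t) + \<nu>) powr (- a - 1) * (\<chi> i. W i (x, t)) $ i * \<zeta> x + (U (x, t) + \<nu>) powr (- a) * partial i \<zeta> x)"
        by (rule W11_o_powr[OF \<Omega> K mp[OF t] measurable_section[OF U] _ _ \<zeta> \<nu>])
          (simp_all add: U_def measurable_section[OF W(1)])
      then show "W11_o K (\<lambda>x. (U (x, t) + \<nu>) powr (- a) * \<zeta> x)
          (\<lambda>x. \<chi> i. - a * (U (x, t) + \<nu>) powr (- a - 1) * W i (x, t) * \<zeta> x + (U (x, t) + \<nu>) powr (- a) * partial i \<zeta> x)"
        by simp
    qed
  next
    fix t1 t2 M :: real and \<phi> :: "real^'n \<Rightarrow> real" and D\<phi> :: "real^'n \<Rightarrow> real^'n"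
    assume t: "0 < t1" "t1 \<le> t2" "t2 < T" and \<phi>: "\<phi> \<in> borel_measurable borel"
      "\<And>i. (\<lambda>x. D\<phi> x $ i) \<in> borel_measurable borel" "W11_o K \<phi> D\<phi>" "\<And>x. 0 \<le> \<phi> x" "\<And>x. \<phi> x \<le> M"
      "\<And>i. integrable lborel (\<lambda>x. indicator K x * \<bar>D\<phi> x $ i\<bar> powr p i)"
    show "(LINT x:K|lebesgue. u x t2 * \<phi> x) - (LINT x:K|lebesgue. u x t1 * \<phi> x)
        + (LINT z|lborel. indicator (K \<times> {t1..t2}) z * (\<Sum>i\<in>UNIV. \<alpha> i z * D\<phi> (fst z) $ i))
      \<ge> (LINT z|lborel. indicator (K \<times> {t1..t2}) z * (\<beta> z * \<phi> (fst z)))"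
      by (rule weak_ineq_time_independent[OF Du2(2) K p(1) C' \<alpha>(1) \<beta>(1) W(3)[OF K t(1,3)] AB[OF Du2W] growth t \<phi>])
    show "(LINT x:K|lebesgue. u x t2 * \<phi> x) - (LINT x:K|lebesgue. u x t1 * \<phi> x)
        + (LINT z|lborel. indicator (K \<times> {t1..t2}) z * (\<Sum>i\<in>UNIV. \<alpha> i z * D\<phi> (fst z) $ i))
      \<le> (LINT z|lborel. indicator (K \<times> {t1..t2}) z * (\<beta> z * \<phi> (fst z)))"
      by (rule weak_ineq_time_independent[OF Du1(2) K p(1) C' \<alpha>(1) \<beta>(1) W(3)[OF K t(1,3)] AB[OF Du1W] growth t \<phi>])
  qed (use K p C U W(1) W(3)[OF K] \<alpha>(1) \<beta>(1) struct in \<open>auto simp: U_def\<close>)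
  then show thesis by (rule that)
qed

section \<open>The energy inequality\<close>

lemma AE_lborel_shift:
  fixes y :: "'a::euclidean_space"
  assumes "AE z in lborel. P z"
  shows "AE z in lborel. P (z - y)"
proof -
  have "distr lborel borel (\<lambda>z. - y + 1 *\<^sub>R z) = lborel" by (rule lborel_affine_sign) simp
  then have "AE z in distr lborel borel (\<lambda>z. - y + 1 *\<^sub>R z). P z" using assms by (simp only:)
  from AE_distrD[OF _ this] show ?thesis by simp
qed

lemma integrable_tail:
  fixes w :: "'a \<Rightarrow> real"
  assumes [measurable]: "w \<in> borel_measurable M" "S \<in> sets M"
    and int: "integrable M (\<lambda>z. indicator S z * \<bar>w z\<bar> powr q)" and e: "0 < e"
  obtains R where "0 < R" "(\<integral>\<^sup>+z. ennreal (indicator S z * (if R < \<bar>w z\<bar> then \<bar>w z\<bar> powr q else 0)) \<partial>M) \<le> ennreal e"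
proof -
  define f where "f n z = indicator S z * (if real n < \<bar>w z\<bar> then \<bar>w z\<bar> powr q else 0)" for n z
  have [measurable]: "f n \<in> borel_measurable M" for n unfolding f_def by measurable
  have "(\<lambda>n. \<integral>\<^sup>+z. ennreal (f n z) \<partial>M) \<longlonglongrightarrow> (\<integral>\<^sup>+z. 0 \<partial>M)"
  proof (rule nn_integral_dominated_convergence[where w = "\<lambda>z. ennreal (indicator S z * \<bar>w z\<bar> powr q)"])
    show "(\<integral>\<^sup>+z. ennreal (indicator S z * \<bar>w z\<bar> powr q) \<partial>M) < \<infinity>"
      using int by (simp add: integrable_iff_bounded)
    show "AE z in M. (\<lambda>n. ennreal (f n z)) \<longlonglongrightarrow> 0"
    proof (rule AE_I2)
      fix z
      obtain N :: nat where "\<bar>w z\<bar> \<le> real N" using real_arch_simple by blast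
      then have "\<not> real n < \<bar>w z\<bar>" if "N \<le> n" for n
        using of_nat_mono[OF that, where 'a = real] by simp
      then have "f n z = 0" if "N \<le> n" for n
        using that unfolding f_def by simp
      then have "\<forall>\<^sub>F n in sequentially. ennreal (f n z) = 0" unfolding eventually_sequentially by (intro exI[of _ N]) simp
      then show "(\<lambda>n. ennreal (f n z)) \<longlonglongrightarrow> 0" by (rule tendsto_eventually)
    qed
    show "AE z in M. ennreal (f n z) \<le> ennreal (indicator S z * \<bar>w z\<bar> powr q)" for n
      by (intro AE_I2 ennreal_leI) (auto simp: f_def)
  qed auto
  then have "\<forall>\<^sub>F n in sequentially. (\<integral>\<^sup>+z. ennreal (f n z) \<partial>M) < ennreal e"
    using e by (intro order_tendstoD(2)) auto
  then have "\<forall>\<^sub>F n in sequentially. (\<integral>\<^sup>+z. ennreal (f n z) \<partial>M) < ennreal e \<and> 0 < n"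
    using eventually_gt_at_top[of 0] by eventually_elim simp
  then obtain n where n: "(\<integral>\<^sup>+z. ennreal (f n z) \<partial>M) < ennreal e" "0 < n"
    using eventually_happens'[OF sequentially_bot] by blast
  show thesis by (rule that[of "real n"]) (use n in \<open>auto simp: f_def\<close>)
qed

lemma nn_integral_growth_bound:
  fixes q c1 c \<epsilon> :: real
  assumes q: "1 < q" and c: "0 \<le> c1" "0 \<le> c" and \<epsilon>: "0 < \<epsilon>"
    and \<alpha>: "\<bar>\<alpha>\<bar> \<le> c1 * \<bar>W\<bar> powr (q - 1) + c"
  shows "\<bar>\<alpha>\<bar> * \<bar>w\<bar> \<le> \<epsilon> * (c1 * \<bar>W\<bar> powr q + c) + (c1 + c) * \<epsilon> powr (1 - q) * \<bar>w\<bar> powr q"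
proof -
  have 1: "\<bar>W\<bar> powr (q - 1) * \<bar>w\<bar> \<le> \<epsilon> * \<bar>W\<bar> powr q + \<epsilon> powr (1 - q) * \<bar>w\<bar> powr q"
    by (rule young_powr) (use q \<epsilon> in auto)
  have 2: "\<bar>w\<bar> \<le> \<epsilon> + \<epsilon> powr (1 - q) * \<bar>w\<bar> powr q"
    using young_powr[of 1 "\<bar>w\<bar>" \<epsilon> q] q \<epsilon> by simp
  have "\<bar>\<alpha>\<bar> * \<bar>w\<bar> \<le> (c1 * \<bar>W\<bar> powr (q - 1) + c) * \<bar>w\<bar>" using \<alpha> by (intro mult_right_mono) auto
  also have "\<dots> = c1 * (\<bar>W\<bar> powr (q - 1) * \<bar>w\<bar>) + c * \<bar>w\<bar>" by (simp add: algebra_simps)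
  also have "\<dots> \<le> c1 * (\<epsilon> * \<bar>W\<bar> powr q + \<epsilon> powr (1 - q) * \<bar>w\<bar> powr q) + c * (\<epsilon> + \<epsilon> powr (1 - q) * \<bar>w\<bar> powr q)"
    using 1 2 c by (intro add_mono mult_left_mono) auto
  finally show ?thesis by (simp add: algebra_simps)
qed

lemma ennreal_combination:
  assumes "0 \<le> a" "0 \<le> b" "0 \<le> c" "0 \<le> x" "0 \<le> y" "0 \<le> z"
  shows "ennreal a * ennreal x + (ennreal b * ennreal y + ennreal b * ennreal y) + ennreal c * ennreal z
     = ennreal (a * x + (b * y + b * y) + c * z)"
  using assms by (simp only: ennreal_plus ennreal_mult mult_nonneg_nonneg add_nonneg_nonneg)

text \<open>Continuity of translations in L1 is not enough by itself, as w is unbounded. Where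
  \<open>\<bar>w z\<bar> \<le> R\<close>, the error is at most R times the L1 translation error of
  \<alpha>. Where w is larger, both values of \<alpha> are estimated by Young's inequality: a small
  multiple of the growth bound, plus a large multiple of the tail of w, which is small for large R.
  The order of choice is \<epsilon>, then R, then d.\<close>

lemma translation_pairing:
  fixes \<alpha> W w :: "'a::euclidean_space \<Rightarrow> real" and q c1 c :: real
  assumes q: "1 < q" and c: "0 \<le> c1" "0 \<le> c"
    and [measurable]: "\<alpha> \<in> borel_measurable borel" "W \<in> borel_measurable borel" "w \<in> borel_measurable borel"
      "S \<in> sets borel" "S0 \<in> sets borel"
    and sub: "S \<subseteq> S0" and I0: "integrable lborel (indicat_real S0)"
    and W0: "integrable lborel (\<lambda>z. indicator S0 z * \<bar>W z\<bar> powr q)"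
    and w0: "integrable lborel (\<lambda>z. indicator S z * \<bar>w z\<bar> powr q)"
    and growth: "AE z in lborel. z \<in> S0 \<longrightarrow> \<bar>\<alpha> z\<bar> \<le> c1 * \<bar>W z\<bar> powr (q - 1) + c"
    and e: "0 < e"
  shows "\<exists>d>0. \<forall>y. norm y < d \<longrightarrow> (\<forall>z\<in>S. z - y \<in> S0) \<longrightarrow>
     (\<integral>\<^sup>+z. ennreal (indicator S z * (\<bar>\<alpha> (z - y) - \<alpha> z\<bar> * \<bar>w z\<bar>)) \<partial>lborel) \<le> ennreal e"
proof -
  define h where "h z = indicat_real S0 z * (c1 * \<bar>W z\<bar> powr q + c)" for z
  have hi: "integrable lborel h"
    using integrable_mult_right[OF W0, of c1] integrable_mult_right[OF I0, of c]
    unfolding h_def by (simp add: distrib_left mult_ac)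
  have [measurable]: "h \<in> borel_measurable borel" using hi by auto
  have h0: "0 \<le> h z" for z unfolding h_def using c by simp
  define P where "P = (LINT z|lborel. h z)"
  have P: "0 \<le> P" unfolding P_def using h0 by simp
  have Pn: "(\<integral>\<^sup>+z. ennreal (h z) \<partial>lborel) = ennreal P"
    unfolding P_def using hi h0 by (intro nn_integral_eq_integral) auto
  define f where "f z = indicat_real S0 z * \<alpha> z" for z
  have [measurable]: "f \<in> borel_measurable borel" unfolding f_def by measurable
  have fi: "integrable lborel f"
    unfolding f_def
  proof (rule integrable_dominated[OF _ _ _])
    have "(\<lambda>z. indicator S0 z * (c1 * (1 + \<bar>W z\<bar> powr q) + c)) = (\<lambda>z. c1 * (indicat_real S0 z * \<bar>W z\<bar> powr q) + (c1 + c) * indicat_real S0 z)"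
      by (simp add: fun_eq_iff algebra_simps)
    then show "integrable lborel (\<lambda>z. indicator S0 z * (c1 * (1 + \<bar>W z\<bar> powr q) + c))"
      using integrable_mult_right[OF W0, of c1] integrable_mult_right[OF I0, of "c1 + c"] by simp
    show "AE z in lborel. z \<in> S0 \<longrightarrow> \<bar>\<alpha> z\<bar> \<le> c1 * (1 + \<bar>W z\<bar> powr q) + c"
      using growth
    proof eventually_elim
      case (elim z)
      show ?case using elim mult_left_mono[OF powr_minus_one_le[of "\<bar>W z\<bar>" q] c(1)] q by auto
    qed
  qed auto
  \<comment> \<open>P is the integral of the growth bound h. It is met twice, translated and
    untranslated, and both together shall cost at most e / 3.\<close>
  define \<epsilon> where "\<epsilon> = e / (6 * (P + 1))"
  have \<epsilon>: "0 < \<epsilon>" using e P by (simp add: \<epsilon>_def)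
  have \<epsilon>P: "2 * (\<epsilon> * P) \<le> e / 3"
  proof -
    have "2 * (\<epsilon> * P) \<le> 2 * (\<epsilon> * (P + 1))" using \<epsilon> by (intro mult_left_mono) auto
    also have "\<dots> = e / 3" using P by (simp add: \<epsilon>_def field_simps add_nonneg_eq_0_iff)
    finally show ?thesis .
  qed
  \<comment> \<open>The factor 2 again counts the translated and the untranslated value of \<alpha>.
    The tail of w is chosen small relative to this constant.\<close>
  define c2 where "c2 = 2 * ((c1 + c) * \<epsilon> powr (1 - q))"
  have c2: "0 \<le> c2" using c by (simp add: c2_def)
  have e3: "0 < e / 3 / (c2 + 1)" using e c2 by simp
  have "w \<in> borel_measurable lborel" "S \<in> sets lborel" by simp_all
  from integrable_tail[OF this w0 e3]
  obtain R where R: "0 < R" "(\<integral>\<^sup>+z. ennreal (indicator S z * (if R < \<bar>w z\<bar> then \<bar>w z\<bar> powr q else 0)) \<partial>lborel) \<le> ennreal (e / 3 / (c2 + 1))" .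
  have eR: "0 < e / 3 / R" using e R by simp
  obtain d where d: "0 < d" "\<forall>y. norm y < d \<longrightarrow> (\<integral>\<^sup>+z. ennreal \<bar>f (z - y) - f z\<bar> \<partial>lborel) \<le> ennreal (e / 3 / R)"
    using L1_translation_continuous[OF fi eR] by blast
  show ?thesis
  proof (intro exI[of _ d] conjI allI impI d(1))
    fix y assume y: "norm y < d" "\<forall>z\<in>S. z - y \<in> S0"
    define k where "k z = indicator S z * (if R < \<bar>w z\<bar> then \<bar>w z\<bar> powr q else 0)" for z
    have [measurable]: "k \<in> borel_measurable borel" unfolding k_def by measurable
    have k0: "0 \<le> k z" for z by (simp add: k_def)
    have "AE z in lborel. ennreal (indicator S z * (\<bar>\<alpha> (z - y) - \<alpha> z\<bar> * \<bar>w z\<bar>))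
       \<le> ennreal R * ennreal \<bar>f (z - y) - f z\<bar> + (ennreal \<epsilon> * ennreal (h (z - y)) + ennreal \<epsilon> * ennreal (h z)) + ennreal c2 * ennreal (k z)"
      using growth AE_lborel_shift[OF growth, of y]
    proof eventually_elim
      case (elim z)
      have "indicator S z * (\<bar>\<alpha> (z - y) - \<alpha> z\<bar> * \<bar>w z\<bar>)
         \<le> R * \<bar>f (z - y) - f z\<bar> + (\<epsilon> * h (z - y) + \<epsilon> * h z) + c2 * k z"
      proof (cases "z \<in> S")
        case True
        then have z0: "z \<in> S0" "z - y \<in> S0" using sub y(2) by auto
        have f: "f (z - y) - f z = \<alpha> (z - y) - \<alpha> z" using z0 by (simp add: f_def)
        show ?thesis
        proof (cases "R < \<bar>w z\<bar>")
          case False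
          have "\<bar>\<alpha> (z - y) - \<alpha> z\<bar> * \<bar>w z\<bar> \<le> \<bar>\<alpha> (z - y) - \<alpha> z\<bar> * R"
            using False by (intro mult_left_mono) auto
          then have "\<bar>\<alpha> (z - y) - \<alpha> z\<bar> * \<bar>w z\<bar> \<le> R * \<bar>f (z - y) - f z\<bar>"
            unfolding f by (simp add: mult.commute)
          moreover have "0 \<le> \<epsilon> * h (z - y)" "0 \<le> \<epsilon> * h z" "0 \<le> c2 * k z" using \<epsilon> h0 c2 k0 by simp_all
          ultimately show ?thesis using True by simp
        next
          case True': True
          have hz: "h z = c1 * \<bar>W z\<bar> powr q + c" "h (z - y) = c1 * \<bar>W (z - y)\<bar> powr q + c"
            "k z = \<bar>w z\<bar> powr q"
            using z0 True True' by (simp_all add: h_def k_def)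
          have "\<bar>\<alpha> (z - y) - \<alpha> z\<bar> * \<bar>w z\<bar> \<le> (\<bar>\<alpha> (z - y)\<bar> + \<bar>\<alpha> z\<bar>) * \<bar>w z\<bar>"
            by (intro mult_right_mono) auto
          also have "\<dots> = \<bar>\<alpha> (z - y)\<bar> * \<bar>w z\<bar> + \<bar>\<alpha> z\<bar> * \<bar>w z\<bar>" by (simp add: distrib_right)
          also have "\<dots> \<le> (\<epsilon> * h (z - y) + (c1 + c) * \<epsilon> powr (1 - q) * k z) + (\<epsilon> * h z + (c1 + c) * \<epsilon> powr (1 - q) * k z)"
            unfolding hz using elim z0 by (intro add_mono nn_integral_growth_bound[OF q c \<epsilon>]) auto
          also have "\<dots> = (\<epsilon> * h (z - y) + \<epsilon> * h z) + c2 * k z" by (simp add: c2_def)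
          finally have "\<bar>\<alpha> (z - y) - \<alpha> z\<bar> * \<bar>w z\<bar> \<le> (\<epsilon> * h (z - y) + \<epsilon> * h z) + c2 * k z" .
          moreover have "0 \<le> R * \<bar>f (z - y) - f z\<bar>" using R(1) by simp
          ultimately show ?thesis using True by simp
        qed
      next
        case False
        then show ?thesis using R(1) \<epsilon> h0[of z] h0[of "z - y"] c2 k0[of z] by simp
      qed
      then have "ennreal (indicator S z * (\<bar>\<alpha> (z - y) - \<alpha> z\<bar> * \<bar>w z\<bar>))
        \<le> ennreal (R * \<bar>f (z - y) - f z\<bar> + (\<epsilon> * h (z - y) + \<epsilon> * h z) + c2 * k z)" by (rule ennreal_leI)
      also have "\<dots> = ennreal R * ennreal \<bar>f (z - y) - f z\<bar> + (ennreal \<epsilon> * ennreal (h (z - y)) + ennreal \<epsilon> * ennreal (h z)) + ennreal c2 * ennreal (k z)"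
        using R(1) \<epsilon> h0[of z] h0[of "z - y"] c2 k0[of z] by (simp add: ennreal_plus ennreal_mult)
      finally show ?case .
    qed
    then have "(\<integral>\<^sup>+z. ennreal (indicator S z * (\<bar>\<alpha> (z - y) - \<alpha> z\<bar> * \<bar>w z\<bar>)) \<partial>lborel)
      \<le> (\<integral>\<^sup>+z. ennreal R * ennreal \<bar>f (z - y) - f z\<bar> + (ennreal \<epsilon> * ennreal (h (z - y)) + ennreal \<epsilon> * ennreal (h z)) + ennreal c2 * ennreal (k z) \<partial>lborel)"
      by (rule nn_integral_mono_AE)
    also have "\<dots> = ennreal R * (\<integral>\<^sup>+z. ennreal \<bar>f (z - y) - f z\<bar> \<partial>lborel)
      + (ennreal \<epsilon> * (\<integral>\<^sup>+z. ennreal (h (z - y)) \<partial>lborel) + ennreal \<epsilon> * (\<integral>\<^sup>+z. ennreal (h z) \<partial>lborel))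
      + ennreal c2 * (\<integral>\<^sup>+z. ennreal (k z) \<partial>lborel)"
      by (simp add: nn_integral_add nn_integral_cmult)
    also have "(\<integral>\<^sup>+z. ennreal (h (z - y)) \<partial>lborel) = (\<integral>\<^sup>+z. ennreal (h z) \<partial>lborel)"
      by (rule nn_integral_lborel_shift[of "\<lambda>z. ennreal (h z)"]) simp
    also have "ennreal R * (\<integral>\<^sup>+z. ennreal \<bar>f (z - y) - f z\<bar> \<partial>lborel)
      + (ennreal \<epsilon> * (\<integral>\<^sup>+z. ennreal (h z) \<partial>lborel) + ennreal \<epsilon> * (\<integral>\<^sup>+z. ennreal (h z) \<partial>lborel))
      + ennreal c2 * (\<integral>\<^sup>+z. ennreal (k z) \<partial>lborel)
      \<le> ennreal R * ennreal (e / 3 / R) + (ennreal \<epsilon> * ennreal P + ennreal \<epsilon> * ennreal P) + ennreal c2 * ennreal (e / 3 / (c2 + 1))"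
      unfolding Pn using d(2) y(1) R(2) by (intro add_mono mult_left_mono order_refl) (auto simp: k_def)
    also have "\<dots> = ennreal (R * (e / 3 / R) + (\<epsilon> * P + \<epsilon> * P) + c2 * (e / 3 / (c2 + 1)))"
      using R(1) \<epsilon> P c2 e by (intro ennreal_combination) auto
    also have "\<dots> \<le> ennreal e"
    proof (rule ennreal_leI)
      have "R * (e / 3 / R) = e / 3" using R(1) by simp
      moreover have "c2 * (e / 3 / (c2 + 1)) = (c2 / (c2 + 1)) * (e / 3)" by simp
      moreover have "(c2 / (c2 + 1)) * (e / 3) \<le> 1 * (e / 3)"
        using c2 e by (intro mult_right_mono) auto
      ultimately show "R * (e / 3 / R) + (\<epsilon> * P + \<epsilon> * P) + c2 * (e / 3 / (c2 + 1)) \<le> e" using \<epsilon>P by linarith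
    qed
    finally show "(\<integral>\<^sup>+z. ennreal (indicator S z * (\<bar>\<alpha> (z - y) - \<alpha> z\<bar> * \<bar>w z\<bar>)) \<partial>lborel) \<le> ennreal e" .
  qed
qed

text \<open>A concave function lies below its tangent at s; here this is derived from the weighted
  inequality of arithmetic and geometric means. The slope is evaluated at s and not at s', which is
  why the test function has to be frozen at the later of the two times.\<close>

lemma powr_concave_increment:
  fixes s s' \<nu> a :: real
  assumes "0 \<le> s" "0 \<le> s'" "0 < \<nu>" "0 < a" "a < 1"
  shows "(s - s') * (s + \<nu>) powr (- a) \<le> (s + \<nu>) powr (1 - a) / (1 - a) - (s' + \<nu>) powr (1 - a) / (1 - a)"
proof -
  define X Y where "X = s + \<nu>" and "Y = s' + \<nu>"
  have X: "0 < X" "0 < Y" using assms by (auto simp: X_def Y_def)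
  have "Y powr (1 - a) * X powr a \<le> (1 - a) * Y + a * X"
    using Youngs_inequality_0[of "1 - a" a Y X] assms X by simp
  then have "Y powr (1 - a) * X powr a * X powr (- a) \<le> ((1 - a) * Y + a * X) * X powr (- a)"
    by (intro mult_right_mono) auto
  moreover have "Y powr (1 - a) * X powr a * X powr (- a) = Y powr (1 - a)"
    using X by (simp add: powr_minus mult.assoc)
  moreover
  have XX: "X * X powr (- a) = X powr (1 - a)"
    using X by (simp add: powr_diff powr_minus divide_inverse)
  ultimately have "Y powr (1 - a) \<le> ((1 - a) * Y + a * X) * X powr (- a)" by (simp only:)
  also have "\<dots> = (1 - a) * (Y * X powr (- a)) + a * (X * X powr (- a))" by (simp add: distrib_right mult.assoc)
  finally have "Y powr (1 - a) \<le> (1 - a) * (Y * X powr (- a)) + a * X powr (1 - a)" by (simp only: XX)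
  then have "(1 - a) * ((X - Y) * X powr (- a)) \<le> X powr (1 - a) - Y powr (1 - a)"
    unfolding left_diff_distrib XX by (simp add: algebra_simps)
  then have "(X - Y) * X powr (- a) \<le> (X powr (1 - a) - Y powr (1 - a)) / (1 - a)"
    using assms by (simp add: pos_le_divide_eq mult.commute)
  then show ?thesis by (simp add: X_def Y_def diff_divide_distrib)
qed

section \<open>Iterated integrals\<close>

lemma Fubini_lborel_snd:
  fixes f :: "'a::euclidean_space \<times> 'b::euclidean_space \<Rightarrow> real"
  assumes "integrable lborel f"
  shows "AE t in lborel. integrable lborel (\<lambda>x. f (x, t))" "integrable lborel (\<lambda>t. LINT x|lborel. f (x, t))"
    "(LINT t|lborel. LINT x|lborel. f (x, t)) = (LINT z|lborel. f z)"
proof -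
  have i: "integrable (lborel \<Otimes>\<^sub>M lborel) (case_prod (\<lambda>x t. f (x, t)))"
    unfolding lborel_prod using assms by simp
  show "AE t in lborel. integrable lborel (\<lambda>x. f (x, t))" by (rule lborel_pair.AE_integrable_snd[OF i])
  show "integrable lborel (\<lambda>t. LINT x|lborel. f (x, t))" by (rule lborel_pair.integrable_snd[OF i])
  show "(LINT t|lborel. LINT x|lborel. f (x, t)) = (LINT z|lborel. f z)"
    using lborel_pair.integral_snd[OF i] unfolding lborel_prod by simp
qed

lemma nn_integral_lborel_iterated:
  fixes f :: "'a::euclidean_space \<times> 'b::euclidean_space \<Rightarrow> ennreal"
  assumes "f \<in> borel_measurable borel"
  shows "(\<integral>\<^sup>+z. f z \<partial>lborel) = (\<integral>\<^sup>+x. \<integral>\<^sup>+t. f (x, t) \<partial>lborel \<partial>lborel)"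
    "(\<integral>\<^sup>+z. f z \<partial>lborel) = (\<integral>\<^sup>+t. \<integral>\<^sup>+x. f (x, t) \<partial>lborel \<partial>lborel)"
proof -
  have m: "case_prod (\<lambda>x t. f (x, t)) \<in> borel_measurable (lborel \<Otimes>\<^sub>M lborel)"
    unfolding lborel_prod using assms by simp
  have m': "f \<in> borel_measurable (lborel \<Otimes>\<^sub>M lborel)"
    unfolding lborel_prod using assms by simp
  show 1: "(\<integral>\<^sup>+z. f z \<partial>lborel) = (\<integral>\<^sup>+x. \<integral>\<^sup>+t. f (x, t) \<partial>lborel \<partial>lborel)"
    using lborel.nn_integral_fst[OF m'] unfolding lborel_prod by simp
  show "(\<integral>\<^sup>+z. f z \<partial>lborel) = (\<integral>\<^sup>+t. \<integral>\<^sup>+x. f (x, t) \<partial>lborel \<partial>lborel)"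
    unfolding 1 using lborel_pair.Fubini'[OF m] by simp
qed

text \<open>Tonelli's theorem in three variables with a regrouping: \<sigma> is the time at which
  the test function is frozen, s the time shift. The integral at fixed \<sigma> becomes a space-time
  integral at fixed shift.\<close>

lemma nn_integral_lborel_triple:
  fixes F :: "'a::euclidean_space \<Rightarrow> real \<Rightarrow> real \<Rightarrow> ennreal"
  assumes M: "(\<lambda>w. F (fst w) (fst (snd w)) (snd (snd w))) \<in> borel_measurable borel"
  shows "(\<integral>\<^sup>+\<sigma>. \<integral>\<^sup>+z. F (fst z) (snd z) \<sigma> \<partial>lborel \<partial>lborel) = (\<integral>\<^sup>+s. \<integral>\<^sup>+z. F (fst z) s (snd z) \<partial>lborel \<partial>lborel)"
proof -
  have m: "(\<lambda>y. F (f1 y) (f2 y) (f3 y)) \<in> borel_measurable borel"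
    if "continuous_on UNIV f1" "continuous_on UNIV f2" "continuous_on UNIV f3" for f1 f2 f3 and N :: "'b::topological_space itself"
  proof -
    have "(\<lambda>y. (f1 y, f2 y, f3 y)) \<in> borel_measurable borel"
      by (intro borel_measurable_continuous_onI continuous_on_Pair that)
    from measurable_compose[OF this M] show ?thesis by simp
  qed
  have "(\<integral>\<^sup>+z. F (fst z) (snd z) \<sigma> \<partial>lborel) = (\<integral>\<^sup>+s. \<integral>\<^sup>+x. F x s \<sigma> \<partial>lborel \<partial>lborel)" for \<sigma>
    by (subst nn_integral_lborel_iterated(2)) (auto intro!: m continuous_intros)
  moreover have "(\<integral>\<^sup>+z. F (fst z) s (snd z) \<partial>lborel) = (\<integral>\<^sup>+\<sigma>. \<integral>\<^sup>+x. F x s \<sigma> \<partial>lborel \<partial>lborel)" for s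
    by (subst nn_integral_lborel_iterated(2)) (auto intro!: m continuous_intros)
  moreover have "(\<integral>\<^sup>+\<sigma>. \<integral>\<^sup>+s. \<integral>\<^sup>+x. F x s \<sigma> \<partial>lborel \<partial>lborel \<partial>lborel) = (\<integral>\<^sup>+s. \<integral>\<^sup>+\<sigma>. \<integral>\<^sup>+x. F x s \<sigma> \<partial>lborel \<partial>lborel \<partial>lborel)"
  proof (rule lborel_pair.Fubini')
    have "case_prod (\<lambda>y x. F x (fst y) (snd y)) \<in> borel_measurable (borel :: ((real \<times> real) \<times> 'a) measure)"
      unfolding case_prod_beta' by (intro m continuous_intros)
    then have "case_prod (\<lambda>y x. F x (fst y) (snd y)) \<in> borel_measurable (borel \<Otimes>\<^sub>M lborel)"
      by (simp add: borel_prod[symmetric] cong: measurable_cong_sets)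
    then have "(\<lambda>y::real \<times> real. \<integral>\<^sup>+x. F x (fst y) (snd y) \<partial>lborel) \<in> borel_measurable borel"
      by (rule lborel.borel_measurable_nn_integral)
    then show "(\<lambda>(x, y). \<integral>\<^sup>+ xa. F xa x y \<partial>lborel) \<in> borel_measurable (lborel \<Otimes>\<^sub>M lborel)"
      unfolding lborel_prod by (simp add: case_prod_beta')
  qed
  ultimately show ?thesis by simp
qed

text \<open>\<open>ennreal\<close> sends negative numbers to 0, so for a signed integrand only this
  inequality is left. It permits an upper bound by a nonnegative majorant whose integrability is not
  known beforehand.\<close>

lemma ennreal_integral_le_nn_integral:
  fixes f :: "'a \<Rightarrow> real"
  assumes "integrable M f"
  shows "ennreal (LINT x|M. f x) \<le> (\<integral>\<^sup>+x. ennreal (f x) \<partial>M)"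
proof -
  have i: "integrable M (\<lambda>x. max 0 (f x))" using assms by simp
  have "(LINT x|M. f x) \<le> (LINT x|M. max 0 (f x))" using assms i by (intro integral_mono) auto
  then have "ennreal (LINT x|M. f x) \<le> ennreal (LINT x|M. max 0 (f x))" by (rule ennreal_leI)
  also have "\<dots> = (\<integral>\<^sup>+x. ennreal (max 0 (f x)) \<partial>M)" using i by (intro nn_integral_eq_integral[symmetric]) auto
  also have "\<dots> = (\<integral>\<^sup>+x. ennreal (f x) \<partial>M)" by (intro nn_integral_cong) (simp add: max_def ennreal_neg)
  finally show ?thesis .
qed

lemma borel_measurable_fst_comp:
  fixes f :: "'a::euclidean_space \<Rightarrow> real"
  shows "f \<in> borel_measurable borel \<Longrightarrow> (\<lambda>z. f (fst z)) \<in> borel_measurable (borel :: ('a \<times> 'b::euclidean_space) measure)"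
  by (rule measurable_compose[of fst borel borel]) (intro borel_measurable_continuous_onI continuous_intros)

lemma powr_sum_le:
  fixes x y q :: real
  assumes "0 \<le> x" "0 \<le> y" "0 < q" "q < 2"
  shows "(x + y) powr q \<le> 4 * (x powr q + y powr q)"
proof -
  have "(x + y) powr q \<le> (2 * max x y) powr q" using assms by (intro powr_mono2) auto
  also have "\<dots> = 2 powr q * (max x y) powr q" using assms by (simp add: powr_mult)
  also have "\<dots> \<le> 4 * (x powr q + y powr q)"
  proof (rule mult_mono)
    have "(2::real) powr q \<le> 2 powr 2" using assms by (intro powr_mono) auto
    then show "(2::real) powr q \<le> 4" by (simp add: powr_numeral)
    show "max x y powr q \<le> x powr q + y powr q" by (simp add: max_def)
  qed auto
  finally show ?thesis .
qed

section \<open>Test functions built from negative powers of the solution\<close>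

context borel_weak_solution
begin

definition phi :: "real \<Rightarrow> real \<Rightarrow> (real^'n \<Rightarrow> real) \<Rightarrow> (real^'n) \<times> real \<Rightarrow> real" where
  "phi \<nu> a \<zeta> z = (U z + \<nu>) powr (- a) * \<zeta> (fst z)"

definition dphi :: "real \<Rightarrow> real \<Rightarrow> (real^'n \<Rightarrow> real) \<Rightarrow> 'n \<Rightarrow> (real^'n) \<times> real \<Rightarrow> real" where
  "dphi \<nu> a \<zeta> i z = - a * (U z + \<nu>) powr (- a - 1) * W i z * \<zeta> (fst z) + (U z + \<nu>) powr (- a) * partial i \<zeta> (fst z)"

text \<open>The primitive of \<open>phi\<close> with respect to the value of U. Its integral over K
  is the quantity whose time increments telescope.\<close>

definition gphi :: "real \<Rightarrow> real \<Rightarrow> (real^'n \<Rightarrow> real) \<Rightarrow> (real^'n) \<times> real \<Rightarrow> real" where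
  "gphi \<nu> a \<zeta> z = (U z + \<nu>) powr (1 - a) / (1 - a) * \<zeta> (fst z)"

lemma K_borel[measurable]: "K \<in> sets borel" using K by (simp add: borel_compact)

lemma KI_borel: "K \<times> {a..b::real} \<in> sets borel" by (intro borel_Times K_borel) auto

lemma KI_integrable: "integrable lborel (indicat_real (K \<times> {a..b::real}))"
  using K by (intro integrable_indicator_compact compact_Times) auto

lemma alpha_integrable:
  assumes "0 < a" "b < T" and D: "D \<in> borel_measurable borel"
    and Di: "integrable lborel (\<lambda>z. indicator (K \<times> {a..b}) z * \<bar>D z\<bar> powr p i)"
  shows "integrable lborel (\<lambda>z. indicator (K \<times> {a..b}) z * (\<alpha> i z * D z))"
proof (rule integrable_growth_pairing[OF p(1)[of i] _ _ _ _ _ KI_integrable W_int[OF assms(1,2)] Di])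
  show "0 \<le> C1" "0 \<le> C powr (p i - 1)" using C by auto
  show "\<alpha> i \<in> borel_measurable lborel" "D \<in> borel_measurable lborel" "K \<times> {a..b} \<in> sets lborel"
    using D KI_borel by simp_all
  show "AE z in lborel. z \<in> K \<times> {a..b} \<longrightarrow> \<bar>\<alpha> i z\<bar> \<le> C1 * \<bar>W i z\<bar> powr (p i - 1) + C powr (p i - 1)"
    using struct by eventually_elim (use assms in auto)
qed

lemma beta_integrable:
  assumes "0 < a" "b < T"
  shows "integrable lborel (\<lambda>z. indicator (K \<times> {a..b}) z * \<beta> z)"
proof (rule integrable_dominated[where g = "\<lambda>z. \<Sum>i\<in>UNIV. C * ((1 + \<bar>W i z\<bar> powr p i) + C powr (p i - 1))"])
  have "integrable lborel (\<lambda>z. \<Sum>i\<in>UNIV. (C * (1 + C powr (p i - 1))) * indicator (K \<times> {a..b}) z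
      + C * (indicator (K \<times> {a..b}) z * \<bar>W i z\<bar> powr p i))"
    by (intro Bochner_Integration.integrable_sum Bochner_Integration.integrable_add integrable_mult_right KI_integrable W_int assms)
  then show "integrable lborel (\<lambda>z. indicator (K \<times> {a..b}) z * (\<Sum>i\<in>UNIV. C * ((1 + \<bar>W i z\<bar> powr p i) + C powr (p i - 1))))"
    by (simp add: sum_distrib_left algebra_simps)
  show "AE z in lborel. z \<in> K \<times> {a..b} \<longrightarrow> \<bar>\<beta> z\<bar> \<le> (\<Sum>i\<in>UNIV. C * ((1 + \<bar>W i z\<bar> powr p i) + C powr (p i - 1)))"
    using struct
  proof (eventually_elim, intro impI)
    fix z assume *: "z \<in> K \<times> {0<..<T} \<longrightarrow>
      (\<forall>i. Co * \<bar>W i z\<bar> powr p i - C powr p i \<le> \<alpha> i z * W i z \<and>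
        \<bar>\<alpha> i z\<bar> \<le> C1 * \<bar>W i z\<bar> powr (p i - 1) + C powr (p i - 1)) \<and>
      \<bar>\<beta> z\<bar> \<le> (\<Sum>i\<in>UNIV. C * (\<bar>W i z\<bar> powr (p i - 1) + C powr (p i - 1)))" "z \<in> K \<times> {a..b}"
    then have "\<bar>\<beta> z\<bar> \<le> (\<Sum>i\<in>UNIV. C * (\<bar>W i z\<bar> powr (p i - 1) + C powr (p i - 1)))" using assms by auto
    also have "\<dots> \<le> (\<Sum>i\<in>UNIV. C * ((1 + \<bar>W i z\<bar> powr p i) + C powr (p i - 1)))"
      using C powr_minus_one_le[OF _ p(1)] by (intro sum_mono mult_left_mono add_mono) auto
    finally show "\<bar>\<beta> z\<bar> \<le> (\<Sum>i\<in>UNIV. C * ((1 + \<bar>W i z\<bar> powr p i) + C powr (p i - 1)))" .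
  qed
qed (use KI_borel in simp_all)

lemma time_section_integrable:
  "AE t in lborel. t \<in> {0<..<T} \<longrightarrow> integrable lborel (\<lambda>x. indicator K x * U (x, t))"
  using u_U
proof (eventually_elim, intro impI)
  fix t assume *: "t \<in> {0<..<T} \<longrightarrow> (AE x in lborel. x \<in> K \<longrightarrow> u x t = U (x, t))" "t \<in> {0<..<T}"
  have [measurable]: "(\<lambda>x. U (x, t)) \<in> borel_measurable borel" by (rule measurable_section) simp
  have "t \<in> {0..T}" using *(2) by simp
  then have "set_integrable lebesgue K (\<lambda>x. (u x t)\<^sup>2)" using cont K unfolding C_L2_loc_def by blast
  moreover have "AE x in lborel. x \<in> K \<longrightarrow> (u x t)\<^sup>2 = (U (x, t))\<^sup>2"
    using mp[OF *] by eventually_elim auto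
  moreover have "(\<lambda>x. (U (x, t))\<^sup>2) \<in> borel_measurable borel" by measurable
  ultimately have sq: "integrable lborel (\<lambda>x. indicator K x * (U (x, t))\<^sup>2)"
    using set_integral_lebesgue_AE(1)[OF K_borel, of "\<lambda>x. (U (x, t))\<^sup>2" "\<lambda>x. (u x t)\<^sup>2"] by simp
  have b: "U z \<le> 1 + (U z)\<^sup>2" for z
  proof -
    have "0 \<le> (U z - 1 / 2)\<^sup>2" by simp
    then show ?thesis by (simp add: power2_eq_square algebra_simps)
  qed
  show "integrable lborel (\<lambda>x. indicator K x * U (x, t))"
  proof (rule integrable_dominated[where g = "\<lambda>x. 1 + (U (x, t))\<^sup>2"])
    show "integrable lborel (\<lambda>x. indicator K x * (1 + (U (x, t))\<^sup>2))"
      using sq integrable_indicator_compact[OF K] by (simp add: distrib_left)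
    show "AE x in lborel. x \<in> K \<longrightarrow> \<bar>U (x, t)\<bar> \<le> 1 + (U (x, t))\<^sup>2"
      using b U_nonneg by simp
  qed simp_all
qed

end

lemma slab_integrable:
  fixes f :: "'a::euclidean_space \<Rightarrow> real"
  assumes "integrable lborel (\<lambda>x. indicator K x * f x)"
  shows "integrable lborel (\<lambda>z. indicator (K \<times> {a..b::real}) z * f (fst z))"
    and "a \<le> b \<Longrightarrow> (LINT z|lborel. indicator (K \<times> {a..b}) z * f (fst z)) = (b - a) * (LINT x|lborel. indicator K x * f x)"
proof -
  have eq: "indicator (K \<times> {a..b}) z * f (fst z) = (indicator K (fst z) * f (fst z)) * indicat_real {a..b} (snd z)" for z
    by (simp add: indicator_times mult_ac)
  have I: "integrable lborel (indicat_real {a..b})" by (rule integrable_indicator_compact) simp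
  show i: "integrable lborel (\<lambda>z. indicator (K \<times> {a..b}) z * f (fst z))"
    unfolding eq by (rule integrable_product_lborel[OF assms I])
  assume ab: "a \<le> b"
  have "(LINT z|lborel. indicator (K \<times> {a..b}) z * f (fst z)) = (LINT t|lborel. LINT x|lborel. (indicator K x * f x) * indicat_real {a..b} t)"
    using Fubini_lborel_snd(3)[OF i] unfolding eq by simp
  also have "\<dots> = (b - a) * (LINT x|lborel. indicator K x * f x)"
    using ab by simp
  finally show "(LINT z|lborel. indicator (K \<times> {a..b}) z * f (fst z)) = (b - a) * (LINT x|lborel. indicator K x * f x)" .
qed

locale borel_weak_solution_test = borel_weak_solution +
  fixes \<nu> a :: real and \<zeta> :: "real^'a \<Rightarrow> real"
  assumes \<nu>: "0 < \<nu>" and a: "0 < a" "a < 1" and \<zeta>: "\<zeta> \<in> test_functions (interior K)" "\<And>x. 0 \<le> \<zeta> x"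
begin

abbreviation "\<phi> \<equiv> phi \<nu> a \<zeta>"
abbreviation "D\<phi> \<equiv> dphi \<nu> a \<zeta>"
abbreviation "G \<equiv> gphi \<nu> a \<zeta>"

lemma zeta_borel[measurable]: "\<zeta> \<in> borel_measurable borel" "partial i \<zeta> \<in> borel_measurable borel"
  by (rule compactly_supported_borel[OF test_functions_compactly_supported[OF \<zeta>(1)]]
      compactly_supported_borel[OF test_functions_compactly_supported[OF test_functions_partial[OF \<zeta>(1)]]])+

lemma zeta_fst_borel[measurable]:
  "(\<lambda>z. \<zeta> (fst z)) \<in> borel_measurable (borel :: ((real^'a) \<times> real) measure)"
  "(\<lambda>z. partial i \<zeta> (fst z)) \<in> borel_measurable (borel :: ((real^'a) \<times> real) measure)"
  by (rule borel_measurable_fst_comp; measurable)+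

lemma phi_borel[measurable]: "\<phi> \<in> borel_measurable borel" "D\<phi> i \<in> borel_measurable borel" "G \<in> borel_measurable borel"
  unfolding phi_def[abs_def] dphi_def[abs_def] gphi_def[abs_def] by measurable

lemma phi_bounded: obtains M where "\<And>z. 0 \<le> \<phi> z" "\<And>z. \<phi> z \<le> M" "0 < M"
proof -
  obtain Z where Z: "0 < Z" "\<And>x. \<bar>\<zeta> x\<bar> \<le> Z"
    by (rule compactly_supported_bounded[OF test_functions_compactly_supported[OF \<zeta>(1)]]) (rule that)
  have "\<phi> z \<le> \<nu> powr (- a) * Z" for z
  proof -
    have "(U z + \<nu>) powr (- a) \<le> \<nu> powr (- a)" using U_nonneg[of z] \<nu> a by (intro powr_mono2') auto
    moreover have "\<zeta> (fst z) \<le> Z" using Z(2)[of "fst z"] by simp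
    ultimately show ?thesis unfolding phi_def using \<zeta>(2) by (intro mult_mono) auto
  qed
  moreover have "0 \<le> \<phi> z" for z unfolding phi_def using \<zeta>(2) by simp
  ultimately show thesis using that[of "\<nu> powr (- a) * Z"] Z \<nu> by simp
qed

lemma dphi_integrable:
  assumes "0 < s" "t < T"
  shows "integrable lborel (\<lambda>z. indicator (K \<times> {s..t}) z * \<bar>D\<phi> i z\<bar> powr p i)"
proof -
  obtain Z where Z: "0 < Z" "\<And>x. \<bar>\<zeta> x\<bar> \<le> Z"
    by (rule compactly_supported_bounded[OF test_functions_compactly_supported[OF \<zeta>(1)]]) (rule that)
  obtain Z' where Z': "0 < Z'" "\<And>x. \<bar>partial i \<zeta> x\<bar> \<le> Z'"
    by (rule compactly_supported_bounded[OF test_functions_compactly_supported[OF test_functions_partial[OF \<zeta>(1)]]]) (rule that)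
  define L0 L1 where "L0 = \<nu> powr (- a) * Z'" and "L1 = a * \<nu> powr (- a - 1) * Z"
  have L: "0 \<le> L0" "0 \<le> L1" using Z Z' a by (auto simp: L0_def L1_def)
  have b: "\<bar>D\<phi> i z\<bar> powr p i \<le> 4 * (L1 powr p i * \<bar>W i z\<bar> powr p i + L0 powr p i)" for z
  proof -
    have 1: "(U z + \<nu>) powr (- a) \<le> \<nu> powr (- a)" "(U z + \<nu>) powr (- a - 1) \<le> \<nu> powr (- a - 1)"
      using U_nonneg[of z] \<nu> a by (auto intro!: powr_mono2')
    have "\<bar>D\<phi> i z\<bar> \<le> \<bar>- a * (U z + \<nu>) powr (- a - 1) * W i z * \<zeta> (fst z)\<bar> + \<bar>(U z + \<nu>) powr (- a) * partial i \<zeta> (fst z)\<bar>"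
      unfolding dphi_def by (rule abs_triangle_ineq)
    also have "\<dots> = (a * (U z + \<nu>) powr (- a - 1) * \<bar>\<zeta> (fst z)\<bar>) * \<bar>W i z\<bar> + (U z + \<nu>) powr (- a) * \<bar>partial i \<zeta> (fst z)\<bar>"
      using a by (simp add: abs_mult mult_ac)
    also have "\<dots> \<le> (a * \<nu> powr (- a - 1) * Z) * \<bar>W i z\<bar> + \<nu> powr (- a) * Z'"
      using 1 a Z Z' by (intro add_mono mult_mono mult_nonneg_nonneg) auto
    finally have "\<bar>D\<phi> i z\<bar> \<le> L1 * \<bar>W i z\<bar> + L0" by (simp add: L0_def L1_def)
    then have "\<bar>D\<phi> i z\<bar> powr p i \<le> (L1 * \<bar>W i z\<bar> + L0) powr p i"
      using p(1)[of i] by (intro powr_mono2) auto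
    also have "\<dots> \<le> 4 * ((L1 * \<bar>W i z\<bar>) powr p i + L0 powr p i)"
      using p[of i] L by (intro powr_sum_le) auto
    finally show ?thesis using L by (simp add: powr_mult)
  qed
  show ?thesis
  proof (rule integrable_dominated[where g = "\<lambda>z. 4 * (L1 powr p i * \<bar>W i z\<bar> powr p i + L0 powr p i)"])
    have "integrable lborel (\<lambda>z. (4 * L1 powr p i) * (indicator (K \<times> {s..t}) z * \<bar>W i z\<bar> powr p i) + (4 * L0 powr p i) * indicator (K \<times> {s..t}) z)"
      using W_int[OF assms] KI_integrable by (intro Bochner_Integration.integrable_add integrable_mult_right)
    then show "integrable lborel (\<lambda>z. indicator (K \<times> {s..t}) z * (4 * (L1 powr p i * \<bar>W i z\<bar> powr p i + L0 powr p i)))"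
      by (simp add: algebra_simps)
    show "AE z in lborel. z \<in> K \<times> {s..t} \<longrightarrow> \<bar>\<bar>D\<phi> i z\<bar> powr p i\<bar> \<le> 4 * (L1 powr p i * \<bar>W i z\<bar> powr p i + L0 powr p i)"
      using b by simp
  qed (use KI_borel in simp_all)
qed

lemma dphi_section_integrable:
  assumes "0 < s" "t < T"
  shows "AE \<sigma> in lborel. \<sigma> \<in> {s..t} \<longrightarrow> (\<forall>i. integrable lborel (\<lambda>x. indicator K x * \<bar>D\<phi> i (x, \<sigma>)\<bar> powr p i))"
proof -
  have "AE \<sigma> in lborel. \<forall>i\<in>UNIV. integrable lborel (\<lambda>x. indicator (K \<times> {s..t}) (x, \<sigma>) * \<bar>D\<phi> i (x, \<sigma>)\<bar> powr p i)"
    using Fubini_lborel_snd(1)[OF dphi_integrable[OF assms]] by (subst AE_finite_all) auto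
  then show ?thesis
  proof (eventually_elim, intro impI allI)
    fix \<sigma> i
    assume *: "\<forall>i\<in>UNIV. integrable lborel (\<lambda>x. indicator (K \<times> {s..t}) (x, \<sigma>) * \<bar>D\<phi> i (x, \<sigma>)\<bar> powr p i)" "\<sigma> \<in> {s..t}"
    have "indicat_real (K \<times> {s..t}) (x, \<sigma>) = indicator K x" for x using *(2) by (simp add: indicator_times)
    then show "integrable lborel (\<lambda>x. indicator K x * \<bar>D\<phi> i (x, \<sigma>)\<bar> powr p i)" using bspec[OF *(1), of i] by simp
  qed
qed

lemma G_nonneg: "0 \<le> G z" unfolding gphi_def using a \<zeta>(2) by simp

lemma G_section_integrable:
  assumes "integrable lborel (\<lambda>x. indicator K x * U (x, t))"
  shows "integrable lborel (\<lambda>x. indicator K x * G (x, t))"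
proof -
  obtain Z where Z: "0 < Z" "\<And>x. \<bar>\<zeta> x\<bar> \<le> Z"
    by (rule compactly_supported_bounded[OF test_functions_compactly_supported[OF \<zeta>(1)]]) (rule that)
  have b: "\<bar>G z\<bar> \<le> Z / (1 - a) * (1 + \<nu> + U z)" for z
  proof -
    have u: "0 < U z + \<nu>" using U_nonneg[of z] \<nu> by simp
    have "(U z + \<nu>) powr (1 - a) \<le> 1 + (U z + \<nu>)"
    proof (cases "U z + \<nu> \<le> 1")
      case True
      then have "(U z + \<nu>) powr (1 - a) \<le> 1" using u a by (intro powr_le1) auto
      then show ?thesis using u by simp
    next
      case False
      then have "(U z + \<nu>) powr (1 - a) \<le> (U z + \<nu>) powr 1" using a by (intro powr_mono) auto
      then show ?thesis using u by simp
    qed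
    then have "(U z + \<nu>) powr (1 - a) / (1 - a) * \<zeta> (fst z) \<le> (1 + \<nu> + U z) / (1 - a) * Z"
      using a Z(2)[of "fst z"] \<zeta>(2) u by (intro mult_mono divide_right_mono) auto
    then show ?thesis unfolding abs_of_nonneg[OF G_nonneg] by (simp add: gphi_def mult_ac)
  qed
  have [measurable]: "(\<lambda>x. G (x, t)) \<in> borel_measurable borel" by (rule measurable_section) simp
  define c where "c = Z / (1 - a)"
  show ?thesis
  proof (rule integrable_dominated[where g = "\<lambda>x. c * (1 + \<nu> + U (x, t))"])
    have "integrable lborel (\<lambda>x. (c * (1 + \<nu>)) * indicator K x + c * (indicator K x * U (x, t)))"
      using assms integrable_indicator_compact[OF K] by (intro Bochner_Integration.integrable_add integrable_mult_right)
    moreover have "indicator K x * (c * (1 + \<nu> + U (x, t))) = (c * (1 + \<nu>)) * indicator K x + c * (indicator K x * U (x, t))" for x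
      by (simp add: algebra_simps)
    ultimately show "integrable lborel (\<lambda>x. indicator K x * (c * (1 + \<nu> + U (x, t))))"
      by simp
  qed (use b in \<open>simp_all add: c_def\<close>)
qed

text \<open>The integrand of the weak inequality at z when the test function is frozen at time
  \<sigma>. On the diagonal, \<open>q (snd z) z\<close> is the integrand that the inadmissible test
  function \<open>phi\<close> would produce.\<close>

definition q :: "real \<Rightarrow> (real^'a) \<times> real \<Rightarrow> real" where
  "q \<sigma> z = (\<Sum>i\<in>UNIV. \<alpha> i z * D\<phi> i (fst z, \<sigma>)) - \<beta> z * \<phi> (fst z, \<sigma>)"

text \<open>The price of evaluating the coefficients at the time of z instead of the time \<sigma>
  of the test function. Absolute values are taken termwise, so that each term is a translation
  error.\<close>

definition err :: "real \<Rightarrow> (real^'a) \<times> real \<Rightarrow> real" where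
  "err \<sigma> z = (\<Sum>i\<in>UNIV. \<bar>\<alpha> i z - \<alpha> i (fst z, \<sigma>)\<bar> * \<bar>D\<phi> i (fst z, \<sigma>)\<bar>) + \<bar>\<beta> z - \<beta> (fst z, \<sigma>)\<bar> * \<bar>\<phi> (fst z, \<sigma>)\<bar>"

lemma q_diff_le: "q \<sigma> z - q \<sigma> (fst z, \<sigma>) \<le> err \<sigma> z"
proof -
  have "q \<sigma> z - q \<sigma> (fst z, \<sigma>) = (\<Sum>i\<in>UNIV. (\<alpha> i z - \<alpha> i (fst z, \<sigma>)) * D\<phi> i (fst z, \<sigma>))
     + - ((\<beta> z - \<beta> (fst z, \<sigma>)) * \<phi> (fst z, \<sigma>))"
    unfolding q_def by (simp add: sum_subtractf left_diff_distrib)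
  also have "\<dots> \<le> err \<sigma> z"
    unfolding err_def abs_mult[symmetric] by (intro add_mono sum_mono) auto
  finally show ?thesis .
qed

lemma q_slab_integrable:
  assumes "0 < s" "t < T" and D: "\<And>i. integrable lborel (\<lambda>x. indicator K x * \<bar>D\<phi> i (x, \<sigma>)\<bar> powr p i)"
  shows "integrable lborel (\<lambda>z. indicator (K \<times> {s..t}) z * (\<Sum>i\<in>UNIV. \<alpha> i z * D\<phi> i (fst z, \<sigma>)))"
    "integrable lborel (\<lambda>z. indicator (K \<times> {s..t}) z * (\<beta> z * \<phi> (fst z, \<sigma>)))"
proof -
  have m: "(\<lambda>z. D\<phi> i (fst z, \<sigma>)) \<in> borel_measurable (borel :: ((real^'a) \<times> real) measure)" for i
    by (rule borel_measurable_fst_comp[OF measurable_section]) simp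
  have m2: "(\<lambda>z. \<phi> (fst z, \<sigma>)) \<in> borel_measurable (borel :: ((real^'a) \<times> real) measure)"
    by (rule borel_measurable_fst_comp[OF measurable_section]) simp
  have "integrable lborel (\<lambda>z. indicator (K \<times> {s..t}) z * (\<alpha> i z * D\<phi> i (fst z, \<sigma>)))" for i
    by (rule alpha_integrable[OF assms(1,2) m slab_integrable(1)[OF D]])
  then show "integrable lborel (\<lambda>z. indicator (K \<times> {s..t}) z * (\<Sum>i\<in>UNIV. \<alpha> i z * D\<phi> i (fst z, \<sigma>)))"
    unfolding sum_distrib_left by (intro Bochner_Integration.integrable_sum)
  obtain M where M: "\<And>z. 0 \<le> \<phi> z" "\<And>z. \<phi> z \<le> M" by (rule phi_bounded) blast
  have "integrable lborel (\<lambda>z. (indicator (K \<times> {s..t}) z * \<beta> z) * \<phi> (fst z, \<sigma>))"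
    by (rule integrable_mult_bounded[OF beta_integrable[OF assms(1,2)], where B = M]) (use m2 M in auto)
  then show "integrable lborel (\<lambda>z. indicator (K \<times> {s..t}) z * (\<beta> z * \<phi> (fst z, \<sigma>)))"
    by (simp add: mult_ac)
qed

lemma section_integral:
  assumes "AE x in lborel. x \<in> K \<longrightarrow> u x t = U (x, t)" and f[measurable]: "f \<in> borel_measurable borel"
  shows "(LINT x:K|lebesgue. u x t * f x) = (LINT x|lborel. indicator K x * (U (x, t) * f x))"
proof (rule set_integral_lebesgue_AE(2)[OF K_borel])
  have [measurable]: "(\<lambda>x. U (x, t)) \<in> borel_measurable borel" by (rule measurable_section) simp
  show "(\<lambda>x. U (x, t) * f x) \<in> borel_measurable borel" by measurable
  show "AE x in lborel. x \<in> K \<longrightarrow> u x t * f x = U (x, t) * f x" using assms(1) by eventually_elim auto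
qed

text \<open>Only almost every \<sigma> qualifies: U has to represent u at \<sigma> and at \<sigma> -
  h, and the test function frozen at \<sigma> must have its gradient in the right spaces. This is
  the reason for the translated exceptional sets.\<close>

lemma super_step:
  assumes h: "0 < h" "h < t1" and t: "t2 < T"
  shows "AE \<sigma> in lborel. \<sigma> \<in> {t1..t2} \<longrightarrow>
    (LINT x|lborel. indicator K x * G (x, \<sigma> - h)) - (LINT x|lborel. indicator K x * G (x, \<sigma>))
      \<le> (LINT z|lborel. indicator (K \<times> {\<sigma> - h..\<sigma>}) z * q \<sigma> z)"
proof -
  have t1: "0 < t1" using h by simp
  show ?thesis
    using u_U AE_lborel_shift[OF u_U, of h] time_section_integrable AE_lborel_shift[OF time_section_integrable, of h]
      powr_test dphi_section_integrable[OF t1 t]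
  proof (eventually_elim, intro impI)
    fix \<sigma>
    assume A: "\<sigma> \<in> {0<..<T} \<longrightarrow> (AE x in lborel. x \<in> K \<longrightarrow> u x \<sigma> = U (x, \<sigma>))"
      "\<sigma> - h \<in> {0<..<T} \<longrightarrow> (AE x in lborel. x \<in> K \<longrightarrow> u x (\<sigma> - h) = U (x, \<sigma> - h))"
      "\<sigma> \<in> {0<..<T} \<longrightarrow> integrable lborel (\<lambda>x. indicator K x * U (x, \<sigma>))"
      "\<sigma> - h \<in> {0<..<T} \<longrightarrow> integrable lborel (\<lambda>x. indicator K x * U (x, \<sigma> - h))"
      "\<sigma> \<in> {0<..<T} \<longrightarrow> (\<forall>\<zeta> \<nu> a. \<zeta> \<in> test_functions (interior K) \<longrightarrow> 0 < \<nu> \<longrightarrow> 0 < a \<longrightarrow>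
        W11_o K (\<lambda>x. (U (x, \<sigma>) + \<nu>) powr (- a) * \<zeta> x)
          (\<lambda>x. \<chi> i. - a * (U (x, \<sigma>) + \<nu>) powr (- a - 1) * W i (x, \<sigma>) * \<zeta> x + (U (x, \<sigma>) + \<nu>) powr (- a) * partial i \<zeta> x))"
      "\<sigma> \<in> {t1..t2} \<longrightarrow> (\<forall>i. integrable lborel (\<lambda>x. indicator K x * \<bar>D\<phi> i (x, \<sigma>)\<bar> powr p i))"
      and \<sigma>: "\<sigma> \<in> {t1..t2}"
    have s: "\<sigma> \<in> {0<..<T}" "\<sigma> - h \<in> {0<..<T}" using \<sigma> h t by auto
    note u1 = mp[OF A(1) s(1)] and u2 = mp[OF A(2) s(2)] and U1 = mp[OF A(3) s(1)] and U2 = mp[OF A(4) s(2)]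
    have Dp: "integrable lborel (\<lambda>x. indicator K x * \<bar>D\<phi> i (x, \<sigma>)\<bar> powr p i)" for i using A(6) \<sigma> by blast
    define f where "f x = \<phi> (x, \<sigma>)" for x
    define Df :: "real^'a \<Rightarrow> real^'a" where "Df x = (\<chi> i. D\<phi> i (x, \<sigma>))" for x
    have fm[measurable]: "f \<in> borel_measurable borel" unfolding f_def by (rule measurable_section) simp
    have Dm: "(\<lambda>x. Df x $ i) \<in> borel_measurable borel" for i
      unfolding Df_def vec_lambda_beta by (rule measurable_section) simp
    have Wo: "W11_o K f Df"
      using mp[OF A(5) s(1)] \<zeta>(1) \<nu> a(1) unfolding f_def[abs_def] Df_def[abs_def] phi_def dphi_def by simp
    obtain M where M: "\<And>z. 0 \<le> \<phi> z" "\<And>z. \<phi> z \<le> M" by (rule phi_bounded) blast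
    have fb: "0 \<le> f x" "f x \<le> M" for x using M by (auto simp: f_def)
    have Dfi: "integrable lborel (\<lambda>x. indicator K x * \<bar>Df x $ i\<bar> powr p i)" for i using Dp by (simp add: Df_def)
    have sup: "(LINT x:K|lebesgue. u x \<sigma> * f x) - (LINT x:K|lebesgue. u x (\<sigma> - h) * f x)
        + (LINT z|lborel. indicator (K \<times> {\<sigma> - h..\<sigma>}) z * (\<Sum>i\<in>UNIV. \<alpha> i z * Df (fst z) $ i))
      \<ge> (LINT z|lborel. indicator (K \<times> {\<sigma> - h..\<sigma>}) z * (\<beta> z * f (fst z)))"
      by (rule super[OF _ _ _ fm Dm Wo fb Dfi]) (use s h in auto)
    have c: "0 < \<sigma> - h" "\<sigma> < T" using s by auto
    note qi = q_slab_integrable[OF c Dp]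
    have q: "(LINT z|lborel. indicator (K \<times> {\<sigma> - h..\<sigma>}) z * q \<sigma> z)
      = (LINT z|lborel. indicator (K \<times> {\<sigma> - h..\<sigma>}) z * (\<Sum>i\<in>UNIV. \<alpha> i z * Df (fst z) $ i))
       - (LINT z|lborel. indicator (K \<times> {\<sigma> - h..\<sigma>}) z * (\<beta> z * f (fst z)))"
      using qi unfolding q_def right_diff_distrib f_def Df_def by simp
    have fi: "integrable lborel (\<lambda>x. indicator K x * (U (x, t) * f x))" if "integrable lborel (\<lambda>x. indicator K x * U (x, t))" for t
    proof -
      have "integrable lborel (\<lambda>x. (indicator K x * U (x, t)) * f x)"
        by (rule integrable_mult_bounded[OF that, where B = M]) (use fb in auto)
      then show ?thesis by (simp add: mult.assoc)
    qed
    have "(LINT x:K|lebesgue. u x \<sigma> * f x) - (LINT x:K|lebesgue. u x (\<sigma> - h) * f x)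
       = (LINT x|lborel. indicator K x * (U (x, \<sigma>) * f x) - indicator K x * (U (x, \<sigma> - h) * f x))"
      unfolding section_integral[OF u1 fm] section_integral[OF u2 fm] using fi[OF U1] fi[OF U2] by simp
    also have "\<dots> \<le> (LINT x|lborel. indicator K x * G (x, \<sigma>) - indicator K x * G (x, \<sigma> - h))"
    proof (rule integral_mono)
      show "integrable lborel (\<lambda>x. indicator K x * (U (x, \<sigma>) * f x) - indicator K x * (U (x, \<sigma> - h) * f x))"
        using fi[OF U1] fi[OF U2] by simp
      show "integrable lborel (\<lambda>x. indicator K x * G (x, \<sigma>) - indicator K x * G (x, \<sigma> - h))"
        using G_section_integrable[OF U1] G_section_integrable[OF U2] by simp
      fix x
      have "(U (x, \<sigma>) - U (x, \<sigma> - h)) * (U (x, \<sigma>) + \<nu>) powr (- a)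
        \<le> (U (x, \<sigma>) + \<nu>) powr (1 - a) / (1 - a) - (U (x, \<sigma> - h) + \<nu>) powr (1 - a) / (1 - a)"
        by (rule powr_concave_increment[OF U_nonneg U_nonneg \<nu> a])
      from mult_right_mono[OF this \<zeta>(2)[of x]]
      have "(U (x, \<sigma>) - U (x, \<sigma> - h)) * f x \<le> G (x, \<sigma>) - G (x, \<sigma> - h)"
        by (simp add: f_def phi_def gphi_def left_diff_distrib mult.assoc)
      then show "indicator K x * (U (x, \<sigma>) * f x) - indicator K x * (U (x, \<sigma> - h) * f x)
          \<le> indicator K x * G (x, \<sigma>) - indicator K x * G (x, \<sigma> - h)"
        by (simp add: left_diff_distrib indicator_def)
    qed
    also have "\<dots> = (LINT x|lborel. indicator K x * G (x, \<sigma>)) - (LINT x|lborel. indicator K x * G (x, \<sigma> - h))"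
      using G_section_integrable[OF U1] G_section_integrable[OF U2] by simp
    finally show "(LINT x|lborel. indicator K x * G (x, \<sigma> - h)) - (LINT x|lborel. indicator K x * G (x, \<sigma>))
      \<le> (LINT z|lborel. indicator (K \<times> {\<sigma> - h..\<sigma>}) z * q \<sigma> z)"
      using sup q by linarith
  qed
qed

lemma Q_integrable:
  assumes "0 < s" "t < T"
  shows "integrable lborel (\<lambda>z. indicator (K \<times> {s..t}) z * q (snd z) z)"
proof -
  have "integrable lborel (\<lambda>z. indicator (K \<times> {s..t}) z * (\<alpha> i z * D\<phi> i z))" for i
    by (rule alpha_integrable[OF assms phi_borel(2) dphi_integrable[OF assms]])
  then have 1: "integrable lborel (\<lambda>z. indicator (K \<times> {s..t}) z * (\<Sum>i\<in>UNIV. \<alpha> i z * D\<phi> i z))"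
    unfolding sum_distrib_left by (intro Bochner_Integration.integrable_sum)
  obtain M where M: "\<And>z. 0 \<le> \<phi> z" "\<And>z. \<phi> z \<le> M" by (rule phi_bounded) blast
  have "integrable lborel (\<lambda>z. (indicator (K \<times> {s..t}) z * \<beta> z) * \<phi> z)"
    by (rule integrable_mult_bounded[OF beta_integrable[OF assms], where B = M]) (use M in auto)
  then have 2: "integrable lborel (\<lambda>z. indicator (K \<times> {s..t}) z * (\<beta> z * \<phi> z))" by (simp add: mult_ac)
  show ?thesis using 1 2 by (simp add: q_def right_diff_distrib)
qed

text \<open>The shift s is a translation in the time direction. The flux terms pair \<alpha> with an
  unbounded gradient and use \<open>translation_pairing\<close>; the test function itself is
  bounded, so for \<beta> continuity of translations in L1 suffices.\<close>

lemma err_small: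
  assumes t: "0 < t1" "t2 < T" and \<delta>: "0 < \<delta>"
  shows "\<exists>d>0. \<forall>s. 0 \<le> s \<longrightarrow> s < d \<longrightarrow>
    (\<integral>\<^sup>+z. ennreal (indicator (K \<times> {t1..t2}) z * err (snd z) (fst z, snd z - s)) \<partial>lborel) \<le> ennreal \<delta>"
proof -
  let ?S = "K \<times> {t1..t2}" and ?R = "K \<times> {t1 / 2..t2}"
  have t0: "0 < t1 / 2" using t by simp
  have sub: "?S \<subseteq> ?R" using t by auto
  obtain M where M: "\<And>z. 0 \<le> \<phi> z" "\<And>z. \<phi> z \<le> M" "0 < M" by (rule phi_bounded) blast
  \<comment> \<open>One share for each of the flux terms and one for the term with \<beta>.\<close>
  define e where "e = \<delta> / (real CARD('a) + 1)"
  have e: "0 < e" using \<delta> by (simp add: e_def add_nonneg_pos)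
  have e_sum: "real CARD('a) * e + e = \<delta>"
    unfolding e_def by (simp add: field_simps add_nonneg_eq_0_iff)
  have "\<exists>d>0. \<forall>y. norm y < d \<longrightarrow> (\<forall>z\<in>?S. z - y \<in> ?R) \<longrightarrow>
     (\<integral>\<^sup>+z. ennreal (indicator ?S z * (\<bar>\<alpha> i (z - y) - \<alpha> i z\<bar> * \<bar>D\<phi> i z\<bar>)) \<partial>lborel) \<le> ennreal e" for i
  proof (rule translation_pairing[OF p(1)[of i] _ _ _ _ _ _ _ sub KI_integrable W_int[OF t0 t(2)] dphi_integrable[OF t] _ e])
    show "0 \<le> C1" "0 \<le> C powr (p i - 1)" using C by auto
    show "AE z in lborel. z \<in> ?R \<longrightarrow> \<bar>\<alpha> i z\<bar> \<le> C1 * \<bar>W i z\<bar> powr (p i - 1) + C powr (p i - 1)"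
      using struct by eventually_elim (use t in auto)
  qed (use KI_borel in simp_all)
  then have "\<forall>i. \<exists>d. 0 < d \<and> (\<forall>y. norm y < d \<longrightarrow> (\<forall>z\<in>?S. z - y \<in> ?R) \<longrightarrow>
     (\<integral>\<^sup>+z. ennreal (indicator ?S z * (\<bar>\<alpha> i (z - y) - \<alpha> i z\<bar> * \<bar>D\<phi> i z\<bar>)) \<partial>lborel) \<le> ennreal e)" by blast
  from choice[OF this] obtain d where d: "\<forall>i. 0 < d i \<and> (\<forall>y. norm y < d i \<longrightarrow> (\<forall>z\<in>?S. z - y \<in> ?R) \<longrightarrow>
     (\<integral>\<^sup>+z. ennreal (indicator ?S z * (\<bar>\<alpha> i (z - y) - \<alpha> i z\<bar> * \<bar>D\<phi> i z\<bar>)) \<partial>lborel) \<le> ennreal e)" ..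
  define b where "b z = indicat_real ?R z * \<beta> z" for z
  have bi: "integrable lborel b" unfolding b_def by (rule beta_integrable[OF t0 t(2)])
  have [measurable]: "b \<in> borel_measurable borel" using bi by auto
  have eM: "0 < e / M" using e M by simp
  obtain db where db: "0 < db" "\<forall>y. norm y < db \<longrightarrow> (\<integral>\<^sup>+z. ennreal \<bar>b (z - y) - b z\<bar> \<partial>lborel) \<le> ennreal (e / M)"
    using L1_translation_continuous[OF bi eM] by blast
  \<comment> \<open>Shifts below t1 / 2 keep the cylinder inside
    \<open>K \<times> {t1 / 2..t2}\<close>, where the gradient is still known to be
    integrable.\<close>
  define D where "D = Min (insert (t1 / 2) (insert db (range d)))"
  have d0: "0 < d i" for i using spec[OF d, of i] by blast
  have "0 < D" unfolding D_def by (subst Min_gr_iff) (use d0 db(1) t0 in auto)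
  moreover have "D \<le> t1 / 2" "D \<le> db" "\<And>i. D \<le> d i" unfolding D_def by (rule Min_le; simp)+
  ultimately have D: "0 < D" "D \<le> t1 / 2" "D \<le> db" "\<And>i. D \<le> d i" by blast+
  show ?thesis
  proof (intro exI[of _ D] conjI allI impI D(1))
    fix s assume s: "0 \<le> s" "s < D"
    define y :: "(real^'a) \<times> real" where "y = (0, s)"
    have y: "norm y = s" using s by (simp add: y_def norm_Pair)
    have zy: "(fst z, snd z - s) = z - y" for z by (simp add: y_def prod_eq_iff)
    have yS: "\<forall>z\<in>?S. z - y \<in> ?R" using s D(2) t by (auto simp: y_def)
    have [measurable]: "(\<lambda>z. \<alpha> i (z - y)) \<in> borel_measurable borel" "(\<lambda>z. \<beta> (z - y)) \<in> borel_measurable borel" for i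
      by measurable
    have [measurable]: "?S \<in> sets borel" by (rule KI_borel)
    have eq: "ennreal (indicator ?S z * err (snd z) (fst z, snd z - s))
      = (\<Sum>i\<in>UNIV. ennreal (indicator ?S z * (\<bar>\<alpha> i (z - y) - \<alpha> i z\<bar> * \<bar>D\<phi> i z\<bar>)))
         + ennreal (indicator ?S z * (\<bar>\<beta> (z - y) - \<beta> z\<bar> * \<bar>\<phi> z\<bar>))" for z
    proof -
      have "err (snd z) (fst z, snd z - s) = (\<Sum>i\<in>UNIV. \<bar>\<alpha> i (z - y) - \<alpha> i z\<bar> * \<bar>D\<phi> i z\<bar>) + \<bar>\<beta> (z - y) - \<beta> z\<bar> * \<bar>\<phi> z\<bar>"
        unfolding err_def zy by (simp add: y_def)
      then show ?thesis
        by (simp add: distrib_left sum_distrib_left ennreal_plus sum_nonneg sum_ennreal)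
    qed
    have "(\<integral>\<^sup>+z. ennreal (indicator ?S z * err (snd z) (fst z, snd z - s)) \<partial>lborel)
      = (\<Sum>i\<in>UNIV. \<integral>\<^sup>+z. ennreal (indicator ?S z * (\<bar>\<alpha> i (z - y) - \<alpha> i z\<bar> * \<bar>D\<phi> i z\<bar>)) \<partial>lborel)
         + (\<integral>\<^sup>+z. ennreal (indicator ?S z * (\<bar>\<beta> (z - y) - \<beta> z\<bar> * \<bar>\<phi> z\<bar>)) \<partial>lborel)"
    proof -
      define f1 where "f1 i z = ennreal (indicator ?S z * (\<bar>\<alpha> i (z - y) - \<alpha> i z\<bar> * \<bar>D\<phi> i z\<bar>))" for i z
      define f2 where "f2 z = ennreal (indicator ?S z * (\<bar>\<beta> (z - y) - \<beta> z\<bar> * \<bar>\<phi> z\<bar>))" for z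
      have m1: "f1 i \<in> borel_measurable lborel" for i unfolding f1_def by measurable
      have m2: "f2 \<in> borel_measurable lborel" unfolding f2_def by measurable
      have "(\<integral>\<^sup>+z. (\<Sum>i\<in>UNIV. f1 i z) + f2 z \<partial>lborel) = (\<integral>\<^sup>+z. (\<Sum>i\<in>UNIV. f1 i z) \<partial>lborel) + (\<integral>\<^sup>+z. f2 z \<partial>lborel)"
        by (rule nn_integral_add[OF borel_measurable_sum m2]) (rule m1)
      also have "(\<integral>\<^sup>+z. (\<Sum>i\<in>UNIV. f1 i z) \<partial>lborel) = (\<Sum>i\<in>UNIV. \<integral>\<^sup>+z. f1 i z \<partial>lborel)"
        by (rule nn_integral_sum) (rule m1)
      finally show ?thesis unfolding eq f1_def f2_def .
    qed
    also have "\<dots> \<le> (\<Sum>i\<in>(UNIV::'a set). ennreal e) + ennreal M * ennreal (e / M)"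
    proof (intro add_mono sum_mono)
      fix i
      show "(\<integral>\<^sup>+z. ennreal (indicator ?S z * (\<bar>\<alpha> i (z - y) - \<alpha> i z\<bar> * \<bar>D\<phi> i z\<bar>)) \<partial>lborel) \<le> ennreal e"
      proof (rule mp[OF mp[OF spec[OF conjunct2[OF spec[OF d, of i]], of y]] yS])
        show "norm y < d i" using y s(2) D(4)[of i] by linarith
      qed
    next
      have "(\<integral>\<^sup>+z. ennreal (indicator ?S z * (\<bar>\<beta> (z - y) - \<beta> z\<bar> * \<bar>\<phi> z\<bar>)) \<partial>lborel)
        \<le> (\<integral>\<^sup>+z. ennreal M * ennreal \<bar>b (z - y) - b z\<bar> \<partial>lborel)"
      proof (intro nn_integral_mono)
        fix z
        have "indicator ?S z * (\<bar>\<beta> (z - y) - \<beta> z\<bar> * \<bar>\<phi> z\<bar>) \<le> M * \<bar>b (z - y) - b z\<bar>"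
        proof (cases "z \<in> ?S")
          case True
          then have "b (z - y) - b z = \<beta> (z - y) - \<beta> z" using yS sub unfolding b_def by auto
          moreover have "\<bar>\<beta> (z - y) - \<beta> z\<bar> * \<bar>\<phi> z\<bar> \<le> \<bar>\<beta> (z - y) - \<beta> z\<bar> * M"
            using M by (intro mult_left_mono) auto
          ultimately show ?thesis using True by (simp add: mult.commute)
        qed (use M in simp)
        then show "ennreal (indicator ?S z * (\<bar>\<beta> (z - y) - \<beta> z\<bar> * \<bar>\<phi> z\<bar>)) \<le> ennreal M * ennreal \<bar>b (z - y) - b z\<bar>"
          using M(3) by (simp add: ennreal_mult[symmetric] ennreal_leI)
      qed
      also have "\<dots> = ennreal M * (\<integral>\<^sup>+z. ennreal \<bar>b (z - y) - b z\<bar> \<partial>lborel)"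
        by (rule nn_integral_cmult) measurable
      also have "\<dots> \<le> ennreal M * ennreal (e / M)"
      proof (intro mult_left_mono mp[OF spec[OF db(2), of y]])
        show "norm y < db" using y s(2) D(3) by linarith
      qed simp
      finally show "(\<integral>\<^sup>+z. ennreal (indicator ?S z * (\<bar>\<beta> (z - y) - \<beta> z\<bar> * \<bar>\<phi> z\<bar>)) \<partial>lborel) \<le> ennreal M * ennreal (e / M)" .
    qed
    also have "\<dots> = ennreal (real CARD('a) * e + e)"
    proof -
      have "(\<Sum>i\<in>(UNIV::'a set). ennreal e) = ennreal (real CARD('a) * e)"
        using e by (subst sum_ennreal) auto
      moreover have "ennreal M * ennreal (e / M) = ennreal e"
        using M(3) e by (simp add: ennreal_mult[symmetric])
      ultimately show ?thesis using e by (simp add: ennreal_plus)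
    qed
    finally show "(\<integral>\<^sup>+z. ennreal (indicator ?S z * err (snd z) (fst z, snd z - s)) \<partial>lborel) \<le> ennreal \<delta>"
      unfolding e_sum .
  qed
qed

text \<open>The substitution s = \<sigma> - \<tau> turns the slabs of varying position into one
  space-time integral for each shift s in [0,h], each at most \<delta>. The gain of the factor h is
  essential, because the inequality is afterwards divided by h.\<close>

lemma error_tonelli:
  assumes t: "0 < t1" "t2 < T" and h: "0 < h" and \<delta>: "0 \<le> \<delta>"
    and small: "\<And>s. 0 \<le> s \<Longrightarrow> s \<le> h \<Longrightarrow>
      (\<integral>\<^sup>+z. ennreal (indicator (K \<times> {t1..t2}) z * err (snd z) (fst z, snd z - s)) \<partial>lborel) \<le> ennreal \<delta>"
  shows "(\<integral>\<^sup>+\<sigma>. indicator {t1..t2} \<sigma> * (\<integral>\<^sup>+z. ennreal (indicator (K \<times> {\<sigma> - h..\<sigma>}) z * err \<sigma> z) \<partial>lborel) \<partial>lborel) \<le> ennreal (h * \<delta>)"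
proof -
  define F where "F x s \<sigma> = ennreal (indicator (K \<times> {t1..t2}) (x, \<sigma>) * (indicator {0..h} s * err \<sigma> (x, \<sigma> - s)))" for x s \<sigma>
  have c: "(\<lambda>w. f (fst w, snd (snd w) - fst (snd w))) \<in> borel_measurable (borel :: ((real^'a) \<times> real \<times> real) measure)"
    "(\<lambda>w. f (fst w, snd (snd w))) \<in> borel_measurable (borel :: ((real^'a) \<times> real \<times> real) measure)"
    if "f \<in> borel_measurable borel" for f :: "(real^'a) \<times> real \<Rightarrow> real"
    by (rule measurable_compose[OF _ that], intro borel_measurable_continuous_onI continuous_intros)+
  have [measurable]: "(\<lambda>w. indicat_real (K \<times> {t1..t2}) (fst w, snd (snd w))) \<in> borel_measurable (borel :: ((real^'a) \<times> real \<times> real) measure)"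
    by (rule c(2)) (use KI_borel in measurable)
  have "(\<lambda>w. fst (snd w)) \<in> borel_measurable (borel :: ((real^'a) \<times> real \<times> real) measure)"
    by (intro borel_measurable_continuous_onI continuous_intros)
  from measurable_compose[OF this, of "indicat_real {0..h}" borel]
  have [measurable]: "(\<lambda>w. indicat_real {0..h} (fst (snd w))) \<in> borel_measurable (borel :: ((real^'a) \<times> real \<times> real) measure)" by simp
  have [measurable]: "(\<lambda>w. err (snd (snd w)) (fst w, snd (snd w) - fst (snd w))) \<in> borel_measurable (borel :: ((real^'a) \<times> real \<times> real) measure)"
    unfolding err_def fst_conv
    by (intro borel_measurable_add borel_measurable_sum borel_measurable_times borel_measurable_abs borel_measurable_diff c borel phi_borel)
  have M: "(\<lambda>w. F (fst w) (fst (snd w)) (snd (snd w))) \<in> borel_measurable borel"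
    unfolding F_def by measurable
  have A: "indicator {t1..t2} \<sigma> * (\<integral>\<^sup>+z. ennreal (indicator (K \<times> {\<sigma> - h..\<sigma>}) z * err \<sigma> z) \<partial>lborel)
    = (\<integral>\<^sup>+z. F (fst z) (snd z) \<sigma> \<partial>lborel)" for \<sigma>
  proof -
    define E where "E z = ennreal (indicator (K \<times> {\<sigma> - h..\<sigma>}) z * err \<sigma> z)" for z
    have [measurable]: "(\<lambda>z. f (fst z, \<sigma>)) \<in> borel_measurable (borel :: ((real^'a) \<times> real) measure)"
      if "f \<in> borel_measurable borel" for f :: "(real^'a) \<times> real \<Rightarrow> real"
      by (rule borel_measurable_fst_comp[OF measurable_section[OF that]])
    have [measurable]: "err \<sigma> \<in> borel_measurable borel" unfolding err_def[abs_def]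
      by (intro borel_measurable_add borel_measurable_sum borel_measurable_times borel_measurable_abs borel_measurable_diff
          borel phi_borel borel_measurable_fst_comp[OF measurable_section])
    have [measurable]: "K \<times> {\<sigma> - h..\<sigma>} \<in> sets borel" by (rule KI_borel)
    have E[measurable]: "E \<in> borel_measurable borel" unfolding E_def by measurable
    have Es: "(\<lambda>t. E (x, t)) \<in> borel_measurable borel" for x
      by (rule measurable_compose[OF _ E]) (intro borel_measurable_continuous_onI continuous_intros)
    have Fm: "(\<lambda>z. F (fst z) (snd z) \<sigma>) \<in> borel_measurable borel"
      using measurable_compose[OF _ M, of "\<lambda>z. (fst z, snd z, \<sigma>)" borel]
      by (simp add: borel_measurable_continuous_onI continuous_intros)
    have "(\<integral>\<^sup>+z. E z \<partial>lborel) = (\<integral>\<^sup>+x. \<integral>\<^sup>+t. E (x, t) \<partial>lborel \<partial>lborel)" by (rule nn_integral_lborel_iterated(1)[OF E])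
    also have "\<dots> = (\<integral>\<^sup>+x. \<integral>\<^sup>+s. E (x, \<sigma> - s) \<partial>lborel \<partial>lborel)"
      using nn_integral_lborel_reflect[OF Es, of _ \<sigma>] by simp
    finally have EE: "(\<integral>\<^sup>+z. E z \<partial>lborel) = (\<integral>\<^sup>+x. \<integral>\<^sup>+s. E (x, \<sigma> - s) \<partial>lborel \<partial>lborel)" .
    have FF: "(\<integral>\<^sup>+z. F (fst z) (snd z) \<sigma> \<partial>lborel) = (\<integral>\<^sup>+x. \<integral>\<^sup>+s. F x s \<sigma> \<partial>lborel \<partial>lborel)"
      using nn_integral_lborel_iterated(1)[OF Fm] by simp
    show ?thesis
    proof (cases "\<sigma> \<in> {t1..t2}")
      case True
      have "E (x, \<sigma> - s) = F x s \<sigma>" for x s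
      proof -
        have "indicat_real (K \<times> {\<sigma> - h..\<sigma>}) (x, \<sigma> - s) = indicator K x * indicator {0..h} s"
          by (auto simp: indicator_def)
        moreover have "indicat_real (K \<times> {t1..t2}) (x, \<sigma>) = indicator K x" using True by (auto simp: indicator_def)
        ultimately show ?thesis unfolding E_def F_def by (simp only: mult.assoc)
      qed
      then show ?thesis using EE FF True unfolding E_def by simp
    next
      case False
      then have "F x s \<sigma> = 0" for x s by (simp add: F_def)
      then show ?thesis using FF False by simp
    qed
  qed
  have "(\<integral>\<^sup>+\<sigma>. indicator {t1..t2} \<sigma> * (\<integral>\<^sup>+z. ennreal (indicator (K \<times> {\<sigma> - h..\<sigma>}) z * err \<sigma> z) \<partial>lborel) \<partial>lborel)
    = (\<integral>\<^sup>+s. \<integral>\<^sup>+z. F (fst z) s (snd z) \<partial>lborel \<partial>lborel)"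
    unfolding A by (rule nn_integral_lborel_triple[OF M])
  also have "\<dots> \<le> (\<integral>\<^sup>+s. ennreal \<delta> * indicator {0..h} s \<partial>lborel)"
  proof (rule nn_integral_mono)
    fix s
    show "(\<integral>\<^sup>+z. F (fst z) s (snd z) \<partial>lborel) \<le> ennreal \<delta> * indicator {0..h} s"
    proof (cases "s \<in> {0..h}")
      case True
      then have "F (fst z) s (snd z) = ennreal (indicator (K \<times> {t1..t2}) z * err (snd z) (fst z, snd z - s))" for z
        by (simp add: F_def)
      then show ?thesis using small[of s] True by simp
    qed (simp add: F_def)
  qed
  also have "\<dots> = ennreal \<delta> * emeasure lborel {0..h}" by (rule nn_integral_cmult_indicator) simp
  also have "\<dots> = ennreal (h * \<delta>)" using h \<delta> by (simp add: ennreal_mult[symmetric] mult.commute)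
  finally show ?thesis .
qed

text \<open>Only the upper bound \<open>Gb\<close> for the integral of G enters. After integration
  over \<sigma> two boundary layers of length h remain: the initial one is nonnegative and is
  dropped, the final one is at most h times \<open>Gb\<close>.\<close>

proposition energy_inequality:
  assumes t: "0 < t1" "t1 \<le> t2" "t2 < T" and Gb0: "0 \<le> Gb"
    and Gb: "AE t in lborel. t \<in> {0<..t2} \<longrightarrow> (LINT x|lborel. indicator K x * G (x, t)) \<le> Gb"
  shows "- Gb \<le> (LINT z|lborel. indicator (K \<times> {t1..t2}) z * ((\<Sum>i\<in>UNIV. \<alpha> i z * D\<phi> i z) - \<beta> z * \<phi> z))"
proof -
  define g where "g t = (LINT x|lborel. indicator K x * G (x, t))" for t
  define J where "J t = (LINT x|lborel. indicator K x * q t (x, t))" for t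
  have g0: "0 \<le> g t" for t unfolding g_def using G_nonneg by (intro Bochner_Integration.integral_nonneg) simp
  have gm[measurable]: "g \<in> borel_measurable borel"
  proof -
    have "(\<lambda>w. indicat_real K (snd w) * G (snd w, fst w)) \<in> borel_measurable (borel :: (real \<times> (real^'a)) measure)"
      by (intro borel_measurable_times measurable_compose[OF _ phi_borel(3)] measurable_compose[OF _ borel_measurable_indicator[OF K_borel]]
          borel_measurable_continuous_onI continuous_intros)
    then have "(\<lambda>(t, x). indicat_real K x * G (x, t)) \<in> borel_measurable (borel \<Otimes>\<^sub>M lborel)"
      by (simp add: case_prod_beta' borel_prod[symmetric] cong: measurable_cong_sets)
    from lborel.borel_measurable_lebesgue_integral[OF this] show ?thesis unfolding g_def[abs_def] by simp
  qed
  have gb: "AE t in lborel. t \<in> {0<..t2} \<longrightarrow> g t \<le> Gb" using Gb by (simp only: g_def)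
  have gi: "integrable lborel (\<lambda>t. indicator {s..r} t * g t)" if "0 < s" "r \<le> t2" for s r
  proof (rule integrable_dominated[where g = "\<lambda>_. Gb"])
    show "integrable lborel (\<lambda>t. indicat_real {s..r} t * Gb)"
      by (intro integrable_mult_left integrable_indicator_compact) simp
    show "AE t in lborel. t \<in> {s..r} \<longrightarrow> \<bar>g t\<bar> \<le> Gb"
      using gb by eventually_elim (use that g0 in auto)
  qed simp_all
  have Qi: "integrable lborel (\<lambda>z. indicator (K \<times> {t1..t2}) z * q (snd z) z)" by (rule Q_integrable[OF t(1,3)])
  have QJ: "(LINT x|lborel. indicator (K \<times> {t1..t2}) (x, \<sigma>) * q (snd (x, \<sigma>)) (x, \<sigma>)) = indicator {t1..t2} \<sigma> * J \<sigma>" for \<sigma>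
    unfolding J_def integral_mult_right_zero[symmetric] by (simp add: indicator_times mult_ac)
  have Ji: "integrable lborel (\<lambda>\<sigma>. indicator {t1..t2} \<sigma> * J \<sigma>)"
    using Fubini_lborel_snd(2)[OF Qi] unfolding QJ .
  have JQ: "(LINT \<sigma>|lborel. indicator {t1..t2} \<sigma> * J \<sigma>) = (LINT z|lborel. indicator (K \<times> {t1..t2}) z * q (snd z) z)"
    using Fubini_lborel_snd(3)[OF Qi] unfolding QJ .
  have Jsec: "AE \<sigma> in lborel. \<sigma> \<in> {t1..t2} \<longrightarrow> integrable lborel (\<lambda>x. indicator K x * q \<sigma> (x, \<sigma>))"
    using Fubini_lborel_snd(1)[OF Qi]
  proof (eventually_elim, intro impI)
    fix \<sigma>
    assume *: "integrable lborel (\<lambda>x. indicator (K \<times> {t1..t2}) (x, \<sigma>) * q (snd (x, \<sigma>)) (x, \<sigma>))" "\<sigma> \<in> {t1..t2}"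
    have "indicat_real (K \<times> {t1..t2}) (x, \<sigma>) = indicator K x" for x using *(2) by (simp add: indicator_times)
    then show "integrable lborel (\<lambda>x. indicator K x * q \<sigma> (x, \<sigma>))" using *(1) by simp
  qed
  have main: "- Gb - \<delta> \<le> (LINT \<sigma>|lborel. indicator {t1..t2} \<sigma> * J \<sigma>)" if \<delta>: "0 < \<delta>" for \<delta>
  proof -
    obtain d where d: "0 < d" "\<forall>s. 0 \<le> s \<longrightarrow> s < d \<longrightarrow>
      (\<integral>\<^sup>+z. ennreal (indicator (K \<times> {t1..t2}) z * err (snd z) (fst z, snd z - s)) \<partial>lborel) \<le> ennreal \<delta>"
      using err_small[OF t(1,3) \<delta>] by blast
    \<comment> \<open>h < d makes the freezing error small, h < t1 keeps \<sigma> - h positive. For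
      each \<delta> one such h is enough, since h cancels in the resulting inequality.\<close>
    define h where "h = min (d / 2) (t1 / 2)"
    have h: "0 < h" "h < d" "h < t1" using d(1) t(1) by (auto simp: h_def)
    \<comment> \<open>The excess of the drop of g over h times the desired integrand at time
      \<sigma>. By \<open>super_step\<close> its positive part is controlled by the freezing
      error.\<close>
    define X where "X \<sigma> = indicator {t1..t2} \<sigma> * (g (\<sigma> - h) - g \<sigma> - h * J \<sigma>)" for \<sigma>
    define f where "f \<tau> = indicator {t1 - h..t2 - h} \<tau> * g \<tau>" for \<tau>
    have fi: "integrable lborel f" unfolding f_def by (rule gi) (use h t in auto)
    have fh: "indicator {t1..t2} \<sigma> * g (\<sigma> - h) = f (\<sigma> - h)" for \<sigma> by (simp add: f_def indicator_def)
    have Xeq: "X \<sigma> = f (\<sigma> - h) - indicator {t1..t2} \<sigma> * g \<sigma> - h * (indicator {t1..t2} \<sigma> * J \<sigma>)" for \<sigma>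
      unfolding X_def fh[symmetric] by (simp add: algebra_simps)
    have fi': "integrable lborel (\<lambda>\<sigma>. f (\<sigma> - h))" by (rule integrable_lborel_shift[OF fi])
    have gi': "integrable lborel (\<lambda>\<sigma>. indicator {t1..t2} \<sigma> * g \<sigma>)" by (rule gi) (use t in auto)
    have Xi: "integrable lborel X" unfolding Xeq[abs_def] using fi' gi' Ji by simp
    have "AE \<sigma> in lborel. ennreal (X \<sigma>) \<le> indicator {t1..t2} \<sigma> * (\<integral>\<^sup>+z. ennreal (indicator (K \<times> {\<sigma> - h..\<sigma>}) z * err \<sigma> z) \<partial>lborel)"
      using super_step[OF h(1,3) t(3)] Jsec dphi_section_integrable[OF t(1,3)]
    proof eventually_elim
      case (elim \<sigma>)
      show ?case
      proof (cases "\<sigma> \<in> {t1..t2}")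
        case True
        then have s: "g (\<sigma> - h) - g \<sigma> \<le> (LINT z|lborel. indicator (K \<times> {\<sigma> - h..\<sigma>}) z * q \<sigma> z)"
          and ji: "integrable lborel (\<lambda>x. indicator K x * q \<sigma> (x, \<sigma>))"
          and Dp: "\<And>i. integrable lborel (\<lambda>x. indicator K x * \<bar>D\<phi> i (x, \<sigma>)\<bar> powr p i)"
          using elim by (auto simp: g_def)
        have c: "0 < \<sigma> - h" "\<sigma> < T" using True h t by auto
        have qi: "integrable lborel (\<lambda>z. indicator (K \<times> {\<sigma> - h..\<sigma>}) z * q \<sigma> z)"
          using q_slab_integrable[OF c Dp] by (simp add: q_def right_diff_distrib)
        have qd: "integrable lborel (\<lambda>z. indicator (K \<times> {\<sigma> - h..\<sigma>}) z * q \<sigma> (fst z, \<sigma>))"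
          by (rule slab_integrable(1)[OF ji])
        have hJ: "h * J \<sigma> = (LINT z|lborel. indicator (K \<times> {\<sigma> - h..\<sigma>}) z * q \<sigma> (fst z, \<sigma>))"
          unfolding J_def using slab_integrable(2)[OF ji, of "\<sigma> - h" \<sigma>] h by simp
        have "X \<sigma> \<le> (LINT z|lborel. indicator (K \<times> {\<sigma> - h..\<sigma>}) z * q \<sigma> z - indicator (K \<times> {\<sigma> - h..\<sigma>}) z * q \<sigma> (fst z, \<sigma>))"
          using s hJ True qi qd by (simp add: X_def)
        then have "ennreal (X \<sigma>) \<le> ennreal (LINT z|lborel. indicator (K \<times> {\<sigma> - h..\<sigma>}) z * q \<sigma> z - indicator (K \<times> {\<sigma> - h..\<sigma>}) z * q \<sigma> (fst z, \<sigma>))"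
          by (rule ennreal_leI)
        also have "\<dots> \<le> (\<integral>\<^sup>+z. ennreal (indicator (K \<times> {\<sigma> - h..\<sigma>}) z * q \<sigma> z - indicator (K \<times> {\<sigma> - h..\<sigma>}) z * q \<sigma> (fst z, \<sigma>)) \<partial>lborel)"
          using qi qd by (intro ennreal_integral_le_nn_integral) simp
        also have "\<dots> \<le> (\<integral>\<^sup>+z. ennreal (indicator (K \<times> {\<sigma> - h..\<sigma>}) z * err \<sigma> z) \<partial>lborel)"
        proof (intro nn_integral_mono ennreal_leI)
          fix z
          show "indicator (K \<times> {\<sigma> - h..\<sigma>}) z * q \<sigma> z - indicator (K \<times> {\<sigma> - h..\<sigma>}) z * q \<sigma> (fst z, \<sigma>)
              \<le> indicator (K \<times> {\<sigma> - h..\<sigma>}) z * err \<sigma> z"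
            using q_diff_le[of \<sigma> z] unfolding right_diff_distrib[symmetric] by (intro mult_left_mono) auto
        qed
        finally show ?thesis using True by simp
      next
        case False
        then show ?thesis by (simp add: X_def)
      qed
    qed
    then have "(\<integral>\<^sup>+\<sigma>. ennreal (X \<sigma>) \<partial>lborel) \<le> (\<integral>\<^sup>+\<sigma>. indicator {t1..t2} \<sigma> * (\<integral>\<^sup>+z. ennreal (indicator (K \<times> {\<sigma> - h..\<sigma>}) z * err \<sigma> z) \<partial>lborel) \<partial>lborel)"
      by (rule nn_integral_mono_AE)
    also have "\<dots> \<le> ennreal (h * \<delta>)"
      by (rule error_tonelli[OF t(1,3) h(1)]) (use d(2) h \<delta> in auto)
    finally have "ennreal (LINT \<sigma>|lborel. X \<sigma>) \<le> ennreal (h * \<delta>)"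
      using ennreal_integral_le_nn_integral[OF Xi] order_trans by blast
    then have XL: "(LINT \<sigma>|lborel. X \<sigma>) \<le> h * \<delta>" using h \<delta> by (simp add: ennreal_le_iff)
    have XE: "(LINT \<sigma>|lborel. X \<sigma>) = (LINT \<sigma>|lborel. f \<sigma>) - (LINT \<sigma>|lborel. indicator {t1..t2} \<sigma> * g \<sigma>)
        - h * (LINT \<sigma>|lborel. indicator {t1..t2} \<sigma> * J \<sigma>)"
      unfolding Xeq using fi fi' gi' Ji integral_lborel_shift[of f h] by simp
    \<comment> \<open>The two integrals overlap except near the ends. Where only the second one
      contributes, the difference is negative; so the layer \<open>{t2 - h..t2}\<close> alone
      counts.\<close>
    have "(LINT \<sigma>|lborel. indicator {t1..t2} \<sigma> * g \<sigma>) - (LINT \<sigma>|lborel. f \<sigma>)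
       = (LINT \<sigma>|lborel. indicator {t1..t2} \<sigma> * g \<sigma> - f \<sigma>)" using gi' fi by simp
    also have "\<dots> \<le> (LINT \<sigma>|lborel. indicat_real {t2 - h..t2} \<sigma> * Gb)"
    proof (rule integral_mono_AE)
      show "integrable lborel (\<lambda>\<sigma>. indicator {t1..t2} \<sigma> * g \<sigma> - f \<sigma>)" using gi' fi by simp
      show "integrable lborel (\<lambda>\<sigma>. indicat_real {t2 - h..t2} \<sigma> * Gb)"
        by (intro integrable_mult_left integrable_indicator_compact) simp
      show "AE \<sigma> in lborel. indicator {t1..t2} \<sigma> * g \<sigma> - f \<sigma> \<le> indicat_real {t2 - h..t2} \<sigma> * Gb"
        using gb
      proof eventually_elim
        case (elim \<sigma>)
        show ?case
        proof (cases "\<sigma> \<in> {t1..t2} \<and> \<not> \<sigma> \<in> {t1 - h..t2 - h}")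
          case True
          then have "\<sigma> \<in> {t2 - h..t2}" "\<sigma> \<in> {0<..t2}" using h t by auto
          then show ?thesis using True elim by (simp add: f_def)
        next
          case False
          then have "indicator {t1..t2} \<sigma> * g \<sigma> - f \<sigma> \<le> 0" using g0[of \<sigma>] by (auto simp: f_def indicator_def)
          also have "0 \<le> indicat_real {t2 - h..t2} \<sigma> * Gb" using Gb0 by simp
          finally show ?thesis .
        qed
      qed
    qed
    also have "\<dots> = h * Gb" using h by simp
    finally have "- (h * Gb) - h * (LINT \<sigma>|lborel. indicator {t1..t2} \<sigma> * J \<sigma>) \<le> h * \<delta>"
      using XL XE by linarith
    then have "h * (- Gb - \<delta>) \<le> h * (LINT \<sigma>|lborel. indicator {t1..t2} \<sigma> * J \<sigma>)" by (simp add: algebra_simps)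
    then show ?thesis using h(1) by simp
  qed
  have "- Gb \<le> (LINT \<sigma>|lborel. indicator {t1..t2} \<sigma> * J \<sigma>)"
  proof (rule field_le_epsilon)
    fix e :: real assume "0 < e"
    from main[OF this] show "- Gb \<le> (LINT \<sigma>|lborel. indicator {t1..t2} \<sigma> * J \<sigma>) + e" by simp
  qed
  then show ?thesis unfolding JQ by (simp add: q_def)
qed

end

section \<open>Pointwise estimates\<close>

text \<open>Young's inequality with y = v / (r \<xi>), multiplied by \<open>\<xi> ^ m / v\<close>.
  The last term then carries the power m - q of \<xi>, which is at most
  \<open>\<xi> ^ (m - 2)\<close> because q < 2 and \<xi> \<le> 1. This is where two powers of the
  cutoff are lost.\<close>

lemma young_weighted:
  fixes \<xi> w v r q \<epsilon> :: real and m :: nat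
  assumes \<xi>: "0 \<le> \<xi>" "\<xi> \<le> 1" and w: "0 \<le> w" and v: "0 < v" and r: "0 < r" and q: "1 < q" "q < 2" and \<epsilon>: "0 < \<epsilon>" and m: "2 \<le> m"
  shows "\<xi> ^ (m - 1) * w powr (q - 1) / r
    \<le> \<epsilon> * (\<xi> ^ m * w powr q / v) + \<epsilon> powr (1 - q) * (\<xi> ^ (m - 2) * v * (v powr (q - 2) / r powr q))"
proof (cases "\<xi> = 0")
  case True
  have "0 < m - 1" using m by simp
  then have "\<xi> ^ (m - 1) * w powr (q - 1) / r = 0" using True by simp
  moreover have "0 \<le> \<epsilon> * (\<xi> ^ m * w powr q / v) + \<epsilon> powr (1 - q) * (\<xi> ^ (m - 2) * v * (v powr (q - 2) / r powr q))"
    using assms by (intro add_nonneg_nonneg mult_nonneg_nonneg divide_nonneg_nonneg zero_le_power) auto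
  ultimately show ?thesis by linarith
next
  case False
  then have \<xi>0: "0 < \<xi>" using \<xi> by simp
  define y where "y = v / (r * \<xi>)"
  have y: "0 \<le> y" using v r \<xi>0 by (simp add: y_def)
  obtain k where k: "m = Suc (Suc k)" using m by (metis add_2_eq_Suc le_Suc_ex)
  have "w powr (q - 1) * y \<le> \<epsilon> * w powr q + \<epsilon> powr (1 - q) * y powr q"
    by (rule young_powr[OF w y \<epsilon> q(1)])
  from mult_left_mono[OF this, of "\<xi> ^ m / v"] v \<xi>0
  have "\<xi> ^ m / v * (w powr (q - 1) * y) \<le> \<xi> ^ m / v * (\<epsilon> * w powr q + \<epsilon> powr (1 - q) * y powr q)" by simp
  moreover have "\<xi> ^ m / v * (w powr (q - 1) * y) = \<xi> ^ (m - 1) * w powr (q - 1) / r"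
    using v r \<xi>0 by (simp add: y_def k)
  moreover have "\<xi> ^ m / v * (\<epsilon> * w powr q + \<epsilon> powr (1 - q) * y powr q)
    = \<epsilon> * (\<xi> ^ m * w powr q / v) + \<epsilon> powr (1 - q) * (\<xi> ^ m * (y powr q / v))"
    by (simp add: algebra_simps add_divide_distrib)
  moreover have "\<xi> ^ m * (y powr q / v) \<le> \<xi> ^ (m - 2) * v * (v powr (q - 2) / r powr q)"
  proof -
    have yq: "y powr q = v powr q / (r powr q * \<xi> powr q)"
      using v r \<xi>0 by (simp add: y_def powr_divide powr_mult)
    have vq: "v powr q / v = v * v powr (q - 2)"
      using v by (simp add: powr_diff powr_numeral power2_eq_square)
    have "y powr q / v = (v powr q / v) / (r powr q * \<xi> powr q)" unfolding yq by simp
    then have "\<xi> ^ m * (y powr q / v) = (\<xi> ^ m / \<xi> powr q) * (v * v powr (q - 2) / r powr q)"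
      unfolding vq by simp
    also have "\<dots> \<le> \<xi> ^ (m - 2) * (v * v powr (q - 2) / r powr q)"
    proof (rule mult_right_mono)
      have "\<xi> powr 2 \<le> \<xi> powr q" using \<xi> \<xi>0 q by (intro powr_mono') auto
      then have "\<xi> ^ 2 \<le> \<xi> powr q" using \<xi>0 by (simp add: powr_numeral)
      then have "\<xi> ^ (m - 2) * \<xi> ^ 2 \<le> \<xi> ^ (m - 2) * \<xi> powr q" using \<xi> by (intro mult_left_mono) auto
      then have "\<xi> ^ m \<le> \<xi> ^ (m - 2) * \<xi> powr q" by (simp add: k power2_eq_square mult_ac)
      then show "\<xi> ^ m / \<xi> powr q \<le> \<xi> ^ (m - 2)" using \<xi>0 by (simp add: pos_divide_le_eq)
    qed (use v in simp)
    finally show ?thesis by (simp add: mult_ac)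
  qed
  ultimately show ?thesis
    using mult_left_mono[of "\<xi> ^ m * (y powr q / v)" "\<xi> ^ (m - 2) * v * (v powr (q - 2) / r powr q)" "\<epsilon> powr (1 - q)"] by simp
qed

text \<open>Since m a \<ge> 2 and \<xi> \<le> 1, the power m - 2 of \<xi> is at most its power m (1
  - a), so the left side is bounded by \<open>\<nu> powr a * X powr (1 - a)\<close> with
  \<open>X = v * \<xi> ^ m\<close>. It remains to interpolate between \<nu> and X; the lost powers
  of the cutoff are thus regained because 1 - a < 1.\<close>

lemma young_absorb:
  fixes v \<nu> \<xi> a \<delta> :: real and m :: nat
  assumes "0 \<le> v" "0 < \<nu>" "0 \<le> \<xi>" "\<xi> \<le> 1" "0 < a" "a < 1" "2 \<le> real m * a" "0 < \<delta>"
  shows "\<nu> powr a * (v powr (1 - a) * \<xi> ^ (m - 2)) \<le> \<delta> * (v * \<xi> ^ m) + \<delta> powr ((a - 1) / a) * \<nu>"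
proof -
  define X where "X = v * \<xi> ^ m"
  have X: "0 \<le> X" using assms by (simp add: X_def)
  have m: "2 \<le> m"
  proof (rule ccontr)
    assume "\<not> 2 \<le> m"
    then have "real m * a \<le> 1 * a" using assms by (intro mult_right_mono) auto
    then show False using assms(6,7) by linarith
  qed
  have "v powr (1 - a) * \<xi> ^ (m - 2) \<le> X powr (1 - a)"
  proof (cases "\<xi> = 0")
    case True
    \<comment> \<open>For m = 2 the power \<open>\<xi> ^ 0 = 1\<close> would not vanish at \<xi> =
      0; that case is excluded by 2 \<le> m a and a < 1.\<close>
    have "0 < m - 2" using assms m by (cases "m = 2") auto
    then have "\<xi> ^ (m - 2) = 0" using True by (simp add: power_0_left)
    then show ?thesis by (simp only: mult_zero_right powr_ge_zero)
  next
    case False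
    then have \<xi>: "0 < \<xi>" using assms by simp
    have "\<xi> ^ (m - 2) = \<xi> powr (real (m - 2))" using \<xi> by (simp add: powr_realpow)
    also have "\<dots> \<le> \<xi> powr (real m * (1 - a))"
      using assms \<xi> m by (intro powr_mono') (auto simp: algebra_simps of_nat_diff)
    also have "\<dots> = (\<xi> ^ m) powr (1 - a)" using \<xi> by (simp add: powr_powr[symmetric] powr_realpow)
    finally have "v powr (1 - a) * \<xi> ^ (m - 2) \<le> v powr (1 - a) * (\<xi> ^ m) powr (1 - a)"
      by (intro mult_left_mono) auto
    also have "\<dots> = X powr (1 - a)" unfolding X_def using assms by (simp add: powr_mult)
    finally show ?thesis .
  qed
  then have "\<nu> powr a * (v powr (1 - a) * \<xi> ^ (m - 2)) \<le> \<nu> powr a * X powr (1 - a)"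
    by (intro mult_left_mono) auto
  also have "\<dots> \<le> \<delta> * X + \<delta> powr ((a - 1) / a) * \<nu>"
  proof -
    \<comment> \<open>The threshold between \<nu> and X is chosen so that the first case yields
      exactly \<delta> X.\<close>
    define \<kappa> where "\<kappa> = \<delta> powr (1 / a)"
    have \<kappa>: "0 < \<kappa>" "\<kappa> powr a = \<delta>" "\<kappa> powr (a - 1) = \<delta> powr ((a - 1) / a)"
      using assms by (auto simp: \<kappa>_def powr_powr)
    show ?thesis
    proof (cases "\<nu> \<le> \<kappa> * X")
      case True
      then have Xp: "0 < X" using assms X \<kappa> by (cases "X = 0") auto
      have "\<nu> powr a * X powr (1 - a) \<le> (\<kappa> * X) powr a * X powr (1 - a)"
        using True assms by (intro mult_right_mono powr_mono2) auto
      also have "\<dots> = \<delta> * X" using Xp \<kappa> by (simp add: powr_mult powr_diff)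
      finally show ?thesis using assms by (simp add: add_increasing2)
    next
      case False
      then have "X \<le> \<nu> / \<kappa>" using \<kappa> by (simp add: field_simps)
      then have "\<nu> powr a * X powr (1 - a) \<le> \<nu> powr a * (\<nu> / \<kappa>) powr (1 - a)"
        using assms X by (intro mult_left_mono powr_mono2) auto
      also have "\<dots> = \<kappa> powr (a - 1) * \<nu>"
        using assms \<kappa>(1) by (simp add: powr_divide powr_diff field_simps)
      finally show ?thesis using assms X \<kappa>(3) by (simp add: add_increasing)
    qed
  qed
  finally show ?thesis by (simp add: X_def)
qed

lemma W11_o_test_function:
  fixes \<zeta> :: "real^'n::finite \<Rightarrow> real"
  assumes K: "compact K" and \<zeta>: "\<zeta> \<in> test_functions (interior K)"
  shows "W11_o K \<zeta> (\<lambda>x. \<chi> i. partial i \<zeta> x)"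
proof -
  have Kb: "K \<in> sets borel" using K by (simp add: borel_compact)
  have int: "f absolutely_integrable_on K" if "f \<in> test_functions (interior K)" for f
  proof -
    note cs = test_functions_compactly_supported[OF that]
    have "integrable lborel (\<lambda>x. f x * indicat_real K x)"
      using Kb by (intro integrable_mult_bounded[OF compactly_supported_integrable[OF cs], where B = 1]) auto
    then show ?thesis
      using set_integrable_lebesgue_iff[OF Kb compactly_supported_borel[OF cs]] by (simp add: mult.commute)
  qed
  have "(\<lambda>x. \<chi> i. partial i \<zeta> x) absolutely_integrable_on K"
    by (intro absolutely_integrable_vec_lambda int test_functions_partial \<zeta>)
  moreover have "\<exists>\<psi>. (\<forall>n::nat. \<psi> n \<in> test_functions (interior K)) \<and>
        (\<lambda>n. LINT x:K|lebesgue. \<bar>\<zeta> x - \<psi> n x\<bar>) \<longlonglongrightarrow> 0 \<and>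
        (\<forall>i. (\<lambda>n. LINT x:K|lebesgue. \<bar>(\<chi> i. partial i \<zeta> x) $ i - partial i (\<psi> n) x\<bar>) \<longlonglongrightarrow> 0)"
    using \<zeta> by (intro exI[of _ "\<lambda>_. \<zeta>"]) (simp add: set_lebesgue_integral_def)
  ultimately show ?thesis unfolding W11_o_def using int[OF \<zeta>] by blast
qed

text \<open>Only the inequalities between the parameters are retained: \<open>r i\<close> stands for
  the half-edge \<rho>^(p/p_i), \<theta> for the length of the time interval, \<xi> for the cutoff
  with \<zeta> as its m-th power. \<open>nu_theta\<close> is the intrinsic scaling of \<nu>,
  \<open>Cr\<close> expresses that the first alternative fails, and \<open>ap\<close> and
  \<open>ma\<close> are the requirements on a and m.\<close>

locale mass_setting = borel_weak_solution_test +
  fixes \<xi> :: "real^'a \<Rightarrow> real" and m :: nat and r :: "'a \<Rightarrow> real" and \<theta> c :: real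
  assumes xi_borel[measurable]: "\<xi> \<in> borel_measurable borel" and xi: "\<And>x. 0 \<le> \<xi> x" "\<And>x. \<xi> x \<le> 1"
    and zeta_xi: "\<And>x. \<zeta> x = \<xi> x ^ m" and c: "0 < c" and r: "\<And>i. 0 < r i"
    and dzeta: "\<And>i x. \<bar>partial i \<zeta> x\<bar> \<le> c * \<xi> x ^ (m - 1) / r i"
    and ap: "\<And>i. a * p i \<le> 2 - p i" and ma: "2 \<le> real m * a"
    and \<theta>: "0 < \<theta>" "\<theta> \<le> T" and nu_theta: "\<And>i. \<theta> * \<nu> powr (p i - 2) \<le> r i powr p i"
    and Cr: "\<And>i. C * r i \<le> 1" "\<And>i. C * r i \<le> \<nu>"
begin

definition v :: "(real^'a) \<times> real \<Rightarrow> real" where "v z = U z + \<nu>"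

text \<open>The common majorant of all error terms. Its power of the cutoff is m - 2, as left over
  by \<open>young_weighted\<close>, and \<open>young_absorb\<close> is designed for it.\<close>

definition H :: "(real^'a) \<times> real \<Rightarrow> real" where "H z = v z powr (1 - a) * \<xi> (fst z) ^ (m - 2)"

definition en :: "(real^'a) \<times> real \<Rightarrow> real" where
  "en z = (\<Sum>i\<in>UNIV. v z powr (- a - 1) * \<bar>W i z\<bar> powr p i * \<zeta> (fst z))"

text \<open>The part \<open>c * (C1 + 1)\<close> comes from the flux against the derivative of
  \<zeta>, the 1 from the right-hand side \<beta>; both are multiples of \<open>fl\<close>.\<close>

definition c' :: real where "c' = c * (C1 + 1) + 1"

text \<open>Chosen so that \<open>c' * \<epsilon>\<close> is half of the coercivity constant
  \<open>a * Co\<close>, which leaves the other half after absorption.\<close>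

definition \<epsilon> :: real where "\<epsilon> = a * Co / (2 * c')"

text \<open>The sum of all coefficients of \<open>H z / \<theta>\<close> in the energy estimate; it
  is composed of data only.\<close>

definition \<Gamma> :: real where "\<Gamma> = (\<Sum>i\<in>UNIV. a + c' * \<epsilon> powr (1 - p i) + c')"

lemma m2: "2 \<le> m"
proof (rule ccontr)
  assume "\<not> 2 \<le> m"
  then have "real m * a \<le> 1 * a" using a by (intro mult_right_mono) auto
  then show False using a ma by linarith
qed

lemma v_pos: "0 < v z" "\<nu> \<le> v z" using U_nonneg[of z] \<nu> by (auto simp: v_def)

lemma c'_pos: "0 < c'" "1 \<le> c'" "c * C1 \<le> c'" "c + 1 \<le> c'"
proof -
  have "0 < c * C1" using c C by simp
  then show "0 < c'" "1 \<le> c'" "c * C1 \<le> c'" "c + 1 \<le> c'" unfolding c'_def using c by (auto simp: distrib_left)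
qed

lemma eps_pos: "0 < \<epsilon>" unfolding \<epsilon>_def using a C c'_pos by simp

lemma Gamma_nonneg: "0 \<le> \<Gamma>" unfolding \<Gamma>_def using a c'_pos by (intro sum_nonneg add_nonneg_nonneg) auto

lemma R_pos: "0 < r i powr p i" using r[of i] by simp

lemma nu_R: "\<nu> powr (p i - 2) / r i powr p i \<le> 1 / \<theta>"
  using nu_theta[of i] R_pos[of i] \<theta> by (simp add: field_simps)

lemma v_R: "v z powr (p i - 2) / r i powr p i \<le> 1 / \<theta>"
proof -
  have "v z powr (p i - 2) \<le> \<nu> powr (p i - 2)" using v_pos[of z] \<nu> p(2)[of i] by (intro powr_mono2') auto
  then have "v z powr (p i - 2) / r i powr p i \<le> \<nu> powr (p i - 2) / r i powr p i" by (intro divide_right_mono) auto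
  then show ?thesis using nu_R[of i] by simp
qed

text \<open>Extracting \<open>r i powr p i\<close> turns C into \<open>C * r i\<close>, which is at
  most \<nu>; the scaling \<open>nu_R\<close> then exchanges \<open>r i powr p i\<close> for
  \<theta>.\<close>

lemma C_term: "C powr (p i - 1) / r i \<le> \<nu> / \<theta>" "C powr p i \<le> \<nu>\<^sup>2 / \<theta>"
proof -
  have Cr0: "0 \<le> C * r i" using C r[of i] by simp
  have "C powr (p i - 1) / r i = (C * r i) powr (p i - 1) / r i powr p i"
    using C r[of i] by (simp add: powr_mult powr_diff)
  also have "\<dots> \<le> \<nu> powr (p i - 1) / r i powr p i"
    using Cr(2)[of i] Cr0 p(1)[of i] by (intro divide_right_mono powr_mono2) auto
  also have "\<dots> = \<nu> * (\<nu> powr (p i - 2) / r i powr p i)"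
    using \<nu> by (simp add: powr_diff powr_numeral power2_eq_square)
  also have "\<dots> \<le> \<nu> * (1 / \<theta>)" using nu_R[of i] \<nu> by (intro mult_left_mono) auto
  finally show "C powr (p i - 1) / r i \<le> \<nu> / \<theta>" by simp
  have "C powr p i = (C * r i) powr p i / r i powr p i"
    using C r[of i] by (simp add: powr_mult)
  also have "\<dots> \<le> \<nu> powr p i / r i powr p i"
    using Cr(2)[of i] Cr0 p(1)[of i] by (intro divide_right_mono powr_mono2) auto
  also have "\<dots> = \<nu>\<^sup>2 * (\<nu> powr (p i - 2) / r i powr p i)"
    using \<nu> by (simp add: powr_diff powr_numeral)
  also have "\<dots> \<le> \<nu>\<^sup>2 * (1 / \<theta>)" using nu_R[of i] by (intro mult_left_mono) auto
  finally show "C powr p i \<le> \<nu>\<^sup>2 / \<theta>" by simp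
qed

text \<open>The lower order terms carry the factor \<open>C\<close>, which is at most \<open>1 / r i\<close>; hence they are treated
  like the terms in which the cutoff function is differentiated.\<close>

definition fl :: "'a \<Rightarrow> (real^'a) \<times> real \<Rightarrow> real" where
  "fl i z = \<xi> (fst z) ^ (m - 1) * (\<bar>W i z\<bar> powr (p i - 1) + C powr (p i - 1)) / r i"

text \<open>The weight \<epsilon>' is left open because it is used in two ways: as the constant
  \<epsilon> in the energy estimate, and as a function of the point in the estimate of the
  flux.\<close>

lemma fl_le_energy:
  assumes "0 < \<epsilon>'"
  shows "fl i z \<le> \<epsilon>' * (\<zeta> (fst z) * \<bar>W i z\<bar> powr p i / v z)
    + \<epsilon>' powr (1 - p i) * (\<xi> (fst z) ^ (m - 2) * v z * (v z powr (p i - 2) / r i powr p i))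
    + \<xi> (fst z) ^ (m - 2) * (\<nu> / \<theta>)"
proof -
  have "\<xi> (fst z) ^ (m - 1) * C powr (p i - 1) / r i \<le> \<xi> (fst z) ^ (m - 2) * (\<nu> / \<theta>)"
  proof -
    have "\<xi> (fst z) ^ (m - 1) \<le> \<xi> (fst z) ^ (m - 2)"
      using xi by (intro power_decreasing) auto
    then have "\<xi> (fst z) ^ (m - 1) * (C powr (p i - 1) / r i) \<le> \<xi> (fst z) ^ (m - 2) * (\<nu> / \<theta>)"
      using C_term(1)[of i] xi r[of i] by (intro mult_mono) auto
    then show ?thesis by simp
  qed
  moreover have "\<xi> (fst z) ^ (m - 1) * \<bar>W i z\<bar> powr (p i - 1) / r i \<le> \<epsilon>' * (\<xi> (fst z) ^ m * \<bar>W i z\<bar> powr p i / v z)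
    + \<epsilon>' powr (1 - p i) * (\<xi> (fst z) ^ (m - 2) * v z * (v z powr (p i - 2) / r i powr p i))"
    by (rule young_weighted[OF xi abs_ge_zero v_pos(1) r p assms m2])
  ultimately show ?thesis unfolding fl_def zeta_xi by (simp add: distrib_left add_divide_distrib)
qed

lemma pointwise_energy_term:
  "v z powr (- a) * (c' * fl i z) + a * v z powr (- a - 1) * \<zeta> (fst z) * C powr p i
    \<le> a * Co / 2 * (v z powr (- a - 1) * \<bar>W i z\<bar> powr p i * \<zeta> (fst z))
      + (a + c' * \<epsilon> powr (1 - p i) + c') * (H z / \<theta>)"
proof -
  let ?x = "\<xi> (fst z)" and ?v = "v z" and ?w = "\<bar>W i z\<bar>"
  note vp = v_pos[of z]
  have va: "?v powr (- a) / ?v = ?v powr (- a - 1)" "?v powr (- a) * ?v = ?v powr (1 - a)"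
    "?v powr (- a - 1) * ?v\<^sup>2 = ?v powr (1 - a)"
    using vp by (simp_all add: powr_diff powr_minus field_simps power2_eq_square)
  have "fl i z \<le> \<epsilon> * (\<zeta> (fst z) * ?w powr p i / ?v) + \<epsilon> powr (1 - p i) * (?x ^ (m - 2) * ?v * (?v powr (p i - 2) / r i powr p i))
      + ?x ^ (m - 2) * (\<nu> / \<theta>)" by (rule fl_le_energy[OF eps_pos])
  also have "\<dots> \<le> \<epsilon> * (\<zeta> (fst z) * ?w powr p i / ?v) + \<epsilon> powr (1 - p i) * (?x ^ (m - 2) * ?v * (1 / \<theta>))
      + ?x ^ (m - 2) * (?v / \<theta>)"
    using v_R[of z i] vp xi \<theta> \<zeta>(2)[of "fst z"] eps_pos by (intro add_mono mult_left_mono divide_right_mono order_refl) auto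
  also have "\<dots> = \<epsilon> * (\<zeta> (fst z) * ?w powr p i / ?v) + (\<epsilon> powr (1 - p i) + 1) * (?x ^ (m - 2) * ?v / \<theta>)"
    by (simp add: algebra_simps add_divide_distrib)
  finally have "v z powr (- a) * (c' * fl i z)
    \<le> v z powr (- a) * (c' * (\<epsilon> * (\<zeta> (fst z) * ?w powr p i / ?v) + (\<epsilon> powr (1 - p i) + 1) * (?x ^ (m - 2) * ?v / \<theta>)))"
    using c'_pos by (intro mult_left_mono) auto
  also have "\<dots> = (c' * \<epsilon>) * ((?v powr (- a) / ?v) * ?w powr p i * \<zeta> (fst z))
     + (c' * \<epsilon> powr (1 - p i) + c') * ((?v powr (- a) * ?v) * ?x ^ (m - 2) / \<theta>)"
    by (simp add: algebra_simps)
  also have "c' * \<epsilon> = a * Co / 2" unfolding \<epsilon>_def using c'_pos by simp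
  finally have 1: "v z powr (- a) * (c' * fl i z) \<le> a * Co / 2 * (?v powr (- a - 1) * ?w powr p i * \<zeta> (fst z))
     + (c' * \<epsilon> powr (1 - p i) + c') * (H z / \<theta>)"
    unfolding va H_def .
  have "C powr p i \<le> ?v\<^sup>2 / \<theta>"
  proof -
    have "\<nu>\<^sup>2 / \<theta> \<le> ?v\<^sup>2 / \<theta>" using vp \<nu> \<theta> by (intro divide_right_mono power_mono) auto
    then show ?thesis using C_term(2)[of i] by simp
  qed
  moreover have "\<zeta> (fst z) \<le> ?x ^ (m - 2)" unfolding zeta_xi using xi by (intro power_decreasing) auto
  ultimately have "\<zeta> (fst z) * C powr p i \<le> ?x ^ (m - 2) * (?v\<^sup>2 / \<theta>)"
    using xi by (intro mult_mono) auto
  then have "(a * ?v powr (- a - 1)) * (\<zeta> (fst z) * C powr p i) \<le> (a * ?v powr (- a - 1)) * (?x ^ (m - 2) * (?v\<^sup>2 / \<theta>))"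
    using a by (intro mult_left_mono) auto
  also have "\<dots> = a * ((?v powr (- a - 1) * ?v\<^sup>2) * ?x ^ (m - 2) / \<theta>)" by simp
  finally have 2: "a * ?v powr (- a - 1) * \<zeta> (fst z) * C powr p i \<le> a * (H z / \<theta>)"
    unfolding va H_def by (simp add: mult.assoc)
  have "(a + c' * \<epsilon> powr (1 - p i) + c') * (H z / \<theta>) = (c' * \<epsilon> powr (1 - p i) + c') * (H z / \<theta>) + a * (H z / \<theta>)"
    by (simp only: distrib_right)
  then show ?thesis using 1 2 by linarith
qed

text \<open>The weight in Young's inequality is the power a of \<nu> / v at the given point. It
  converts the factor 1 / v into \<open>\<nu> powr a * v powr (- a - 1)\<close>, which is the weight
  of the energy density; the price is a power of v / \<nu> in the remaining term, which is harmless
  by \<open>ap\<close>.\<close>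

lemma pointwise_flux:
  "fl i z \<le> \<nu> powr a * (v z powr (- a - 1) * \<bar>W i z\<bar> powr p i * \<zeta> (fst z)) + 2 * (\<nu> powr a * H z / \<theta>)"
proof -
  let ?x = "\<xi> (fst z)" and ?v = "v z" and ?w = "\<bar>W i z\<bar>" and ?e = "(\<nu> / v z) powr a"
  note vp = v_pos[of z]
  have e: "0 < ?e" using vp \<nu> by simp
  have e1: "?e * (\<zeta> (fst z) * ?w powr p i / ?v) = \<nu> powr a * (?v powr (- a - 1) * ?w powr p i * \<zeta> (fst z))"
    using vp \<nu> by (simp add: powr_divide powr_diff powr_minus field_simps)
  have e2: "?e powr (1 - p i) * (?v * (?v powr (p i - 2) / r i powr p i)) \<le> \<nu> powr a * ?v powr (1 - a) / \<theta>"
  proof -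
    define s where "s = ?v / \<nu>"
    have s: "1 \<le> s" using vp \<nu> by (simp add: s_def)
    have vs: "?v = s * \<nu>" using \<nu> by (simp add: s_def)
    have "\<nu> / ?v = s powr (- 1)" using vp \<nu> by (simp add: s_def powr_minus)
    then have "?e powr (1 - p i) = s powr (- 1 * a * (1 - p i))" by (simp only: powr_powr)
    then have "?e powr (1 - p i) = s powr (a * (p i - 1))" by (simp add: algebra_simps)
    moreover have "?v powr (p i - 2) = s powr (p i - 2) * \<nu> powr (p i - 2)"
      unfolding vs using s \<nu> by (simp add: powr_mult)
    ultimately have "?e powr (1 - p i) * (?v * (?v powr (p i - 2) / r i powr p i))
      = ?v * (s powr (a * (p i - 1)) * s powr (p i - 2)) * (\<nu> powr (p i - 2) / r i powr p i)" by simp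
    also have "s powr (a * (p i - 1)) * s powr (p i - 2) = s powr (a * (p i - 1) + (p i - 2))" by (simp add: powr_add)
    also have "?v * s powr (a * (p i - 1) + (p i - 2)) * (\<nu> powr (p i - 2) / r i powr p i)
      \<le> ?v * s powr (- a) * (1 / \<theta>)"
    proof (intro mult_mono mult_nonneg_nonneg)
      \<comment> \<open>As s \<ge> 1, this compares exponents: a (p_i - 1) + p_i - 2 \<le> - a is
        the same as a p_i \<le> 2 - p_i. The choice of a is made for this line.\<close>
      show "s powr (a * (p i - 1) + (p i - 2)) \<le> s powr (- a)"
        using s ap[of i] by (intro powr_mono) (auto simp: algebra_simps)
    qed (use nu_R[of i] vp R_pos[of i] \<theta> in auto)
    also have "?v * s powr (- a) = \<nu> powr a * ?v powr (1 - a)"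
      using vp \<nu> by (simp add: s_def powr_divide powr_minus powr_diff field_simps)
    finally show ?thesis by simp
  qed
  have "\<nu> \<le> \<nu> powr a * ?v powr (1 - a)"
  proof -
    have "\<nu> = \<nu> powr a * \<nu> powr (1 - a)" using \<nu> by (simp add: powr_diff)
    also have "\<dots> \<le> \<nu> powr a * ?v powr (1 - a)" using vp \<nu> a by (intro mult_left_mono powr_mono2) auto
    finally show ?thesis .
  qed
  then have e3: "\<nu> / \<theta> \<le> \<nu> powr a * ?v powr (1 - a) / \<theta>" using \<theta> by (intro divide_right_mono) auto
  have "fl i z \<le> ?e * (\<zeta> (fst z) * ?w powr p i / ?v) + ?x ^ (m - 2) * (?e powr (1 - p i) * (?v * (?v powr (p i - 2) / r i powr p i)))
     + ?x ^ (m - 2) * (\<nu> / \<theta>)"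
    using fl_le_energy[OF e, of i z] by (simp add: mult_ac)
  also have "\<dots> \<le> \<nu> powr a * (?v powr (- a - 1) * ?w powr p i * \<zeta> (fst z)) + ?x ^ (m - 2) * (\<nu> powr a * ?v powr (1 - a) / \<theta>)
     + ?x ^ (m - 2) * (\<nu> powr a * ?v powr (1 - a) / \<theta>)"
    unfolding e1 using e2 e3 xi by (intro add_mono mult_left_mono order_refl) auto
  also have "\<dots> = \<nu> powr a * (?v powr (- a - 1) * ?w powr p i * \<zeta> (fst z)) + 2 * (\<nu> powr a * H z / \<theta>)"
    by (simp add: H_def mult_ac)
  finally show ?thesis .
qed

definition str :: "(real^'a) \<times> real \<Rightarrow> bool" where
  "str z \<longleftrightarrow> (\<forall>i. Co * \<bar>W i z\<bar> powr p i - C powr p i \<le> \<alpha> i z * W i z \<and>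
        \<bar>\<alpha> i z\<bar> \<le> C1 * \<bar>W i z\<bar> powr (p i - 1) + C powr (p i - 1)) \<and>
      \<bar>\<beta> z\<bar> \<le> (\<Sum>i\<in>UNIV. C * (\<bar>W i z\<bar> powr (p i - 1) + C powr (p i - 1)))"

lemma flux_bounds:
  assumes "str z"
  shows "\<bar>\<alpha> i z * partial i \<zeta> (fst z)\<bar> \<le> c * (C1 + 1) * fl i z" "\<bar>\<beta> z\<bar> * \<zeta> (fst z) \<le> (\<Sum>i\<in>UNIV. fl i z)"
proof -
  let ?w = "\<lambda>i. \<bar>W i z\<bar> powr (p i - 1)" and ?C = "\<lambda>i. C powr (p i - 1)"
  have "\<bar>\<alpha> i z\<bar> \<le> C1 * ?w i + ?C i" using assms unfolding str_def by blast
  also have "\<dots> \<le> (C1 + 1) * (?w i + ?C i)" using C by (simp add: algebra_simps)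
  finally have "\<bar>\<alpha> i z\<bar> \<le> (C1 + 1) * (?w i + ?C i)" .
  then have "\<bar>\<alpha> i z\<bar> * \<bar>partial i \<zeta> (fst z)\<bar> \<le> ((C1 + 1) * (?w i + ?C i)) * (c * \<xi> (fst z) ^ (m - 1) / r i)"
    using dzeta[of i "fst z"] C by (intro mult_mono) auto
  then show "\<bar>\<alpha> i z * partial i \<zeta> (fst z)\<bar> \<le> c * (C1 + 1) * fl i z"
    by (simp add: abs_mult fl_def mult_ac)
  have "\<bar>\<beta> z\<bar> \<le> (\<Sum>i\<in>UNIV. C * (?w i + ?C i))" using assms unfolding str_def by blast
  then have "\<bar>\<beta> z\<bar> * \<zeta> (fst z) \<le> (\<Sum>i\<in>UNIV. C * (?w i + ?C i)) * \<zeta> (fst z)"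
    using \<zeta>(2) by (intro mult_right_mono) auto
  also have "\<dots> \<le> (\<Sum>i\<in>UNIV. fl i z)"
    unfolding sum_distrib_right
  proof (rule sum_mono)
    fix i
    have "C \<le> 1 / r i" using Cr(1)[of i] r[of i] by (simp add: field_simps)
    moreover have "\<zeta> (fst z) \<le> \<xi> (fst z) ^ (m - 1)" unfolding zeta_xi using xi by (intro power_decreasing) auto
    ultimately have "C * \<zeta> (fst z) \<le> (1 / r i) * \<xi> (fst z) ^ (m - 1)"
      using C \<zeta>(2) r[of i] by (intro mult_mono) auto
    then have "(C * \<zeta> (fst z)) * (?w i + ?C i) \<le> ((1 / r i) * \<xi> (fst z) ^ (m - 1)) * (?w i + ?C i)"
      by (intro mult_right_mono) auto
    then show "C * (?w i + ?C i) * \<zeta> (fst z) \<le> fl i z" by (simp add: fl_def mult_ac)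
  qed
  finally show "\<bar>\<beta> z\<bar> * \<zeta> (fst z) \<le> (\<Sum>i\<in>UNIV. fl i z)" .
qed

text \<open>The negative power in the test function gives the coercive term the good sign. Half of
  it pays for the flux against the derivative of \<zeta> and for \<beta>, and the other half is the
  energy that is kept.\<close>

lemma pointwise_energy:
  assumes "str z"
  shows "(\<Sum>i\<in>UNIV. \<alpha> i z * D\<phi> i z) - \<beta> z * \<phi> z \<le> - (a * Co / 2) * en z + \<Gamma> * (H z / \<theta>)"
proof -
  let ?v = "v z" and ?Z = "\<zeta> (fst z)"
  have va: "0 \<le> ?v powr (- a)" "0 \<le> a * ?v powr (- a - 1) * ?Z" using a \<zeta>(2) by auto
  have trm: "\<alpha> i z * D\<phi> i z \<le> - a * Co * (?v powr (- a - 1) * \<bar>W i z\<bar> powr p i * ?Z)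
      + a * ?v powr (- a - 1) * ?Z * C powr p i + ?v powr (- a) * (c * (C1 + 1) * fl i z)" for i
  proof -
    have "\<alpha> i z * D\<phi> i z = - (a * ?v powr (- a - 1) * ?Z * (\<alpha> i z * W i z)) + ?v powr (- a) * (\<alpha> i z * partial i \<zeta> (fst z))"
      unfolding dphi_def v_def by (simp add: algebra_simps)
    also have "\<dots> \<le> - (a * ?v powr (- a - 1) * ?Z * (Co * \<bar>W i z\<bar> powr p i - C powr p i)) + ?v powr (- a) * (c * (C1 + 1) * fl i z)"
    proof (intro add_mono le_imp_neg_le mult_left_mono va)
      show "Co * \<bar>W i z\<bar> powr p i - C powr p i \<le> \<alpha> i z * W i z" using assms unfolding str_def by blast
      show "\<alpha> i z * partial i \<zeta> (fst z) \<le> c * (C1 + 1) * fl i z" using flux_bounds(1)[OF assms, of i] by linarith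
    qed
    finally show ?thesis by (simp add: algebra_simps)
  qed
  have "- (\<beta> z * \<phi> z) \<le> ?v powr (- a) * (\<bar>\<beta> z\<bar> * ?Z)"
  proof -
    have "- (\<beta> z * \<phi> z) = ?v powr (- a) * ((- \<beta> z) * ?Z)" unfolding phi_def v_def by simp
    also have "\<dots> \<le> ?v powr (- a) * (\<bar>\<beta> z\<bar> * ?Z)" using va \<zeta>(2) by (intro mult_left_mono mult_right_mono) auto
    finally show ?thesis .
  qed
  also have "\<dots> \<le> ?v powr (- a) * (\<Sum>i\<in>UNIV. fl i z)" using va flux_bounds(2)[OF assms] by (intro mult_left_mono)
  also have "\<dots> = (\<Sum>i\<in>UNIV. ?v powr (- a) * fl i z)" by (rule sum_distrib_left)
  finally have "(\<Sum>i\<in>UNIV. \<alpha> i z * D\<phi> i z) - \<beta> z * \<phi> z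
    \<le> (\<Sum>i\<in>UNIV. - a * Co * (?v powr (- a - 1) * \<bar>W i z\<bar> powr p i * ?Z)
      + a * ?v powr (- a - 1) * ?Z * C powr p i + ?v powr (- a) * (c * (C1 + 1) * fl i z)) + (\<Sum>i\<in>UNIV. ?v powr (- a) * fl i z)"
    using sum_mono[of UNIV "\<lambda>i. \<alpha> i z * D\<phi> i z", OF trm] by linarith
  also have "\<dots> = (\<Sum>i\<in>UNIV. - a * Co * (?v powr (- a - 1) * \<bar>W i z\<bar> powr p i * ?Z)
      + (?v powr (- a) * (c' * fl i z) + a * ?v powr (- a - 1) * ?Z * C powr p i))"
    unfolding sum.distrib[symmetric] c'_def by (intro sum.cong refl) (simp add: algebra_simps)
  also have "\<dots> \<le> (\<Sum>i\<in>UNIV. - a * Co * (?v powr (- a - 1) * \<bar>W i z\<bar> powr p i * ?Z)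
      + (a * Co / 2 * (?v powr (- a - 1) * \<bar>W i z\<bar> powr p i * ?Z) + (a + c' * \<epsilon> powr (1 - p i) + c') * (H z / \<theta>)))"
    by (intro sum_mono add_mono order_refl pointwise_energy_term)
  also have "\<dots> = (\<Sum>i\<in>UNIV. - (a * Co / 2) * (?v powr (- a - 1) * \<bar>W i z\<bar> powr p i * ?Z) + (a + c' * \<epsilon> powr (1 - p i) + c') * (H z / \<theta>))"
    by (intro sum.cong refl) (simp add: field_simps)
  also have "\<dots> = - (a * Co / 2) * en z + \<Gamma> * (H z / \<theta>)"
    unfolding en_def \<Gamma>_def by (subst sum.distrib) (simp only: sum_distrib_left sum_distrib_right)
  finally show ?thesis .
qed

lemma pointwise_mass:
  assumes "str z"
  shows "\<bar>(\<Sum>i\<in>UNIV. \<alpha> i z * partial i \<zeta> (fst z)) - \<beta> z * \<zeta> (fst z)\<bar>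
    \<le> c' * (\<nu> powr a * en z + 2 * real CARD('a) * (\<nu> powr a * H z / \<theta>))"
proof -
  have "\<bar>(\<Sum>i\<in>UNIV. \<alpha> i z * partial i \<zeta> (fst z)) - \<beta> z * \<zeta> (fst z)\<bar>
    \<le> (\<Sum>i\<in>UNIV. \<bar>\<alpha> i z * partial i \<zeta> (fst z)\<bar>) + \<bar>\<beta> z\<bar> * \<zeta> (fst z)"
    using sum_abs[of "\<lambda>i. \<alpha> i z * partial i \<zeta> (fst z)" UNIV] \<zeta>(2)[of "fst z"]
      abs_triangle_ineq4[of "\<Sum>i\<in>UNIV. \<alpha> i z * partial i \<zeta> (fst z)" "\<beta> z * \<zeta> (fst z)"]
    by (simp add: abs_mult)
  also have "\<dots> \<le> (\<Sum>i\<in>UNIV. c * (C1 + 1) * fl i z) + (\<Sum>i\<in>UNIV. fl i z)"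
    by (intro add_mono sum_mono flux_bounds assms)
  also have "\<dots> = (\<Sum>i\<in>UNIV. c' * fl i z)"
    unfolding sum.distrib[symmetric] c'_def by (intro sum.cong refl) (simp add: algebra_simps)
  also have "\<dots> \<le> (\<Sum>i\<in>UNIV. c' * (\<nu> powr a * (v z powr (- a - 1) * \<bar>W i z\<bar> powr p i * \<zeta> (fst z)) + 2 * (\<nu> powr a * H z / \<theta>)))"
    using c'_pos by (intro sum_mono mult_left_mono pointwise_flux) auto
  also have "\<dots> = c' * (\<nu> powr a * en z + 2 * real CARD('a) * (\<nu> powr a * H z / \<theta>))"
    by (simp add: en_def sum.distrib sum_distrib_left distrib_left mult_ac)
  finally show ?thesis .
qed

lemma str_AE: "AE z in lborel. z \<in> K \<times> {0<..<T} \<longrightarrow> str z"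
  using struct unfolding str_def .

end

section \<open>Comparison of the masses at two times\<close>

lemma AE_imp_exists_between:
  fixes s t :: real
  assumes "AE x in lborel. P x" "s < t"
  shows "\<exists>x. s < x \<and> x < t \<and> P x"
proof (rule ccontr)
  assume "\<not> (\<exists>x. s < x \<and> x < t \<and> P x)"
  then have "AE x in lborel. x \<notin> {s<..<t}" using assms(1) by (auto elim: eventually_mono)
  then have "{s<..<t} \<in> null_sets lborel" by (subst (asm) AE_iff_null_sets[symmetric]) auto
  then show False using assms(2) by (simp add: null_sets_def)
qed

section \<open>Sign of the solution and continuity of its masses at every time\<close>

context borel_weak_solution
begin

lemma time_representative:
  assumes t: "t \<in> {0..T}"
  obtains w where "w \<in> borel_measurable borel" "AE x in lborel. x \<in> K \<longrightarrow> u x t = w x"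
    "integrable lborel (\<lambda>x. indicator K x * (w x)\<^sup>2)"
proof -
  have "(\<lambda>x. u x t) \<in> borel_measurable (lebesgue_on K)" using cont t unfolding C_L2_loc_def by blast
  then obtain w where w: "w \<in> borel_measurable borel" "AE x in lborel. x \<in> K \<longrightarrow> u x t = w x"
    by (rule borel_representative[OF _ K_borel])
  have "set_integrable lebesgue K (\<lambda>x. (u x t)\<^sup>2)" using cont K t unfolding C_L2_loc_def by blast
  moreover have "AE x in lborel. x \<in> K \<longrightarrow> (u x t)\<^sup>2 = (w x)\<^sup>2" using w(2) by eventually_elim auto
  moreover have "(\<lambda>x. (w x)\<^sup>2) \<in> borel_measurable borel" using w(1) by measurable
  ultimately have "integrable lborel (\<lambda>x. indicator K x * (w x)\<^sup>2)"
    using set_integral_lebesgue_AE(1)[OF K_borel, of "\<lambda>x. (w x)\<^sup>2" "\<lambda>x. (u x t)\<^sup>2"] by simp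
  then show thesis using that w by blast
qed

lemma L2_diff:
  assumes w: "w \<in> borel_measurable borel" "AE x in lborel. x \<in> K \<longrightarrow> u x s = w x" "integrable lborel (\<lambda>x. indicator K x * (w x)\<^sup>2)"
    and w': "w' \<in> borel_measurable borel" "AE x in lborel. x \<in> K \<longrightarrow> u x t = w' x" "integrable lborel (\<lambda>x. indicator K x * (w' x)\<^sup>2)"
  shows "integrable lborel (\<lambda>x. indicator K x * (w x - w' x)\<^sup>2)"
    "(LINT x:K|lebesgue. (u x s - u x t)\<^sup>2) = (LINT x|lborel. indicator K x * (w x - w' x)\<^sup>2)"
proof -
  note [measurable] = w(1) w'(1)
  show "integrable lborel (\<lambda>x. indicator K x * (w x - w' x)\<^sup>2)"
  proof (rule integrable_dominated[where g = "\<lambda>x. 2 * (w x)\<^sup>2 + 2 * (w' x)\<^sup>2"])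
    have "integrable lborel (\<lambda>x. 2 * (indicator K x * (w x)\<^sup>2) + 2 * (indicator K x * (w' x)\<^sup>2))" using w(3) w'(3) by simp
    then show "integrable lborel (\<lambda>x. indicator K x * (2 * (w x)\<^sup>2 + 2 * (w' x)\<^sup>2))" by (simp add: algebra_simps)
    have "(x - y)\<^sup>2 \<le> 2 * x\<^sup>2 + 2 * y\<^sup>2" for x y :: real
      using sum_squares_ge_zero[of "x + y" 0] by (simp add: power2_eq_square algebra_simps)
    then show "AE x in lborel. x \<in> K \<longrightarrow> \<bar>(w x - w' x)\<^sup>2\<bar> \<le> 2 * (w x)\<^sup>2 + 2 * (w' x)\<^sup>2" by simp
  qed simp_all
  show "(LINT x:K|lebesgue. (u x s - u x t)\<^sup>2) = (LINT x|lborel. indicator K x * (w x - w' x)\<^sup>2)"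
  proof (rule set_integral_lebesgue_AE(2)[OF K_borel])
    show "AE x in lborel. x \<in> K \<longrightarrow> (u x s - u x t)\<^sup>2 = (w x - w' x)\<^sup>2"
      using w(2) w'(2) by eventually_elim auto
  qed measurable
qed

lemma L2_continuous:
  assumes "t \<in> {0..T}" "0 < e"
  obtains d where "0 < d" "\<And>s. s \<in> {0..T} \<Longrightarrow> \<bar>s - t\<bar> < d \<Longrightarrow> (LINT x:K|lebesgue. (u x s - u x t)\<^sup>2) < e"
proof -
  have "((\<lambda>s. LINT x:K|lebesgue. (u x s - u x t)\<^sup>2) \<longlongrightarrow> 0) (at t within {0..T})"
    using cont K assms(1) unfolding C_L2_loc_def by blast
  from order_tendstoD(2)[OF this assms(2)]
  obtain d where d: "0 < d" "\<And>s. s \<in> {0..T} \<Longrightarrow> s \<noteq> t \<Longrightarrow> dist s t < d \<Longrightarrow> (LINT x:K|lebesgue. (u x s - u x t)\<^sup>2) < e"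
    unfolding eventually_at by blast
  show thesis
  proof (rule that[OF d(1)])
    fix s assume "s \<in> {0..T}" "\<bar>s - t\<bar> < d"
    then show "(LINT x:K|lebesgue. (u x s - u x t)\<^sup>2) < e"
      using d(2)[of s] assms(2) by (cases "s = t") (auto simp: dist_real_def set_lebesgue_integral_def)
  qed
qed

text \<open>The sign is given almost everywhere in space-time, which says nothing about a single
  time. At a nearby good time s the solution equals the nonnegative U, so the negative part at time
  t is bounded by the L^2 distance between the two times, and this is small by continuity.\<close>

lemma nonneg_at_all_times:
  assumes t: "t \<in> {0..T}" and T: "0 < T"
  shows "AE x in lborel. x \<in> K \<longrightarrow> 0 \<le> u x t"
proof -
  obtain w where w: "w \<in> borel_measurable borel" "AE x in lborel. x \<in> K \<longrightarrow> u x t = w x"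
    "integrable lborel (\<lambda>x. indicator K x * (w x)\<^sup>2)" using time_representative[OF t] by blast
  note [measurable] = w(1)
  define n where "n x = indicator K x * (min 0 (w x))\<^sup>2" for x
  have ni: "integrable lborel n"
    unfolding n_def
  proof (rule integrable_dominated[OF w(3)])
    show "AE x in lborel. x \<in> K \<longrightarrow> \<bar>(min 0 (w x))\<^sup>2\<bar> \<le> (w x)\<^sup>2" by (simp add: min_def)
  qed simp_all
  have n0: "0 \<le> n x" for x by (simp add: n_def)
  have "(LINT x|lborel. n x) \<le> e" if e: "0 < e" for e
  proof -
    obtain d where d: "0 < d" "\<And>s. s \<in> {0..T} \<Longrightarrow> \<bar>s - t\<bar> < d \<Longrightarrow> (LINT x:K|lebesgue. (u x s - u x t)\<^sup>2) < e"
      by (rule L2_continuous[OF t e]) (rule that)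
    \<comment> \<open>The interval is nonempty also for t = 0 and t = T; it contains a time of (0,T)
      at which U represents u.\<close>
    have "max 0 (t - d) < min T (t + d)" using t T d(1) by auto
    from AE_imp_exists_between[OF u_U this]
    obtain s where s: "max 0 (t - d) < s" "s < min T (t + d)" "s \<in> {0<..<T} \<longrightarrow> (AE x in lborel. x \<in> K \<longrightarrow> u x s = U (x, s))" by blast
    have sT: "s \<in> {0..T}" "\<bar>s - t\<bar> < d" using s by auto
    have us: "AE x in lborel. x \<in> K \<longrightarrow> u x s = U (x, s)" using s by auto
    have Um[measurable]: "(\<lambda>x. U (x, s)) \<in> borel_measurable borel" by (rule measurable_section) simp
    have "set_integrable lebesgue K (\<lambda>x. (u x s)\<^sup>2)" using cont K sT unfolding C_L2_loc_def by blast
    moreover have "AE x in lborel. x \<in> K \<longrightarrow> (u x s)\<^sup>2 = (U (x, s))\<^sup>2" using us by eventually_elim auto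
    moreover have "(\<lambda>x. (U (x, s))\<^sup>2) \<in> borel_measurable borel" by measurable
    ultimately have Ui: "integrable lborel (\<lambda>x. indicator K x * (U (x, s))\<^sup>2)"
      using set_integral_lebesgue_AE(1)[OF K_borel, of "\<lambda>x. (U (x, s))\<^sup>2" "\<lambda>x. (u x s)\<^sup>2"] by simp
    note L = L2_diff[OF Um us Ui w]
    have "(LINT x|lborel. n x) \<le> (LINT x|lborel. indicator K x * (U (x, s) - w x)\<^sup>2)"
    proof (rule integral_mono[OF ni L(1)])
      fix x
      have "(min 0 (w x))\<^sup>2 \<le> (U (x, s) - w x)\<^sup>2"
      proof (cases "w x < 0")
        case True
        then have "\<bar>w x\<bar> \<le> \<bar>U (x, s) - w x\<bar>" using U_nonneg[of "(x, s)"] by simp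
        then have "(w x)\<^sup>2 \<le> (U (x, s) - w x)\<^sup>2" by (simp add: abs_le_square_iff)
        then show ?thesis using True by simp
      qed simp
      then show "n x \<le> indicator K x * (U (x, s) - w x)\<^sup>2" unfolding n_def by (intro mult_left_mono) auto
    qed
    also have "\<dots> < e" using d(2)[OF sT] L(2) by simp
    finally show ?thesis by simp
  qed
  then have "(LINT x|lborel. n x) \<le> 0" by (rule field_le_epsilon) simp
  moreover have "0 \<le> (LINT x|lborel. n x)" using n0 by (rule Bochner_Integration.integral_nonneg)
  ultimately have "(LINT x|lborel. n x) = 0" by linarith
  then have "AE x in lborel. n x = 0" using integral_nonneg_eq_0_iff_AE[OF ni] n0 by simp
  then show ?thesis using w(2)
  proof (eventually_elim, intro impI)
    fix x assume x: "n x = 0" "x \<in> K \<longrightarrow> u x t = w x" "x \<in> K"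
    then have "min 0 (w x) = 0" by (simp add: n_def)
    then show "0 \<le> u x t" using x by simp
  qed
qed

lemma section_mass_representation:
  assumes f[measurable]: "f \<in> borel_measurable borel" and fb: "\<And>x. 0 \<le> f x" "\<And>x. f x \<le> 1"
    and w: "w \<in> borel_measurable borel" "AE x in lborel. x \<in> K \<longrightarrow> u x t = w x" "integrable lborel (\<lambda>x. indicator K x * (w x)\<^sup>2)"
  shows "(LINT x:K|lebesgue. u x t * f x) = (LINT x|lborel. indicator K x * (w x * f x))"
    "integrable lborel (\<lambda>x. indicator K x * (w x * f x))"
proof -
  note [measurable] = w(1)
  show "(LINT x:K|lebesgue. u x t * f x) = (LINT x|lborel. indicator K x * (w x * f x))"
    by (rule set_integral_lebesgue_AE(2)[OF K_borel]) (measurable, use w(2) in \<open>eventually_elim, auto\<close>)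
  show "integrable lborel (\<lambda>x. indicator K x * (w x * f x))"
  proof (rule integrable_dominated[where g = "\<lambda>x. 1 + (w x)\<^sup>2"])
    show "integrable lborel (\<lambda>x. indicator K x * (1 + (w x)\<^sup>2))"
      using w(3) integrable_indicator_compact[OF K] by (simp add: distrib_left)
    have b: "\<bar>y\<bar> \<le> 1 + y\<^sup>2" for y :: real
    proof -
      have "0 \<le> (\<bar>y\<bar> - 1 / 2)\<^sup>2" by simp
      then show ?thesis by (simp add: power2_eq_square algebra_simps)
    qed
    have "\<bar>w x * f x\<bar> \<le> 1 + (w x)\<^sup>2" for x
    proof -
      have "\<bar>w x\<bar> * \<bar>f x\<bar> \<le> \<bar>w x\<bar> * 1" using fb[of x] by (intro mult_left_mono) auto
      then show ?thesis using b[of "w x"] by (simp add: abs_mult)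
    qed
    then show "AE x in lborel. x \<in> K \<longrightarrow> \<bar>w x * f x\<bar> \<le> 1 + (w x)\<^sup>2" by simp
  qed simp_all
qed

text \<open>L^2 continuity on a compact set implies L1 continuity. Cauchy-Schwarz is replaced by the
  pointwise bound of |y| by \<eta> + y^2 / \<eta>, with \<eta> chosen first and the L^2 distance
  afterwards.\<close>

lemma section_mass_continuous:
  assumes f[measurable]: "f \<in> borel_measurable borel" and fb: "\<And>x. 0 \<le> f x" "\<And>x. f x \<le> 1"
  shows "continuous_on {0..T} (\<lambda>t. LINT x:K|lebesgue. u x t * f x)"
proof -
  define k where "k = (LINT x|lborel. indicat_real K x)"
  have k: "0 \<le> k" by (simp add: k_def)
  note rep = section_mass_representation[OF f fb]
  show ?thesis unfolding continuous_on_iff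
  proof (intro ballI allI impI)
    fix t e :: real assume t: "t \<in> {0..T}" and e: "0 < e"
    \<comment> \<open>The term \<eta> times the measure of K gets half of e; the other half is left
      for the squared L^2 distance divided by \<eta>.\<close>
    define \<eta> where "\<eta> = e / (2 * (k + 1))"
    have \<eta>: "0 < \<eta>" using e k by (simp add: \<eta>_def)
    have \<eta>e: "0 < \<eta> * (e / 2)" using \<eta> e by simp
    obtain d where d: "0 < d" "\<And>s. s \<in> {0..T} \<Longrightarrow> \<bar>s - t\<bar> < d \<Longrightarrow> (LINT x:K|lebesgue. (u x s - u x t)\<^sup>2) < \<eta> * (e / 2)"
      by (rule L2_continuous[OF t \<eta>e]) (rule that)
    show "\<exists>d>0. \<forall>s\<in>{0..T}. dist s t < d \<longrightarrow> dist (LINT x:K|lebesgue. u x s * f x) (LINT x:K|lebesgue. u x t * f x) < e"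
    proof (intro exI[of _ d] conjI ballI impI d(1))
      fix s assume s: "s \<in> {0..T}" "dist s t < d"
      obtain w where w: "w \<in> borel_measurable borel" "AE x in lborel. x \<in> K \<longrightarrow> u x s = w x"
        "integrable lborel (\<lambda>x. indicator K x * (w x)\<^sup>2)" using time_representative[OF s(1)] by blast
      obtain w' where w': "w' \<in> borel_measurable borel" "AE x in lborel. x \<in> K \<longrightarrow> u x t = w' x"
        "integrable lborel (\<lambda>x. indicator K x * (w' x)\<^sup>2)" using time_representative[OF t] by blast
      note L = L2_diff[OF w w']
      have bnd: "\<bar>indicator K x * (w x * f x) - indicator K x * (w' x * f x)\<bar>
        \<le> \<eta> * indicator K x + (1 / \<eta>) * (indicator K x * (w x - w' x)\<^sup>2)" for x
      proof -
        define y where "y = w x - w' x"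
        have "0 \<le> (\<bar>y\<bar> - \<eta>)\<^sup>2" by simp
        then have "2 * (\<bar>y\<bar> * \<eta>) \<le> y\<^sup>2 + \<eta>\<^sup>2" by (simp add: power2_eq_square algebra_simps)
        moreover have "0 \<le> \<bar>y\<bar> * \<eta>" using \<eta> by simp
        ultimately have "\<bar>y\<bar> * \<eta> \<le> y\<^sup>2 + \<eta>\<^sup>2" by linarith
        then have "\<bar>y\<bar> \<le> (y\<^sup>2 + \<eta>\<^sup>2) / \<eta>" using \<eta> by (simp add: pos_le_divide_eq)
        also have "\<dots> = \<eta> + (1 / \<eta>) * y\<^sup>2" using \<eta> by (simp add: add_divide_distrib power2_eq_square)
        finally have 1: "\<bar>y\<bar> \<le> \<eta> + (1 / \<eta>) * y\<^sup>2" .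
        have "\<bar>y * f x\<bar> \<le> \<bar>y\<bar> * 1" unfolding abs_mult using fb[of x] by (intro mult_left_mono) auto
        then have "\<bar>w x * f x - w' x * f x\<bar> \<le> \<eta> + (1 / \<eta>) * (w x - w' x)\<^sup>2"
          using 1 by (simp add: y_def left_diff_distrib)
        then show ?thesis by (cases "x \<in> K") auto
      qed
      have "\<bar>(LINT x:K|lebesgue. u x s * f x) - (LINT x:K|lebesgue. u x t * f x)\<bar>
        = \<bar>LINT x|lborel. indicator K x * (w x * f x) - indicator K x * (w' x * f x)\<bar>"
        using rep[OF w] rep[OF w'] by simp
      also have "\<dots> \<le> (LINT x|lborel. \<eta> * indicator K x + (1 / \<eta>) * (indicator K x * (w x - w' x)\<^sup>2))"
      proof (rule abs_integral_le[OF _ _ bnd])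
        show "integrable lborel (\<lambda>x. indicator K x * (w x * f x) - indicator K x * (w' x * f x))"
          using rep(2)[OF w] rep(2)[OF w'] by simp
        show "integrable lborel (\<lambda>x. \<eta> * indicator K x + (1 / \<eta>) * (indicator K x * (w x - w' x)\<^sup>2))"
          using L(1) integrable_indicator_compact[OF K] by (intro Bochner_Integration.integrable_add integrable_mult_right)
      qed
      also have "\<dots> = (LINT x|lborel. \<eta> * indicator K x) + (LINT x|lborel. (1 / \<eta>) * (indicator K x * (w x - w' x)\<^sup>2))"
        using L(1) integrable_indicator_compact[OF K] by (intro Bochner_Integration.integral_add integrable_mult_right)
      also have "\<dots> = \<eta> * k + (1 / \<eta>) * (LINT x:K|lebesgue. (u x s - u x t)\<^sup>2)"
        unfolding L(2) k_def by (simp only: integral_mult_right_zero)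
      also have "\<dots> < \<eta> * (k + 1) + (1 / \<eta>) * (\<eta> * (e / 2))"
      proof (rule add_less_le_mono)
        show "\<eta> * k < \<eta> * (k + 1)" using \<eta> by simp
        have "(LINT x:K|lebesgue. (u x s - u x t)\<^sup>2) \<le> \<eta> * (e / 2)"
          using d(2)[OF s(1)] s(2) by (simp add: dist_real_def less_imp_le)
        then show "(1 / \<eta>) * (LINT x:K|lebesgue. (u x s - u x t)\<^sup>2) \<le> (1 / \<eta>) * (\<eta> * (e / 2))"
          using \<eta> by (intro mult_left_mono) auto
      qed
      also have "\<dots> = e"
      proof -
        have "\<eta> * (k + 1) = e / 2" using k unfolding \<eta>_def by (simp add: field_simps add_nonneg_eq_0_iff)
        then show ?thesis using \<eta> by simp
      qed
      finally show "dist (LINT x:K|lebesgue. u x s * f x) (LINT x:K|lebesgue. u x t * f x) < e"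
        by (simp add: dist_real_def)
    qed
  qed
qed

end

section \<open>Integrated estimates for energy and mass\<close>

context mass_setting
begin

definition mass :: "real \<Rightarrow> real" where "mass t = (LINT x:K|lebesgue. u x t * \<zeta> x)"

definition \<kappa> :: real where "\<kappa> = (LINT x|lborel. indicat_real K x)"

text \<open>The first summand is the contribution of the energy to the flux, the second that of the
  H term in \<open>pointwise_mass\<close>.\<close>

definition \<gamma>\<^sub>1 :: real where
  "\<gamma>\<^sub>1 = c' * (2 / (a * Co) * (1 / (1 - a) + \<Gamma>) + 2 * real CARD('a))"

lemma kappa_nonneg: "0 \<le> \<kappa>" by (simp add: \<kappa>_def)

lemma gamma1_pos: "0 < \<gamma>\<^sub>1"
  unfolding \<gamma>\<^sub>1_def using c'_pos a C Gamma_nonneg by (intro mult_pos_pos add_nonneg_pos mult_nonneg_nonneg add_nonneg_nonneg) auto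

lemma zeta_le_1: "\<zeta> x \<le> 1" unfolding zeta_xi using xi by (intro power_le_one)

lemma zeta_le_xi: "\<zeta> x \<le> \<xi> x ^ (m - 2)" unfolding zeta_xi using xi by (intro power_decreasing) auto

lemma v_borel[measurable]: "v \<in> borel_measurable borel" unfolding v_def[abs_def] by measurable

lemma xi_fst_borel[measurable]: "(\<lambda>z. \<xi> (fst z)) \<in> borel_measurable (borel :: ((real^'a) \<times> real) measure)"
  by (rule borel_measurable_fst_comp) simp

lemma H_borel[measurable]: "H \<in> borel_measurable borel" unfolding H_def[abs_def] by measurable

lemma en_borel[measurable]: "en \<in> borel_measurable borel" unfolding en_def[abs_def] by measurable

lemma H_nonneg: "0 \<le> H z" unfolding H_def using xi by simp

lemma en_nonneg: "0 \<le> en z" unfolding en_def using \<zeta>(2) by (intro sum_nonneg) simp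

text \<open>The bound for \<open>\<nu> powr a\<close> times the integral of H over K at one time,
  obtained by integrating \<open>young_absorb\<close>: the integral of v \<zeta> is at most M +
  \<nu> \<kappa>, where \<kappa> is the measure of K.\<close>

definition lam :: "real \<Rightarrow> real \<Rightarrow> real" where
  "lam \<delta> M = \<delta> * (M + \<nu> * \<kappa>) + \<delta> powr ((a - 1) / a) * \<nu> * \<kappa>"

lemma H_section:
  assumes M: "\<forall>t\<in>{0..\<theta>}. mass t \<le> M" and \<delta>: "0 < \<delta>"
  shows "AE t in lborel. t \<in> {0<..<T} \<longrightarrow> t \<le> \<theta> \<longrightarrow> integrable lborel (\<lambda>x. indicator K x * H (x, t)) \<and>
    \<nu> powr a * (LINT x|lborel. indicator K x * H (x, t)) \<le> lam \<delta> M"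
  using u_U time_section_integrable
proof (eventually_elim, intro impI)
  fix t assume A: "t \<in> {0<..<T} \<longrightarrow> (AE x in lborel. x \<in> K \<longrightarrow> u x t = U (x, t))"
    "t \<in> {0<..<T} \<longrightarrow> integrable lborel (\<lambda>x. indicator K x * U (x, t))" and t: "t \<in> {0<..<T}" "t \<le> \<theta>"
  define k where "k = \<delta> powr ((a - 1) / a)"
  note IK = integrable_indicator_compact[OF K]
  have [measurable]: "(\<lambda>x. H (x, t)) \<in> borel_measurable borel" "(\<lambda>x. U (x, t)) \<in> borel_measurable borel"
    by (rule measurable_section; simp)+
  have Uz: "integrable lborel (\<lambda>x. indicator K x * (U (x, t) * \<zeta> x))"
    using integrable_mult_bounded[OF mp[OF A(2) t(1)], of \<zeta> 1] \<zeta>(2) zeta_le_1 by (simp add: mult.assoc)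
  have Iz: "integrable lborel (\<lambda>x. indicator K x * \<zeta> x)"
    using integrable_mult_bounded[OF IK, of \<zeta> 1] \<zeta>(2) zeta_le_1 by simp
  have b: "\<nu> powr a * H (x, t) \<le> \<delta> * (U (x, t) * \<zeta> x) + \<delta> * \<nu> * \<zeta> x + k * \<nu>" for x
  proof -
    have "\<nu> powr a * (v (x, t) powr (1 - a) * \<xi> x ^ (m - 2)) \<le> \<delta> * (v (x, t) * \<xi> x ^ m) + \<delta> powr ((a - 1) / a) * \<nu>"
      using v_pos[of "(x, t)"] \<nu> xi a ma \<delta> by (intro young_absorb) auto
    then show ?thesis unfolding H_def zeta_xi k_def v_def by (simp add: algebra_simps)
  qed
  define B where "B x = \<delta> * (indicator K x * (U (x, t) * \<zeta> x)) + \<delta> * \<nu> * (indicator K x * \<zeta> x) + k * \<nu> * indicator K x" for x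
  have Bi: "integrable lborel B" unfolding B_def using Uz Iz IK by (intro Bochner_Integration.integrable_add integrable_mult_right)
  have HB: "indicator K x * (\<nu> powr a * H (x, t)) \<le> B x" for x
    using mult_left_mono[OF b[of x], of "indicator K x"] by (simp add: B_def algebra_simps)
  have aHi: "integrable lborel (\<lambda>x. indicator K x * (\<nu> powr a * H (x, t)))"
  proof (rule Bochner_Integration.integrable_bound[OF Bi])
    show "AE x in lborel. norm (indicator K x * (\<nu> powr a * H (x, t))) \<le> norm (B x)"
    proof (rule AE_I2)
      fix x
      have "0 \<le> indicator K x * (\<nu> powr a * H (x, t))" using H_nonneg by simp
      then show "norm (indicator K x * (\<nu> powr a * H (x, t))) \<le> norm (B x)" using HB[of x] by simp
    qed
  qed simp
  then have "integrable lborel (\<lambda>x. (1 / \<nu> powr a) * (indicator K x * (\<nu> powr a * H (x, t))))" by (rule integrable_mult_right)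
  then have Hi: "integrable lborel (\<lambda>x. indicator K x * H (x, t))" using \<nu> by simp
  have "\<nu> powr a * (LINT x|lborel. indicator K x * H (x, t)) = (LINT x|lborel. indicator K x * (\<nu> powr a * H (x, t)))"
    by (simp only: mult.left_commute[of _ "\<nu> powr a"] integral_mult_right_zero)
  also have "\<dots> \<le> (LINT x|lborel. B x)" by (rule integral_mono[OF aHi Bi HB])
  also have "\<dots> = \<delta> * (LINT x|lborel. indicator K x * (U (x, t) * \<zeta> x)) + \<delta> * \<nu> * (LINT x|lborel. indicator K x * \<zeta> x) + k * \<nu> * \<kappa>"
    unfolding B_def \<kappa>_def using Uz Iz IK by simp
  also have "\<dots> \<le> \<delta> * M + \<delta> * \<nu> * \<kappa> + k * \<nu> * \<kappa>"
  proof (intro add_mono mult_left_mono order_refl)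
    have "(LINT x|lborel. indicator K x * (U (x, t) * \<zeta> x)) = mass t"
      unfolding mass_def by (rule section_integral[OF mp[OF A(1) t(1)], symmetric]) simp
    then show "(LINT x|lborel. indicator K x * (U (x, t) * \<zeta> x)) \<le> M" using M t by simp
    show "(LINT x|lborel. indicator K x * \<zeta> x) \<le> \<kappa>"
      unfolding \<kappa>_def using zeta_le_1 by (intro integral_mono Iz IK) (auto simp: indicator_def)
  qed (use \<delta> \<nu> in \<open>auto simp: k_def\<close>)
  also have "\<dots> = lam \<delta> M" by (simp add: lam_def k_def algebra_simps)
  finally show "integrable lborel (\<lambda>x. indicator K x * H (x, t)) \<and>
    \<nu> powr a * (LINT x|lborel. indicator K x * H (x, t)) \<le> lam \<delta> M" using Hi by simp
qed

text \<open>Integrability of H over the slab is part of the claim, so the slice bound is integrated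
  as a nonnegative extended integral first.\<close>

lemma H_slab:
  assumes M: "\<forall>t\<in>{0..\<theta>}. mass t \<le> M" and \<delta>: "0 < \<delta>" and M0: "0 \<le> M"
    and t: "0 < t1" "t1 \<le> t2" "t2 < T" "t2 \<le> \<theta>"
  shows "integrable lborel (\<lambda>z. indicator (K \<times> {t1..t2}) z * H z)"
    "\<nu> powr a * (LINT z|lborel. indicator (K \<times> {t1..t2}) z * H z) \<le> \<theta> * lam \<delta> M"
proof -
  define L where "L = lam \<delta> M / \<nu> powr a"
  have L0: "0 \<le> L" unfolding L_def lam_def using M0 \<delta> \<nu> kappa_nonneg by (intro divide_nonneg_nonneg add_nonneg_nonneg mult_nonneg_nonneg) auto
  have KIm[measurable]: "K \<times> {t1..t2} \<in> sets borel" by (rule KI_borel)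
  have "(\<integral>\<^sup>+z. ennreal (indicator (K \<times> {t1..t2}) z * H z) \<partial>lborel)
    = (\<integral>\<^sup>+t. \<integral>\<^sup>+x. ennreal (indicator (K \<times> {t1..t2}) (x, t) * H (x, t)) \<partial>lborel \<partial>lborel)"
    by (rule nn_integral_lborel_iterated(2)) measurable
  also have "\<dots> \<le> (\<integral>\<^sup>+t. ennreal L * indicator {t1..t2} t \<partial>lborel)"
  proof (rule nn_integral_mono_AE)
    show "AE t in lborel. (\<integral>\<^sup>+x. ennreal (indicator (K \<times> {t1..t2}) (x, t) * H (x, t)) \<partial>lborel) \<le> ennreal L * indicator {t1..t2} t"
      using H_section[OF M \<delta>]
    proof eventually_elim
      case (elim t)
      show ?case
      proof (cases "t \<in> {t1..t2}")
        case True
        then have hi: "integrable lborel (\<lambda>x. indicator K x * H (x, t))"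
          and hl: "\<nu> powr a * (LINT x|lborel. indicator K x * H (x, t)) \<le> lam \<delta> M"
          using elim t by auto
        have "(\<integral>\<^sup>+x. ennreal (indicator (K \<times> {t1..t2}) (x, t) * H (x, t)) \<partial>lborel) = (\<integral>\<^sup>+x. ennreal (indicator K x * H (x, t)) \<partial>lborel)"
          using True by (simp add: indicator_times)
        also have "\<dots> = ennreal (LINT x|lborel. indicator K x * H (x, t))"
          using hi H_nonneg by (intro nn_integral_eq_integral) auto
        also have "\<dots> \<le> ennreal L" using hl \<nu> by (intro ennreal_leI) (simp add: L_def field_simps)
        finally show ?thesis using True by simp
      qed (simp add: indicator_times)
    qed
  qed
  also have "\<dots> = ennreal L * emeasure lborel {t1..t2}" by (rule nn_integral_cmult_indicator) simp
  also have "\<dots> = ennreal (L * (t2 - t1))" using t L0 by (simp add: ennreal_mult[symmetric])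
  finally have nn: "(\<integral>\<^sup>+z. ennreal (indicator (K \<times> {t1..t2}) z * H z) \<partial>lborel) \<le> ennreal (L * (t2 - t1))" .
  have ind0: "0 \<le> indicat_real (K \<times> {t1..t2}) z * H z" for z using H_nonneg by simp
  show Hi: "integrable lborel (\<lambda>z. indicator (K \<times> {t1..t2}) z * H z)"
  proof (rule integrableI_bounded)
    have "(\<integral>\<^sup>+z. ennreal (norm (indicat_real (K \<times> {t1..t2}) z * H z)) \<partial>lborel) = (\<integral>\<^sup>+z. ennreal (indicator (K \<times> {t1..t2}) z * H z) \<partial>lborel)"
      unfolding real_norm_def abs_of_nonneg[OF ind0] ..
    also have "\<dots> < \<infinity>" using nn by (simp add: order_le_less_trans)
    finally show "(\<integral>\<^sup>+z. ennreal (norm (indicat_real (K \<times> {t1..t2}) z * H z)) \<partial>lborel) < \<infinity>" .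
  qed measurable
  have "ennreal (LINT z|lborel. indicator (K \<times> {t1..t2}) z * H z) \<le> ennreal (L * (t2 - t1))"
    using nn nn_integral_eq_integral[OF Hi] ind0 by simp
  then have "(LINT z|lborel. indicator (K \<times> {t1..t2}) z * H z) \<le> L * (t2 - t1)"
    using L0 t by (simp add: ennreal_le_iff)
  also have "\<dots> \<le> L * \<theta>" using L0 t by (intro mult_left_mono) auto
  finally have "\<nu> powr a * (LINT z|lborel. indicator (K \<times> {t1..t2}) z * H z) \<le> \<nu> powr a * (L * \<theta>)"
    by (intro mult_left_mono) auto
  also have "\<dots> = \<theta> * lam \<delta> M" using \<nu> by (simp add: L_def)
  finally show "\<nu> powr a * (LINT z|lborel. indicator (K \<times> {t1..t2}) z * H z) \<le> \<theta> * lam \<delta> M" .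
qed

lemma en_slab_integrable:
  assumes t: "0 < t1" "t2 < T"
  shows "integrable lborel (\<lambda>z. indicator (K \<times> {t1..t2}) z * en z)"
proof (rule integrable_dominated[where g = "\<lambda>z. \<Sum>i\<in>UNIV. \<nu> powr (- a - 1) * \<bar>W i z\<bar> powr p i"])
  have "integrable lborel (\<lambda>z. \<Sum>i\<in>UNIV. \<nu> powr (- a - 1) * (indicator (K \<times> {t1..t2}) z * \<bar>W i z\<bar> powr p i))"
    using W_int[OF t] by (intro Bochner_Integration.integrable_sum integrable_mult_right)
  then show "integrable lborel (\<lambda>z. indicator (K \<times> {t1..t2}) z * (\<Sum>i\<in>UNIV. \<nu> powr (- a - 1) * \<bar>W i z\<bar> powr p i))"
    by (simp add: sum_distrib_left mult_ac)
  have "en z \<le> (\<Sum>i\<in>UNIV. \<nu> powr (- a - 1) * \<bar>W i z\<bar> powr p i)" for z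
    unfolding en_def
  proof (rule sum_mono)
    fix i
    have "v z powr (- a - 1) \<le> \<nu> powr (- a - 1)" using v_pos[of z] \<nu> a by (intro powr_mono2') auto
    then have "(v z powr (- a - 1) * \<bar>W i z\<bar> powr p i) * \<zeta> (fst z) \<le> (\<nu> powr (- a - 1) * \<bar>W i z\<bar> powr p i) * 1"
      using \<zeta>(2) zeta_le_1 by (intro mult_mono mult_right_mono) auto
    then show "v z powr (- a - 1) * \<bar>W i z\<bar> powr p i * \<zeta> (fst z) \<le> \<nu> powr (- a - 1) * \<bar>W i z\<bar> powr p i" by simp
  qed
  then show "AE z in lborel. z \<in> K \<times> {t1..t2} \<longrightarrow> \<bar>en z\<bar> \<le> (\<Sum>i\<in>UNIV. \<nu> powr (- a - 1) * \<bar>W i z\<bar> powr p i)"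
    using en_nonneg by simp
qed (use KI_borel in simp_all)

text \<open>G is at most H / (1 - a), so the slice bound for H provides the constant
  \<open>Gb\<close> of the energy inequality. The pointwise estimate then bounds the energy by
  \<open>Gb\<close> and the slab integral of H, both controlled by \<open>lam\<close>.\<close>

lemma energy_bound:
  assumes M: "\<forall>t\<in>{0..\<theta>}. mass t \<le> M" and \<delta>: "0 < \<delta>" and M0: "0 \<le> M"
    and t: "0 < t1" "t1 \<le> t2" "t2 < T" "t2 \<le> \<theta>"
  shows "\<nu> powr a * (LINT z|lborel. indicator (K \<times> {t1..t2}) z * en z) \<le> 2 / (a * Co) * (1 / (1 - a) + \<Gamma>) * lam \<delta> M"
proof -
  let ?S = "K \<times> {t1..t2}"
  define Gb where "Gb = lam \<delta> M / \<nu> powr a / (1 - a)"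
  have lam0: "0 \<le> lam \<delta> M" unfolding lam_def using M0 \<delta> \<nu> kappa_nonneg by (intro add_nonneg_nonneg mult_nonneg_nonneg) auto
  have Gb0: "0 \<le> Gb" unfolding Gb_def using lam0 a by simp
  have GH: "G z \<le> 1 / (1 - a) * H z" for z
  proof -
    have "(v z powr (1 - a) / (1 - a)) * \<zeta> (fst z) \<le> (v z powr (1 - a) / (1 - a)) * \<xi> (fst z) ^ (m - 2)"
      using a zeta_le_xi by (intro mult_left_mono) auto
    then show ?thesis by (simp add: gphi_def H_def v_def)
  qed
  have "AE t in lborel. t \<in> {0<..t2} \<longrightarrow> (LINT x|lborel. indicator K x * G (x, t)) \<le> Gb"
    using H_section[OF M \<delta>] time_section_integrable
  proof (eventually_elim, intro impI)
    fix s assume A: "s \<in> {0<..<T} \<longrightarrow> s \<le> \<theta> \<longrightarrow> integrable lborel (\<lambda>x. indicator K x * H (x, s)) \<and>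
        \<nu> powr a * (LINT x|lborel. indicator K x * H (x, s)) \<le> lam \<delta> M"
      "s \<in> {0<..<T} \<longrightarrow> integrable lborel (\<lambda>x. indicator K x * U (x, s))" "s \<in> {0<..t2}"
    then have hi: "integrable lborel (\<lambda>x. indicator K x * H (x, s))"
      and hl: "\<nu> powr a * (LINT x|lborel. indicator K x * H (x, s)) \<le> lam \<delta> M"
      and ui: "integrable lborel (\<lambda>x. indicator K x * U (x, s))" using t by auto
    have "(LINT x|lborel. indicator K x * G (x, s)) \<le> (LINT x|lborel. 1 / (1 - a) * (indicator K x * H (x, s)))"
    proof (rule integral_mono[OF G_section_integrable[OF ui] integrable_mult_right[OF hi]])
      fix x
      show "indicator K x * G (x, s) \<le> 1 / (1 - a) * (indicator K x * H (x, s))"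
        using mult_left_mono[OF GH[of "(x, s)"], of "indicator K x"] by (simp add: mult_ac)
    qed
    also have "\<dots> = 1 / (1 - a) * (LINT x|lborel. indicator K x * H (x, s))" by (rule integral_mult_right_zero)
    also have "\<dots> \<le> 1 / (1 - a) * (lam \<delta> M / \<nu> powr a)"
      using hl \<nu> a by (intro mult_left_mono) (auto simp: field_simps)
    finally show "(LINT x|lborel. indicator K x * G (x, s)) \<le> Gb" by (simp add: Gb_def mult.commute)
  qed
  from energy_inequality[OF t(1-3) Gb0 this]
  have e1: "- Gb \<le> (LINT z|lborel. indicator ?S z * ((\<Sum>i\<in>UNIV. \<alpha> i z * D\<phi> i z) - \<beta> z * \<phi> z))" .
  note Hs = H_slab[OF M \<delta> M0 t] and ei = en_slab_integrable[OF t(1,3)]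
  have qi: "integrable lborel (\<lambda>z. indicator ?S z * ((\<Sum>i\<in>UNIV. \<alpha> i z * D\<phi> i z) - \<beta> z * \<phi> z))"
    using Q_integrable[OF t(1,3)] by (simp add: q_def)
  have Ri: "integrable lborel (\<lambda>z. - (a * Co / 2) * (indicator ?S z * en z) + \<Gamma> / \<theta> * (indicator ?S z * H z))"
    using Hs(1) ei by (intro Bochner_Integration.integrable_add integrable_mult_right)
  have "(LINT z|lborel. indicator ?S z * ((\<Sum>i\<in>UNIV. \<alpha> i z * D\<phi> i z) - \<beta> z * \<phi> z))
    \<le> (LINT z|lborel. - (a * Co / 2) * (indicator ?S z * en z) + \<Gamma> / \<theta> * (indicator ?S z * H z))"
  proof (rule integral_mono_AE[OF qi Ri])
    show "AE z in lborel. indicator ?S z * ((\<Sum>i\<in>UNIV. \<alpha> i z * D\<phi> i z) - \<beta> z * \<phi> z)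
       \<le> - (a * Co / 2) * (indicator ?S z * en z) + \<Gamma> / \<theta> * (indicator ?S z * H z)"
      using str_AE
    proof eventually_elim
      case (elim z)
      show ?case
      proof (cases "z \<in> ?S")
        case True
        then have "str z" using elim t by auto
        from pointwise_energy[OF this] True show ?thesis by simp
      qed simp
    qed
  qed
  also have "\<dots> = - (a * Co / 2) * (LINT z|lborel. indicator ?S z * en z) + \<Gamma> / \<theta> * (LINT z|lborel. indicator ?S z * H z)"
    using Hs(1) ei by simp
  finally have "a * Co / 2 * (LINT z|lborel. indicator ?S z * en z) \<le> Gb + \<Gamma> / \<theta> * (LINT z|lborel. indicator ?S z * H z)"
    using e1 by linarith
  from mult_left_mono[OF this, of "\<nu> powr a"]
  have "a * Co / 2 * (\<nu> powr a * (LINT z|lborel. indicator ?S z * en z))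
    \<le> \<nu> powr a * Gb + \<Gamma> / \<theta> * (\<nu> powr a * (LINT z|lborel. indicator ?S z * H z))"
    by (simp add: algebra_simps)
  also have "\<dots> \<le> \<nu> powr a * Gb + \<Gamma> / \<theta> * (\<theta> * lam \<delta> M)"
    using Hs(2) Gamma_nonneg \<theta> by (intro add_left_mono mult_left_mono) auto
  also have "\<dots> = (1 / (1 - a) + \<Gamma>) * lam \<delta> M" using \<nu> \<theta> by (simp add: Gb_def distrib_right)
  finally have E: "a * Co / 2 * (\<nu> powr a * (LINT z|lborel. indicator ?S z * en z)) \<le> (1 / (1 - a) + \<Gamma>) * lam \<delta> M" .
  have aC: "0 < 2 / (a * Co)" using a C by simp
  have "\<nu> powr a * (LINT z|lborel. indicator ?S z * en z) = 2 / (a * Co) * (a * Co / 2 * (\<nu> powr a * (LINT z|lborel. indicator ?S z * en z)))"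
    using a C by simp
  also have "\<dots> \<le> 2 / (a * Co) * ((1 / (1 - a) + \<Gamma>) * lam \<delta> M)" using E aC by (intro mult_left_mono) auto
  finally show ?thesis by (simp only: mult.assoc)
qed

text \<open>The time-independent \<zeta> is admissible in both inequalities, which together give an
  identity for the mass difference and hence a two-sided bound. The energy was estimated from the
  supersolution inequality alone.\<close>

lemma mass_difference:
  assumes M: "\<forall>t\<in>{0..\<theta>}. mass t \<le> M" and \<delta>: "0 < \<delta>" and M0: "0 \<le> M"
    and t: "0 < t1" "t1 \<le> t2" "t2 < T" "t2 \<le> \<theta>"
  shows "\<bar>mass t2 - mass t1\<bar> \<le> \<gamma>\<^sub>1 * lam \<delta> M"
proof -
  let ?S = "K \<times> {t1..t2}"
  define D :: "real^'a \<Rightarrow> real^'a" where "D x = (\<chi> i. partial i \<zeta> x)" for x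
  have Dp: "integrable lborel (\<lambda>x. indicator K x * \<bar>D x $ i\<bar> powr p i)" for i
  proof -
    obtain B where B: "0 < B" "\<And>x. \<bar>partial i \<zeta> x\<bar> \<le> B"
      by (rule compactly_supported_bounded[OF test_functions_compactly_supported[OF test_functions_partial[OF \<zeta>(1)]]]) (rule that)
    have "\<bar>\<bar>partial i \<zeta> x\<bar> powr p i\<bar> \<le> B powr p i" for x using B p(1)[of i] by (simp add: powr_mono2)
    then show ?thesis unfolding D_def by (intro integrable_mult_bounded[OF integrable_indicator_compact[OF K]]) simp_all
  qed
  have Dm: "(\<lambda>x. D x $ i) \<in> borel_measurable borel" for i by (simp add: D_def)
  have Wo: "W11_o K \<zeta> D" unfolding D_def by (rule W11_o_test_function[OF K \<zeta>(1)])
  define A where "A = (LINT z|lborel. indicator ?S z * (\<Sum>i\<in>UNIV. \<alpha> i z * D (fst z) $ i))"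
  define B where "B = (LINT z|lborel. indicator ?S z * (\<beta> z * \<zeta> (fst z)))"
  have "mass t2 - mass t1 + A \<ge> B"
    unfolding mass_def A_def B_def by (rule super[OF t(1-3) zeta_borel(1) Dm Wo \<zeta>(2) zeta_le_1 Dp])
  moreover have "mass t2 - mass t1 + A \<le> B"
    unfolding mass_def A_def B_def by (rule sub[OF t(1-3) zeta_borel(1) Dm Wo \<zeta>(2) zeta_le_1 Dp])
  ultimately have eq: "\<bar>mass t2 - mass t1\<bar> = \<bar>A - B\<bar>" by simp
  have "(\<lambda>z. D (fst z) $ i) \<in> borel_measurable (borel :: ((real^'a) \<times> real) measure)" for i
    by (rule borel_measurable_fst_comp[OF Dm])
  then have Ai: "integrable lborel (\<lambda>z. indicator ?S z * (\<Sum>i\<in>UNIV. \<alpha> i z * D (fst z) $ i))"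
    unfolding sum_distrib_left
    by (intro Bochner_Integration.integrable_sum alpha_integrable t slab_integrable(1)[OF Dp])
  have Bi: "integrable lborel (\<lambda>z. indicator ?S z * (\<beta> z * \<zeta> (fst z)))"
  proof -
    have "integrable lborel (\<lambda>z. (indicator ?S z * \<beta> z) * \<zeta> (fst z))"
      by (rule integrable_mult_bounded[OF beta_integrable[OF t(1,3)], where B = 1]) (use \<zeta>(2) zeta_le_1 in auto)
    then show ?thesis by (simp add: mult.assoc)
  qed
  note Hs = H_slab[OF M \<delta> M0 t] and ei = en_slab_integrable[OF t(1,3)]
  define N where "N = 2 * real CARD('a) / \<theta>"
  have "\<bar>A - B\<bar> = \<bar>LINT z|lborel. indicator ?S z * (\<Sum>i\<in>UNIV. \<alpha> i z * D (fst z) $ i) - indicator ?S z * (\<beta> z * \<zeta> (fst z))\<bar>"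
    unfolding A_def B_def using Ai Bi by simp
  also have "\<dots> \<le> (LINT z|lborel. \<bar>indicator ?S z * (\<Sum>i\<in>UNIV. \<alpha> i z * D (fst z) $ i) - indicator ?S z * (\<beta> z * \<zeta> (fst z))\<bar>)"
    by (rule integral_abs_bound)
  also have "\<dots> \<le> (LINT z|lborel. (c' * \<nu> powr a) * (indicator ?S z * en z) + (c' * N * \<nu> powr a) * (indicator ?S z * H z))"
  proof (rule integral_mono_AE)
    show "integrable lborel (\<lambda>z. \<bar>indicator ?S z * (\<Sum>i\<in>UNIV. \<alpha> i z * D (fst z) $ i) - indicator ?S z * (\<beta> z * \<zeta> (fst z))\<bar>)"
      using Ai Bi by (intro integrable_abs Bochner_Integration.integrable_diff)
    show "integrable lborel (\<lambda>z. (c' * \<nu> powr a) * (indicator ?S z * en z) + (c' * N * \<nu> powr a) * (indicator ?S z * H z))"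
      using Hs(1) ei by (intro Bochner_Integration.integrable_add integrable_mult_right)
    show "AE z in lborel. \<bar>indicator ?S z * (\<Sum>i\<in>UNIV. \<alpha> i z * D (fst z) $ i) - indicator ?S z * (\<beta> z * \<zeta> (fst z))\<bar>
       \<le> (c' * \<nu> powr a) * (indicator ?S z * en z) + (c' * N * \<nu> powr a) * (indicator ?S z * H z)"
      using str_AE
    proof eventually_elim
      case (elim z)
      show ?case
      proof (cases "z \<in> ?S")
        case True
        then have "str z" using elim t by auto
        from pointwise_mass[OF this] True show ?thesis by (simp add: D_def N_def algebra_simps)
      qed simp
    qed
  qed
  also have "\<dots> = c' * (\<nu> powr a * (LINT z|lborel. indicator ?S z * en z)) + c' * N * (\<nu> powr a * (LINT z|lborel. indicator ?S z * H z))"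
    using Hs(1) ei by simp
  also have "\<dots> \<le> c' * (2 / (a * Co) * (1 / (1 - a) + \<Gamma>) * lam \<delta> M) + c' * N * (\<theta> * lam \<delta> M)"
    using energy_bound[OF M \<delta> M0 t] Hs(2) c'_pos \<theta> by (intro add_mono mult_left_mono) (auto simp: N_def)
  also have "\<dots> = \<gamma>\<^sub>1 * lam \<delta> M"
  proof -
    have "c' * N * (\<theta> * lam \<delta> M) = c' * (2 * real CARD('a)) * lam \<delta> M" using \<theta> by (simp add: N_def)
    then show ?thesis by (simp add: \<gamma>\<^sub>1_def distrib_left distrib_right mult.assoc)
  qed
  finally show ?thesis unfolding eq .
qed

text \<open>M is the largest mass on the closed interval, attained by continuity. Since it is
  finite, the part of it that appears on the right can be absorbed, which doubles the remaining
  terms.\<close>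

proposition mass_comparison:
  assumes \<tau>: "\<tau>1 \<in> {0..\<theta>}" "\<tau>2 \<in> {0..\<theta>}"
  shows "mass \<tau>2 \<le> 2 * mass \<tau>1 + (1 + 2 * \<gamma>\<^sub>1 * (1 / (2 * \<gamma>\<^sub>1)) powr ((a - 1) / a)) * (\<nu> * \<kappa>)"
proof -
  have T: "0 < T" using \<theta> by simp
  have cont: "continuous_on {0..\<theta>} mass"
    unfolding mass_def using \<theta>(2) \<zeta>(2) zeta_le_1
    by (intro continuous_on_subset[OF section_mass_continuous]) auto
  have mass0: "0 \<le> mass t" if "t \<in> {0..\<theta>}" for t
  proof -
    have tT: "t \<in> {0..T}" using that \<theta> by auto
    have "0 \<le> (LINT x|lebesgue. indicator K x *\<^sub>R (u x t * \<zeta> x))"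
    proof (rule integral_nonneg_AE)
      have "AE x in lborel. 0 \<le> indicator K x *\<^sub>R (u x t * \<zeta> x)"
        using nonneg_at_all_times[OF tT T] by eventually_elim (use \<zeta>(2) in \<open>auto simp: indicator_def\<close>)
      then show "AE x in lebesgue. 0 \<le> indicator K x *\<^sub>R (u x t * \<zeta> x)" by (rule AE_completion)
    qed
    then show ?thesis by (simp add: mass_def set_lebesgue_integral_def)
  qed
  have "{0..\<theta>} \<noteq> {}" using \<theta> by auto
  then obtain s where s: "s \<in> {0..\<theta>}" "\<And>t. t \<in> {0..\<theta>} \<Longrightarrow> mass t \<le> mass s"
    using continuous_attains_sup[OF compact_Icc _ cont] by blast
  define M where "M = mass s"
  have M: "\<forall>t\<in>{0..\<theta>}. mass t \<le> M" "0 \<le> M" using s mass0 by (auto simp: M_def)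
  \<comment> \<open>This makes the coefficient of M in the bound for mass differences equal to 1 /
    2.\<close>
  define \<delta> where "\<delta> = 1 / (2 * \<gamma>\<^sub>1)"
  have \<delta>: "0 < \<delta>" using gamma1_pos by (simp add: \<delta>_def)
  define Q where "Q = \<gamma>\<^sub>1 * lam \<delta> M"
  have cl: "closure {0<..<\<theta>} = {0..\<theta>}" by (rule closure_greaterThanLessThan[OF \<theta>(1)])
  have Q1: "\<bar>mass t - mass t'\<bar> \<le> Q" if "t \<in> {0<..<\<theta>}" "t' \<in> {0<..<\<theta>}" for t t'
  proof (cases "t \<le> t'")
    case True
    then show ?thesis unfolding Q_def using mass_difference[OF M(1) \<delta> M(2), of t t'] that \<theta> by (simp add: abs_minus_commute)
  next
    case False
    then show ?thesis unfolding Q_def using mass_difference[OF M(1) \<delta> M(2), of t' t] that \<theta> by simp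
  qed
  have c1: "continuous_on (closure {0<..<\<theta>}) (\<lambda>t. \<bar>mass t - b\<bar>)" for b
    unfolding cl by (intro continuous_intros cont)
  have c2: "continuous_on (closure {0<..<\<theta>}) (\<lambda>t. \<bar>b - mass t\<bar>)" for b
    unfolding cl by (intro continuous_intros cont)
  \<comment> \<open>\<open>mass_difference\<close> covers interior times only, and \<theta> may be
    equal to T. Continuity of the mass extends the bound to the closed interval, one argument at a
    time.\<close>
  have Q2: "\<bar>mass t - mass t'\<bar> \<le> Q" if "t \<in> {0..\<theta>}" "t' \<in> {0<..<\<theta>}" for t t'
    using continuous_le_on_closure[OF c1, of t "mass t'" Q] Q1 that unfolding cl by blast
  have Q3: "\<bar>mass t - mass t'\<bar> \<le> Q" if "t \<in> {0..\<theta>}" "t' \<in> {0..\<theta>}" for t t'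
    using continuous_le_on_closure[OF c2, of t' "mass t" Q] Q2 that unfolding cl by blast
  have "Q = M / 2 + (1 / 2 + \<gamma>\<^sub>1 * \<delta> powr ((a - 1) / a)) * (\<nu> * \<kappa>)"
  proof -
    have gd: "\<gamma>\<^sub>1 * \<delta> = 1 / 2" using gamma1_pos by (simp add: \<delta>_def)
    have "Q = (\<gamma>\<^sub>1 * \<delta>) * (M + \<nu> * \<kappa>) + \<gamma>\<^sub>1 * \<delta> powr ((a - 1) / a) * (\<nu> * \<kappa>)"
      unfolding Q_def lam_def by (simp add: algebra_simps)
    then show ?thesis unfolding gd by (simp add: algebra_simps)
  qed
  moreover have "M \<le> mass \<tau>1 + Q" using Q3[OF s(1) \<tau>(1)] unfolding M_def by linarith
  ultimately have "M \<le> 2 * mass \<tau>1 + 2 * ((1 / 2 + \<gamma>\<^sub>1 * \<delta> powr ((a - 1) / a)) * (\<nu> * \<kappa>))" by linarith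
  moreover have "2 * ((1 / 2 + \<gamma>\<^sub>1 * \<delta> powr ((a - 1) / a)) * (\<nu> * \<kappa>)) = (1 + 2 * \<gamma>\<^sub>1 * \<delta> powr ((a - 1) / a)) * (\<nu> * \<kappa>)"
    by (simp add: algebra_simps)
  ultimately show ?thesis using bspec[OF M(1) \<tau>(2)] unfolding \<delta>_def by linarith
qed

end

section \<open>Comparison of extended nonnegative integrals\<close>

context borel_weak_solution
begin

lemma section_mass_nn_integral:
  assumes f: "f \<in> borel_measurable borel" "\<And>x. 0 \<le> f x" "\<And>x. f x \<le> 1"
    and t: "t \<in> {0..T}" and T: "0 < T" and b: "0 \<le> b"
  shows "(\<integral>\<^sup>+x. ennreal (b * (indicator K x * (u x t * f x))) \<partial>lebesgue) = ennreal (b * (LINT x:K|lebesgue. u x t * f x))"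
proof -
  obtain w where w: "w \<in> borel_measurable borel" "AE x in lborel. x \<in> K \<longrightarrow> u x t = w x"
    "integrable lborel (\<lambda>x. indicator K x * (w x)\<^sup>2)" using time_representative[OF t] by blast
  note R = section_mass_representation[OF f w]
  have "(\<integral>\<^sup>+x. ennreal (b * (indicator K x * (u x t * f x))) \<partial>lborel) = (\<integral>\<^sup>+x. ennreal (b * (indicator K x * (w x * f x))) \<partial>lborel)"
    by (rule nn_integral_cong_AE) (use w(2) in \<open>eventually_elim, auto simp: indicator_def\<close>)
  also have "\<dots> = ennreal (LINT x|lborel. b * (indicator K x * (w x * f x)))"
  proof (rule nn_integral_eq_integral[OF integrable_mult_right[OF R(2)]])
    show "AE x in lborel. 0 \<le> b * (indicator K x * (w x * f x))"
      using w(2) nonneg_at_all_times[OF t T]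
      by eventually_elim (use b f(2) in \<open>auto simp: indicator_def\<close>)
  qed
  also have "\<dots> = ennreal (b * (LINT x:K|lebesgue. u x t * f x))"
    unfolding R(1) by (simp only: integral_mult_right_zero)
  finally show ?thesis by (simp only: nn_integral_completion)
qed

end

context mass_setting
begin

text \<open>The test function is at least c0 on Q and at most 1 on K, which yields the two sides.
  Extended integrals are used because the closure of the larger cube need not lie in the domain, so
  the integral over Q' may be infinite.\<close>

lemma nn_integral_comparison:
  assumes c0: "0 < c0" "\<And>x. x \<in> Q \<Longrightarrow> c0 \<le> \<zeta> x" and Q: "Q \<subseteq> K" "K \<subseteq> Q'"
    and \<tau>: "\<tau>1 \<in> {0..\<theta>}" "\<tau>2 \<in> {0..\<theta>}"
  shows "(\<integral>\<^sup>+x\<in>Q. ennreal (u x \<tau>2) \<partial>lebesgue) \<le> ennreal (2 / c0) * (\<integral>\<^sup>+x\<in>Q'. ennreal (u x \<tau>1) \<partial>lebesgue)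
    + ennreal ((1 + 2 * \<gamma>\<^sub>1 * (1 / (2 * \<gamma>\<^sub>1)) powr ((a - 1) / a)) / c0 * (\<nu> * \<kappa>))"
proof -
  have T: "0 < T" using \<theta> by simp
  have \<tau>T: "\<tau>1 \<in> {0..T}" "\<tau>2 \<in> {0..T}" using \<tau> \<theta> by auto
  define k where "k = 1 + 2 * \<gamma>\<^sub>1 * (1 / (2 * \<gamma>\<^sub>1)) powr ((a - 1) / a)"
  have k: "0 \<le> k" using gamma1_pos by (simp add: k_def)
  note nn = section_mass_nn_integral[OF zeta_borel(1) \<zeta>(2) zeta_le_1 _ T, folded mass_def]
  have m1: "ennreal (mass \<tau>1) \<le> (\<integral>\<^sup>+x\<in>Q'. ennreal (u x \<tau>1) \<partial>lebesgue)"
  proof -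
    have "ennreal (mass \<tau>1) = (\<integral>\<^sup>+x. ennreal (1 * (indicator K x * (u x \<tau>1 * \<zeta> x))) \<partial>lebesgue)"
      using nn[where t = \<tau>1 and b = 1] \<tau>T by simp
    also have "\<dots> \<le> (\<integral>\<^sup>+x\<in>Q'. ennreal (u x \<tau>1) \<partial>lebesgue)"
    proof (rule nn_integral_mono)
      fix x
      show "ennreal (1 * (indicator K x * (u x \<tau>1 * \<zeta> x))) \<le> ennreal (u x \<tau>1) * indicator Q' x"
      proof (cases "x \<in> K")
        case True
        have "ennreal (u x \<tau>1 * \<zeta> x) \<le> ennreal (u x \<tau>1)"
        proof (cases "0 \<le> u x \<tau>1")
          case True
          then show ?thesis using mult_left_mono[OF zeta_le_1[of x] True] by (intro ennreal_leI) simp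
        next
          case False
          then show ?thesis using \<zeta>(2)[of x] by (simp add: ennreal_neg mult_nonpos_nonneg)
        qed
        then show ?thesis using True Q by auto
      qed simp
    qed
    finally show ?thesis .
  qed
  have m0: "0 \<le> mass \<tau>1"
  proof -
    have "AE x in lebesgue. 0 \<le> indicator K x *\<^sub>R (u x \<tau>1 * \<zeta> x)"
      unfolding AE_completion_iff using nonneg_at_all_times[OF \<tau>T(1) T]
      by eventually_elim (use \<zeta>(2) in \<open>auto simp: indicator_def\<close>)
    then show ?thesis unfolding mass_def set_lebesgue_integral_def by (rule integral_nonneg_AE)
  qed
  have "(\<integral>\<^sup>+x\<in>Q. ennreal (u x \<tau>2) \<partial>lebesgue) \<le> (\<integral>\<^sup>+x. ennreal (1 / c0 * (indicator K x * (u x \<tau>2 * \<zeta> x))) \<partial>lebesgue)"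
  proof (rule nn_integral_mono_AE)
    show "AE x in lebesgue. ennreal (u x \<tau>2) * indicator Q x \<le> ennreal (1 / c0 * (indicator K x * (u x \<tau>2 * \<zeta> x)))"
      unfolding AE_completion_iff using nonneg_at_all_times[OF \<tau>T(2) T]
    proof eventually_elim
      case (elim x)
      show ?case
      proof (cases "x \<in> Q")
        case True
        then have "x \<in> K" using Q by auto
        then have "u x \<tau>2 * c0 \<le> u x \<tau>2 * \<zeta> x" using elim c0(2)[OF True] by (intro mult_left_mono) auto
        then have "u x \<tau>2 \<le> 1 / c0 * (u x \<tau>2 * \<zeta> x)" using c0(1) by (simp add: field_simps)
        then show ?thesis using True \<open>x \<in> K\<close> by (simp add: ennreal_leI)
      qed simp
    qed
  qed
  also have "\<dots> = ennreal (1 / c0 * mass \<tau>2)" by (rule nn) (use \<tau>T c0 in auto)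
  also have "\<dots> \<le> ennreal (2 / c0 * mass \<tau>1 + k / c0 * (\<nu> * \<kappa>))"
  proof (rule ennreal_leI)
    have "1 / c0 * mass \<tau>2 \<le> 1 / c0 * (2 * mass \<tau>1 + k * (\<nu> * \<kappa>))"
      unfolding k_def using c0(1) by (intro mult_left_mono mass_comparison \<tau>) simp
    then show "1 / c0 * mass \<tau>2 \<le> 2 / c0 * mass \<tau>1 + k / c0 * (\<nu> * \<kappa>)" by (simp add: add_divide_distrib)
  qed
  also have "\<dots> = ennreal (2 / c0) * ennreal (mass \<tau>1) + ennreal (k / c0 * (\<nu> * \<kappa>))"
  proof -
    have "0 \<le> k / c0 * (\<nu> * \<kappa>)" "0 \<le> 2 / c0 * mass \<tau>1" using k c0(1) \<nu> kappa_nonneg m0 by auto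
    moreover have "ennreal (2 / c0) * ennreal (mass \<tau>1) = ennreal (2 / c0 * mass \<tau>1)"
      by (rule ennreal_mult[symmetric]) (use c0 m0 in auto)
    ultimately show ?thesis by (simp only: ennreal_plus)
  qed
  also have "\<dots> \<le> ennreal (2 / c0) * (\<integral>\<^sup>+x\<in>Q'. ennreal (u x \<tau>1) \<partial>lebesgue) + ennreal (k / c0 * (\<nu> * \<kappa>))"
    by (intro add_right_mono mult_left_mono m1) simp
  finally show ?thesis unfolding k_def .
qed

end

section \<open>The cutoff function and the parameters\<close>

lemma bump_ge:
  assumes "0 < d" "\<bar>s\<bar> \<le> 1 - d"
  shows "flat 0 d ^ 2 \<le> bump s"
proof -
  have "flat 0 d \<le> flat 0 y" if "d \<le> y" for y
    using that assms(1) by (simp add: flat_def frac_le)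
  then show ?thesis using assms(2) flat0_bounds
    unfolding bump_def power2_eq_square by (intro mult_mono) auto
qed

definition cutoff :: "('n \<Rightarrow> real) \<Rightarrow> real^'n::finite \<Rightarrow> real" where
  "cutoff R x = (\<Prod>j\<in>UNIV. bump (x $ j / R j))"

lemma C_k_cutoff: "C_k k (cutoff R :: real^'n::finite \<Rightarrow> real)"
proof -
  have "C_k k (\<lambda>x::real^'n. bump (0 + x $ j / R j))" for j
    by (rule C_k_affine_comp[OF C_k_bump]) (auto intro!: linearI simp: add_divide_distrib)
  then show ?thesis unfolding cutoff_def[abs_def] by (intro C_k_prod) simp
qed

lemma cutoff_bounds: "0 \<le> cutoff R x" "cutoff R x \<le> 1"
  unfolding cutoff_def using bump_bounds by (auto intro: prod_nonneg prod_le_1)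

lemma cutoff_support:
  fixes x :: "real^'n::finite"
  assumes R: "\<And>j. 0 < R j" and x: "cutoff R x \<noteq> 0"
  shows "x \<in> cbox (\<chi> j. - R j) (\<chi> j. R j)"
proof -
  have *: "\<bar>x $ j\<bar> < R j" for j
  proof (rule ccontr)
    assume "\<not> \<bar>x $ j\<bar> < R j"
    then have "1 \<le> \<bar>x $ j / R j\<bar>" using R[of j] by simp
    from bump_eq_0[OF this] show False using x by (auto simp: cutoff_def)
  qed
  have "- R j \<le> x $ j \<and> x $ j \<le> R j" for j using *[of j] by linarith
  then show ?thesis by (simp add: mem_box_cart)
qed

text \<open>Differentiating the m-th power leaves \<open>cutoff R x ^ (m - 1)\<close> as a factor,
  so the derivative is small wherever the cutoff is; a bare bump function would not give this. In
  the product rule only the i-th factor depends on the i-th coordinate.\<close>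

lemma partial_cutoff_power:
  fixes x :: "real^'n::finite"
  assumes b': "\<And>s. (bump has_real_derivative b' s) (at s)" "\<And>s. \<bar>b' s\<bar> \<le> B" and R: "\<And>j. 0 < R j"
  shows "\<bar>partial i (\<lambda>x. cutoff R x ^ m) x\<bar> \<le> real m * B * cutoff R x ^ (m - 1) / R i"
proof -
  define f where "f j x = bump (x $ j / R j)" for j and x :: "real^'n"
  define f' where "f' j h = b' (x $ j / R j) * (h $ j / R j)" for j and h :: "real^'n"
  have f: "(f j has_derivative f' j) (at x)" for j
  proof -
    have "((\<lambda>x::real^'n. x $ j / R j) has_derivative (\<lambda>h. h $ j / R j)) (at x)"
      by (intro bounded_linear_imp_has_derivative bounded_linear_compose[OF bounded_linear_divide bounded_linear_vec_nth])
    from has_derivative_compose[OF this b'(1)[unfolded has_field_derivative_def]]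
    show ?thesis unfolding f_def f'_def .
  qed
  have "((\<lambda>x. cutoff R x ^ m) has_derivative
      (\<lambda>h. real m * (\<Sum>j\<in>UNIV. f' j h * (\<Prod>k\<in>UNIV - {j}. f k x)) * cutoff R x ^ (m - 1))) (at x)"
    unfolding cutoff_def f_def[symmetric] by (rule has_derivative_power[OF has_derivative_prod[OF f]])
  from partial_eqI[OF this]
  have "partial i (\<lambda>x. cutoff R x ^ m) x
    = real m * (\<Sum>j\<in>UNIV. f' j (axis i 1) * (\<Prod>k\<in>UNIV - {j}. f k x)) * cutoff R x ^ (m - 1)" .
  also have "(\<Sum>j\<in>UNIV. f' j (axis i 1) * (\<Prod>k\<in>UNIV - {j}. f k x)) = f' i (axis i 1) * (\<Prod>k\<in>UNIV - {i}. f k x)"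
    by (rule sum.mono_neutral_cong_right[of _ "{i}", THEN trans]) (auto simp: f'_def axis_def)
  finally have eq: "partial i (\<lambda>x. cutoff R x ^ m) x
    = real m * (f' i (axis i 1) * (\<Prod>k\<in>UNIV - {i}. f k x)) * cutoff R x ^ (m - 1)" .
  have P: "0 \<le> (\<Prod>k\<in>UNIV - {i}. f k x)" "(\<Prod>k\<in>UNIV - {i}. f k x) \<le> 1"
    unfolding f_def using bump_bounds by (auto intro: prod_nonneg prod_le_1)
  have "\<bar>f' i (axis i 1)\<bar> \<le> B / R i" using b'(2)[of "x $ i / R i"] R[of i] by (simp add: f'_def divide_right_mono)
  then have "\<bar>f' i (axis i 1)\<bar> * \<bar>\<Prod>k\<in>UNIV - {i}. f k x\<bar> \<le> B / R i * 1"
    using P by (intro mult_mono) auto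
  then have "real m * (\<bar>f' i (axis i 1)\<bar> * \<bar>\<Prod>k\<in>UNIV - {i}. f k x\<bar>) * cutoff R x ^ (m - 1) \<le> real m * (B / R i * 1) * cutoff R x ^ (m - 1)"
    using cutoff_bounds(1)[of R x] by (intro mult_right_mono mult_left_mono) auto
  then show ?thesis unfolding eq using cutoff_bounds(1)[of R x] by (simp add: abs_mult)
qed

lemma cutoff_power_test_function:
  fixes R :: "'n::finite \<Rightarrow> real"
  assumes R: "\<And>j. 0 < R j" "\<And>j. R j < R' j" and m: "0 < m"
  shows "(\<lambda>x. cutoff R x ^ m) \<in> test_functions (interior (cbox (\<chi> j. - R' j) (\<chi> j. R' j)))"
proof -
  have sub: "{x. cutoff R x ^ m \<noteq> 0} \<subseteq> cbox (\<chi> j. - R j) (\<chi> j. R j)"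
  proof
    fix x assume "x \<in> {x. cutoff R x ^ m \<noteq> 0}"
    then have "cutoff R x \<noteq> 0" using m by auto
    then show "x \<in> cbox (\<chi> j. - R j) (\<chi> j. R j)" by (rule cutoff_support[OF R(1)])
  qed
  have "cbox (\<chi> j. - R j) (\<chi> j. R j) \<subseteq> box (\<chi> j. - R' j) (\<chi> j. R' j)"
  proof
    fix x assume x: "x \<in> cbox (\<chi> j. - R j) (\<chi> j. R j)"
    have "- R' j < x $ j \<and> x $ j < R' j" for j
      using x R(2)[of j] unfolding mem_box_cart vec_lambda_beta by (auto dest!: spec[of _ j])
    then show "x \<in> box (\<chi> j. - R' j) (\<chi> j. R' j)" by (simp add: mem_box_cart)
  qed
  moreover have "closure {x. cutoff R x ^ m \<noteq> 0} \<subseteq> cbox (\<chi> j. - R j) (\<chi> j. R j)"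
    by (rule closure_minimal[OF sub closed_cbox])
  moreover have "compact (closure {x. cutoff R x ^ m \<noteq> 0})"
    using bounded_subset[OF bounded_cbox sub] by (simp only: compact_closure)
  ultimately show ?thesis
    unfolding test_functions_def interior_cbox using C_k_power[OF C_k_cutoff] by blast
qed

lemma cutoff_ge:
  fixes x :: "real^'n::finite"
  assumes "0 < d" "\<And>j. 0 < R j" "\<And>j. \<bar>x $ j\<bar> \<le> (1 - d) * R j"
  shows "(flat 0 d ^ 2) ^ CARD('n) \<le> cutoff R x"
proof -
  have "(\<Prod>j::'n\<in>UNIV. flat 0 d ^ 2) \<le> (\<Prod>j\<in>UNIV. bump (x $ j / R j))"
  proof (rule prod_mono)
    fix j
    have "\<bar>x $ j / R j\<bar> \<le> 1 - d" using assms(2)[of j] assms(3)[of j] by (simp add: pos_divide_le_eq)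
    then show "0 \<le> flat 0 d ^ 2 \<and> flat 0 d ^ 2 \<le> bump (x $ j / R j)" using bump_ge[OF assms(1)] by simp
  qed
  then show ?thesis by (simp add: cutoff_def)
qed

section \<open>Arithmetic of the exponents\<close>

lemma hmean_gt_1:
  fixes p :: "'n::finite \<Rightarrow> real"
  assumes "\<And>i. 1 < p i"
  shows "1 < hmean p"
proof -
  have "(\<Sum>i\<in>UNIV. 1 / p i) < (\<Sum>i::'n\<in>UNIV. 1)"
    using assms by (intro sum_strict_mono) (auto simp: order.strict_trans[OF zero_less_one])
  moreover have "0 < (\<Sum>i\<in>UNIV. 1 / p i)"
    using assms by (intro sum_pos) (auto intro: order.strict_trans[OF zero_less_one])
  ultimately show ?thesis by (simp add: hmean_def)
qed

text \<open>The exponents p / p_i add up to N by the definition of the harmonic mean; hence the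
  anisotropic cube has the volume of an ordinary cube of the same size, up to a factor depending on
  N.\<close>

lemma prod_powr_hmean:
  fixes p :: "'n::finite \<Rightarrow> real"
  assumes "\<And>i. 1 < p i" "0 < \<rho>"
  shows "(\<Prod>i\<in>UNIV. \<rho> powr (hmean p / p i)) = \<rho> powr real CARD('n)"
proof -
  have "0 < (\<Sum>i\<in>UNIV. 1 / p i)"
    using assms by (intro sum_pos) (auto intro: order.strict_trans[OF zero_less_one])
  then have "(\<Sum>i\<in>UNIV. hmean p / p i) = real CARD('n)"
    by (simp add: hmean_def sum_divide_distrib[symmetric] sum_distrib_left[symmetric] divide_inverse)
  then show ?thesis using assms(2) by (simp add: powr_sum[symmetric])
qed

lemma nu_Sigma_pos:
  assumes "0 < t" "0 < \<rho>"
  shows "0 < nu_Sigma p t \<rho>"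
  unfolding nu_Sigma_def using assms by (intro sum_pos) auto

text \<open>The i-th summand of \<open>nu_Sigma\<close> alone would give equality. The whole sum is
  larger, and the exponent p_i - 2 is negative.\<close>

lemma nu_Sigma_scaling:
  assumes p: "p i < 2" and t: "0 < t" "0 < \<rho>"
  shows "t * nu_Sigma p t \<rho> powr (p i - 2) \<le> \<rho> powr hmean p"
proof -
  define x where "x = t / \<rho> powr hmean p"
  have x: "0 < x" using t by (simp add: x_def)
  have "x powr (1 / (2 - p i)) \<le> nu_Sigma p t \<rho>"
    unfolding nu_Sigma_def x_def by (rule member_le_sum) auto
  then have "nu_Sigma p t \<rho> powr (p i - 2) \<le> (x powr (1 / (2 - p i))) powr (p i - 2)"
    using x p by (intro powr_mono2') auto
  also have "\<dots> = x powr (- 1)"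
  proof -
    have "1 / (2 - p i) * (p i - 2) = - 1" using p by (simp add: field_simps)
    then show ?thesis by (simp only: powr_powr)
  qed
  also have "\<dots> = \<rho> powr hmean p / t" using t by (simp add: powr_minus x_def)
  finally show ?thesis using t by (simp only: pos_le_divide_eq mult.commute)
qed

text \<open>Termwise identity: the exponent of \<rho> is N - p / (2 - p_i), which equals -
  \<lambda>_i / (2 - p_i).\<close>

lemma nu_Sigma_volume:
  fixes p :: "'n::finite \<Rightarrow> real"
  assumes p: "\<And>i. p i < 2" and t: "0 < t" "0 < \<rho>"
  shows "nu_Sigma p t \<rho> * \<rho> powr real CARD('n) = (\<Sum>i\<in>UNIV. (t / \<rho> powr lambda_exp p i) powr (1 / (2 - p i)))"
  unfolding nu_Sigma_def sum_distrib_right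
proof (rule sum.cong[OF refl])
  fix i
  define e where "e = 1 / (2 - p i)"
  have e: "(2 - p i) * e = 1" using p[of i] by (simp add: e_def)
  have "- lambda_exp p i * e = real CARD('n) * ((2 - p i) * e) - hmean p * e"
    by (simp add: lambda_exp_def algebra_simps)
  then have l: "- lambda_exp p i * e = real CARD('n) - hmean p * e" unfolding e by simp
  have "(t / \<rho> powr hmean p) powr e * \<rho> powr real CARD('n) = t powr e * \<rho> powr (real CARD('n) - hmean p * e)"
    using t by (simp add: powr_divide powr_powr powr_diff)
  also have "\<dots> = (t / \<rho> powr lambda_exp p i) powr e"
    unfolding l[symmetric] using t by (simp add: powr_divide powr_powr powr_minus_divide)
  finally show "(t / \<rho> powr hmean p) powr (1 / (2 - p i)) * \<rho> powr real CARD('n) = (t / \<rho> powr lambda_exp p i) powr (1 / (2 - p i))"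
    unfolding e_def .
qed

lemma le_of_powr_le:
  fixes x y q :: real
  assumes "x powr q \<le> y powr q" "0 \<le> y" "0 < q"
  shows "x \<le> y"
  using assms powr_less_mono2[of q y x] by (meson linorder_not_less)

lemma symmetric_box_measure:
  fixes R :: "'n::finite \<Rightarrow> real"
  assumes "\<And>j. 0 < R j"
  shows "(LINT x|lborel. indicat_real (cbox (\<chi> j. - R j) (\<chi> j. R j)) x) = (\<Prod>j\<in>UNIV. 2 * R j)"
proof -
  have "0 \<in> cbox (\<chi> j. - R j) (\<chi> j. R j)" using assms by (simp add: mem_box_cart less_imp_le)
  then have "cbox (\<chi> j. - R j) (\<chi> j. R j) \<noteq> {}" by blast
  from content_cbox_cart[OF this] show ?thesis by simp
qed

text \<open>The inequality is solved for \<open>g t\<close> so that the infimum can be inserted,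
  then multiplied back. This is legitimate since \<gamma> is positive and both constants are
  finite.\<close>

lemma SUP_le_INF_ennreal:
  fixes f g :: "'a \<Rightarrow> ennreal" and \<gamma> :: real
  assumes \<gamma>: "0 < \<gamma>" and le: "\<And>s t. s \<in> I \<Longrightarrow> t \<in> I \<Longrightarrow> f s \<le> ennreal \<gamma> * g t + ennreal b"
  shows "(SUP s\<in>I. f s) \<le> ennreal \<gamma> * (INF t\<in>I. g t) + ennreal b"
proof (rule SUP_least)
  fix s assume s: "s \<in> I"
  have "(f s - ennreal b) / ennreal \<gamma> \<le> (INF t\<in>I. g t)"
  proof (rule INF_greatest)
    fix t assume "t \<in> I"
    then have "f s - ennreal b \<le> ennreal \<gamma> * g t" using le[OF s] by (simp add: ennreal_minus_le_iff add.commute)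
    then show "(f s - ennreal b) / ennreal \<gamma> \<le> g t" using \<gamma> by (intro divide_le_posI_ennreal) (auto simp: mult.commute)
  qed
  then have "ennreal \<gamma> * ((f s - ennreal b) / ennreal \<gamma>) \<le> ennreal \<gamma> * (INF t\<in>I. g t)" by (intro mult_left_mono) simp_all
  moreover have "ennreal \<gamma> * ((f s - ennreal b) / ennreal \<gamma>) = f s - ennreal b"
    using \<gamma> by (simp add: ennreal_times_divide mult.commute[of "ennreal \<gamma>"] ennreal_mult_divide_eq)
  ultimately have "f s - ennreal b \<le> ennreal \<gamma> * (INF t\<in>I. g t)" by simp
  then show "f s \<le> ennreal \<gamma> * (INF t\<in>I. g t) + ennreal b" by (simp add: ennreal_minus_le_iff add.commute)
qed

theorem theorem2p2:
  fixes p :: "'n::{finite,linorder} \<Rightarrow> real" and Co C1 :: real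
  assumes "\<And>i. 1 < p i" and "\<And>i. p i < 2" and "mono p" and "hmean p < real CARD('n)"
    and "Co > 0" and "C1 > 0"
  shows "\<exists>\<gamma>>0. \<forall>(\<Omega> :: (real^'n::{finite,linorder}) set) T C A B u t \<rho>.
    open \<Omega> \<and> bounded \<Omega> \<and> T > 0 \<and> C \<ge> 0 \<and>
    caratheodory \<Omega> T A \<and> caratheodory \<Omega> T B \<and> structure_conditions \<Omega> T p Co C1 C A B \<and>
    local_weak_solution \<Omega> T p A B u \<and>
    (AE (x, \<tau>) in lebesgue_on (\<Omega> \<times> {0..T}). 0 \<le> u x \<tau>) \<and>
    t > 0 \<and> \<rho> > 0 \<and> aniso_cube p (2 * \<rho>) \<times> {0..t} \<subseteq> \<Omega> \<times> {0..T} \<longrightarrow>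
    (\<exists>i. C powr p i * \<rho> powr hmean p > min 1 (nu_Sigma p t \<rho> powr p i)) \<or>
    (SUP \<tau>\<in>{0..t}. \<integral>\<^sup>+x\<in>aniso_cube p \<rho>. ennreal (u x \<tau>) \<partial>lebesgue)
      \<le> ennreal \<gamma> * (INF \<tau>\<in>{0..t}. \<integral>\<^sup>+x\<in>aniso_cube p (2 * \<rho>). ennreal (u x \<tau>) \<partial>lebesgue)
        + ennreal (\<gamma> * (\<Sum>i\<in>UNIV. (t / \<rho> powr lambda_exp p i) powr (1 / (2 - p i))))"
proof -
  note p = assms(1,2) and Co = assms(5) and C1 = assms(6)
  \<comment> \<open>The largest exponent with a p_i \<le> 2 - p_i for every i, as required by
    \<open>pointwise_flux\<close>. It is positive because p_i < 2 and below 1 because p_i >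
    1.\<close>
  define a where "a = Min (range (\<lambda>i. (2 - p i) / p i))"
  have p0: "0 < p i" for i using p(1)[of i] by simp
  have a0: "0 < a" unfolding a_def using p(2) p0 by simp
  have al: "a \<le> (2 - p i) / p i" for i unfolding a_def by (rule Min_le) auto
  have "(2 - p i) / p i < 1" for i using p(1)[of i] by simp
  then have a1: "a < 1" using al by (rule order.strict_trans1[rotated])
  have ap: "a * p i \<le> 2 - p i" for i using al[of i] p0[of i] by (simp add: pos_le_divide_eq)
  obtain m :: nat where "2 / a < real m" using reals_Archimedean2 by blast
  then have ma: "2 \<le> real m * a" using a0 by (simp add: pos_divide_less_eq less_imp_le)
  have m0: "0 < m" using ma by (cases m) auto
  obtain b' B where b': "\<And>s. (bump has_real_derivative b' s) (at s)" "\<And>s. \<bar>b' s\<bar> \<le> B" and B: "0 < B"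
    by (rule bump_deriv) (rule that)
  define c where "c = real m * B"
  have c0: "0 < c" using m0 B by (simp add: c_def)
  \<comment> \<open>The lower bound of \<zeta> on the inner cube. Its half-edges are 5/7 of the
    edges R of the cutoff, whence the distance 2/7 from the boundary.\<close>
  define d where "d = ((flat 0 (2 / 7) ^ 2) ^ CARD('n)) ^ m"
  have d0: "0 < d" by (simp add: d_def flat_def)
  \<comment> \<open>These four definitions repeat the constants of \<open>mass_setting\<close>,
    because \<gamma> has to be fixed before the solution is introduced; the two versions are
    identified later.\<close>
  define c' where "c' = c * (C1 + 1) + 1"
  define \<epsilon> where "\<epsilon> = a * Co / (2 * c')"
  define \<Gamma> where "\<Gamma> = (\<Sum>i\<in>UNIV. a + c' * \<epsilon> powr (1 - p i) + c')"
  define g where "g = c' * (2 / (a * Co) * (1 / (1 - a) + \<Gamma>) + 2 * real CARD('n))"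
  \<comment> \<open>The factor (141/50)^N comes from the volume of K, whose i-th edge is 2 * 141/100
    times \<open>r i\<close>.\<close>
  define h where "h = (1 + 2 * g * (1 / (2 * g)) powr ((a - 1) / a)) / d * (141 / 50) ^ CARD('n)"
  \<comment> \<open>The absolute value makes \<gamma> positive and at least h without a discussion
    of the sign of h.\<close>
  define \<gamma> where "\<gamma> = 2 / d + \<bar>h\<bar>"
  have \<gamma>0: "0 < \<gamma>" unfolding \<gamma>_def using d0 by (intro add_pos_nonneg) auto
  have \<gamma>1: "2 / d \<le> \<gamma>" "h \<le> \<gamma>" using d0 by (auto simp: \<gamma>_def add_increasing)
  have h1: "1 < hmean p" by (rule hmean_gt_1[OF p(1)])
  show ?thesis
  proof (intro exI[of _ \<gamma>] conjI allI impI \<gamma>0)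
    fix \<Omega> :: "(real, 'n) vec set" and T C t \<rho> :: real and A B and u :: "(real, 'n) vec \<Rightarrow> real \<Rightarrow> real"
    assume H: "open \<Omega> \<and> bounded \<Omega> \<and> T > 0 \<and> C \<ge> 0 \<and>
      caratheodory \<Omega> T A \<and> caratheodory \<Omega> T B \<and> structure_conditions \<Omega> T p Co C1 C A B \<and>
      local_weak_solution \<Omega> T p A B u \<and>
      (AE (x, \<tau>) in lebesgue_on (\<Omega> \<times> {0..T}). 0 \<le> u x \<tau>) \<and>
      t > 0 \<and> \<rho> > 0 \<and> aniso_cube p (2 * \<rho>) \<times> {0..t} \<subseteq> \<Omega> \<times> {0..T}"
    then have \<Omega>: "open \<Omega>" and C: "0 \<le> C" and car: "caratheodory \<Omega> T A" "caratheodory \<Omega> T B"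
      and st: "structure_conditions \<Omega> T p Co C1 C A B" and sol: "local_weak_solution \<Omega> T p A B u"
      and nonneg: "AE (x, \<tau>) in lebesgue_on (\<Omega> \<times> {0..T}). 0 \<le> u x \<tau>" and t: "0 < t" and \<rho>: "0 < \<rho>"
      and sub: "aniso_cube p (2 * \<rho>) \<times> {0..t} \<subseteq> \<Omega> \<times> {0..T}"
      by simp_all
    define V where "V = (\<Sum>i\<in>UNIV. (t / \<rho> powr lambda_exp p i) powr (1 / (2 - p i)))"
    have est: "(\<integral>\<^sup>+x\<in>aniso_cube p \<rho>. ennreal (u x \<tau>2) \<partial>lebesgue)
      \<le> ennreal \<gamma> * (\<integral>\<^sup>+x\<in>aniso_cube p (2 * \<rho>). ennreal (u x \<tau>1) \<partial>lebesgue) + ennreal (\<gamma> * V)"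
      if \<tau>: "\<tau>1 \<in> {0..t}" "\<tau>2 \<in> {0..t}" and small: "\<And>i. C powr p i * \<rho> powr hmean p \<le> min 1 (nu_Sigma p t \<rho> powr p i)"
      for \<tau>1 \<tau>2
    proof -
      define \<nu> where "\<nu> = nu_Sigma p t \<rho>"
      have \<nu>: "0 < \<nu>" unfolding \<nu>_def by (rule nu_Sigma_pos[OF t \<rho>])
      define r where "r i = \<rho> powr (hmean p / p i)" for i
      have r0: "0 < r i" for i using \<rho> by (simp add: r_def)
      have rp: "r i powr p i = \<rho> powr hmean p" for i using p0[of i] by (simp add: r_def powr_powr)
      \<comment> \<open>The cutoff is supported in the box with half-edges R, K has half-edges R'.
        The factors are chosen with 1 < 7/5 < 141/100 < sqrt 2, so that the support is in the
        interior of K and K is inside the larger cube.\<close>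
      define R where "R i = 7 / 5 * r i" for i
      define R' where "R' i = 141 / 100 * r i" for i
      have R0: "0 < R i" "0 < R' i" "R i < R' i" for i using r0[of i] by (auto simp: R_def R'_def)
      define K :: "(real, 'n) vec set" where "K = cbox (\<chi> j. - R' j) (\<chi> j. R' j)"
      define \<zeta> :: "(real, 'n) vec \<Rightarrow> real" where "\<zeta> x = cutoff R x ^ m" for x
      \<comment> \<open>The larger cube has half-edges 2^(p/p_i) times \<open>r i\<close>, and p > 1
        and p_i < 2 give p/p_i > 1/2; so every factor exceeds sqrt 2.\<close>
      have R'2: "R' i < (2 * \<rho>) powr (hmean p / p i)" for i
      proof -
        have "141 / 100 < sqrt 2" by (rule real_less_rsqrt) (simp add: power2_eq_square)
        also have "\<dots> = 2 powr (1 / 2)" by (simp add: powr_half_sqrt)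
        also have "\<dots> \<le> 2 powr (hmean p / p i)" using h1 p(2)[of i] p0[of i] by (intro powr_mono) (auto simp: field_simps)
        finally have "141 / 100 * r i < 2 powr (hmean p / p i) * r i" using r0[of i] by (rule mult_strict_right_mono)
        then show ?thesis using \<rho> by (simp add: R'_def r_def powr_mult)
      qed
      have KQ: "K \<subseteq> aniso_cube p (2 * \<rho>)"
      proof
        fix x assume x: "x \<in> K"
        have "\<bar>x $ i\<bar> < (2 * \<rho>) powr (hmean p / p i)" for i
          using x R'2[of i] unfolding K_def mem_box_cart vec_lambda_beta by (auto dest!: spec[of _ i])
        then show "x \<in> aniso_cube p (2 * \<rho>)" by (simp add: aniso_cube_def)
      qed
      have QK: "aniso_cube p \<rho> \<subseteq> K"
      proof
        fix x assume x: "x \<in> aniso_cube p \<rho>"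
        have "- R' i \<le> x $ i \<and> x $ i \<le> R' i" for i
        proof -
          have "\<bar>x $ i\<bar> < r i" using x by (simp add: aniso_cube_def r_def)
          then show ?thesis using r0[of i] unfolding R'_def by linarith
        qed
        then show "x \<in> K" by (simp add: K_def mem_box_cart)
      qed
      have Q0: "0 \<in> aniso_cube p (2 * \<rho>)" using \<rho> by (simp add: aniso_cube_def)
      have "(0, t) \<in> \<Omega> \<times> {0..T}" by (rule subsetD[OF sub]) (use Q0 t in simp)
      then have tT: "t \<le> T" by simp
      have K\<Omega>: "K \<subseteq> \<Omega>"
      proof
        fix x assume "x \<in> K"
        then have "(x, 0) \<in> aniso_cube p (2 * \<rho>) \<times> {0..t}" using KQ t by (simp add: subset_iff)
        from subsetD[OF sub this] show "x \<in> \<Omega>" by simp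
      qed
      have Kc: "compact K" by (simp add: K_def)
      obtain U W \<alpha> \<beta> where "borel_weak_solution K T p Co C1 C u U W \<alpha> \<beta>"
        by (rule borel_weak_solution_exists[OF \<Omega> Kc K\<Omega> p Co C1 C car st sol nonneg]) (rule that)
      then interpret S: borel_weak_solution K T p Co C1 C u U W \<alpha> \<beta> .
      \<comment> \<open>By \<open>rp\<close> the failure of the first alternative bounds the power
        p_i of \<open>C * r i\<close> by 1 and by the power p_i of \<nu>; roots are taken.\<close>
      have Cr: "C * r i \<le> 1" "C * r i \<le> \<nu>" for i
      proof -
        have "(C * r i) powr p i \<le> min 1 (\<nu> powr p i)" using small[of i] C r0[of i] rp[of i] by (simp add: powr_mult \<nu>_def)
        then have "(C * r i) powr p i \<le> 1 powr p i" "(C * r i) powr p i \<le> \<nu> powr p i" by simp_all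
        then show "C * r i \<le> 1" "C * r i \<le> \<nu>" using \<nu> p0[of i] by (auto intro: le_of_powr_le)
      qed
      interpret S: mass_setting K T p Co C1 C u U W \<alpha> \<beta> \<nu> a \<zeta> "cutoff R" m r t c
      proof unfold_locales
        show "\<zeta> \<in> test_functions (interior K)"
          unfolding \<zeta>_def[abs_def] K_def by (rule cutoff_power_test_function[OF R0(1,3) m0])
        show "cutoff R \<in> borel_measurable borel"
          by (rule borel_measurable_continuous_onI[OF C_k_continuous[OF C_k_cutoff[of 0]]])
        show "\<bar>partial i \<zeta> x\<bar> \<le> c * cutoff R x ^ (m - 1) / r i" for i x
        proof -
          have "\<bar>partial i \<zeta> x\<bar> \<le> c * cutoff R x ^ (m - 1) / R i"
            unfolding \<zeta>_def[abs_def] c_def by (rule partial_cutoff_power[OF b' R0(1)])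
          also have "\<dots> \<le> c * cutoff R x ^ (m - 1) / r i"
            using c0 cutoff_bounds(1)[of R x] r0[of i] by (intro divide_left_mono mult_nonneg_nonneg mult_pos_pos) (auto simp: R_def)
          finally show ?thesis .
        qed
        show "t * \<nu> powr (p i - 2) \<le> r i powr p i" for i
          unfolding rp \<nu>_def by (rule nu_Sigma_scaling[OF p(2) t \<rho>])
      qed (use \<nu> a0 a1 cutoff_bounds[of R] c0 r0 ap ma t tT Cr in \<open>auto simp: \<zeta>_def\<close>)
      have dz: "d \<le> \<zeta> x" if "x \<in> aniso_cube p \<rho>" for x
      proof -
        have "\<bar>x $ j\<bar> \<le> (1 - 2 / 7) * R j" for j
          using that by (simp add: aniso_cube_def R_def r_def less_imp_le)
        from cutoff_ge[OF _ R0(1) this] show ?thesis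
          unfolding d_def \<zeta>_def by (intro power_mono) auto
      qed
      have S1: "S.\<gamma>\<^sub>1 = g"
        by (simp only: S.\<gamma>\<^sub>1_def S.\<Gamma>_def S.\<epsilon>_def S.c'_def g_def \<Gamma>_def \<epsilon>_def c'_def)
      have "S.\<kappa> = (\<Prod>j\<in>UNIV. 2 * R' j)"
        unfolding S.\<kappa>_def unfolding K_def by (rule symmetric_box_measure[OF R0(2)])
      also have "\<dots> = (\<Prod>j\<in>UNIV. 141 / 50 * r j)" by (simp add: R'_def)
      also have "\<dots> = (141 / 50) ^ CARD('n) * \<rho> powr real CARD('n)"
        unfolding r_def prod.distrib prod_powr_hmean[OF p(1) \<rho>] by simp
      finally have S2: "S.\<kappa> = (141 / 50) ^ CARD('n) * \<rho> powr real CARD('n)" .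
      have V0: "0 \<le> V" unfolding V_def by (intro sum_nonneg) simp
      have V: "\<nu> * \<rho> powr real CARD('n) = V" unfolding \<nu>_def V_def by (rule nu_Sigma_volume[OF p(2) t \<rho>])
      have "(1 + 2 * g * (1 / (2 * g)) powr ((a - 1) / a)) / d * (\<nu> * S.\<kappa>) = h * V"
        unfolding S2 h_def V[symmetric] by (simp only: mult_ac)
      from S.nn_integral_comparison[OF d0 dz QK KQ \<tau>, unfolded S1, unfolded this]
      have "(\<integral>\<^sup>+x\<in>aniso_cube p \<rho>. ennreal (u x \<tau>2) \<partial>lebesgue)
          \<le> ennreal (2 / d) * (\<integral>\<^sup>+x\<in>aniso_cube p (2 * \<rho>). ennreal (u x \<tau>1) \<partial>lebesgue) + ennreal (h * V)" .
      also have "\<dots> \<le> ennreal \<gamma> * (\<integral>\<^sup>+x\<in>aniso_cube p (2 * \<rho>). ennreal (u x \<tau>1) \<partial>lebesgue) + ennreal (\<gamma> * V)"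
        using \<gamma>1 V0 by (intro add_mono mult_right_mono ennreal_leI) auto
      finally show ?thesis .
    qed
    have "(SUP \<tau>\<in>{0..t}. \<integral>\<^sup>+x\<in>aniso_cube p \<rho>. ennreal (u x \<tau>) \<partial>lebesgue)
        \<le> ennreal \<gamma> * (INF \<tau>\<in>{0..t}. \<integral>\<^sup>+x\<in>aniso_cube p (2 * \<rho>). ennreal (u x \<tau>) \<partial>lebesgue) + ennreal (\<gamma> * V)"
      if "\<And>i. C powr p i * \<rho> powr hmean p \<le> min 1 (nu_Sigma p t \<rho> powr p i)"
      by (rule SUP_le_INF_ennreal[OF \<gamma>0], rule est[OF _ _ that])
    then show "(\<exists>i. C powr p i * \<rho> powr hmean p > min 1 (nu_Sigma p t \<rho> powr p i)) \<or>
      (SUP \<tau>\<in>{0..t}. \<integral>\<^sup>+x\<in>aniso_cube p \<rho>. ennreal (u x \<tau>) \<partial>lebesgue)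
        \<le> ennreal \<gamma> * (INF \<tau>\<in>{0..t}. \<integral>\<^sup>+x\<in>aniso_cube p (2 * \<rho>). ennreal (u x \<tau>) \<partial>lebesgue)
          + ennreal (\<gamma> * (\<Sum>i\<in>UNIV. (t / \<rho> powr lambda_exp p i) powr (1 / (2 - p i))))"
      unfolding V_def[symmetric] by (meson linorder_not_less)
  qed
qed

end
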